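(* Let $\Psi$ be a class of weights. The following are equivalent: (1) $\Psi$ is sound. (2) For every weight $\varphi:\mathscr{E}^{op}\to\mathscr{V}$ ($\mathscr{E}$ small): $\varphi$ is $\Psi$-flat whenever $\varphi\star(-):[\mathscr{E},\mathscr{V}]\to\mathscr{V}$ preserves $\Psi_1(\mathscr{E})$-limits of representables, i.e., whenever the canonical morphism $$\mathsf{can}:\varphi\star\{\psi,Y-\}\longrightarrow\{\psi,\varphi\}$$ is an isomorphism for every $\psi:\mathscr{E}^{op}\to\mathscr{V}$ in $\Psi_1(\mathscr{E})$, where $Y:\mathscr{E}^{op}\to[\mathscr{E},\mathscr{V}]$ is the Yoneda embedding.
   Context: Fix a complete and cocomplete symmetric monoidal category $\mathscr{V}=(\mathscr{V}_o,\otimes,I,[-,-])$ with internal hom $[-,-]$. All categories, functors and natural transformations are $\mathscr{V}$-categories, $\mathscr{V}$-functors and $\mathscr{V}$-natural transformations. A weight is a functor $\varphi:\mathscr{E}^{op}\to\mathscr{V}$ with $\mathscr{E}$ small. The colimit $\varphi\star D$ of $D:\mathscr{E}\to\mathscr{K}$ weighted by $\varphi$ is defined by $\mathscr{K}(\varphi\star D,X)\cong[\mathscr{E}^{op},\mathscr{V}](\varphi,\mathscr{K}(D-,X))$, naturally in $X$. The limit $\{\varphi,D\}$ of $D:\mathscr{E}^{op}\to\mathscr{K}$ weighted by $\varphi$ is defined by $\mathscr{K}(X,\{\varphi,D\})\cong[\mathscr{E}^{op},\mathscr{V}](\varphi,\mathscr{K}(X,D-))$, naturally in $X$. A $\Psi$-limit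 is a limit weighted by a weight in $\Psi$. A weight $\varphi:\mathscr{E}^{op}\to\mathscr{V}$ is $\Psi$-flat if the functor $\varphi\star(-):[\mathscr{E},\mathscr{V}]\to\mathscr{V}$ preserves $\Psi$-limits. The functor $\varphi\star(-)$ preserves $\Psi$-limits of representables if, for every $\psi:\mathscr{D}^{op}\to\mathscr{V}$ in $\Psi$ and every functor $T:\mathscr{D}\to\mathscr{E}$, the canonical morphism $\varphi\star\{\psi,YT^{op}-\}\to\{\psi,\varphi\cdot T^{op}\}$ is an isomorphism (using $\varphi\star Ye\cong\varphi e$). A class $\Psi$ of weights is sound if a weight $\varphi:\mathscr{E}^{op}\to\mathscr{V}$ is $\Psi$-flat whenever $\varphi\star(-):[\mathscr{E},\mathscr{V}]\to\mathscr{V}$ preserves $\Psi$-limits of representables. For small $\mathscr{E}$, $\Psi_1(\mathscr{E})$ is the full subcategory of $[\mathscr{E}^{op},\mathscr{V}]$ spanned by $\Psi$-colimits (colimits weighted by weights in $\Psi$) of representables; that is, $\alpha:\mathscr{E}^{op}\to\mathscr{V}$ is in $\Psi_1(\mathscr{E})$ iff it is of the form $\mathrm{Lan}_{T^{op}}\psi$ for some $T:\mathscr{D}\to\mathscr{E}$ and some weight $\psi:\mathscr{D}^{op}\to\mathscr{V}$ in $\Psi$. *)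

theory Defs
  imports Main "HOL-Library.Equipollence"
begin

section \<open>Categories, smallness, completeness\<close>

text \<open>
  Smallness is relative to a type \<open>'u\<close> that plays the role of a Grothendieck universe: the
  small sets are the subsets of \<open>'u\<close> of smaller cardinality than \<open>'u\<close>. (The elements of a
  Grothendieck universe \<open>U\<close> are exactly the subsets of \<open>U\<close> of cardinality less than that of \<open>U\<close>;
  of the closure properties of a universe, only infinity of \<open>'u\<close> is assumed later.)
  The objects of a small category are elements of \<open>'u\<close>; up to isomorphism this is no restriction.
\<close>

definition small :: "'u set \<Rightarrow> bool" where
  "small A \<longleftrightarrow> A \<prec> (UNIV :: 'u set)"

text \<open>\<open>Comp C g f\<close>, written \<open>g \<cdot> f\<close>, is \<open>g\<close> after \<open>f\<close>.\<close>

record ('o, 'm) cat =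
  Ob   :: "'o set"
  Hom  :: "'o \<Rightarrow> 'o \<Rightarrow> 'm set"
  Comp :: "'m \<Rightarrow> 'm \<Rightarrow> 'm"  (infixl "\<cdot>\<index>" 75)
  Id   :: "'o \<Rightarrow> 'm"  ("\<one>\<index>")

definition category :: "('o, 'm, 'z) cat_scheme \<Rightarrow> bool" where
  "category C \<longleftrightarrow>
     (\<forall>X\<in>Ob C. Id C X \<in> Hom C X X) \<and>
     (\<forall>X\<in>Ob C. \<forall>Y\<in>Ob C. \<forall>Z\<in>Ob C. \<forall>f\<in>Hom C X Y. \<forall>g\<in>Hom C Y Z. g \<cdot>\<^bsub>C\<^esub> f \<in> Hom C X Z) \<and>
     (\<forall>X\<in>Ob C. \<forall>Y\<in>Ob C. \<forall>f\<in>Hom C X Y. f \<cdot>\<^bsub>C\<^esub> Id C X = f \<and> Id C Y \<cdot>\<^bsub>C\<^esub> f = f) \<and>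
     (\<forall>W\<in>Ob C. \<forall>X\<in>Ob C. \<forall>Y\<in>Ob C. \<forall>Z\<in>Ob C. \<forall>f\<in>Hom C W X. \<forall>g\<in>Hom C X Y. \<forall>h\<in>Hom C Y Z.
        h \<cdot>\<^bsub>C\<^esub> (g \<cdot>\<^bsub>C\<^esub> f) = (h \<cdot>\<^bsub>C\<^esub> g) \<cdot>\<^bsub>C\<^esub> f)"

definition inverse_arrows :: "('o, 'm, 'z) cat_scheme \<Rightarrow> 'o \<Rightarrow> 'o \<Rightarrow> 'm \<Rightarrow> 'm \<Rightarrow> bool" where
  "inverse_arrows C X Y f g \<longleftrightarrow>
     f \<in> Hom C X Y \<and> g \<in> Hom C Y X \<and> g \<cdot>\<^bsub>C\<^esub> f = Id C X \<and> f \<cdot>\<^bsub>C\<^esub> g = Id C Y"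

definition iso :: "('o, 'm, 'z) cat_scheme \<Rightarrow> 'o \<Rightarrow> 'o \<Rightarrow> 'm \<Rightarrow> bool" where
  "iso C X Y f \<longleftrightarrow> (\<exists>g. inverse_arrows C X Y f g)"

definition inv_arrow :: "('o, 'm, 'z) cat_scheme \<Rightarrow> 'o \<Rightarrow> 'o \<Rightarrow> 'm \<Rightarrow> 'm" where
  "inv_arrow C X Y f = (THE g. inverse_arrows C X Y f g)"

definition small_category :: "('u, 'u) cat \<Rightarrow> bool" where
  "small_category J \<longleftrightarrow>
     category J \<and> small (Ob J) \<and> small (\<Union>i\<in>Ob J. \<Union>j\<in>Ob J. Hom J i j)"

definition diagram ::
  "('i, 'j) cat \<Rightarrow> ('o, 'm, 'z) cat_scheme \<Rightarrow> ('i \<Rightarrow> 'o) \<Rightarrow> ('j \<Rightarrow> 'm) \<Rightarrow> bool" where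
  "diagram J C F0 F1 \<longleftrightarrow>
     (\<forall>i\<in>Ob J. F0 i \<in> Ob C) \<and>
     (\<forall>i\<in>Ob J. \<forall>j\<in>Ob J. \<forall>u\<in>Hom J i j. F1 u \<in> Hom C (F0 i) (F0 j)) \<and>
     (\<forall>i\<in>Ob J. F1 (Id J i) = Id C (F0 i)) \<and>
     (\<forall>i\<in>Ob J. \<forall>j\<in>Ob J. \<forall>k\<in>Ob J. \<forall>u\<in>Hom J i j. \<forall>v\<in>Hom J j k.
        F1 (v \<cdot>\<^bsub>J\<^esub> u) = F1 v \<cdot>\<^bsub>C\<^esub> F1 u)"

definition cone ::
  "('i, 'j) cat \<Rightarrow> ('o, 'm, 'z) cat_scheme \<Rightarrow> ('i \<Rightarrow> 'o) \<Rightarrow> ('j \<Rightarrow> 'm) \<Rightarrow> 'o \<Rightarrow> ('i \<Rightarrow> 'm) \<Rightarrow> bool" where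
  "cone J C F0 F1 X p \<longleftrightarrow>
     X \<in> Ob C \<and> (\<forall>i\<in>Ob J. p i \<in> Hom C X (F0 i)) \<and>
     (\<forall>i\<in>Ob J. \<forall>j\<in>Ob J. \<forall>u\<in>Hom J i j. F1 u \<cdot>\<^bsub>C\<^esub> p i = p j)"

definition cocone ::
  "('i, 'j) cat \<Rightarrow> ('o, 'm, 'z) cat_scheme \<Rightarrow> ('i \<Rightarrow> 'o) \<Rightarrow> ('j \<Rightarrow> 'm) \<Rightarrow> 'o \<Rightarrow> ('i \<Rightarrow> 'm) \<Rightarrow> bool" where
  "cocone J C F0 F1 X p \<longleftrightarrow>
     X \<in> Ob C \<and> (\<forall>i\<in>Ob J. p i \<in> Hom C (F0 i) X) \<and>
     (\<forall>i\<in>Ob J. \<forall>j\<in>Ob J. \<forall>u\<in>Hom J i j. p j \<cdot>\<^bsub>C\<^esub> F1 u = p i)"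

definition complete :: "'u itself \<Rightarrow> ('o, 'm, 'z) cat_scheme \<Rightarrow> bool" where
  "complete U C \<longleftrightarrow>
     (\<forall>(J :: ('u, 'u) cat) F0 F1. small_category J \<longrightarrow> diagram J C F0 F1 \<longrightarrow>
        (\<exists>L p. cone J C F0 F1 L p \<and>
           (\<forall>X q. cone J C F0 F1 X q \<longrightarrow> (\<exists>!k. k \<in> Hom C X L \<and> (\<forall>i\<in>Ob J. p i \<cdot>\<^bsub>C\<^esub> k = q i)))))"

definition cocomplete :: "'u itself \<Rightarrow> ('o, 'm, 'z) cat_scheme \<Rightarrow> bool" where
  "cocomplete U C \<longleftrightarrow>
     (\<forall>(J :: ('u, 'u) cat) F0 F1. small_category J \<longrightarrow> diagram J C F0 F1 \<longrightarrow>
        (\<exists>L p. cocone J C F0 F1 L p \<and>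
           (\<forall>X q. cocone J C F0 F1 X q \<longrightarrow> (\<exists>!k. k \<in> Hom C L X \<and> (\<forall>i\<in>Ob J. k \<cdot>\<^bsub>C\<^esub> p i = q i)))))"


section \<open>Symmetric monoidal closed categories\<close>

text \<open>
  \<open>X \<otimes> Y\<close> is the tensor product of objects and \<open>f \<odot> g\<close> that of arrows;
  \<open>assoc X Y Z : (X \<otimes> Y) \<otimes> Z \<rightarrow> X \<otimes> (Y \<otimes> Z)\<close>, \<open>lun X : \<I> \<otimes> X \<rightarrow> X\<close>, \<open>run X : X \<otimes> \<I> \<rightarrow> X\<close>,
  \<open>symm X Y : X \<otimes> Y \<rightarrow> Y \<otimes> X\<close>, \<open>ihom X Y = [X,Y]\<close>, \<open>ev X Y : [X,Y] \<otimes> X \<rightarrow> Y\<close>.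
\<close>

record ('o, 'm) smc = "('o, 'm) cat" +
  tens  :: "'o \<Rightarrow> 'o \<Rightarrow> 'o"  (infixr "\<otimes>\<index>" 80)
  tensa :: "'m \<Rightarrow> 'm \<Rightarrow> 'm"  (infixr "\<odot>\<index>" 80)
  unt   :: 'o  ("\<I>\<index>")
  assoc :: "'o \<Rightarrow> 'o \<Rightarrow> 'o \<Rightarrow> 'm"  ("assoc\<index>")
  lun   :: "'o \<Rightarrow> 'm"  ("lun\<index>")
  run   :: "'o \<Rightarrow> 'm"  ("run\<index>")
  symm   :: "'o \<Rightarrow> 'o \<Rightarrow> 'm"  ("symm\<index>")
  ihom  :: "'o \<Rightarrow> 'o \<Rightarrow> 'o"  ("ihom\<index>")
  ev    :: "'o \<Rightarrow> 'o \<Rightarrow> 'm"  ("ev\<index>")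

text \<open>
  \<open>vcat\<close>: objects, hom-objects, composition
  \<open>vcomp A a b c : A(b,c) \<otimes> A(a,b) \<rightarrow> A(a,c)\<close> and identities \<open>vid A a : \<I> \<rightarrow> A(a,a)\<close>.
  \<open>vfun\<close>: object map and action \<open>far F a b : A(a,b) \<rightarrow> B(Fa,Fb)\<close> on hom-objects. The values of
  these functions outside the objects concerned are arbitrary and never matter.
\<close>

record ('a, 'o, 'm) vcat =
  vob   :: "'a set"
  vhom  :: "'a \<Rightarrow> 'a \<Rightarrow> 'o"
  vcomp :: "'a \<Rightarrow> 'a \<Rightarrow> 'a \<Rightarrow> 'm"
  vid   :: "'a \<Rightarrow> 'm"

record ('a, 'b, 'm) vfun =
  fob :: "'a \<Rightarrow> 'b"
  far :: "'a \<Rightarrow> 'a \<Rightarrow> 'm"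

type_synonym ('u, 'o, 'm) weight = "('u, 'o, 'm) vfun"

context
  fixes V :: "('o, 'm) smc" (structure)
begin

definition sym_monoidal :: bool where
  "sym_monoidal \<longleftrightarrow>
     category V \<and>
     \<I> \<in> Ob V \<and>
     (\<forall>X\<in>Ob V. \<forall>Y\<in>Ob V. X \<otimes> Y \<in> Ob V) \<and>
     (\<forall>X\<in>Ob V. \<forall>X'\<in>Ob V. \<forall>Y\<in>Ob V. \<forall>Y'\<in>Ob V. \<forall>f\<in>Hom V X X'. \<forall>g\<in>Hom V Y Y'.
        f \<odot> g \<in> Hom V (X \<otimes> Y) (X' \<otimes> Y')) \<and>
     (\<forall>X\<in>Ob V. \<forall>Y\<in>Ob V. \<one> X \<odot> \<one> Y = \<one> (X \<otimes> Y)) \<and>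
     (\<forall>X\<in>Ob V. \<forall>X'\<in>Ob V. \<forall>X''\<in>Ob V. \<forall>Y\<in>Ob V. \<forall>Y'\<in>Ob V. \<forall>Y''\<in>Ob V.
        \<forall>f\<in>Hom V X X'. \<forall>f'\<in>Hom V X' X''. \<forall>g\<in>Hom V Y Y'. \<forall>g'\<in>Hom V Y' Y''.
        (f' \<cdot> f) \<odot> (g' \<cdot> g) = (f' \<odot> g') \<cdot> (f \<odot> g)) \<and>
     (\<forall>X\<in>Ob V. \<forall>Y\<in>Ob V. \<forall>Z\<in>Ob V. iso V ((X \<otimes> Y) \<otimes> Z) (X \<otimes> (Y \<otimes> Z)) (assoc X Y Z)) \<and>
     (\<forall>X\<in>Ob V. iso V (\<I> \<otimes> X) X (lun X)) \<and>
     (\<forall>X\<in>Ob V. iso V (X \<otimes> \<I>) X (run X)) \<and>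
     (\<forall>X\<in>Ob V. \<forall>Y\<in>Ob V. symm X Y \<in> Hom V (X \<otimes> Y) (Y \<otimes> X)) \<and>
     (\<forall>X\<in>Ob V. \<forall>Y\<in>Ob V. symm Y X \<cdot> symm X Y = \<one> (X \<otimes> Y)) \<and>
     \<comment> \<open>naturality\<close>
     (\<forall>X\<in>Ob V. \<forall>X'\<in>Ob V. \<forall>Y\<in>Ob V. \<forall>Y'\<in>Ob V. \<forall>Z\<in>Ob V. \<forall>Z'\<in>Ob V.
        \<forall>f\<in>Hom V X X'. \<forall>g\<in>Hom V Y Y'. \<forall>h\<in>Hom V Z Z'.
        assoc X' Y' Z' \<cdot> ((f \<odot> g) \<odot> h) = (f \<odot> (g \<odot> h)) \<cdot> assoc X Y Z) \<and>
     (\<forall>X\<in>Ob V. \<forall>Y\<in>Ob V. \<forall>f\<in>Hom V X Y. lun Y \<cdot> (\<one> \<I> \<odot> f) = f \<cdot> lun X) \<and>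
     (\<forall>X\<in>Ob V. \<forall>Y\<in>Ob V. \<forall>f\<in>Hom V X Y. run Y \<cdot> (f \<odot> \<one> \<I>) = f \<cdot> run X) \<and>
     (\<forall>X\<in>Ob V. \<forall>X'\<in>Ob V. \<forall>Y\<in>Ob V. \<forall>Y'\<in>Ob V. \<forall>f\<in>Hom V X X'. \<forall>g\<in>Hom V Y Y'.
        symm X' Y' \<cdot> (f \<odot> g) = (g \<odot> f) \<cdot> symm X Y) \<and>
     \<comment> \<open>pentagon, triangle, hexagon\<close>
     (\<forall>W\<in>Ob V. \<forall>X\<in>Ob V. \<forall>Y\<in>Ob V. \<forall>Z\<in>Ob V.
        assoc W X (Y \<otimes> Z) \<cdot> assoc (W \<otimes> X) Y Z =
        (\<one> W \<odot> assoc X Y Z) \<cdot> assoc W (X \<otimes> Y) Z \<cdot> (assoc W X Y \<odot> \<one> Z)) \<and>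
     (\<forall>X\<in>Ob V. \<forall>Y\<in>Ob V. (\<one> X \<odot> lun Y) \<cdot> assoc X \<I> Y = run X \<odot> \<one> Y) \<and>
     (\<forall>X\<in>Ob V. \<forall>Y\<in>Ob V. \<forall>Z\<in>Ob V.
        assoc Y Z X \<cdot> symm X (Y \<otimes> Z) \<cdot> assoc X Y Z =
        (\<one> Y \<odot> symm X Z) \<cdot> assoc Y X Z \<cdot> (symm X Y \<odot> \<one> Z))"

definition sym_monoidal_closed :: bool where
  "sym_monoidal_closed \<longleftrightarrow>
     sym_monoidal \<and>
     (\<forall>Y\<in>Ob V. \<forall>Z\<in>Ob V. ihom Y Z \<in> Ob V \<and> ev Y Z \<in> Hom V (ihom Y Z \<otimes> Y) Z) \<and>
     (\<forall>X\<in>Ob V. \<forall>Y\<in>Ob V. \<forall>Z\<in>Ob V. \<forall>f\<in>Hom V (X \<otimes> Y) Z.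
        \<exists>!k. k \<in> Hom V X (ihom Y Z) \<and> ev Y Z \<cdot> (k \<odot> \<one> Y) = f)"

definition vcurry :: "'o \<Rightarrow> 'o \<Rightarrow> 'o \<Rightarrow> 'm \<Rightarrow> 'm" where
  "vcurry X Y Z f = (THE k. k \<in> Hom V X (ihom Y Z) \<and> ev Y Z \<cdot> (k \<odot> \<one> Y) = f)"

definition vuncurry :: "'o \<Rightarrow> 'o \<Rightarrow> 'm \<Rightarrow> 'm" where
  "vuncurry Y Z k = ev Y Z \<cdot> (k \<odot> \<one> Y)"

text \<open>The bijection between arrows \<open>X \<rightarrow> Y\<close> and elements \<open>\<I> \<rightarrow> [X,Y]\<close>.\<close>

definition nm :: "'o \<Rightarrow> 'o \<Rightarrow> 'm \<Rightarrow> 'm" where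
  "nm X Y f = vcurry \<I> X Y (f \<cdot> lun X)"

definition unnm :: "'o \<Rightarrow> 'o \<Rightarrow> 'm \<Rightarrow> 'm" where
  "unnm X Y k = vuncurry X Y k \<cdot> inv_arrow V (\<I> \<otimes> X) X (lun X)"

text \<open>\<open>[1,f] : [W,X] \<rightarrow> [W,Y]\<close> for \<open>f : X \<rightarrow> Y\<close>.\<close>

definition ihom_post :: "'o \<Rightarrow> 'o \<Rightarrow> 'o \<Rightarrow> 'm \<Rightarrow> 'm" where
  "ihom_post W X Y f = vcurry (ihom W X) W Y (f \<cdot> ev W X)"


section \<open>Enriched categories and functors\<close>

definition vcategory :: "('a, 'o, 'm) vcat \<Rightarrow> bool" where
  "vcategory A \<longleftrightarrow>
     (\<forall>a\<in>vob A. \<forall>b\<in>vob A. vhom A a b \<in> Ob V) \<and>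
     (\<forall>a\<in>vob A. vid A a \<in> Hom V \<I> (vhom A a a)) \<and>
     (\<forall>a\<in>vob A. \<forall>b\<in>vob A. \<forall>c\<in>vob A.
        vcomp A a b c \<in> Hom V (vhom A b c \<otimes> vhom A a b) (vhom A a c)) \<and>
     (\<forall>a\<in>vob A. \<forall>b\<in>vob A. \<forall>c\<in>vob A. \<forall>d\<in>vob A.
        vcomp A a b d \<cdot> (vcomp A b c d \<odot> \<one> (vhom A a b)) =
        vcomp A a c d \<cdot> (\<one> (vhom A c d) \<odot> vcomp A a b c) \<cdot>
          assoc (vhom A c d) (vhom A b c) (vhom A a b)) \<and>
     (\<forall>a\<in>vob A. \<forall>b\<in>vob A. vcomp A a b b \<cdot> (vid A b \<odot> \<one> (vhom A a b)) = lun (vhom A a b)) \<and>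
     (\<forall>a\<in>vob A. \<forall>b\<in>vob A. vcomp A a a b \<cdot> (\<one> (vhom A a b) \<odot> vid A a) = run (vhom A a b))"

definition small_vcategory :: "('u, 'o, 'm) vcat \<Rightarrow> bool" where
  "small_vcategory E \<longleftrightarrow> vcategory E \<and> small (vob E)"

definition vfunctor ::
  "('a, 'o, 'm) vcat \<Rightarrow> ('b, 'o, 'm) vcat \<Rightarrow> ('a, 'b, 'm) vfun \<Rightarrow> bool" where
  "vfunctor A B F \<longleftrightarrow>
     (\<forall>a\<in>vob A. fob F a \<in> vob B) \<and>
     (\<forall>a\<in>vob A. \<forall>b\<in>vob A. far F a b \<in> Hom V (vhom A a b) (vhom B (fob F a) (fob F b))) \<and>
     (\<forall>a\<in>vob A. far F a a \<cdot> vid A a = vid B (fob F a)) \<and>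
     (\<forall>a\<in>vob A. \<forall>b\<in>vob A. \<forall>c\<in>vob A.
        far F a c \<cdot> vcomp A a b c =
        vcomp B (fob F a) (fob F b) (fob F c) \<cdot> (far F b c \<odot> far F a b))"

definition vop :: "('a, 'o, 'm) vcat \<Rightarrow> ('a, 'o, 'm) vcat" where
  "vop A = \<lparr> vob = vob A,
             vhom = (\<lambda>a b. vhom A b a),
             vcomp = (\<lambda>a b c. vcomp A c b a \<cdot> symm (vhom A c b) (vhom A b a)),
             vid = vid A \<rparr>"

definition fop :: "('a, 'b, 'm) vfun \<Rightarrow> ('a, 'b, 'm) vfun" where
  "fop F = \<lparr> fob = fob F, far = (\<lambda>a b. far F b a) \<rparr>"

definition fcomp :: "('b, 'c, 'm) vfun \<Rightarrow> ('a, 'b, 'm) vfun \<Rightarrow> ('a, 'c, 'm) vfun" where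
  "fcomp G F = \<lparr> fob = (\<lambda>a. fob G (fob F a)),
                 far = (\<lambda>a b. far G (fob F a) (fob F b) \<cdot> far F a b) \<rparr>"

text \<open>\<open>V\<close> as a category enriched over itself.\<close>

definition vself :: "('o, 'o, 'm) vcat" where
  "vself =
     \<lparr> vob = Ob V,
       vhom = ihom,
       vcomp = (\<lambda>X Y Z. vcurry (ihom Y Z \<otimes> ihom X Y) X Z
                  (ev Y Z \<cdot> (\<one> (ihom Y Z) \<odot> ev X Y) \<cdot> assoc (ihom Y Z) (ihom X Y) X)),
       vid = (\<lambda>X. vcurry \<I> X X (lun X)) \<rparr>"

text \<open>
  Natural transformations between functors \<open>F, G : A \<rightarrow> V\<close>, the components being given as arrows
  \<open>Fa \<rightarrow> Ga\<close> of \<open>V\<close> (instead of \<open>\<I> \<rightarrow> [Fa,Ga]\<close>) and the naturality square being transposed to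
  arrows \<open>A(a,b) \<otimes> Fa \<rightarrow> Gb\<close>.
\<close>

definition vnat ::
  "('a, 'o, 'm) vcat \<Rightarrow> ('a, 'o, 'm) vfun \<Rightarrow> ('a, 'o, 'm) vfun \<Rightarrow> ('a \<Rightarrow> 'm) \<Rightarrow> bool" where
  "vnat A F G \<alpha> \<longleftrightarrow>
     (\<forall>a\<in>vob A. \<alpha> a \<in> Hom V (fob F a) (fob G a)) \<and>
     (\<forall>a\<in>vob A. \<forall>b\<in>vob A.
        \<alpha> b \<cdot> vuncurry (fob F a) (fob F b) (far F a b) =
        vuncurry (fob G a) (fob G b) (far G a b) \<cdot> (\<one> (vhom A a b) \<odot> \<alpha> a))"

text \<open>
  The functor \<open>K(X,-) : K \<rightarrow> V\<close>. Since \<open>K(-,X)\<close> is the covariant hom-functor of the opposite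
  category, it is written \<open>homfun (vop K) X\<close>.
\<close>

definition homfun :: "('k, 'o, 'm) vcat \<Rightarrow> 'k \<Rightarrow> ('k, 'o, 'm) vfun" where
  "homfun K X =
     \<lparr> fob = vhom K X,
       far = (\<lambda>a b. vcurry (vhom K a b) (vhom K X a) (vhom K X b) (vcomp K X a b)) \<rparr>"


section \<open>Functor categories\<close>

text \<open>
  The hom-object \<open>[A,V](F,G)\<close> is the end of the \<open>[Fa,Ga]\<close>. A wedge is a family
  \<open>\<pi>\<^sub>a : N \<rightarrow> [Fa,Ga]\<close> for which the two induced arrows \<open>N \<otimes> A(a,b) \<rightarrow> [Fa,Gb]\<close> agree.
\<close>

definition wedge ::
  "('a, 'o, 'm) vcat \<Rightarrow> ('a, 'o, 'm) vfun \<Rightarrow> ('a, 'o, 'm) vfun \<Rightarrow> 'o \<Rightarrow> ('a \<Rightarrow> 'm) \<Rightarrow> bool" where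
  "wedge A F G N \<pi> \<longleftrightarrow>
     N \<in> Ob V \<and>
     (\<forall>a\<in>vob A. \<pi> a \<in> Hom V N (ihom (fob F a) (fob G a))) \<and>
     (\<forall>a\<in>vob A. \<forall>b\<in>vob A.
        vcomp vself (fob F a) (fob F b) (fob G b) \<cdot> (\<pi> b \<odot> far F a b) =
        vcomp vself (fob F a) (fob G a) (fob G b) \<cdot> (far G a b \<odot> \<pi> a) \<cdot> symm N (vhom A a b))"

definition is_end ::
  "('a, 'o, 'm) vcat \<Rightarrow> ('a, 'o, 'm) vfun \<Rightarrow> ('a, 'o, 'm) vfun \<Rightarrow> 'o \<Rightarrow> ('a \<Rightarrow> 'm) \<Rightarrow> bool" where
  "is_end A F G N \<pi> \<longleftrightarrow>
     wedge A F G N \<pi> \<and>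
     (\<forall>X q. wedge A F G X q \<longrightarrow> (\<exists>!k. k \<in> Hom V X N \<and> (\<forall>a\<in>vob A. \<pi> a \<cdot> k = q a)))"

definition the_end ::
  "('a, 'o, 'm) vcat \<Rightarrow> ('a, 'o, 'm) vfun \<Rightarrow> ('a, 'o, 'm) vfun \<Rightarrow> 'o \<times> ('a \<Rightarrow> 'm)" where
  "the_end A F G = (SOME (N, \<pi>). is_end A F G N \<pi>)"

definition natob :: "('a, 'o, 'm) vcat \<Rightarrow> ('a, 'o, 'm) vfun \<Rightarrow> ('a, 'o, 'm) vfun \<Rightarrow> 'o" where
  "natob A F G = fst (the_end A F G)"

definition proj :: "('a, 'o, 'm) vcat \<Rightarrow> ('a, 'o, 'm) vfun \<Rightarrow> ('a, 'o, 'm) vfun \<Rightarrow> 'a \<Rightarrow> 'm" where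
  "proj A F G = snd (the_end A F G)"

text \<open>The arrow \<open>X \<rightarrow> [A,V](F,G)\<close> with given components \<open>X \<rightarrow> [Fa,Ga]\<close>.\<close>

definition into_end ::
  "('a, 'o, 'm) vcat \<Rightarrow> ('a, 'o, 'm) vfun \<Rightarrow> ('a, 'o, 'm) vfun \<Rightarrow> 'o \<Rightarrow> ('a \<Rightarrow> 'm) \<Rightarrow> 'm" where
  "into_end A F G X q =
     (THE k. k \<in> Hom V X (natob A F G) \<and> (\<forall>a\<in>vob A. proj A F G a \<cdot> k = q a))"

definition funcat :: "('a, 'o, 'm) vcat \<Rightarrow> (('a, 'o, 'm) vfun, 'o, 'm) vcat" where
  "funcat A =
     \<lparr> vob = {F. vfunctor A vself F},
       vhom = natob A,
       vcomp = (\<lambda>F G H. into_end A F H (natob A G H \<otimes> natob A F G)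
                  (\<lambda>a. vcomp vself (fob F a) (fob G a) (fob H a) \<cdot>
                       (proj A G H a \<odot> proj A F G a))),
       vid = (\<lambda>F. into_end A F F \<I> (\<lambda>a. vid vself (fob F a))) \<rparr>"

text \<open>
  The Yoneda embedding \<open>Y : E\<^sup>o\<^sup>p \<rightarrow> [E,V]\<close>, \<open>e \<mapsto> E(e,-)\<close>. The other Yoneda embedding
  \<open>E \<rightarrow> [E\<^sup>o\<^sup>p,V]\<close>, \<open>e \<mapsto> E(-,e)\<close>, is \<open>yoneda (vop E)\<close>.
\<close>

definition yoneda ::
  "('a, 'o, 'm) vcat \<Rightarrow> ('a, ('a, 'o, 'm) vfun, 'm) vfun" where
  "yoneda E =
     \<lparr> fob = homfun E,
       far = (\<lambda>a b. into_end E (homfun E a) (homfun E b) (vhom E b a)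
                (\<lambda>c. far (homfun (vop E) c) a b)) \<rparr>"

text \<open>For \<open>D : A \<rightarrow> K\<close>, the functor \<open>K\<^sup>o\<^sup>p \<rightarrow> [A,V]\<close>, \<open>X \<mapsto> K(X,D-)\<close>.\<close>

definition nerve ::
  "('a, 'o, 'm) vcat \<Rightarrow> ('k, 'o, 'm) vcat \<Rightarrow> ('a, 'k, 'm) vfun \<Rightarrow>
   ('k, ('a, 'o, 'm) vfun, 'm) vfun" where
  "nerve A K D =
     \<lparr> fob = (\<lambda>X. fcomp (homfun K X) D),
       far = (\<lambda>X Y. into_end A (fcomp (homfun K X) D) (fcomp (homfun K Y) D) (vhom K Y X)
                (\<lambda>a. far (homfun (vop K) (fob D a)) X Y)) \<rparr>"


section \<open>Weighted limits and colimits\<close>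

text \<open>
  \<open>is_wlim A K \<psi> D L \<theta>\<close>: for \<open>\<psi> : A \<rightarrow> V\<close> and \<open>D : A \<rightarrow> K\<close>, the isomorphisms
  \<open>\<theta>\<^sub>X : K(X,L) \<rightarrow> [A,V](\<psi>, K(X,D-))\<close>, natural in \<open>X\<close>, exhibit \<open>L\<close> as \<open>{\<psi>,D}\<close>. The index
  category \<open>A\<close> is the domain of the weight, so it is \<open>E\<^sup>o\<^sup>p\<close> for a weight on \<open>E\<close>.
\<close>

definition is_wlim ::
  "('a, 'o, 'm) vcat \<Rightarrow> ('k, 'o, 'm) vcat \<Rightarrow> ('a, 'o, 'm) weight \<Rightarrow> ('a, 'k, 'm) vfun \<Rightarrow>
   'k \<Rightarrow> ('k \<Rightarrow> 'm) \<Rightarrow> bool" where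
  "is_wlim A K \<psi> D L \<theta> \<longleftrightarrow>
     L \<in> vob K \<and>
     vnat (vop K) (homfun (vop K) L) (fcomp (homfun (funcat A) \<psi>) (nerve A K D)) \<theta> \<and>
     (\<forall>X\<in>vob K. iso V (vhom K X L) (natob A \<psi> (fcomp (homfun K X) D)) (\<theta> X))"

text \<open>
  For a weight \<open>\<phi> : E\<^sup>o\<^sup>p \<rightarrow> V\<close> and \<open>D : E \<rightarrow> K\<close>, the colimit \<open>\<phi> \<star> D\<close> in \<open>K\<close> is the limit
  \<open>{\<phi>, D\<^sup>o\<^sup>p}\<close> in \<open>K\<^sup>o\<^sup>p\<close>: here \<open>\<theta>\<^sub>X : K(C,X) \<rightarrow> [E\<^sup>o\<^sup>p,V](\<phi>, K(D-,X))\<close>.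
\<close>

definition is_wcolim ::
  "('a, 'o, 'm) vcat \<Rightarrow> ('k, 'o, 'm) vcat \<Rightarrow> ('a, 'o, 'm) weight \<Rightarrow> ('a, 'k, 'm) vfun \<Rightarrow>
   'k \<Rightarrow> ('k \<Rightarrow> 'm) \<Rightarrow> bool" where
  "is_wcolim E K \<phi> D C \<theta> \<longleftrightarrow> is_wlim (vop E) (vop K) \<phi> (fop D) C \<theta>"

text \<open>
  The components \<open>\<psi>a \<rightarrow> K(X,Da)\<close> of the cylinder that corresponds under \<open>\<theta>\<^sub>X\<close> to an element
  \<open>k : \<I> \<rightarrow> K(X,L)\<close>; the unit of the limit is the cylinder of the identity of \<open>L\<close>.
\<close>

definition cylinder ::
  "('a, 'o, 'm) vcat \<Rightarrow> ('k, 'o, 'm) vcat \<Rightarrow> ('a, 'o, 'm) weight \<Rightarrow> ('a, 'k, 'm) vfun \<Rightarrow>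
   ('k \<Rightarrow> 'm) \<Rightarrow> 'k \<Rightarrow> 'm \<Rightarrow> 'a \<Rightarrow> 'm" where
  "cylinder A K \<psi> D \<theta> X k a =
     unnm (fob \<psi> a) (vhom K X (fob D a)) (proj A \<psi> (fcomp (homfun K X) D) a \<cdot> \<theta> X \<cdot> k)"

definition lim_unit ::
  "('a, 'o, 'm) vcat \<Rightarrow> ('k, 'o, 'm) vcat \<Rightarrow> ('a, 'o, 'm) weight \<Rightarrow> ('a, 'k, 'm) vfun \<Rightarrow>
   'k \<Rightarrow> ('k \<Rightarrow> 'm) \<Rightarrow> 'a \<Rightarrow> 'm" where
  "lim_unit A K \<psi> D L \<theta> = cylinder A K \<psi> D \<theta> L (vid K L)"

text \<open>\<open>F : K \<rightarrow> B\<close> preserves a limit if \<open>F\<close> applied to its unit is the unit of a limit in \<open>B\<close>.\<close>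

definition preserves_wlim ::
  "('a, 'o, 'm) vcat \<Rightarrow> ('k, 'o, 'm) vcat \<Rightarrow> ('b, 'o, 'm) vcat \<Rightarrow> ('k, 'b, 'm) vfun \<Rightarrow>
   ('a, 'o, 'm) weight \<Rightarrow> ('a, 'k, 'm) vfun \<Rightarrow> 'k \<Rightarrow> ('k \<Rightarrow> 'm) \<Rightarrow> bool" where
  "preserves_wlim A K B F \<psi> D L \<theta> \<longleftrightarrow>
     (\<exists>\<theta>'. is_wlim A B \<psi> (fcomp F D) (fob F L) \<theta>' \<and>
       (\<forall>a\<in>vob A. lim_unit A B \<psi> (fcomp F D) (fob F L) \<theta>' a =
                   far F L (fob D a) \<cdot> lim_unit A K \<psi> D L \<theta> a))"


section \<open>The functor \<open>\<phi> \<star> (-) : [E,V] \<rightarrow> V\<close>\<close>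

definition is_weight :: "('u, 'o, 'm) vcat \<Rightarrow> ('u, 'o, 'm) weight \<Rightarrow> bool" where
  "is_weight E \<phi> \<longleftrightarrow> small_vcategory E \<and> vfunctor (vop E) vself \<phi>"

definition the_star ::
  "('u, 'o, 'm) vcat \<Rightarrow> ('u, 'o, 'm) weight \<Rightarrow> ('u, 'o, 'm) vfun \<Rightarrow> 'o \<times> ('o \<Rightarrow> 'm)" where
  "the_star E \<phi> F = (SOME (C, \<theta>). is_wcolim E vself \<phi> F C \<theta>)"

definition star_ob ::
  "('u, 'o, 'm) vcat \<Rightarrow> ('u, 'o, 'm) weight \<Rightarrow> ('u, 'o, 'm) vfun \<Rightarrow> 'o" where
  "star_ob E \<phi> F = fst (the_star E \<phi> F)"

definition star_rep ::
  "('u, 'o, 'm) vcat \<Rightarrow> ('u, 'o, 'm) weight \<Rightarrow> ('u, 'o, 'm) vfun \<Rightarrow> 'o \<Rightarrow> 'm" where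
  "star_rep E \<phi> F = snd (the_star E \<phi> F)"

text \<open>The unit \<open>\<phi>e \<rightarrow> [Fe, \<phi> \<star> F]\<close> of the colimit.\<close>

definition star_unit ::
  "('u, 'o, 'm) vcat \<Rightarrow> ('u, 'o, 'm) weight \<Rightarrow> ('u, 'o, 'm) vfun \<Rightarrow> 'u \<Rightarrow> 'm" where
  "star_unit E \<phi> F =
     lim_unit (vop E) (vop vself) \<phi> (fop F) (star_ob E \<phi> F) (star_rep E \<phi> F)"

text \<open>
  The action \<open>[E,V](F,G) \<rightarrow> [\<phi> \<star> F, \<phi> \<star> G]\<close> is the arrow whose composite with
  \<open>[\<phi> \<star> F, \<phi> \<star> G] \<cong> [E\<^sup>o\<^sup>p,V](\<phi>, [F-, \<phi> \<star> G])\<close> has as components the transposes of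
  \<open>[E,V](F,G) \<otimes> \<phi>e \<rightarrow> [Fe,Ge] \<otimes> [Ge, \<phi> \<star> G] \<rightarrow> [Fe, \<phi> \<star> G]\<close>. It is the only action that makes
  these representations natural in \<open>F\<close>.
\<close>

definition star :: "('u, 'o, 'm) vcat \<Rightarrow> ('u, 'o, 'm) weight \<Rightarrow> (('u, 'o, 'm) vfun, 'o, 'm) vfun" where
  "star E \<phi> =
     \<lparr> fob = star_ob E \<phi>,
       far = (\<lambda>F G. THE k.
         k \<in> Hom V (natob E F G) (ihom (star_ob E \<phi> F) (star_ob E \<phi> G)) \<and>
         (\<forall>e\<in>vob E.
            proj (vop E) \<phi> (fcomp (homfun (vop vself) (star_ob E \<phi> G)) (fop F)) e \<cdot>
              star_rep E \<phi> F (star_ob E \<phi> G) \<cdot> k =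
            vcurry (natob E F G) (fob \<phi> e) (ihom (fob F e) (star_ob E \<phi> G))
              (vcomp (vop vself) (star_ob E \<phi> G) (fob G e) (fob F e) \<cdot>
                 (proj E F G e \<odot> star_unit E \<phi> G e)))) \<rparr>"

text \<open>
  The canonical arrow \<open>\<phi> \<star> Ye \<rightarrow> \<phi>e\<close> (an isomorphism): under the representation it corresponds to
  the family \<open>\<phi>c \<rightarrow> [E(e,c), \<phi>e]\<close> given by the action of \<open>\<phi>\<close>.
\<close>

definition star_yoneda :: "('u, 'o, 'm) vcat \<Rightarrow> ('u, 'o, 'm) weight \<Rightarrow> 'u \<Rightarrow> 'm" where
  "star_yoneda E \<phi> e = (THE k.
     k \<in> Hom V (star_ob E \<phi> (homfun E e)) (fob \<phi> e) \<and>
     (\<forall>c\<in>vob E.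
        cylinder (vop E) (vop vself) \<phi> (fop (homfun E e)) (star_rep E \<phi> (homfun E e)) (fob \<phi> e)
          (nm (star_ob E \<phi> (homfun E e)) (fob \<phi> e) k) c =
        vcurry (fob \<phi> c) (vhom E e c) (fob \<phi> e)
          (vuncurry (fob \<phi> c) (fob \<phi> e) (far \<phi> c e) \<cdot> symm (fob \<phi> c) (vhom E e c))))"


section \<open>Preservation of limits of representables, flatness, soundness\<close>

text \<open>
  Let \<open>S : A \<rightarrow> [E,V]\<close> have values \<open>Sa = Y(ta)\<close>, let \<open>(L, \<theta>)\<close> be the limit \<open>{\<psi>,S}\<close> and \<open>(P, \<rho>)\<close> the
  limit \<open>{\<psi>,G}\<close> of \<open>G : A \<rightarrow> V\<close>, \<open>Ga = \<phi>(ta)\<close>. The canonical arrow \<open>\<phi> \<star> L \<rightarrow> P\<close> corresponds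
  under \<open>\<rho>\<close> to the cylinder
  \<open>\<psi>a \<rightarrow> [E,V](L,Sa) \<rightarrow> [\<phi> \<star> L, \<phi> \<star> Y(ta)] \<cong> [\<phi> \<star> L, \<phi>(ta)]\<close>.
\<close>

definition can ::
  "('u, 'o, 'm) vcat \<Rightarrow> ('u, 'o, 'm) weight \<Rightarrow> ('a, 'o, 'm) vcat \<Rightarrow> ('a, 'o, 'm) weight \<Rightarrow>
   ('a \<Rightarrow> 'u) \<Rightarrow>
   ('a, ('u, 'o, 'm) vfun, 'm) vfun \<Rightarrow> ('u, 'o, 'm) vfun \<Rightarrow> (('u, 'o, 'm) vfun \<Rightarrow> 'm) \<Rightarrow>
   ('a, 'o, 'm) vfun \<Rightarrow> 'o \<Rightarrow> ('o \<Rightarrow> 'm) \<Rightarrow> 'm" where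
  "can E \<phi> A \<psi> t S L \<theta> G P \<rho> = (THE k.
     k \<in> Hom V (star_ob E \<phi> L) P \<and>
     (\<forall>a\<in>vob A.
        cylinder A vself \<psi> G \<rho> (star_ob E \<phi> L) (nm (star_ob E \<phi> L) P k) a =
        ihom_post (star_ob E \<phi> L) (star_ob E \<phi> (fob S a)) (fob \<phi> (t a)) (star_yoneda E \<phi> (t a)) \<cdot>
          far (star E \<phi>) L (fob S a) \<cdot> lim_unit A (funcat E) \<psi> S L \<theta> a))"

text \<open>
  The canonical arrow is an isomorphism for all choices of the two limits (which always exist
  when \<open>V\<close> is complete and the weights are small).
\<close>

definition can_is_iso ::
  "('u, 'o, 'm) vcat \<Rightarrow> ('u, 'o, 'm) weight \<Rightarrow> ('a, 'o, 'm) vcat \<Rightarrow> ('a, 'o, 'm) weight \<Rightarrow>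
   ('a \<Rightarrow> 'u) \<Rightarrow> ('a, ('u, 'o, 'm) vfun, 'm) vfun \<Rightarrow> ('a, 'o, 'm) vfun \<Rightarrow> bool" where
  "can_is_iso E \<phi> A \<psi> t S G \<longleftrightarrow>
     (\<forall>L \<theta> P \<rho>. is_wlim A (funcat E) \<psi> S L \<theta> \<longrightarrow> is_wlim A vself \<psi> G P \<rho> \<longrightarrow>
        iso V (star_ob E \<phi> L) P (can E \<phi> A \<psi> t S L \<theta> G P \<rho>))"

text \<open>A class of weights is a set of pairs \<open>(D, \<psi>)\<close> with \<open>\<psi> : D\<^sup>o\<^sup>p \<rightarrow> V\<close> and \<open>D\<close> small.\<close>

definition weight_class :: "(('u, 'o, 'm) vcat \<times> ('u, 'o, 'm) weight) set \<Rightarrow> bool" where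
  "weight_class \<Psi> \<longleftrightarrow> (\<forall>(D, \<psi>)\<in>\<Psi>. is_weight D \<psi>)"

definition flat ::
  "(('u, 'o, 'm) vcat \<times> ('u, 'o, 'm) weight) set \<Rightarrow>
   ('u, 'o, 'm) vcat \<Rightarrow> ('u, 'o, 'm) weight \<Rightarrow> bool" where
  "flat \<Psi> E \<phi> \<longleftrightarrow>
     (\<forall>(D, \<psi>)\<in>\<Psi>. \<forall>S L \<theta>. vfunctor (vop D) (funcat E) S \<longrightarrow>
        is_wlim (vop D) (funcat E) \<psi> S L \<theta> \<longrightarrow>
        preserves_wlim (vop D) (funcat E) vself (star E \<phi>) \<psi> S L \<theta>)"

definition preserves_limits_of_representables ::
  "(('u, 'o, 'm) vcat \<times> ('u, 'o, 'm) weight) set \<Rightarrow>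
   ('u, 'o, 'm) vcat \<Rightarrow> ('u, 'o, 'm) weight \<Rightarrow> bool" where
  "preserves_limits_of_representables \<Psi> E \<phi> \<longleftrightarrow>
     (\<forall>(D, \<psi>)\<in>\<Psi>. \<forall>T. vfunctor D E T \<longrightarrow>
        can_is_iso E \<phi> (vop D) \<psi> (fob T) (fcomp (yoneda E) (fop T)) (fcomp \<phi> (fop T)))"

definition sound :: "(('u, 'o, 'm) vcat \<times> ('u, 'o, 'm) weight) set \<Rightarrow> bool" where
  "sound \<Psi> \<longleftrightarrow>
     (\<forall>E \<phi>. is_weight E \<phi> \<longrightarrow> preserves_limits_of_representables \<Psi> E \<phi> \<longrightarrow> flat \<Psi> E \<phi>)"

text \<open>
  The objects of \<open>\<Psi>\<^sub>1(E)\<close>: the colimits \<open>\<psi> \<star> YT\<close> in \<open>[E\<^sup>o\<^sup>p,V]\<close> (that is, the left Kan extensions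
  of \<open>\<psi>\<close> along \<open>T\<^sup>o\<^sup>p\<close>), with \<open>\<psi> : D\<^sup>o\<^sup>p \<rightarrow> V\<close> in \<open>\<Psi>\<close> and \<open>T : D \<rightarrow> E\<close>.
\<close>

definition Psi1 ::
  "(('u, 'o, 'm) vcat \<times> ('u, 'o, 'm) weight) set \<Rightarrow>
   ('u, 'o, 'm) vcat \<Rightarrow> ('u, 'o, 'm) weight set" where
  "Psi1 \<Psi> E =
     {\<alpha>. vfunctor (vop E) vself \<alpha> \<and>
         (\<exists>(D, \<psi>)\<in>\<Psi>. \<exists>T \<theta>. vfunctor D E T \<and>
            is_wcolim D (funcat (vop E)) \<psi> (fcomp (yoneda (vop E)) T) \<alpha> \<theta>)}"

end

end

theory Submission
  imports Defs
begin

text \<open>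
  For a fixed weight \<open>\<phi>\<close> on \<open>E\<close>, soundness and the second condition both assert that some hypothesis
  implies flatness of \<open>\<phi>\<close>. The theorem holds because the two hypotheses are equivalent for each
  single \<open>\<phi>\<close> (\<open>preserves_limits_of_representables_iff\<close>).

  Let \<open>\<psi>\<close> be a weight on \<open>D\<close> belonging to \<open>\<Psi>\<close>, let \<open>T : D \<rightarrow> E\<close>, and let \<open>\<alpha>\<close> be the left Kan extension
  of \<open>\<psi>\<close> along \<open>T\<^sup>o\<^sup>p\<close> with unit \<open>\<eta> : \<psi> \<rightarrow> \<alpha>T\<^sup>o\<^sup>p\<close>. For \<open>S : E\<^sup>o\<^sup>p \<rightarrow> K\<close>, restriction along \<open>\<eta>\<close> identifies
  transformations \<open>\<alpha> \<rightarrow> K(X,S-)\<close> with transformations \<open>\<psi> \<rightarrow> K(X,ST\<^sup>o\<^sup>p-)\<close>, so that \<open>{\<alpha>,S}\<close> and \<open>{\<psi>,ST\<^sup>o\<^sup>p}\<close>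
  are the same limits, the unit of the second being the restriction of the unit of the first
  (\<open>limit_unit_restrict\<close>, \<open>limit_unit_extend\<close>). Applied to \<open>S = Y\<close> and to \<open>S = \<phi>\<close>, this shows that the
  canonical morphisms \<open>\<phi> \<star> {\<alpha>,Y} \<rightarrow> {\<alpha>,\<phi>}\<close> and \<open>\<phi> \<star> {\<psi>,YT\<^sup>o\<^sup>p} \<rightarrow> {\<psi>,\<phi>T\<^sup>o\<^sup>p}\<close> have the same domains and
  codomains. They are also equal, because each is defined by an equation of natural transformations
  out of its weight, and transformations out of \<open>\<alpha>\<close> that agree after restriction along \<open>\<eta>\<close> are equal
  (\<open>can_restrict\<close>). Now \<open>Psi1\<close> consists of the colimits \<open>\<psi> \<star> YT\<close> in \<open>[E\<^sup>o\<^sup>p,V]\<close>, which by the Yoneda lemma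
  are the left Kan extensions (\<open>lan_of_wcolim\<close>, \<open>wcolim_of_lan\<close>), and a left Kan extension exists for
  every \<open>\<psi>\<close> and \<open>T\<close>, namely \<open>e \<mapsto> \<psi> \<star> E(e,T-)\<close> (\<open>lan_exists\<close>).

  Equations of arrows in \<open>V\<close> are proved with generalised elements. An element of \<open>X\<close> is an arrow to
  \<open>X\<close> from a tensor product whose factors are labelled by positions; elements that use different
  positions can be paired, and as a factor is identified by its position, the coherence of \<open>V\<close> makes
  this pairing strictly associative and commutative. Arrows are determined by their values
  on elements, and even arrows out of a tensor product by their values on pairs. The axioms of
  \<open>V\<close>-categories, functors and ends thereby become the equations of ordinary category theory,
  restricted to elements with disjoint positions.
\<close>

section \<open>Coherence in a symmetric monoidal closed category\<close>

locale smc_closed =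
  fixes V :: "('o, 'm) smc" (structure)
  assumes closed: "sym_monoidal_closed V"
begin

text \<open>
  Nothing is known about \<open>Hom V X Y\<close> when \<open>X\<close> or \<open>Y\<close> is not an object. Including these
  conditions in the arrow set makes typing an arrow enough to know that its ends are objects.
\<close>

definition ar :: "'o \<Rightarrow> 'o \<Rightarrow> 'm set" where
  "ar X Y = {f. X \<in> Ob V \<and> Y \<in> Ob V \<and> f \<in> Hom V X Y}"

lemma monoidal: "sym_monoidal V" and cat: "category V"
  using closed by (simp_all add: sym_monoidal_closed_def sym_monoidal_def)

lemma arI: "\<lbrakk>X \<in> Ob V; Y \<in> Ob V; f \<in> Hom V X Y\<rbrakk> \<Longrightarrow> f \<in> ar X Y"
  and ar_dom: "f \<in> ar X Y \<Longrightarrow> X \<in> Ob V"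
  and ar_cod: "f \<in> ar X Y \<Longrightarrow> Y \<in> Ob V"
  and ar_Hom: "f \<in> ar X Y \<Longrightarrow> f \<in> Hom V X Y"
  by (auto simp: ar_def)

lemma id_in [simp]: "X \<in> Ob V \<Longrightarrow> \<one> X \<in> ar X X"
  using cat by (simp add: category_def ar_def)

lemma comp_in: "f \<in> ar X Y \<Longrightarrow> g \<in> ar Y Z \<Longrightarrow> g \<cdot> f \<in> ar X Z"
  using cat unfolding category_def ar_def by blast

lemma comp_id: "f \<in> ar X Y \<Longrightarrow> f \<cdot> \<one> X = f"
  and id_comp: "f \<in> ar X Y \<Longrightarrow> \<one> Y \<cdot> f = f"
  using cat unfolding category_def ar_def by blast+

lemma cassoc:
  assumes "f \<in> ar W X" "g \<in> ar X Y" "h \<in> ar Y Z"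
  shows "(h \<cdot> g) \<cdot> f = h \<cdot> (g \<cdot> f)"
proof -
  have "h \<cdot> (g \<cdot> f) = (h \<cdot> g) \<cdot> f"
    using cat assms unfolding category_def ar_def by blast
  then show ?thesis ..
qed

abbreviation iv :: "'o \<Rightarrow> 'o \<Rightarrow> 'm \<Rightarrow> 'm" where "iv X Y f \<equiv> inv_arrow V X Y f"

lemma inverse_unique:
  assumes "X \<in> Ob V" "Y \<in> Ob V" "inverse_arrows V X Y f g" "inverse_arrows V X Y f h"
  shows "g = h"
proof -
  have t: "f \<in> ar X Y" "g \<in> ar Y X" "h \<in> ar Y X"
    using assms by (auto simp: inverse_arrows_def ar_def)
  have "g = g \<cdot> (f \<cdot> h)" using assms t by (simp add: inverse_arrows_def comp_id)
  also have "\<dots> = (g \<cdot> f) \<cdot> h" using cassoc t by metis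
  also have "\<dots> = h" using assms t by (simp add: inverse_arrows_def id_comp)
  finally show ?thesis .
qed

lemma iv_inverse:
  assumes "X \<in> Ob V" "Y \<in> Ob V" "iso V X Y f"
  shows "inverse_arrows V X Y f (iv X Y f)"
  using assms inverse_unique unfolding inv_arrow_def iso_def by (metis (mono_tags, lifting) theI)

definition isoa :: "'o \<Rightarrow> 'o \<Rightarrow> 'm set" where
  "isoa X Y = {f \<in> ar X Y. iso V X Y f}"

lemma isoa_ar: "f \<in> isoa X Y \<Longrightarrow> f \<in> ar X Y" and isoa_iso: "f \<in> isoa X Y \<Longrightarrow> iso V X Y f"
  by (auto simp: isoa_def)

lemma isoaI: "\<lbrakk>f \<in> ar X Y; g \<in> ar Y X; g \<cdot> f = \<one> X; f \<cdot> g = \<one> Y\<rbrakk> \<Longrightarrow> f \<in> isoa X Y"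
  by (auto simp: isoa_def iso_def inverse_arrows_def ar_def)

lemma isoaI': "\<lbrakk>X \<in> Ob V; Y \<in> Ob V; iso V X Y f\<rbrakk> \<Longrightarrow> f \<in> isoa X Y"
  by (auto simp: isoa_def iso_def inverse_arrows_def ar_def)

lemma iv_in: "f \<in> isoa X Y \<Longrightarrow> iv X Y f \<in> ar Y X"
  and iv_l: "f \<in> isoa X Y \<Longrightarrow> iv X Y f \<cdot> f = \<one> X"
  and iv_r: "f \<in> isoa X Y \<Longrightarrow> f \<cdot> iv X Y f = \<one> Y"
  using iv_inverse[of X Y f] by (auto simp: isoa_def inverse_arrows_def ar_def)

lemma iv_isoa: "f \<in> isoa X Y \<Longrightarrow> iv X Y f \<in> isoa Y X"
  by (rule isoaI[where g=f]) (auto simp: iv_in iv_l iv_r isoa_ar)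

lemma id_isoa: "X \<in> Ob V \<Longrightarrow> \<one> X \<in> isoa X X"
  by (rule isoaI[where g="\<one> X"]) (auto simp: comp_id[of _ X X])

lemma iv_cancel_l: "f \<in> isoa X Y \<Longrightarrow> h \<in> ar W X \<Longrightarrow> iv X Y f \<cdot> (f \<cdot> h) = h"
  by (simp add: cassoc[symmetric, OF _ isoa_ar iv_in] iv_l id_comp)

lemma iv_cancel_r: "f \<in> isoa X Y \<Longrightarrow> h \<in> ar W Y \<Longrightarrow> f \<cdot> (iv X Y f \<cdot> h) = h"
  by (simp add: cassoc[symmetric, OF _ iv_in isoa_ar] iv_r id_comp)

lemma comp_isoa:
  assumes f: "f \<in> isoa X Y" and g: "g \<in> isoa Y Z"
  shows "g \<cdot> f \<in> isoa X Z"
proof (rule isoaI[where g="iv X Y f \<cdot> iv Y Z g"])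
  note t = isoa_ar[OF f] isoa_ar[OF g] iv_in[OF f] iv_in[OF g]
  note gf = comp_in[OF t(1,2)] and fg = comp_in[OF t(4,3)]
  show "g \<cdot> f \<in> ar X Z" "iv X Y f \<cdot> iv Y Z g \<in> ar Z X" using gf fg .
  show "iv X Y f \<cdot> iv Y Z g \<cdot> (g \<cdot> f) = \<one> X"
    using f by (simp add: cassoc[OF gf t(4,3)] iv_cancel_l[OF g t(1)] iv_l)
  show "g \<cdot> f \<cdot> (iv X Y f \<cdot> iv Y Z g) = \<one> Z"
    using g by (simp add: cassoc[OF fg t(1,2)] iv_cancel_r[OF f t(4)] iv_r)
qed

lemma iso_epi:
  assumes e: "e \<in> isoa X Y" and f: "f \<in> ar Y Z" and g: "g \<in> ar Y Z" and eq: "f \<cdot> e = g \<cdot> e"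
  shows "f = g"
proof -
  have *: "(h \<cdot> e) \<cdot> iv X Y e = h" if "h \<in> ar Y Z" for h
    using cassoc[OF iv_in[OF e] isoa_ar[OF e] that] comp_id[OF that] iv_r[OF e] by simp
  have "f = (f \<cdot> e) \<cdot> iv X Y e" by (rule *[OF f, symmetric])
  also have "\<dots> = (g \<cdot> e) \<cdot> iv X Y e" by (simp only: eq)
  also have "\<dots> = g" by (rule *[OF g])
  finally show ?thesis .
qed

lemma iso_mono:
  assumes e: "e \<in> isoa Y Z" and f: "f \<in> ar X Y" and g: "g \<in> ar X Y" and eq: "e \<cdot> f = e \<cdot> g"
  shows "f = g"
proof -
  have "f = iv Y Z e \<cdot> (e \<cdot> f)" by (rule iv_cancel_l[OF e f, symmetric])
  also have "\<dots> = iv Y Z e \<cdot> (e \<cdot> g)" by (simp only: eq)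
  also have "\<dots> = g" by (rule iv_cancel_l[OF e g])
  finally show ?thesis .
qed

text \<open>
  In this order: the type of a tensor of arrows and its functoriality, naturality of \<open>assoc\<close>,
  \<open>lun\<close>, \<open>run\<close> and \<open>symm\<close>, the pentagon, and the conjunction of triangle and hexagon.
\<close>

lemmas monoidal_axioms =
  monoidal[unfolded sym_monoidal_def, THEN conjunct2, THEN conjunct2, THEN conjunct2, THEN conjunct1, rule_format]
  monoidal[unfolded sym_monoidal_def, THEN conjunct2, THEN conjunct2, THEN conjunct2, THEN conjunct2, THEN conjunct2, THEN conjunct1, rule_format]
  monoidal[unfolded sym_monoidal_def, THEN conjunct2, THEN conjunct2, THEN conjunct2, THEN conjunct2, THEN conjunct2, THEN conjunct2, THEN conjunct2, THEN conjunct2, THEN conjunct2, THEN conjunct2, THEN conjunct2, THEN conjunct1, rule_format]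
  monoidal[unfolded sym_monoidal_def, THEN conjunct2, THEN conjunct2, THEN conjunct2, THEN conjunct2, THEN conjunct2, THEN conjunct2, THEN conjunct2, THEN conjunct2, THEN conjunct2, THEN conjunct2, THEN conjunct2, THEN conjunct2, THEN conjunct1, rule_format]
  monoidal[unfolded sym_monoidal_def, THEN conjunct2, THEN conjunct2, THEN conjunct2, THEN conjunct2, THEN conjunct2, THEN conjunct2, THEN conjunct2, THEN conjunct2, THEN conjunct2, THEN conjunct2, THEN conjunct2, THEN conjunct2, THEN conjunct2, THEN conjunct1, rule_format]
  monoidal[unfolded sym_monoidal_def, THEN conjunct2, THEN conjunct2, THEN conjunct2, THEN conjunct2, THEN conjunct2, THEN conjunct2, THEN conjunct2, THEN conjunct2, THEN conjunct2, THEN conjunct2, THEN conjunct2, THEN conjunct2, THEN conjunct2, THEN conjunct2, THEN conjunct1, rule_format]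
  monoidal[unfolded sym_monoidal_def, THEN conjunct2, THEN conjunct2, THEN conjunct2, THEN conjunct2, THEN conjunct2, THEN conjunct2, THEN conjunct2, THEN conjunct2, THEN conjunct2, THEN conjunct2, THEN conjunct2, THEN conjunct2, THEN conjunct2, THEN conjunct2, THEN conjunct2, THEN conjunct1, rule_format]
  monoidal[unfolded sym_monoidal_def, THEN conjunct2, THEN conjunct2, THEN conjunct2, THEN conjunct2, THEN conjunct2, THEN conjunct2, THEN conjunct2, THEN conjunct2, THEN conjunct2, THEN conjunct2, THEN conjunct2, THEN conjunct2, THEN conjunct2, THEN conjunct2, THEN conjunct2, THEN conjunct2, THEN conjunct2, rule_format]

lemma unit_ob [simp]: "\<I> \<in> Ob V"
  and tens_ob [simp]: "X \<in> Ob V \<Longrightarrow> Y \<in> Ob V \<Longrightarrow> X \<otimes> Y \<in> Ob V"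
  and ihom_ob [simp]: "X \<in> Ob V \<Longrightarrow> Y \<in> Ob V \<Longrightarrow> ihom X Y \<in> Ob V"
  using closed by (auto simp: sym_monoidal_closed_def sym_monoidal_def)

lemma tens_in: "f \<in> ar X X' \<Longrightarrow> g \<in> ar Y Y' \<Longrightarrow> f \<odot> g \<in> ar (X \<otimes> Y) (X' \<otimes> Y')"
  by (auto simp: ar_def intro: monoidal_axioms(1))

lemma tens_id [simp]: "X \<in> Ob V \<Longrightarrow> Y \<in> Ob V \<Longrightarrow> \<one> X \<odot> \<one> Y = \<one> (X \<otimes> Y)"
  using monoidal by (simp add: sym_monoidal_def)

lemma tens_comp:
  "\<lbrakk>f \<in> ar X X'; f' \<in> ar X' X''; g \<in> ar Y Y'; g' \<in> ar Y' Y''\<rbrakk> \<Longrightarrow>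
   (f' \<odot> g') \<cdot> (f \<odot> g) = (f' \<cdot> f) \<odot> (g' \<cdot> g)"
  by (rule monoidal_axioms(2)[of X X' X'' Y Y' Y'', symmetric]) (simp_all add: ar_def)

lemma assoc_isoa: "\<lbrakk>X \<in> Ob V; Y \<in> Ob V; Z \<in> Ob V\<rbrakk> \<Longrightarrow>
    assoc X Y Z \<in> isoa ((X \<otimes> Y) \<otimes> Z) (X \<otimes> (Y \<otimes> Z))"
  and lun_isoa: "X \<in> Ob V \<Longrightarrow> lun X \<in> isoa (\<I> \<otimes> X) X"
  and run_isoa: "X \<in> Ob V \<Longrightarrow> run X \<in> isoa (X \<otimes> \<I>) X"
  using monoidal by (simp_all add: sym_monoidal_def isoaI')

lemma assoc_in [simp]: "\<lbrakk>X \<in> Ob V; Y \<in> Ob V; Z \<in> Ob V\<rbrakk> \<Longrightarrow>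
    assoc X Y Z \<in> ar ((X \<otimes> Y) \<otimes> Z) (X \<otimes> (Y \<otimes> Z))"
  and lun_in [simp]: "X \<in> Ob V \<Longrightarrow> lun X \<in> ar (\<I> \<otimes> X) X"
  and run_in [simp]: "X \<in> Ob V \<Longrightarrow> run X \<in> ar (X \<otimes> \<I>) X"
  and symm_in [simp]: "X \<in> Ob V \<Longrightarrow> Y \<in> Ob V \<Longrightarrow> symm X Y \<in> ar (X \<otimes> Y) (Y \<otimes> X)"
  using monoidal
  by (auto simp: assoc_isoa isoa_ar lun_isoa run_isoa sym_monoidal_def intro!: arI)

lemma symm_symm: "X \<in> Ob V \<Longrightarrow> Y \<in> Ob V \<Longrightarrow> symm Y X \<cdot> symm X Y = \<one> (X \<otimes> Y)"
  using monoidal by (simp add: sym_monoidal_def)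

lemma symm_isoa: "X \<in> Ob V \<Longrightarrow> Y \<in> Ob V \<Longrightarrow> symm X Y \<in> isoa (X \<otimes> Y) (Y \<otimes> X)"
  by (rule isoaI[where g="symm Y X"]) (auto simp: symm_symm)

lemma assoc_nat: "\<lbrakk>f \<in> ar X X'; g \<in> ar Y Y'; h \<in> ar Z Z'\<rbrakk> \<Longrightarrow>
    assoc X' Y' Z' \<cdot> ((f \<odot> g) \<odot> h) = (f \<odot> (g \<odot> h)) \<cdot> assoc X Y Z"
  and lun_nat: "f \<in> ar X Y \<Longrightarrow> lun Y \<cdot> (\<one> \<I> \<odot> f) = f \<cdot> lun X"
  and run_nat: "f \<in> ar X Y \<Longrightarrow> run Y \<cdot> (f \<odot> \<one> \<I>) = f \<cdot> run X"
  and symm_nat: "f \<in> ar X X' \<Longrightarrow> g \<in> ar Y Y' \<Longrightarrow> symm X' Y' \<cdot> (f \<odot> g) = (g \<odot> f) \<cdot> symm X Y"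
  by (rule monoidal_axioms(3) monoidal_axioms(4) monoidal_axioms(5) monoidal_axioms(6); auto simp: ar_def)+

lemma tens_isoa:
  assumes f: "f \<in> isoa X X'" and g: "g \<in> isoa Y Y'"
  shows "f \<odot> g \<in> isoa (X \<otimes> Y) (X' \<otimes> Y')"
proof (rule isoaI[where g="iv X X' f \<odot> iv Y Y' g"])
  note t = isoa_ar[OF f] isoa_ar[OF g] iv_in[OF f] iv_in[OF g]
  note o = ar_dom[OF t(1)] ar_cod[OF t(1)] ar_dom[OF t(2)] ar_cod[OF t(2)]
  show "f \<odot> g \<in> ar (X \<otimes> Y) (X' \<otimes> Y')" "iv X X' f \<odot> iv Y Y' g \<in> ar (X' \<otimes> Y') (X \<otimes> Y)"
    using t by (blast intro: tens_in)+
  show "iv X X' f \<odot> iv Y Y' g \<cdot> f \<odot> g = \<one> (X \<otimes> Y)"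
    using tens_comp[OF t(1,3,2,4)] f g o by (simp add: iv_l)
  show "f \<odot> g \<cdot> iv X X' f \<odot> iv Y Y' g = \<one> (X' \<otimes> Y')"
    using tens_comp[OF t(3,1,4,2)] f g o by (simp add: iv_r)
qed

lemma pentagon:
  assumes "W \<in> Ob V" "X \<in> Ob V" "Y \<in> Ob V" "Z \<in> Ob V"
  shows "(\<one> W \<odot> assoc X Y Z) \<cdot> (assoc W (X \<otimes> Y) Z \<cdot> (assoc W X Y \<odot> \<one> Z)) =
         assoc W X (Y \<otimes> Z) \<cdot> assoc (W \<otimes> X) Y Z"
proof -
  have "(\<one> W \<odot> assoc X Y Z) \<cdot> assoc W (X \<otimes> Y) Z \<cdot> (assoc W X Y \<odot> \<one> Z) =
         assoc W X (Y \<otimes> Z) \<cdot> assoc (W \<otimes> X) Y Z"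
    by (rule monoidal_axioms(7)[symmetric]) (fact assms)+
  then show ?thesis
    using assms by (subst (asm) cassoc) (assumption | rule tens_in assoc_in id_in tens_ob)+
qed

lemma triangle: "X \<in> Ob V \<Longrightarrow> Y \<in> Ob V \<Longrightarrow> (\<one> X \<odot> lun Y) \<cdot> assoc X \<I> Y = run X \<odot> \<one> Y"
  using monoidal by (simp add: sym_monoidal_def)

lemma hexagon:
  assumes "X \<in> Ob V" "Y \<in> Ob V" "Z \<in> Ob V"
  shows "assoc Y Z X \<cdot> (symm X (Y \<otimes> Z) \<cdot> assoc X Y Z) =
         (\<one> Y \<odot> symm X Z) \<cdot> (assoc Y X Z \<cdot> (symm X Y \<odot> \<one> Z))"
proof -
  have 1: "assoc Y Z X \<cdot> symm X (Y \<otimes> Z) \<cdot> assoc X Y Z =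
         (\<one> Y \<odot> symm X Z) \<cdot> assoc Y X Z \<cdot> (symm X Y \<odot> \<one> Z)"
    by (rule monoidal_axioms(8)) (fact assms)+
  have 2: "assoc Y Z X \<cdot> symm X (Y \<otimes> Z) \<cdot> assoc X Y Z =
      assoc Y Z X \<cdot> (symm X (Y \<otimes> Z) \<cdot> assoc X Y Z)"
    using assms by (subst cassoc) (assumption | rule refl tens_in assoc_in symm_in id_in tens_ob)+
  have 3: "(\<one> Y \<odot> symm X Z) \<cdot> assoc Y X Z \<cdot> (symm X Y \<odot> \<one> Z) =
      (\<one> Y \<odot> symm X Z) \<cdot> (assoc Y X Z \<cdot> (symm X Y \<odot> \<one> Z))"
    using assms by (subst cassoc) (assumption | rule refl tens_in assoc_in symm_in id_in tens_ob)+
  show ?thesis using 1 2 3 by simp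
qed

lemmas ty = comp_in tens_in assoc_in symm_in id_in tens_ob lun_in run_in unit_ob

lemma tens_l: "\<lbrakk>f \<in> ar X Y; g \<in> ar Y Z; W \<in> Ob V\<rbrakk> \<Longrightarrow>
    (\<one> W \<odot> g) \<cdot> (\<one> W \<odot> f) = \<one> W \<odot> (g \<cdot> f)"
  by (simp add: tens_comp[of _ W W _ W] comp_id[of _ W W])

lemma tens_r: "\<lbrakk>f \<in> ar X Y; g \<in> ar Y Z; W \<in> Ob V\<rbrakk> \<Longrightarrow>
    (g \<odot> \<one> W) \<cdot> (f \<odot> \<one> W) = (g \<cdot> f) \<odot> \<one> W"
  by (simp add: tens_comp[of _ _ _ _ _ _ W W _ W] comp_id[of _ W W])

text \<open>
  Tensoring with the unit is isomorphic to the identity functor, hence faithful. This is how Kelly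
  derives the remaining coherence triangles from the pentagon, triangle and hexagon: an equation
  is tensored with \<open>\<I>\<close>, where the axioms can be used.
\<close>

lemma unit_tens_faithful:
  assumes "f \<in> ar X Y" "g \<in> ar X Y" "\<one> \<I> \<odot> f = \<one> \<I> \<odot> g" shows "f = g"
proof -
  have "f \<cdot> lun X = g \<cdot> lun X" using lun_nat[OF assms(1)] lun_nat[OF assms(2)] assms(3) by simp
  then show ?thesis using iso_epi[OF lun_isoa] assms ar_dom by blast
qed

lemma tens_unit_faithful:
  assumes "f \<in> ar X Y" "g \<in> ar X Y" "f \<odot> \<one> \<I> = g \<odot> \<one> \<I>" shows "f = g"
proof -
  have "f \<cdot> run X = g \<cdot> run X" using run_nat[OF assms(1)] run_nat[OF assms(2)] assms(3) by simp
  then show ?thesis using iso_epi[OF run_isoa] assms ar_dom by blast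
qed

text \<open>
  After tensoring with \<open>\<I>\<close> on the left, this is the pentagon for \<open>\<I>, \<I>, X, Y\<close>, with the units evaluated
  by the triangle.
\<close>

lemma lun_tens:
  assumes X: "X \<in> Ob V" and Y: "Y \<in> Ob V"
  shows "lun (X \<otimes> Y) \<cdot> assoc \<I> X Y = lun X \<odot> \<one> Y"
proof (rule unit_tens_faithful)
  show "lun (X \<otimes> Y) \<cdot> assoc \<I> X Y \<in> ar ((\<I> \<otimes> X) \<otimes> Y) (X \<otimes> Y)"
    "lun X \<odot> \<one> Y \<in> ar ((\<I> \<otimes> X) \<otimes> Y) (X \<otimes> Y)"
    using X Y by (auto intro!: ty)
  let ?e = "assoc \<I> (\<I> \<otimes> X) Y \<cdot> (assoc \<I> \<I> X \<odot> \<one> Y)"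
  have e: "?e \<in> isoa (((\<I> \<otimes> \<I>) \<otimes> X) \<otimes> Y) (\<I> \<otimes> ((\<I> \<otimes> X) \<otimes> Y))"
    using X Y by (auto intro!: comp_isoa tens_isoa assoc_isoa id_isoa)
  note t = X Y isoa_ar[OF e]
  show "\<one> \<I> \<odot> (lun (X \<otimes> Y) \<cdot> assoc \<I> X Y) = \<one> \<I> \<odot> (lun X \<odot> \<one> Y)"
  proof (rule iso_epi[OF e])
    have "(\<one> \<I> \<odot> (lun (X \<otimes> Y) \<cdot> assoc \<I> X Y)) \<cdot> ?e =
          ((\<one> \<I> \<odot> lun (X \<otimes> Y)) \<cdot> (\<one> \<I> \<odot> assoc \<I> X Y)) \<cdot> ?e"
      using t by (subst tens_l) (auto intro!: ty)
    also have "\<dots> = (\<one> \<I> \<odot> lun (X \<otimes> Y)) \<cdot> ((\<one> \<I> \<odot> assoc \<I> X Y) \<cdot> ?e)"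
      by (rule cassoc[OF isoa_ar[OF e]]) (use t in \<open>auto intro!: ty\<close>)
    also have "\<dots> = (\<one> \<I> \<odot> lun (X \<otimes> Y)) \<cdot> (assoc \<I> \<I> (X \<otimes> Y) \<cdot> assoc (\<I> \<otimes> \<I>) X Y)"
      using t by (simp add: pentagon)
    also have "\<dots> = ((\<one> \<I> \<odot> lun (X \<otimes> Y)) \<cdot> assoc \<I> \<I> (X \<otimes> Y)) \<cdot> assoc (\<I> \<otimes> \<I>) X Y"
      by (rule cassoc[symmetric]) (insert t, (assumption | rule ty)+)
    also have "\<dots> = (run \<I> \<odot> (\<one> X \<odot> \<one> Y)) \<cdot> assoc (\<I> \<otimes> \<I>) X Y"
      using t by (simp add: triangle)
    also have "\<dots> = assoc \<I> X Y \<cdot> ((run \<I> \<odot> \<one> X) \<odot> \<one> Y)"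
      by (rule assoc_nat[symmetric]) (insert t, (assumption | rule ty)+)
    also have "\<dots> = assoc \<I> X Y \<cdot> (((\<one> \<I> \<odot> lun X) \<odot> \<one> Y) \<cdot> (assoc \<I> \<I> X \<odot> \<one> Y))"
      using t by (subst tens_r[of _ "(\<I> \<otimes> \<I>) \<otimes> X" "\<I> \<otimes> (\<I> \<otimes> X)" _ "\<I> \<otimes> X"]) (auto simp: triangle intro!: ty)
    also have "\<dots> = (assoc \<I> X Y \<cdot> ((\<one> \<I> \<odot> lun X) \<odot> \<one> Y)) \<cdot> (assoc \<I> \<I> X \<odot> \<one> Y)"
      by (rule cassoc[symmetric]) (insert t, (assumption | rule ty)+)
    also have "\<dots> = ((\<one> \<I> \<odot> (lun X \<odot> \<one> Y)) \<cdot> assoc \<I> (\<I> \<otimes> X) Y) \<cdot> (assoc \<I> \<I> X \<odot> \<one> Y)"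
      using t by (subst assoc_nat) (auto intro!: ty)
    also have "\<dots> = (\<one> \<I> \<odot> (lun X \<odot> \<one> Y)) \<cdot> ?e"
      by (rule cassoc) (insert t, (assumption | rule ty)+)
    finally show "(\<one> \<I> \<odot> (lun (X \<otimes> Y) \<cdot> assoc \<I> X Y)) \<cdot> ?e = (\<one> \<I> \<odot> (lun X \<odot> \<one> Y)) \<cdot> ?e" .
  qed (use t in \<open>auto intro!: ty\<close>)
qed

text \<open>
  After tensoring with \<open>\<I>\<close> on the right, this is the hexagon for \<open>X, \<I>, \<I>\<close>, with the units
  evaluated by the triangle and by \<open>lun_tens\<close>.
\<close>

lemma lun_symm:
  assumes X: "X \<in> Ob V"
  shows "lun X \<cdot> symm X \<I> = run X"
proof (rule tens_unit_faithful)
  show "lun X \<cdot> symm X \<I> \<in> ar (X \<otimes> \<I>) X" "run X \<in> ar (X \<otimes> \<I>) X"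
    using X by (auto intro!: ty)
  note t = X
  show "(lun X \<cdot> symm X \<I>) \<odot> \<one> \<I> = run X \<odot> \<one> \<I>"
  proof (rule iso_mono[OF symm_isoa])
    have "symm X \<I> \<cdot> (run X \<odot> \<one> \<I>) = symm X \<I> \<cdot> ((\<one> X \<odot> lun \<I>) \<cdot> assoc X \<I> \<I>)"
      using X by (simp add: triangle)
    also have "\<dots> = (symm X \<I> \<cdot> (\<one> X \<odot> lun \<I>)) \<cdot> assoc X \<I> \<I>"
      by (rule cassoc[symmetric]) (insert t, (assumption | rule ty)+)
    also have "\<dots> = ((lun \<I> \<odot> \<one> X) \<cdot> symm X (\<I> \<otimes> \<I>)) \<cdot> assoc X \<I> \<I>"
      using symm_nat[of "\<one> X" X X "lun \<I>" "\<I> \<otimes> \<I>" \<I>] X by simp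
    also have "\<dots> = (lun \<I> \<odot> \<one> X) \<cdot> (symm X (\<I> \<otimes> \<I>) \<cdot> assoc X \<I> \<I>)"
      by (rule cassoc) (insert t, (assumption | rule ty)+)
    also have "\<dots> = (lun (\<I> \<otimes> X) \<cdot> assoc \<I> \<I> X) \<cdot> (symm X (\<I> \<otimes> \<I>) \<cdot> assoc X \<I> \<I>)"
      using X by (simp add: lun_tens)
    also have "\<dots> = lun (\<I> \<otimes> X) \<cdot> (assoc \<I> \<I> X \<cdot> (symm X (\<I> \<otimes> \<I>) \<cdot> assoc X \<I> \<I>))"
      by (rule cassoc) (insert t, (assumption | rule ty)+)
    also have "\<dots> = lun (\<I> \<otimes> X) \<cdot> ((\<one> \<I> \<odot> symm X \<I>) \<cdot> (assoc \<I> X \<I> \<cdot> (symm X \<I> \<odot> \<one> \<I>)))"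
      using X by (simp add: hexagon)
    also have "\<dots> = (lun (\<I> \<otimes> X) \<cdot> (\<one> \<I> \<odot> symm X \<I>)) \<cdot> (assoc \<I> X \<I> \<cdot> (symm X \<I> \<odot> \<one> \<I>))"
      by (rule cassoc[symmetric]) (insert t, (assumption | rule ty)+)
    also have "\<dots> = (symm X \<I> \<cdot> lun (X \<otimes> \<I>)) \<cdot> (assoc \<I> X \<I> \<cdot> (symm X \<I> \<odot> \<one> \<I>))"
      using X by (subst lun_nat) (auto intro!: ty)
    also have "\<dots> = symm X \<I> \<cdot> (lun (X \<otimes> \<I>) \<cdot> (assoc \<I> X \<I> \<cdot> (symm X \<I> \<odot> \<one> \<I>)))"
      by (rule cassoc) (insert t, (assumption | rule ty)+)
    also have "\<dots> = symm X \<I> \<cdot> ((lun (X \<otimes> \<I>) \<cdot> assoc \<I> X \<I>) \<cdot> (symm X \<I> \<odot> \<one> \<I>))"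
      by (rule arg_cong[of _ _ "\<lambda>x. symm X \<I> \<cdot> x"], rule cassoc[symmetric]) (insert t, (assumption | rule ty)+)
    also have "\<dots> = symm X \<I> \<cdot> ((lun X \<odot> \<one> \<I>) \<cdot> (symm X \<I> \<odot> \<one> \<I>))"
      using X by (simp add: lun_tens)
    also have "\<dots> = symm X \<I> \<cdot> ((lun X \<cdot> symm X \<I>) \<odot> \<one> \<I>)"
      using X by (subst tens_r) (auto intro!: ty)
    finally show "symm X \<I> \<cdot> ((lun X \<cdot> symm X \<I>) \<odot> \<one> \<I>) = symm X \<I> \<cdot> (run X \<odot> \<one> \<I>)" ..
  qed (use X in \<open>auto intro!: ty\<close>)
qed

lemma lun_unit: "lun \<I> = run \<I>"
proof (rule tens_unit_faithful)
  have "\<one> \<I> \<odot> lun \<I> = lun (\<I> \<otimes> \<I>)"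
    by (rule iso_mono[OF lun_isoa[of \<I>]]) (auto intro!: ty lun_nat)
  then show "lun \<I> \<odot> \<one> \<I> = run \<I> \<odot> \<one> \<I>"
    using lun_tens[of \<I> \<I>] triangle[of \<I> \<I>] by simp
qed (auto intro!: ty)

end

section \<open>Stages and shuffles\<close>

text \<open>
  A stage is a finite sequence of objects placed at certain positions of a list, and it stands for
  their tensor product in the order of the positions. Two stages are apart if they occupy different
  positions; their join then occupies both sets of positions. As a factor is placed by its position
  alone, join is strictly associative and commutative, unlike the tensor product.
  At a position occupied twice the join is \<open>Some undefined\<close>, which keeps these laws unconditional.
\<close>

fun join :: "'o option list \<Rightarrow> 'o option list \<Rightarrow> 'o option list" where
  "join [] t = t"
| "join s [] = s"
| "join (x # s) (y # t) =
     (if x = None then y else if y = None then x else Some undefined) # join s t"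

fun apart :: "'o option list \<Rightarrow> 'o option list \<Rightarrow> bool" where
  "apart [] t \<longleftrightarrow> True"
| "apart s [] \<longleftrightarrow> True"
| "apart (x # s) (y # t) \<longleftrightarrow> (x = None \<or> y = None) \<and> apart s t"

lemma join_Nil2 [simp]: "join s [] = s" and apart_Nil2 [simp]: "apart s []"
  by (cases s; simp)+

lemma join_commute: "join s t = join t s"
  by (induction s t rule: join.induct) auto

lemma join_assoc: "join (join s t) u = join s (join t u)"
proof (induction s arbitrary: t u)
  case (Cons x s)
  then show ?case by (cases t; cases u) auto
qed auto

lemma join_left_commute: "join s (join t u) = join t (join s u)"
  by (metis join_assoc join_commute)

lemmas join_ac = join_assoc join_commute join_left_commute

lemma apart_commute: "apart s t \<longleftrightarrow> apart t s"
  by (induction s t rule: apart.induct) auto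

lemma apart_join [simp]: "apart s (join t u) \<longleftrightarrow> apart s t \<and> apart s u"
proof (induction s arbitrary: t u)
  case (Cons x s)
  then show ?case by (cases t; cases u) auto
qed auto

lemma apart_join' [simp]: "apart (join t u) s \<longleftrightarrow> apart t s \<and> apart u s"
  by (metis apart_commute apart_join)

context smc_closed
begin

fun stage_ob :: "'o option list \<Rightarrow> 'o" where
  "stage_ob [] = \<I>"
| "stage_ob (None # s) = stage_ob s"
| "stage_ob (Some X # s) = X \<otimes> stage_ob s"

definition stage :: "'o option list \<Rightarrow> bool" where
  "stage s \<longleftrightarrow> (\<forall>X. Some X \<in> set s \<longrightarrow> X \<in> Ob V)"

lemma stage_simps [simp]:
  "stage []" "stage (None # s) \<longleftrightarrow> stage s" "stage (Some X # s) \<longleftrightarrow> X \<in> Ob V \<and> stage s"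
  by (auto simp: stage_def)

lemma stage_ob_in [simp]: "stage s \<Longrightarrow> stage_ob s \<in> Ob V"
  by (induction s rule: stage_ob.induct) auto

lemma stage_join: "\<lbrakk>apart s t; stage s; stage t\<rbrakk> \<Longrightarrow> stage (join s t)"
proof (induction s t rule: join.induct)
  case (3 x s y t)
  then show ?case by (cases x; cases y) auto
qed auto

text \<open>
  The isomorphism \<open>[s] \<otimes> [t] \<rightarrow> [join s t]\<close> that moves the factors to their positions. If the first
  position is occupied by \<open>t\<close>, the two stages are exchanged first; hence \<open>shuffle\<close> is called with
  its arguments swapped, and it terminates because the total length decreases.
\<close>

function shuffle :: "'o option list \<Rightarrow> 'o option list \<Rightarrow> 'm" where
  "shuffle [] t = lun (stage_ob t)"
| "shuffle (x # s) [] = run (stage_ob (x # s))"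
| "shuffle (None # s) (None # t) = shuffle s t"
| "shuffle (Some X # s) (None # t) = (\<one> X \<odot> shuffle s t) \<cdot> assoc X (stage_ob s) (stage_ob t)"
| "shuffle (None # s) (Some Y # t) =
     (\<one> Y \<odot> shuffle t s) \<cdot> assoc Y (stage_ob t) (stage_ob s) \<cdot> symm (stage_ob s) (Y \<otimes> stage_ob t)"
| "shuffle (Some X # s) (Some Y # t) = undefined"
  by pat_completeness auto
termination by (relation "measure (\<lambda>(s, t). length s + length t)") auto

lemma shuffle_isoa:
  "\<lbrakk>apart s t; stage s; stage t\<rbrakk> \<Longrightarrow>
   shuffle s t \<in> isoa (stage_ob s \<otimes> stage_ob t) (stage_ob (join s t))"
proof (induction s t rule: shuffle.induct)
  case (2 x s)
  then have "run (stage_ob (x # s)) \<in> isoa (stage_ob (x # s) \<otimes> \<I>) (stage_ob (x # s))"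
    by (intro run_isoa stage_ob_in)
  then show ?case by simp
next
  case (5 s Y t)
  then have "shuffle t s \<in> isoa (stage_ob t \<otimes> stage_ob s) (stage_ob (join s t))"
    by (simp add: join_commute apart_commute)
  with 5 show ?case
    by (auto intro!: comp_isoa tens_isoa id_isoa assoc_isoa symm_isoa)
qed (auto intro!: lun_isoa comp_isoa tens_isoa id_isoa assoc_isoa)

lemmas shuffle_in = shuffle_isoa[THEN isoa_ar]

lemma run_symm: "X \<in> Ob V \<Longrightarrow> run X \<cdot> symm \<I> X = lun X"
  using cassoc[of "symm \<I> X" "\<I> \<otimes> X" "X \<otimes> \<I>" "symm X \<I>" "\<I> \<otimes> X" "lun X" X]
  by (simp add: lun_symm symm_symm comp_id[of _ "\<I> \<otimes> X" X])

text \<open>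
  The case of two empty stages is the equation \<open>lun \<I> = run \<I>\<close>, and the case of one empty stage
  is the compatibility of \<open>lun\<close> and \<open>run\<close> with the symmetry.
\<close>

lemma shuffle_symm:
  "\<lbrakk>apart s t; stage s; stage t\<rbrakk> \<Longrightarrow>
   shuffle t s \<cdot> symm (stage_ob s) (stage_ob t) = shuffle s t"
proof (induction s t rule: shuffle.induct)
  case (1 t)
  then show ?case
    by (cases t) (simp_all add: lun_symm run_symm lun_unit[symmetric] del: stage_ob.simps(2,3))
next
  case (2 x s)
  then show ?case by (simp add: lun_symm del: stage_ob.simps(2,3))
next
  case (4 X s t)
  let ?S = "stage_ob s" and ?T = "stage_ob t"
  let ?m = "(\<one> X \<odot> shuffle s t) \<cdot> assoc X ?S ?T"
  have o: "X \<in> Ob V" "?S \<in> Ob V" "?T \<in> Ob V" using 4 by auto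
  have m: "?m \<in> ar ((X \<otimes> ?S) \<otimes> ?T) (X \<otimes> stage_ob (join s t))"
    using 4 shuffle_in[of s t] by (auto intro!: ty)
  have "(?m \<cdot> symm ?T (X \<otimes> ?S)) \<cdot> symm (X \<otimes> ?S) ?T = ?m \<cdot> (symm ?T (X \<otimes> ?S) \<cdot> symm (X \<otimes> ?S) ?T)"
    by (rule cassoc[OF _ _ m]) (insert o, (assumption | rule ty)+)
  also have "\<dots> = ?m" using 4 m by (simp add: symm_symm comp_id[OF m])
  finally show ?case by simp
qed auto

text \<open>
  The two ways of shuffling three stages; coherence means that they agree up to associativity.
\<close>

definition shuffle_l where
  "shuffle_l s t u = shuffle (join s t) u \<cdot> (shuffle s t \<odot> \<one> (stage_ob u))"

definition shuffle_r where
  "shuffle_r s t u = shuffle s (join t u) \<cdot> (\<one> (stage_ob s) \<odot> shuffle t u)"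

definition shuffle_coherent where
  "shuffle_coherent s t u \<longleftrightarrow>
     shuffle_r s t u \<cdot> assoc (stage_ob s) (stage_ob t) (stage_ob u) = shuffle_l s t u"

definition stages3 where
  "stages3 s t u \<longleftrightarrow> stage s \<and> stage t \<and> stage u \<and> apart s t \<and> apart s u \<and> apart t u"

lemma stages3_perm:
  assumes "stages3 s t u"
  shows "stages3 t s u" "stages3 t u s" "stages3 s u t" "stages3 u s t" "stages3 u t s"
  using assms by (simp_all add: stages3_def apart_commute)

lemma shuffle_lr_in:
  assumes "stages3 s t u"
  shows "shuffle_l s t u \<in> ar ((stage_ob s \<otimes> stage_ob t) \<otimes> stage_ob u) (stage_ob (join s (join t u)))"
    and "shuffle_r s t u \<in> ar (stage_ob s \<otimes> (stage_ob t \<otimes> stage_ob u)) (stage_ob (join s (join t u)))"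
proof -
  have a: "stage s" "stage t" "stage u" "apart s t" "apart s u" "apart t u"
    using assms by (simp_all add: stages3_def)
  note t = a shuffle_in[of s t] shuffle_in[of t u] shuffle_in[of "join s t" u, unfolded join_assoc]
    shuffle_in[of s "join t u"]
  show "shuffle_l s t u \<in> ar ((stage_ob s \<otimes> stage_ob t) \<otimes> stage_ob u) (stage_ob (join s (join t u)))"
    unfolding shuffle_l_def by (rule comp_in[OF tens_in]) (use t in \<open>simp_all add: stage_join\<close>)
  show "shuffle_r s t u \<in> ar (stage_ob s \<otimes> (stage_ob t \<otimes> stage_ob u)) (stage_ob (join s (join t u)))"
    unfolding shuffle_r_def by (rule comp_in[OF tens_in]) (use t in \<open>simp_all add: stage_join\<close>)
qed

lemma shuffle_lr_symm:
  assumes A: "stages3 s t u"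
  shows "shuffle_l t s u \<cdot> (symm (stage_ob s) (stage_ob t) \<odot> \<one> (stage_ob u)) = shuffle_l s t u"
    and "shuffle_r s u t \<cdot> (\<one> (stage_ob s) \<odot> symm (stage_ob t) (stage_ob u)) = shuffle_r s t u"
    and "shuffle_r u s t \<cdot> symm (stage_ob s \<otimes> stage_ob t) (stage_ob u) = shuffle_l s t u"
    and "shuffle_l t u s \<cdot> symm (stage_ob s) (stage_ob t \<otimes> stage_ob u) = shuffle_r s t u"
proof -
  let ?S = "stage_ob s" and ?T = "stage_ob t" and ?U = "stage_ob u"
  have a: "stage s" "stage t" "stage u" "apart s t" "apart s u" "apart t u"
    "apart t s" "apart u s" "apart u t" "stage (join s t)" "stage (join t u)"
    using A by (auto simp: stages3_def apart_commute stage_join)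
  have o: "?S \<in> Ob V" "?T \<in> Ob V" "?U \<in> Ob V" using a by auto
  note i = shuffle_in[OF a(4,1,2)] shuffle_in[OF a(6,2,3)] 
     shuffle_in[OF a(7,2,1), unfolded join_commute[of t s]]
     shuffle_in[OF a(9,3,2), unfolded join_commute[of u t]]
  have j: "shuffle (join s t) u \<in> ar (stage_ob (join s t) \<otimes> ?U) (stage_ob (join s (join t u)))"
    "shuffle s (join t u) \<in> ar (?S \<otimes> stage_ob (join t u)) (stage_ob (join s (join t u)))"
    "shuffle (join t u) s \<in> ar (stage_ob (join t u) \<otimes> ?S) (stage_ob (join s (join t u)))"
    "shuffle u (join s t) \<in> ar (?U \<otimes> stage_ob (join s t)) (stage_ob (join s (join t u)))"
    using shuffle_in[of "join s t" u] shuffle_in[of s "join t u"]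
      shuffle_in[of "join t u" s] shuffle_in[of u "join s t"] a
    by (simp_all add: join_ac)
  show "shuffle_l t s u \<cdot> (symm ?S ?T \<odot> \<one> ?U) = shuffle_l s t u"
  proof -
    have "shuffle_l t s u \<cdot> (symm ?S ?T \<odot> \<one> ?U) =
        shuffle (join s t) u \<cdot> ((shuffle t s \<odot> \<one> ?U) \<cdot> (symm ?S ?T \<odot> \<one> ?U))"
      unfolding shuffle_l_def join_commute[of t s] by (rule cassoc[OF _ _ j(1)]) (insert i o, (assumption | rule ty)+)
    also have "(shuffle t s \<odot> \<one> ?U) \<cdot> (symm ?S ?T \<odot> \<one> ?U) = shuffle s t \<odot> \<one> ?U"
      using tens_r[OF symm_in[OF o(1,2)] i(3) o(3)] shuffle_symm[OF a(4,1,2)] by simp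
    finally show ?thesis by (simp add: shuffle_l_def)
  qed
  show "shuffle_r s u t \<cdot> (\<one> ?S \<odot> symm ?T ?U) = shuffle_r s t u"
  proof -
    have "shuffle_r s u t \<cdot> (\<one> ?S \<odot> symm ?T ?U) =
        shuffle s (join t u) \<cdot> ((\<one> ?S \<odot> shuffle u t) \<cdot> (\<one> ?S \<odot> symm ?T ?U))"
      unfolding shuffle_r_def join_commute[of u t] by (rule cassoc[OF _ _ j(2)]) (insert i o, (assumption | rule ty)+)
    also have "(\<one> ?S \<odot> shuffle u t) \<cdot> (\<one> ?S \<odot> symm ?T ?U) = \<one> ?S \<odot> shuffle t u"
      using tens_l[OF symm_in[OF o(2,3)] i(4) o(1)] shuffle_symm[OF a(6,2,3)] by simp
    finally show ?thesis by (simp add: shuffle_r_def)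
  qed
  show "shuffle_r u s t \<cdot> symm (?S \<otimes> ?T) ?U = shuffle_l s t u"
  proof -
    have "shuffle_r u s t \<cdot> symm (?S \<otimes> ?T) ?U =
        shuffle u (join s t) \<cdot> ((\<one> ?U \<odot> shuffle s t) \<cdot> symm (?S \<otimes> ?T) ?U)"
      unfolding shuffle_r_def by (rule cassoc[OF _ _ j(4)]) (insert i o, (assumption | rule ty)+)
    also have "\<dots> = shuffle u (join s t) \<cdot> (symm (stage_ob (join s t)) ?U \<cdot> (shuffle s t \<odot> \<one> ?U))"
      using symm_nat[OF i(1) id_in[OF o(3)]] by simp
    also have "\<dots> = (shuffle u (join s t) \<cdot> symm (stage_ob (join s t)) ?U) \<cdot> (shuffle s t \<odot> \<one> ?U)"
      by (rule cassoc[OF _ _ j(4), symmetric]) (insert i o a, (rule ty stage_ob_in | assumption)+)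
    also have "\<dots> = shuffle_l s t u"
      using shuffle_symm[of "join s t" u] a by (simp add: shuffle_l_def)
    finally show ?thesis .
  qed
  show "shuffle_l t u s \<cdot> symm ?S (?T \<otimes> ?U) = shuffle_r s t u"
  proof -
    have "shuffle_l t u s \<cdot> symm ?S (?T \<otimes> ?U) =
        shuffle (join t u) s \<cdot> ((shuffle t u \<odot> \<one> ?S) \<cdot> symm ?S (?T \<otimes> ?U))"
      unfolding shuffle_l_def by (rule cassoc[OF _ _ j(3)]) (insert i o, (assumption | rule ty)+)
    also have "\<dots> = shuffle (join t u) s \<cdot> (symm ?S (stage_ob (join t u)) \<cdot> (\<one> ?S \<odot> shuffle t u))"
      using symm_nat[OF id_in[OF o(1)] i(2)] by simp
    also have "\<dots> = (shuffle (join t u) s \<cdot> symm ?S (stage_ob (join t u))) \<cdot> (\<one> ?S \<odot> shuffle t u)"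
      by (rule cassoc[OF _ _ j(3), symmetric]) (insert i o a, (rule ty stage_ob_in | assumption)+)
    also have "\<dots> = shuffle_r s t u"
      using shuffle_symm[of s "join t u"] a by (simp add: shuffle_r_def)
    finally show ?thesis .
  qed
qed

text \<open>
  The hexagon relates the associativity isomorphisms for the orders \<open>s, t, u\<close>, \<open>t, u, s\<close> and
  \<open>t, s, u\<close>. As shuffling is compatible with the symmetry, coherence for the last two orders gives
  coherence for the first. With \<open>shuffle_coherent_last\<close>, this reduces coherence to the case in which the
  first factor of the join comes from the first stage.
\<close>

lemma shuffle_coherent_middle:
  assumes A: "stages3 s t u" and 1: "shuffle_coherent t u s" and 2: "shuffle_coherent t s u"
  shows "shuffle_coherent s t u"
proof -
  let ?S = "stage_ob s" and ?T = "stage_ob t" and ?U = "stage_ob u"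
  have o: "?S \<in> Ob V" "?T \<in> Ob V" "?U \<in> Ob V" using A by (auto simp: stages3_def)
  note p = stages3_perm[OF A]
  note t = o shuffle_lr_in[OF A] shuffle_lr_in[OF p(1)] shuffle_lr_in[OF p(2)]
  have "shuffle_r s t u \<cdot> assoc ?S ?T ?U = (shuffle_l t u s \<cdot> symm ?S (?T \<otimes> ?U)) \<cdot> assoc ?S ?T ?U"
    by (simp add: shuffle_lr_symm[OF A])
  also have "\<dots> = shuffle_l t u s \<cdot> (symm ?S (?T \<otimes> ?U) \<cdot> assoc ?S ?T ?U)"
    by (rule cassoc) (insert t, (assumption | rule ty)+)
  also have "\<dots> = (shuffle_r t u s \<cdot> assoc ?T ?U ?S) \<cdot> (symm ?S (?T \<otimes> ?U) \<cdot> assoc ?S ?T ?U)"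
    using 1 by (simp add: shuffle_coherent_def)
  also have "\<dots> = shuffle_r t u s \<cdot> (assoc ?T ?U ?S \<cdot> (symm ?S (?T \<otimes> ?U) \<cdot> assoc ?S ?T ?U))"
    by (rule cassoc) (insert t, (assumption | rule ty)+)
  also have "\<dots> = shuffle_r t u s \<cdot> ((\<one> ?T \<odot> symm ?S ?U) \<cdot> (assoc ?T ?S ?U \<cdot> (symm ?S ?T \<odot> \<one> ?U)))"
    using o by (simp add: hexagon)
  also have "\<dots> = (shuffle_r t u s \<cdot> (\<one> ?T \<odot> symm ?S ?U)) \<cdot> (assoc ?T ?S ?U \<cdot> (symm ?S ?T \<odot> \<one> ?U))"
    by (rule cassoc[symmetric]) (insert t, (assumption | rule ty)+)
  also have "\<dots> = shuffle_r t s u \<cdot> (assoc ?T ?S ?U \<cdot> (symm ?S ?T \<odot> \<one> ?U))"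
    by (simp add: shuffle_lr_symm[OF p(1)])
  also have "\<dots> = (shuffle_r t s u \<cdot> assoc ?T ?S ?U) \<cdot> (symm ?S ?T \<odot> \<one> ?U)"
    by (rule cassoc[symmetric]) (insert t, (assumption | rule ty)+)
  also have "\<dots> = shuffle_l t s u \<cdot> (symm ?S ?T \<odot> \<one> ?U)"
    using 2 by (simp add: shuffle_coherent_def)
  also have "\<dots> = shuffle_l s t u" by (simp add: shuffle_lr_symm[OF A])
  finally show ?thesis by (simp add: shuffle_coherent_def)
qed

lemma shuffle_coherent_last:
  assumes A: "stages3 s t u" and 1: "shuffle_coherent u s t" and 2: "shuffle_coherent s u t"
  shows "shuffle_coherent s t u"
  unfolding shuffle_coherent_def
proof (rule iso_epi)
  let ?S = "stage_ob s" and ?T = "stage_ob t" and ?U = "stage_ob u"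
  have o: "?S \<in> Ob V" "?T \<in> Ob V" "?U \<in> Ob V" using A by (auto simp: stages3_def)
  note p = stages3_perm[OF A]
  note t = o shuffle_lr_in[OF A] shuffle_lr_in[OF p(3)] shuffle_lr_in[OF p(4)]
  let ?e = "symm ?U (?S \<otimes> ?T) \<cdot> assoc ?U ?S ?T"
  show e: "?e \<in> isoa ((?U \<otimes> ?S) \<otimes> ?T) ((?S \<otimes> ?T) \<otimes> ?U)"
    by (insert o, (assumption | rule comp_isoa symm_isoa assoc_isoa tens_ob)+)
  show "shuffle_l s t u \<in> ar ((?S \<otimes> ?T) \<otimes> ?U) (stage_ob (join s (join t u)))"
    "shuffle_r s t u \<cdot> assoc ?S ?T ?U \<in> ar ((?S \<otimes> ?T) \<otimes> ?U) (stage_ob (join s (join t u)))"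
    by (insert t, (assumption | rule ty)+)
  have "(shuffle_r s t u \<cdot> assoc ?S ?T ?U) \<cdot> ?e = shuffle_r s t u \<cdot> (assoc ?S ?T ?U \<cdot> ?e)"
    by (rule cassoc) (insert t, (assumption | rule ty)+)
  also have "\<dots> = shuffle_r s t u \<cdot> ((\<one> ?S \<odot> symm ?U ?T) \<cdot> (assoc ?S ?U ?T \<cdot> (symm ?U ?S \<odot> \<one> ?T)))"
    using o by (simp add: hexagon)
  also have "\<dots> = (shuffle_r s t u \<cdot> (\<one> ?S \<odot> symm ?U ?T)) \<cdot> (assoc ?S ?U ?T \<cdot> (symm ?U ?S \<odot> \<one> ?T))"
    by (rule cassoc[symmetric]) (insert t, (assumption | rule ty)+)
  also have "\<dots> = shuffle_r s u t \<cdot> (assoc ?S ?U ?T \<cdot> (symm ?U ?S \<odot> \<one> ?T))"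
    by (simp add: shuffle_lr_symm[OF p(3)])
  also have "\<dots> = (shuffle_r s u t \<cdot> assoc ?S ?U ?T) \<cdot> (symm ?U ?S \<odot> \<one> ?T)"
    by (rule cassoc[symmetric]) (insert t, (assumption | rule ty)+)
  also have "\<dots> = shuffle_l s u t \<cdot> (symm ?U ?S \<odot> \<one> ?T)"
    using 2 by (simp add: shuffle_coherent_def)
  also have "\<dots> = shuffle_l u s t" by (simp add: shuffle_lr_symm[OF p(4)])
  also have "\<dots> = shuffle_r u s t \<cdot> assoc ?U ?S ?T"
    using 1 by (simp add: shuffle_coherent_def)
  also have "\<dots> = (shuffle_l s t u \<cdot> symm ?U (?S \<otimes> ?T)) \<cdot> assoc ?U ?S ?T"
    by (simp add: shuffle_lr_symm[OF p(4)])
  also have "\<dots> = shuffle_l s t u \<cdot> ?e"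
    by (rule cassoc) (insert t, (assumption | rule ty)+)
  finally show "(shuffle_r s t u \<cdot> assoc ?S ?T ?U) \<cdot> ?e = shuffle_l s t u \<cdot> ?e" .
qed

lemma shuffle_coherent_Nil:
  assumes A: "stages3 [] t u" shows "shuffle_coherent [] t u"
proof -
  let ?T = "stage_ob t" and ?U = "stage_ob u"
  have a: "stage t" "stage u" "apart t u" using A by (auto simp: stages3_def)
  have o: "?T \<in> Ob V" "?U \<in> Ob V" using a by auto
  note i = shuffle_in[OF a(3,1,2)]
  have "(lun (stage_ob (join t u)) \<cdot> (\<one> \<I> \<odot> shuffle t u)) \<cdot> assoc \<I> ?T ?U =
        (shuffle t u \<cdot> lun (?T \<otimes> ?U)) \<cdot> assoc \<I> ?T ?U"
    by (simp add: lun_nat[OF i])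
  also have "\<dots> = shuffle t u \<cdot> (lun (?T \<otimes> ?U) \<cdot> assoc \<I> ?T ?U)"
    by (rule cassoc) (insert o i, (assumption | rule ty)+)
  finally show ?thesis
    using o by (simp add: shuffle_coherent_def shuffle_l_def shuffle_r_def lun_tens)
qed

text \<open>
  If the first stage supplies the first factor \<open>X\<close> of the join, both ways of shuffling consist of
  shuffling the rest under \<open>\<one> X \<odot> -\<close> and of associativity isomorphisms, which the pentagon compares.
\<close>

lemma shuffle_coherent_first:
  assumes A: "stages3 s t u" and X: "X \<in> Ob V" and IH: "shuffle_coherent s t u"
  shows "shuffle_coherent (Some X # s) (None # t) (None # u)"
proof -
  let ?S = "stage_ob s" and ?T = "stage_ob t" and ?U = "stage_ob u"
  have a: "stage s" "stage t" "stage u" "apart s t" "apart s u" "apart t u"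
    "stage (join s t)" "stage (join t u)"
    using A by (auto simp: stages3_def apart_commute stage_join)
  have o: "?S \<in> Ob V" "?T \<in> Ob V" "?U \<in> Ob V" "X \<in> Ob V" using a X by auto
  let ?J = "stage_ob (join s (join t u))" and ?ST = "stage_ob (join s t)" and ?TU = "stage_ob (join t u)"
  have o2: "?ST \<in> Ob V" "?TU \<in> Ob V" using a by auto
  note i = shuffle_in[OF a(4,1,2)] shuffle_in[OF a(6,2,3)]
  have j: "shuffle (join s t) u \<in> ar (?ST \<otimes> ?U) ?J" "shuffle s (join t u) \<in> ar (?S \<otimes> ?TU) ?J"
    using shuffle_in[of "join s t" u] shuffle_in[of s "join t u"] a by (simp_all add: join_ac)
  note t = o o2 i j shuffle_lr_in[OF A]
  have idi: "\<one> (X \<otimes> ?S) = \<one> X \<odot> \<one> ?S" using o by simp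
  have "(((\<one> X \<odot> shuffle s (join t u)) \<cdot> assoc X ?S ?TU) \<cdot> (\<one> (X \<otimes> ?S) \<odot> shuffle t u)) \<cdot> assoc (X \<otimes> ?S) ?T ?U
      = ((\<one> X \<odot> shuffle s (join t u)) \<cdot> (assoc X ?S ?TU \<cdot> ((\<one> X \<odot> \<one> ?S) \<odot> shuffle t u))) \<cdot> assoc (X \<otimes> ?S) ?T ?U"
    unfolding idi by (rule arg_cong[of _ _ "\<lambda>z. z \<cdot> _"], rule cassoc) (insert t, (assumption | rule ty)+)
  also have "assoc X ?S ?TU \<cdot> ((\<one> X \<odot> \<one> ?S) \<odot> shuffle t u) = (\<one> X \<odot> (\<one> ?S \<odot> shuffle t u)) \<cdot> assoc X ?S (?T \<otimes> ?U)"
    by (rule assoc_nat) (insert t, (assumption | rule ty)+)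
  also have "(\<one> X \<odot> shuffle s (join t u)) \<cdot> ((\<one> X \<odot> (\<one> ?S \<odot> shuffle t u)) \<cdot> assoc X ?S (?T \<otimes> ?U)) =
      ((\<one> X \<odot> shuffle s (join t u)) \<cdot> (\<one> X \<odot> (\<one> ?S \<odot> shuffle t u))) \<cdot> assoc X ?S (?T \<otimes> ?U)"
    by (rule cassoc[symmetric]) (insert t, (assumption | rule ty)+)
  also have "(\<one> X \<odot> shuffle s (join t u)) \<cdot> (\<one> X \<odot> (\<one> ?S \<odot> shuffle t u)) = \<one> X \<odot> shuffle_r s t u"
    unfolding shuffle_r_def by (rule tens_l) (insert t, (assumption | rule ty)+)
  also have "((\<one> X \<odot> shuffle_r s t u) \<cdot> assoc X ?S (?T \<otimes> ?U)) \<cdot> assoc (X \<otimes> ?S) ?T ?U =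
      (\<one> X \<odot> shuffle_r s t u) \<cdot> (assoc X ?S (?T \<otimes> ?U) \<cdot> assoc (X \<otimes> ?S) ?T ?U)"
    by (rule cassoc) (insert t, (assumption | rule ty)+)
  also have "\<dots> = (\<one> X \<odot> shuffle_r s t u) \<cdot> ((\<one> X \<odot> assoc ?S ?T ?U) \<cdot> (assoc X (?S \<otimes> ?T) ?U \<cdot> (assoc X ?S ?T \<odot> \<one> ?U)))"
    using o by (simp add: pentagon)
  also have "\<dots> = ((\<one> X \<odot> shuffle_r s t u) \<cdot> (\<one> X \<odot> assoc ?S ?T ?U)) \<cdot> (assoc X (?S \<otimes> ?T) ?U \<cdot> (assoc X ?S ?T \<odot> \<one> ?U))"
    by (rule cassoc[symmetric]) (insert t, (assumption | rule ty)+)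
  also have "(\<one> X \<odot> shuffle_r s t u) \<cdot> (\<one> X \<odot> assoc ?S ?T ?U) = \<one> X \<odot> (shuffle_r s t u \<cdot> assoc ?S ?T ?U)"
    by (rule tens_l) (insert t, (assumption | rule ty)+)
  also have "shuffle_r s t u \<cdot> assoc ?S ?T ?U = shuffle_l s t u"
    using IH by (simp add: shuffle_coherent_def)
  also have "\<one> X \<odot> shuffle_l s t u = (\<one> X \<odot> shuffle (join s t) u) \<cdot> (\<one> X \<odot> (shuffle s t \<odot> \<one> ?U))"
    unfolding shuffle_l_def by (rule tens_l[symmetric]) (insert t, (assumption | rule ty)+)
  also have "((\<one> X \<odot> shuffle (join s t) u) \<cdot> (\<one> X \<odot> (shuffle s t \<odot> \<one> ?U))) \<cdot> (assoc X (?S \<otimes> ?T) ?U \<cdot> (assoc X ?S ?T \<odot> \<one> ?U)) =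
     (\<one> X \<odot> shuffle (join s t) u) \<cdot> ((\<one> X \<odot> (shuffle s t \<odot> \<one> ?U)) \<cdot> (assoc X (?S \<otimes> ?T) ?U \<cdot> (assoc X ?S ?T \<odot> \<one> ?U)))"
    by (rule cassoc) (insert t, (assumption | rule ty)+)
  also have "(\<one> X \<odot> (shuffle s t \<odot> \<one> ?U)) \<cdot> (assoc X (?S \<otimes> ?T) ?U \<cdot> (assoc X ?S ?T \<odot> \<one> ?U)) =
     ((\<one> X \<odot> (shuffle s t \<odot> \<one> ?U)) \<cdot> assoc X (?S \<otimes> ?T) ?U) \<cdot> (assoc X ?S ?T \<odot> \<one> ?U)"
    by (rule cassoc[symmetric]) (insert t, (assumption | rule ty)+)
  also have "(\<one> X \<odot> (shuffle s t \<odot> \<one> ?U)) \<cdot> assoc X (?S \<otimes> ?T) ?U = assoc X ?ST ?U \<cdot> ((\<one> X \<odot> shuffle s t) \<odot> \<one> ?U)"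
    by (rule assoc_nat[symmetric]) (insert t, (assumption | rule ty)+)
  also have "(assoc X ?ST ?U \<cdot> ((\<one> X \<odot> shuffle s t) \<odot> \<one> ?U)) \<cdot> (assoc X ?S ?T \<odot> \<one> ?U) =
      assoc X ?ST ?U \<cdot> (((\<one> X \<odot> shuffle s t) \<odot> \<one> ?U) \<cdot> (assoc X ?S ?T \<odot> \<one> ?U))"
    by (rule cassoc) (insert t, (assumption | rule ty)+)
  also have "((\<one> X \<odot> shuffle s t) \<odot> \<one> ?U) \<cdot> (assoc X ?S ?T \<odot> \<one> ?U) = ((\<one> X \<odot> shuffle s t) \<cdot> assoc X ?S ?T) \<odot> \<one> ?U"
    by (rule tens_r) (insert t, (assumption | rule ty)+)
  also have "(\<one> X \<odot> shuffle (join s t) u) \<cdot> (assoc X ?ST ?U \<cdot> (((\<one> X \<odot> shuffle s t) \<cdot> assoc X ?S ?T) \<odot> \<one> ?U)) =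
      ((\<one> X \<odot> shuffle (join s t) u) \<cdot> assoc X ?ST ?U) \<cdot> (((\<one> X \<odot> shuffle s t) \<cdot> assoc X ?S ?T) \<odot> \<one> ?U)"
    by (rule cassoc[symmetric]) (insert t, (assumption | rule ty)+)
  finally show ?thesis
    by (simp add: shuffle_coherent_def shuffle_l_def shuffle_r_def)
qed

lemma shuffle_coherent:
  assumes "stages3 s t u" shows "shuffle_coherent s t u"
  using assms
proof (induction "length s + length t + length u" arbitrary: s t u rule: less_induct)
  case less
  note A = less.prems
  note p = stages3_perm[OF A]
  show ?case
  proof (cases s)
    case Nil then show ?thesis using A shuffle_coherent_Nil by simp
  next
    case s: (Cons x s')
    show ?thesis
    proof (cases t)
      case Nil
      then show ?thesis using A p shuffle_coherent_Nil shuffle_coherent_middle by metis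
    next
      case t: (Cons y t')
      show ?thesis
      proof (cases u)
        case Nil
        have "shuffle_coherent s [] t"
          using p Nil shuffle_coherent_Nil shuffle_coherent_middle by metis
        then show ?thesis using A p Nil shuffle_coherent_Nil shuffle_coherent_last by metis
      next
        case u: (Cons z u')
        have B: "stages3 s' t' u'" using A unfolding s t u
          by (cases x; cases y; cases z) (auto simp: stages3_def)
        note q = stages3_perm[OF B]
        have IH: "shuffle_coherent s' t' u'" "shuffle_coherent t' s' u'" "shuffle_coherent t' u' s'"
          "shuffle_coherent s' u' t'" "shuffle_coherent u' s' t'"
          using less.hyps[OF _ B] less.hyps[OF _ q(1)] less.hyps[OF _ q(2)] less.hyps[OF _ q(3)]
            less.hyps[OF _ q(4)] by (simp_all add: s t u)
        consider "x = None" "y = None" "z = None"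
          | X where "x = Some X" "y = None" "z = None" "X \<in> Ob V"
          | X where "x = None" "y = Some X" "z = None" "X \<in> Ob V"
          | X where "x = None" "y = None" "z = Some X" "X \<in> Ob V"
          using A unfolding s t u by (cases x; cases y; cases z) (auto simp: stages3_def)
        then show ?thesis
        proof cases
          case 1
          then show ?thesis using IH(1) unfolding s t u
            by (simp add: shuffle_coherent_def shuffle_l_def shuffle_r_def)
        next
          case 2
          then show ?thesis using shuffle_coherent_first[OF B _ IH(1)] by (simp add: s t u)
        next
          case 3
          then show ?thesis
            using shuffle_coherent_middle[OF A] shuffle_coherent_first[OF q(1) _ IH(2)]
              shuffle_coherent_first[OF q(2) _ IH(3)] by (simp add: s t u)
        next
          case 4
          have "shuffle_coherent s u t"
            using 4 shuffle_coherent_middle[OF p(3)] shuffle_coherent_first[OF q(4) _ IH(5)]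
              shuffle_coherent_first[OF q(5)] less.hyps[OF _ q(5)] by (simp add: s t u)
          then show ?thesis
            using 4 shuffle_coherent_last[OF A] shuffle_coherent_first[OF q(4) _ IH(5)] by (simp add: s t u)
        qed
      qed
    qed
  qed
qed

end

section \<open>Generalised elements\<close>

context smc_closed
begin

text \<open>
  An element of \<open>X\<close> is an arrow to \<open>X\<close> from the tensor product of a stage. The stage is part of the
  element, so that equality of elements includes equality of stages. An arrow \<open>f : X \<rightarrow> Y\<close> acts on
  elements by composition, and elements with disjoint stages can be paired. The coherence of
  shuffles turns the structural isomorphisms of \<open>V\<close> into identities between pairs
  (\<open>app_assoc\<close>, \<open>app_symm\<close>, \<open>app_lun\<close>, \<open>app_run\<close>).
\<close>

definition El :: "'o \<Rightarrow> ('o option list \<times> 'm) set" where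
  "El X = {x. stage (fst x) \<and> snd x \<in> ar (stage_ob (fst x)) X}"

definition app :: "'m \<Rightarrow> 'o option list \<times> 'm \<Rightarrow> 'o option list \<times> 'm" where
  "app f x = (fst x, f \<cdot> snd x)"

definition disj :: "'o option list \<times> 'm \<Rightarrow> 'o option list \<times> 'm \<Rightarrow> bool" where
  "disj x y \<longleftrightarrow> apart (fst x) (fst y)"

abbreviation unshuffle :: "'o option list \<Rightarrow> 'o option list \<Rightarrow> 'm" where
  "unshuffle s t \<equiv> iv (stage_ob s \<otimes> stage_ob t) (stage_ob (join s t)) (shuffle s t)"

definition pair :: "'o option list \<times> 'm \<Rightarrow> 'o option list \<times> 'm \<Rightarrow> 'o option list \<times> 'm" where
  "pair x y = (join (fst x) (fst y), (snd x \<odot> snd y) \<cdot> unshuffle (fst x) (fst y))"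

definition one :: "'o option list \<times> 'm" where
  "one = ([], \<one> \<I>)"

lemma fst_simps [simp]: "fst (app f x) = fst x" "fst (pair x y) = join (fst x) (fst y)" "fst one = []"
  by (simp_all add: app_def pair_def one_def)

lemma disj_simps [simp]:
  "disj (app f x) y = disj x y" "disj x (app f y) = disj x y"
  "disj (pair x y) z = (disj x z \<and> disj y z)" "disj x (pair y z) = (disj x y \<and> disj x z)"
  "disj one x" "disj x one"
  by (simp_all add: disj_def)

lemma disj_commute: "disj x y \<longleftrightarrow> disj y x"
  by (simp add: disj_def apart_commute)

lemma El_ob: "x \<in> El X \<Longrightarrow> X \<in> Ob V"
  by (auto simp: El_def ar_def)

lemma app_in: "f \<in> ar X Y \<Longrightarrow> x \<in> El X \<Longrightarrow> app f x \<in> El Y"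
  by (auto simp: El_def app_def intro: comp_in)

lemma one_in [simp]: "one \<in> El \<I>"
  by (simp add: El_def one_def)

lemma El_stage: "x \<in> El X \<Longrightarrow> stage (fst x)"
  and El_ar: "x \<in> El X \<Longrightarrow> snd x \<in> ar (stage_ob (fst x)) X"
  by (simp_all add: El_def)

lemma El_shuffle:
  assumes "x \<in> El X" "y \<in> El Y" "disj x y"
  shows "shuffle (fst x) (fst y) \<in>
    isoa (stage_ob (fst x) \<otimes> stage_ob (fst y)) (stage_ob (join (fst x) (fst y)))"
  using assms by (simp add: El_def disj_def shuffle_isoa)

lemma pair_in [simp]:
  assumes "x \<in> El X" "y \<in> El Y" "disj x y"
  shows "pair x y \<in> El (X \<otimes> Y)"
  using assms comp_in[OF iv_in[OF El_shuffle[OF assms]] tens_in[OF El_ar El_ar]]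
  by (simp add: El_def pair_def stage_join disj_def)

lemma app_comp: "\<lbrakk>x \<in> El X; f \<in> ar X Y; g \<in> ar Y Z\<rbrakk> \<Longrightarrow> app (g \<cdot> f) x = app g (app f x)"
  by (simp add: app_def cassoc[OF El_ar])

lemma app_id: "x \<in> El X \<Longrightarrow> app (\<one> X) x = x"
  by (simp add: app_def id_comp[OF El_ar])

lemma app_tens:
  assumes f: "f \<in> ar X X'" and g: "g \<in> ar Y Y'" and x: "x \<in> El X" and y: "y \<in> El Y" and d: "disj x y"
  shows "app (f \<odot> g) (pair x y) = pair (app f x) (app g y)"
proof -
  note t = El_ar[OF x] El_ar[OF y] iv_in[OF El_shuffle[OF x y d]]
  show ?thesis
    using cassoc[OF t(3) tens_in[OF t(1,2)] tens_in[OF f g]] tens_comp[OF t(1) f t(2) g]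
    by (simp add: app_def pair_def)
qed

lemma app_iv:
  assumes f: "f \<in> isoa X Y"
  shows "x \<in> El X \<Longrightarrow> app (iv X Y f) (app f x) = x" "y \<in> El Y \<Longrightarrow> app f (app (iv X Y f) y) = y"
  using iv_cancel_l[OF f El_ar] iv_cancel_r[OF f El_ar] by (simp_all add: app_def)

lemma app_symm:
  assumes x: "x \<in> El X" and y: "y \<in> El Y" and d: "disj x y"
  shows "app (symm X Y) (pair x y) = pair y x"
proof -
  let ?S = "stage_ob (fst x)" and ?T = "stage_ob (fst y)"
  have o: "?S \<in> Ob V" "?T \<in> Ob V" "X \<in> Ob V" "Y \<in> Ob V"
    using x y by (auto simp: El_def El_ob[OF x] El_ob[OF y])
  have d': "disj y x" using d by (simp add: disj_commute)
  note t = El_ar[OF x] El_ar[OF y]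
  note a = El_shuffle[OF x y d] and b = El_shuffle[OF y x d', unfolded join_commute[of "fst y"]]
  have u: "symm ?S ?T \<cdot> unshuffle (fst x) (fst y) = iv (?T \<otimes> ?S) (stage_ob (join (fst x) (fst y))) (shuffle (fst y) (fst x))"
    (is "?l = ?r")
  proof (rule iso_mono[OF b])
    have "shuffle (fst y) (fst x) \<cdot> ?l = (shuffle (fst y) (fst x) \<cdot> symm ?S ?T) \<cdot> unshuffle (fst x) (fst y)"
      using cassoc[OF iv_in[OF a] symm_in[OF o(1,2)] isoa_ar[OF b]] by simp
    also have "\<dots> = \<one> (stage_ob (join (fst x) (fst y)))"
      using shuffle_symm[of "fst x" "fst y"] x y d a by (simp add: disj_def El_def iv_r)
    finally show "shuffle (fst y) (fst x) \<cdot> ?l = shuffle (fst y) (fst x) \<cdot> ?r"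
      using b by (simp add: iv_r)
  qed (rule comp_in[OF iv_in[OF a] symm_in[OF o(1,2)]], rule iv_in[OF b])
  have "symm X Y \<cdot> ((snd x \<odot> snd y) \<cdot> unshuffle (fst x) (fst y)) =
        (symm X Y \<cdot> (snd x \<odot> snd y)) \<cdot> unshuffle (fst x) (fst y)"
    using cassoc[OF iv_in[OF a] tens_in[OF t] symm_in[OF o(3,4)]] by simp
  also have "\<dots> = (snd y \<odot> snd x) \<cdot> (symm ?S ?T \<cdot> unshuffle (fst x) (fst y))"
    using cassoc[OF iv_in[OF a] symm_in[OF o(1,2)] tens_in[OF t(2,1)]] by (simp add: symm_nat[OF t])
  finally show ?thesis by (simp add: app_def pair_def u join_commute[of "fst y"])
qed

lemma app_assoc:
  assumes x: "x \<in> El X" and y: "y \<in> El Y" and z: "z \<in> El Z" and d: "disj x y" "disj x z" "disj y z"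
  shows "app (assoc X Y Z) (pair (pair x y) z) = pair x (pair y z)"
proof -
  let ?s = "fst x" and ?t = "fst y" and ?u = "fst z"
  let ?S = "stage_ob ?s" and ?T = "stage_ob ?t" and ?U = "stage_ob ?u"
  let ?ST = "stage_ob (join ?s ?t)" and ?TU = "stage_ob (join ?t ?u)" and ?J = "stage_ob (join ?s (join ?t ?u))"
  have xy: "pair x y \<in> El (X \<otimes> Y)" and yz: "pair y z \<in> El (Y \<otimes> Z)"
    using assms by auto
  have A: "stages3 ?s ?t ?u" using assms by (auto simp: stages3_def El_def disj_def)
  have o: "?S \<in> Ob V" "?T \<in> Ob V" "?U \<in> Ob V" "X \<in> Ob V" "Y \<in> Ob V" "Z \<in> Ob V" "?ST \<in> Ob V" "?TU \<in> Ob V"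
    using A x y z by (auto simp: stages3_def stage_join El_ob)
  note t = El_ar[OF x] El_ar[OF y] El_ar[OF z]
  have hst: "shuffle ?s ?t \<in> isoa (?S \<otimes> ?T) ?ST" and htu: "shuffle ?t ?u \<in> isoa (?T \<otimes> ?U) ?TU"
    using El_shuffle x y z d by blast+
  have hl: "shuffle (join ?s ?t) ?u \<in> isoa (?ST \<otimes> ?U) ?J" and hr: "shuffle ?s (join ?t ?u) \<in> isoa (?S \<otimes> ?TU) ?J"
    using El_shuffle[OF xy z] El_shuffle[OF x yz] d by (simp_all add: join_assoc)
  note ii = iv_in[OF hst] iv_in[OF htu] iv_in[OF hl] iv_in[OF hr]
  let ?L = "(unshuffle ?s ?t \<odot> \<one> ?U) \<cdot> iv (?ST \<otimes> ?U) ?J (shuffle (join ?s ?t) ?u)"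
  let ?R = "(\<one> ?S \<odot> unshuffle ?t ?u) \<cdot> unshuffle ?s (join ?t ?u)"
  have Lin: "?L \<in> ar ?J ((?S \<otimes> ?T) \<otimes> ?U)" and Rin: "?R \<in> ar ?J (?S \<otimes> (?T \<otimes> ?U))"
    by (insert ii o, (assumption | rule ty)+)
  have lr: "shuffle_l ?s ?t ?u \<in> ar ((?S \<otimes> ?T) \<otimes> ?U) ?J" "shuffle_r ?s ?t ?u \<in> ar (?S \<otimes> (?T \<otimes> ?U)) ?J"
    using shuffle_lr_in[OF A] .
  have L: "shuffle_l ?s ?t ?u \<cdot> ?L = \<one> ?J"
  proof -
    have "shuffle_l ?s ?t ?u \<cdot> ?L =
        shuffle (join ?s ?t) ?u \<cdot> ((shuffle ?s ?t \<odot> \<one> ?U) \<cdot> ?L)"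
      unfolding shuffle_l_def
      by (rule cassoc[OF Lin tens_in[OF isoa_ar[OF hst] id_in[OF o(3)]] isoa_ar[OF hl]])
    also have "(shuffle ?s ?t \<odot> \<one> ?U) \<cdot> ?L =
        ((shuffle ?s ?t \<odot> \<one> ?U) \<cdot> (unshuffle ?s ?t \<odot> \<one> ?U)) \<cdot> iv (?ST \<otimes> ?U) ?J (shuffle (join ?s ?t) ?u)"
      by (rule cassoc[symmetric]) (insert ii o isoa_ar[OF hst], (assumption | rule ty)+)
    also have "\<dots> = iv (?ST \<otimes> ?U) ?J (shuffle (join ?s ?t) ?u)"
      using o by (simp add: tens_r[OF ii(1) isoa_ar[OF hst]] iv_r[OF hst] id_comp[OF ii(3)])
    finally show ?thesis by (simp add: iv_r[OF hl])
  qed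
  have R: "shuffle_r ?s ?t ?u \<cdot> ?R = \<one> ?J"
  proof -
    have "shuffle_r ?s ?t ?u \<cdot> ?R =
        shuffle ?s (join ?t ?u) \<cdot> ((\<one> ?S \<odot> shuffle ?t ?u) \<cdot> ?R)"
      unfolding shuffle_r_def
      by (rule cassoc[OF Rin tens_in[OF id_in[OF o(1)] isoa_ar[OF htu]] isoa_ar[OF hr]])
    also have "(\<one> ?S \<odot> shuffle ?t ?u) \<cdot> ?R =
        ((\<one> ?S \<odot> shuffle ?t ?u) \<cdot> (\<one> ?S \<odot> unshuffle ?t ?u)) \<cdot> unshuffle ?s (join ?t ?u)"
      by (rule cassoc[symmetric]) (insert ii o isoa_ar[OF htu], (assumption | rule ty)+)
    also have "\<dots> = unshuffle ?s (join ?t ?u)"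
      using o by (simp add: tens_l[OF ii(2) isoa_ar[OF htu]] iv_r[OF htu] id_comp[OF ii(4)])
    finally show ?thesis by (simp add: iv_r[OF hr])
  qed
  have riso: "shuffle_r ?s ?t ?u \<in> isoa (?S \<otimes> (?T \<otimes> ?U)) ?J"
    unfolding shuffle_r_def by (rule comp_isoa[OF tens_isoa[OF id_isoa[OF o(1)] htu] hr])
  have LR: "assoc ?S ?T ?U \<cdot> ?L = ?R"
  proof (rule iso_mono[OF riso _ Rin])
    show "assoc ?S ?T ?U \<cdot> ?L \<in> ar ?J (?S \<otimes> (?T \<otimes> ?U))"
      by (rule comp_in[OF Lin assoc_in[OF o(1-3)]])
    have "shuffle_r ?s ?t ?u \<cdot> (assoc ?S ?T ?U \<cdot> ?L) = (shuffle_r ?s ?t ?u \<cdot> assoc ?S ?T ?U) \<cdot> ?L"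
      by (rule cassoc[OF Lin assoc_in[OF o(1-3)] lr(2), symmetric])
    also have "\<dots> = shuffle_l ?s ?t ?u \<cdot> ?L"
      using shuffle_coherent[OF A] by (simp add: shuffle_coherent_def)
    finally show "shuffle_r ?s ?t ?u \<cdot> (assoc ?S ?T ?U \<cdot> ?L) = shuffle_r ?s ?t ?u \<cdot> ?R"
      by (simp add: L R)
  qed
  have l: "snd (pair (pair x y) z) = ((snd x \<odot> snd y) \<odot> snd z) \<cdot> ?L"
  proof -
    have "snd (pair (pair x y) z) =
       (((snd x \<odot> snd y) \<cdot> unshuffle ?s ?t) \<odot> snd z) \<cdot> iv (?ST \<otimes> ?U) ?J (shuffle (join ?s ?t) ?u)"
      by (simp add: pair_def join_assoc)
    also have "((snd x \<odot> snd y) \<cdot> unshuffle ?s ?t) \<odot> snd z = ((snd x \<odot> snd y) \<odot> snd z) \<cdot> (unshuffle ?s ?t \<odot> \<one> ?U)"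
      using tens_comp[OF ii(1) tens_in[OF t(1,2)] id_in[OF o(3)] t(3)] comp_id[OF t(3)] by simp
    also have "(((snd x \<odot> snd y) \<odot> snd z) \<cdot> (unshuffle ?s ?t \<odot> \<one> ?U)) \<cdot> iv (?ST \<otimes> ?U) ?J (shuffle (join ?s ?t) ?u)
        = ((snd x \<odot> snd y) \<odot> snd z) \<cdot> ?L"
      by (rule cassoc) (insert ii o t, (assumption | rule ty)+)
    finally show ?thesis .
  qed
  have r: "snd (pair x (pair y z)) = (snd x \<odot> (snd y \<odot> snd z)) \<cdot> ?R"
  proof -
    have "snd (pair x (pair y z)) =
       (snd x \<odot> ((snd y \<odot> snd z) \<cdot> unshuffle ?t ?u)) \<cdot> unshuffle ?s (join ?t ?u)"
      by (simp add: pair_def)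
    also have "snd x \<odot> ((snd y \<odot> snd z) \<cdot> unshuffle ?t ?u) = (snd x \<odot> (snd y \<odot> snd z)) \<cdot> (\<one> ?S \<odot> unshuffle ?t ?u)"
      using tens_comp[OF id_in[OF o(1)] t(1) ii(2) tens_in[OF t(2,3)]] comp_id[OF t(1)] by simp
    also have "((snd x \<odot> (snd y \<odot> snd z)) \<cdot> (\<one> ?S \<odot> unshuffle ?t ?u)) \<cdot> unshuffle ?s (join ?t ?u)
        = (snd x \<odot> (snd y \<odot> snd z)) \<cdot> ?R"
      by (rule cassoc) (insert ii o t, (assumption | rule ty)+)
    finally show ?thesis .
  qed
  have "assoc X Y Z \<cdot> (((snd x \<odot> snd y) \<odot> snd z) \<cdot> ?L) = (assoc X Y Z \<cdot> ((snd x \<odot> snd y) \<odot> snd z)) \<cdot> ?L"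
    by (rule cassoc[symmetric, OF Lin]) (insert o t, (assumption | rule ty)+)
  also have "\<dots> = ((snd x \<odot> (snd y \<odot> snd z)) \<cdot> assoc ?S ?T ?U) \<cdot> ?L"
    by (simp add: assoc_nat[OF t])
  also have "\<dots> = (snd x \<odot> (snd y \<odot> snd z)) \<cdot> (assoc ?S ?T ?U \<cdot> ?L)"
    by (rule cassoc[OF Lin]) (insert o t, (assumption | rule ty)+)
  also have "\<dots> = (snd x \<odot> (snd y \<odot> snd z)) \<cdot> ?R" by (simp only: LR)
  finally have "assoc X Y Z \<cdot> snd (pair (pair x y) z) = snd (pair x (pair y z))"
    by (simp only: l r)
  then show ?thesis by (intro prod_eqI) (simp_all add: app_def join_assoc)
qed

lemma app_lun:
  assumes x: "x \<in> El X" shows "app (lun X) (pair one x) = x"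
proof -
  note t = El_ar[OF x]
  have s: "stage_ob (fst x) \<in> Ob V" using ar_dom[OF t] .
  note l = lun_isoa[OF s]
  have "lun X \<cdot> ((\<one> \<I> \<odot> snd x) \<cdot> iv (\<I> \<otimes> stage_ob (fst x)) (stage_ob (fst x)) (lun (stage_ob (fst x)))) =
        (snd x \<cdot> lun (stage_ob (fst x))) \<cdot> iv (\<I> \<otimes> stage_ob (fst x)) (stage_ob (fst x)) (lun (stage_ob (fst x)))"
    using cassoc[OF iv_in[OF l] tens_in[OF id_in[OF unit_ob] t] lun_in[OF ar_cod[OF t]]] lun_nat[OF t] by simp
  also have "\<dots> = snd x"
    using cassoc[OF iv_in[OF l] isoa_ar[OF l] t] by (simp add: iv_r[OF l] comp_id[OF t])
  finally show ?thesis by (simp add: app_def pair_def one_def)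
qed

lemma app_run:
  assumes x: "x \<in> El X" shows "app (run X) (pair x one) = x"
proof -
  have "app (run X) (pair x one) = app (lun X) (app (symm X \<I>) (pair x one))"
    using app_comp[of "pair x one" "X \<otimes> \<I>" "symm X \<I>" "\<I> \<otimes> X" "lun X" X] x El_ob[OF x]
    by (simp add: lun_symm)
  then show ?thesis using x by (simp add: app_symm app_lun)
qed

lemma El_unit_ar:
  assumes "x \<in> El X" "fst x = []" shows "snd x \<in> ar \<I> X" "app (snd x) one = x"
proof -
  show 1: "snd x \<in> ar \<I> X" using assms by (simp add: El_def)
  show "app (snd x) one = x" using assms(2) comp_id[OF 1] by (cases x) (simp add: app_def one_def)
qed

lemma app_iv_lun: "x \<in> El X \<Longrightarrow> app (iv (\<I> \<otimes> X) X (lun X)) x = pair one x"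
  using app_iv(1)[OF lun_isoa pair_in[OF one_in]] by (simp add: app_lun El_ob)

lemma app_iv_run: "x \<in> El X \<Longrightarrow> app (iv (X \<otimes> \<I>) X (run X)) x = pair x one"
  using app_iv(1)[OF run_isoa pair_in[OF _ one_in]] by (simp add: app_run El_ob)

text \<open>
  The generic element of \<open>X\<close>, placed at position \<open>n\<close>. Its stage stands for \<open>X \<otimes> \<I>\<close> and not for \<open>X\<close>,
  because products of stages end with the unit. The position is variable in order to make it
  disjoint from any given element.
\<close>

definition gen :: "nat \<Rightarrow> 'o \<Rightarrow> 'o option list \<times> 'm" where
  "gen n X = (replicate n None @ [Some X], run X)"

lemma stage_ob_gen: "stage_ob (replicate n None @ [Some X]) = X \<otimes> \<I>"
  by (induction n) auto

lemma gen_in: "X \<in> Ob V \<Longrightarrow> gen n X \<in> El X"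
  by (auto simp: gen_def El_def stage_def stage_ob_gen)

lemma fresh: "apart s (replicate (length s) None @ [Some X])"
  by (induction s) auto

text \<open>
  Agreement at one generic element suffices, because that element is an isomorphism.
\<close>

lemma ext1:
  assumes "f \<in> ar X Y" "g \<in> ar X Y" "\<And>x. x \<in> El X \<Longrightarrow> app f x = app g x"
  shows "f = g"
proof -
  have "f \<cdot> run X = g \<cdot> run X"
    using assms(3)[OF gen_in[of X 0]] ar_dom[OF assms(1)] by (simp add: app_def gen_def)
  then show ?thesis using iso_epi[OF run_isoa assms(1,2)] ar_dom[OF assms(1)] by blast
qed

lemma ext_lun:
  assumes f: "f \<in> ar (\<I> \<otimes> X) Y" and g: "g \<in> ar (\<I> \<otimes> X) Y" and X: "X \<in> Ob V"
    and eq: "\<And>x. x \<in> El X \<Longrightarrow> app f (pair one x) = app g (pair one x)"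
  shows "f = g"
proof (rule iso_epi[OF iv_isoa[OF lun_isoa[OF X]] f g], rule ext1)
  note i = iv_in[OF lun_isoa[OF X]]
  show "f \<cdot> iv (\<I> \<otimes> X) X (lun X) \<in> ar X Y" "g \<cdot> iv (\<I> \<otimes> X) X (lun X) \<in> ar X Y"
    using comp_in[OF i] f g by blast+
  show "app (f \<cdot> iv (\<I> \<otimes> X) X (lun X)) x = app (g \<cdot> iv (\<I> \<otimes> X) X (lun X)) x" if "x \<in> El X" for x
    using eq that by (simp add: app_comp[OF that i f] app_comp[OF that i g] app_iv_lun)
qed

lemma ext_run:
  assumes f: "f \<in> ar (X \<otimes> \<I>) Y" and g: "g \<in> ar (X \<otimes> \<I>) Y" and X: "X \<in> Ob V"
    and eq: "\<And>x. x \<in> El X \<Longrightarrow> app f (pair x one) = app g (pair x one)"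
  shows "f = g"
proof (rule iso_epi[OF iv_isoa[OF run_isoa[OF X]] f g], rule ext1)
  note i = iv_in[OF run_isoa[OF X]]
  show "f \<cdot> iv (X \<otimes> \<I>) X (run X) \<in> ar X Y" "g \<cdot> iv (X \<otimes> \<I>) X (run X) \<in> ar X Y"
    using comp_in[OF i] f g by blast+
  show "app (f \<cdot> iv (X \<otimes> \<I>) X (run X)) x = app (g \<cdot> iv (X \<otimes> \<I>) X (run X)) x" if "x \<in> El X" for x
    using eq that by (simp add: app_comp[OF that i f] app_comp[OF that i g] app_iv_run)
qed

definition ap :: "'o \<Rightarrow> 'o \<Rightarrow> 'o option list \<times> 'm \<Rightarrow> 'o option list \<times> 'm \<Rightarrow> 'o option list \<times> 'm" where
  "ap X Y k x = app (ev X Y) (pair k x)"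

lemma ev_in [simp]: "X \<in> Ob V \<Longrightarrow> Y \<in> Ob V \<Longrightarrow> ev X Y \<in> ar (ihom X Y \<otimes> X) Y"
  using closed by (simp add: sym_monoidal_closed_def ar_def)

lemma fst_ap [simp]: "fst (ap X Y k x) = join (fst k) (fst x)"
  and disj_ap [simp]: "disj (ap X Y k x) y = (disj k y \<and> disj x y)"
    "disj y (ap X Y k x) = (disj y k \<and> disj y x)"
  by (simp_all add: ap_def)

lemma ap_in [simp]:
  "\<lbrakk>X \<in> Ob V; Y \<in> Ob V; k \<in> El (ihom X Y); x \<in> El X; disj k x\<rbrakk> \<Longrightarrow> ap X Y k x \<in> El Y"
  unfolding ap_def by (rule app_in[OF ev_in]) simp_all

lemma curry_ex1:
  "\<lbrakk>f \<in> ar (X \<otimes> Y) Z; X \<in> Ob V; Y \<in> Ob V\<rbrakk> \<Longrightarrow>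
     \<exists>!k. k \<in> Hom V X (ihom Y Z) \<and> ev Y Z \<cdot> (k \<odot> \<one> Y) = f"
  using closed unfolding sym_monoidal_closed_def ar_def by auto

lemma vcurry:
  assumes f: "f \<in> ar (X \<otimes> Y) Z" and X: "X \<in> Ob V" and Y: "Y \<in> Ob V"
  shows vcurry_in: "vcurry V X Y Z f \<in> ar X (ihom Y Z)"
    and ev_vcurry: "ev Y Z \<cdot> (vcurry V X Y Z f \<odot> \<one> Y) = f"
  using theI'[OF curry_ex1[OF f X Y]] X Y ar_cod[OF f]
  unfolding vcurry_def[symmetric] by (auto simp: ar_def)

lemma curry_unique:
  assumes k: "k \<in> ar X (ihom Y Z)" and k': "k' \<in> ar X (ihom Y Z)" and Y: "Y \<in> Ob V" and Z: "Z \<in> Ob V"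
    and eq: "ev Y Z \<cdot> (k \<odot> \<one> Y) = ev Y Z \<cdot> (k' \<odot> \<one> Y)"
  shows "k = k'"
proof -
  have "ev Y Z \<cdot> (k \<odot> \<one> Y) \<in> ar (X \<otimes> Y) Z"
    using comp_in[OF tens_in[OF k id_in[OF Y]] ev_in[OF Y Z]] .
  from curry_ex1[OF this ar_dom[OF k] Y] show ?thesis
    using k k' eq by (metis ar_Hom)
qed

text \<open>
  It suffices to evaluate \<open>k\<close> and \<open>k'\<close> at a generic element of \<open>X\<close> placed beyond the common stage \<open>s\<close>
  of \<open>k\<close> and \<open>k'\<close>: up to isomorphism the results are the transposes \<open>[s] \<otimes> X \<rightarrow> Y\<close> of \<open>k\<close> and \<open>k'\<close>.
  Both orders of the disjointness hypotheses are granted to the user of this rule, since the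
  simplifier does not use that disjointness is symmetric.
\<close>

lemma ext_ihom:
  assumes k: "k \<in> El (ihom X Y)" and k': "k' \<in> El (ihom X Y)" and X: "X \<in> Ob V" and Y: "Y \<in> Ob V"
    and st: "fst k = fst k'"
    and eq: "\<And>x. \<lbrakk>x \<in> El X; disj k x; disj x k; disj k' x; disj x k'\<rbrakk> \<Longrightarrow> ap X Y k x = ap X Y k' x"
  shows "k = k'"
proof (rule prod_eqI[OF st])
  let ?s = "fst k" and ?x = "gen (length (fst k)) X"
  have x: "?x \<in> El X" using X by (rule gen_in)
  have d: "disj k ?x" "disj ?x k" "disj k' ?x" "disj ?x k'"
    using fresh[of ?s X] st by (auto simp: disj_def gen_def apart_commute)
  note K = El_ar[OF k] and K' = El_ar[OF k', folded st]
  have sx: "snd ?x \<in> isoa (stage_ob (fst ?x)) X" using run_isoa[OF X] by (simp add: gen_def stage_ob_gen)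
  have s: "stage_ob ?s \<in> Ob V" using ar_dom[OF K] .
  note u = El_shuffle[OF k x d(1)]
  let ?u = "unshuffle ?s (fst ?x)"
  have e: "(\<one> (stage_ob ?s) \<odot> snd ?x) \<cdot> ?u \<in> isoa (stage_ob (join ?s (fst ?x))) (stage_ob ?s \<otimes> X)"
    by (rule comp_isoa[OF iv_isoa[OF u] tens_isoa[OF id_isoa[OF s] sx]])
  have *: "snd (ap X Y h ?x) = (ev X Y \<cdot> (snd h \<odot> \<one> X)) \<cdot> ((\<one> (stage_ob ?s) \<odot> snd ?x) \<cdot> ?u)"
    if h: "snd h \<in> ar (stage_ob ?s) (ihom X Y)" and f: "fst h = ?s" for h
  proof -
    have t: "snd h \<odot> \<one> X \<in> ar (stage_ob ?s \<otimes> X) (ihom X Y \<otimes> X)"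
      "\<one> (stage_ob ?s) \<odot> snd ?x \<in> ar (stage_ob ?s \<otimes> stage_ob (fst ?x)) (stage_ob ?s \<otimes> X)"
      using h sx s X by (auto intro: tens_in isoa_ar)
    have "snd (ap X Y h ?x) = ev X Y \<cdot> ((snd h \<odot> snd ?x) \<cdot> ?u)"
      by (simp add: ap_def app_def pair_def f)
    also have "snd h \<odot> snd ?x = (snd h \<odot> \<one> X) \<cdot> (\<one> (stage_ob ?s) \<odot> snd ?x)"
      using tens_comp[OF id_in[OF s] h isoa_ar[OF sx] id_in[OF X]] comp_id[OF h] id_comp[OF isoa_ar[OF sx]] by simp
    also have "\<dots> \<cdot> ?u = (snd h \<odot> \<one> X) \<cdot> ((\<one> (stage_ob ?s) \<odot> snd ?x) \<cdot> ?u)"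
      by (rule cassoc[OF iv_in[OF u] t(2,1)])
    also have "ev X Y \<cdot> \<dots> = (ev X Y \<cdot> (snd h \<odot> \<one> X)) \<cdot> ((\<one> (stage_ob ?s) \<odot> snd ?x) \<cdot> ?u)"
      by (rule cassoc[OF isoa_ar[OF e] t(1) ev_in[OF X Y], symmetric])
    finally show ?thesis .
  qed
  have "ev X Y \<cdot> (snd k \<odot> \<one> X) = ev X Y \<cdot> (snd k' \<odot> \<one> X)"
  proof (rule iso_epi[OF e])
    show "(ev X Y \<cdot> (snd k \<odot> \<one> X)) \<cdot> ((\<one> (stage_ob ?s) \<odot> snd ?x) \<cdot> ?u) =
        (ev X Y \<cdot> (snd k' \<odot> \<one> X)) \<cdot> ((\<one> (stage_ob ?s) \<odot> snd ?x) \<cdot> ?u)"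
      using eq[OF x d] *[OF K refl] *[OF K' st[symmetric]] by simp
  qed (insert K K' X Y, (assumption | rule comp_in tens_in ev_in id_in)+)
  then show "snd k = snd k'" by (rule curry_unique[OF K K' X Y])
qed

lemma ap_vcurry:
  assumes f: "f \<in> ar (X \<otimes> Y) Z" and x: "x \<in> El X" and y: "y \<in> El Y" and d: "disj x y"
  shows "ap Y Z (app (vcurry V X Y Z f) x) y = app f (pair x y)"
proof -
  note o = El_ob[OF x] El_ob[OF y] ar_cod[OF f]
  note c = vcurry_in[OF f o(1,2)]
  have "app f (pair x y) = app (ev Y Z) (app (vcurry V X Y Z f \<odot> \<one> Y) (pair x y))"
    using app_comp[OF pair_in[OF x y d] tens_in[OF c id_in[OF o(2)]] ev_in[OF o(2,3)]]
    by (simp add: ev_vcurry[OF f o(1,2)])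
  also have "app (vcurry V X Y Z f \<odot> \<one> Y) (pair x y) = pair (app (vcurry V X Y Z f) x) y"
    using app_tens[OF c id_in[OF o(2)] x y d] by (simp add: app_id[OF y])
  finally show ?thesis by (simp add: ap_def)
qed

lemma vuncurry:
  assumes k: "k \<in> ar X (ihom Y Z)" and Y: "Y \<in> Ob V" and Z: "Z \<in> Ob V"
  shows vuncurry_in: "vuncurry V Y Z k \<in> ar (X \<otimes> Y) Z"
    and app_vuncurry: "\<lbrakk>x \<in> El X; y \<in> El Y; disj x y\<rbrakk> \<Longrightarrow>
       app (vuncurry V Y Z k) (pair x y) = ap Y Z (app k x) y"
proof -
  show "vuncurry V Y Z k \<in> ar (X \<otimes> Y) Z"
    unfolding vuncurry_def using comp_in[OF tens_in[OF k id_in[OF Y]] ev_in[OF Y Z]] .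
  show "app (vuncurry V Y Z k) (pair x y) = ap Y Z (app k x) y"
    if "x \<in> El X" "y \<in> El Y" "disj x y"
    using app_comp[OF pair_in[OF that] tens_in[OF k id_in[OF Y]] ev_in[OF Y Z]]
      app_tens[OF k id_in[OF Y] that] app_id[OF that(2)]
    by (simp add: vuncurry_def ap_def)
qed

text \<open>
  Transposing twice: elements of the form \<open>pair x y\<close> detect equality of arrows out of a tensor
  product, although not every element of a tensor product has this form.
\<close>

lemma ext2:
  assumes f: "f \<in> ar (X \<otimes> Y) Z" and g: "g \<in> ar (X \<otimes> Y) Z" and X: "X \<in> Ob V" and Y: "Y \<in> Ob V"
    and eq: "\<And>x y. \<lbrakk>x \<in> El X; y \<in> El Y; disj x y; disj y x\<rbrakk> \<Longrightarrow> app f (pair x y) = app g (pair x y)"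
  shows "f = g"
proof -
  note Z = ar_cod[OF f]
  note c = vcurry_in[OF f X Y] vcurry_in[OF g X Y]
  have "vcurry V X Y Z f = vcurry V X Y Z g"
  proof (rule ext1[OF c])
    fix x assume x: "x \<in> El X"
    show "app (vcurry V X Y Z f) x = app (vcurry V X Y Z g) x"
      by (rule ext_ihom[OF app_in[OF c(1) x] app_in[OF c(2) x] Y Z])
        (simp_all add: ap_vcurry[OF f x] ap_vcurry[OF g x] eq x)
  qed
  then have "ev Y Z \<cdot> (vcurry V X Y Z f \<odot> \<one> Y) = ev Y Z \<cdot> (vcurry V X Y Z g \<odot> \<one> Y)" by (rule arg_cong)
  then show ?thesis by (simp only: ev_vcurry[OF f X Y] ev_vcurry[OF g X Y])
qed

lemma ext3:
  assumes f: "f \<in> ar ((X \<otimes> Y) \<otimes> W) Z" and g: "g \<in> ar ((X \<otimes> Y) \<otimes> W) Z"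
    and X: "X \<in> Ob V" and Y: "Y \<in> Ob V" and W: "W \<in> Ob V"
    and eq: "\<And>x y w. \<lbrakk>x \<in> El X; y \<in> El Y; w \<in> El W; disj x y; disj y x;
      disj x w; disj w x; disj y w; disj w y\<rbrakk> \<Longrightarrow>
      app f (pair (pair x y) w) = app g (pair (pair x y) w)"
  shows "f = g"
proof -
  note Z = ar_cod[OF f]
  note XY = tens_ob[OF X Y]
  note c = vcurry_in[OF f XY W] vcurry_in[OF g XY W]
  have "vcurry V (X \<otimes> Y) W Z f = vcurry V (X \<otimes> Y) W Z g"
  proof (rule ext2[OF c X Y])
    fix x y assume xy: "x \<in> El X" "y \<in> El Y" "disj x y" "disj y x"
    note p = pair_in[OF xy(1-3)]
    show "app (vcurry V (X \<otimes> Y) W Z f) (pair x y) = app (vcurry V (X \<otimes> Y) W Z g) (pair x y)"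
      by (rule ext_ihom[OF app_in[OF c(1) p] app_in[OF c(2) p] W Z])
        (simp_all add: ap_vcurry[OF f p] ap_vcurry[OF g p] eq xy)
  qed
  then have "ev W Z \<cdot> (vcurry V (X \<otimes> Y) W Z f \<odot> \<one> W) = ev W Z \<cdot> (vcurry V (X \<otimes> Y) W Z g \<odot> \<one> W)" by (rule arg_cong)
  then show ?thesis by (simp only: ev_vcurry[OF f XY W] ev_vcurry[OF g XY W])
qed

section \<open>Multilinear functions\<close>

text \<open>
  A function of several disjoint elements is multilinear if some arrow out of the tensor product
  realises it. The closure properties below construct arrows of \<open>V\<close> from formulas about elements.
\<close>

definition lin1 where
  "lin1 X Z \<Phi> \<longleftrightarrow> X \<in> Ob V \<and> (\<exists>f\<in>ar X Z. \<forall>x\<in>El X. app f x = \<Phi> x)"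

definition lin2 where
  "lin2 X Y Z \<Phi> \<longleftrightarrow> X \<in> Ob V \<and> Y \<in> Ob V \<and>
     (\<exists>f\<in>ar (X \<otimes> Y) Z. \<forall>x\<in>El X. \<forall>y\<in>El Y. disj x y \<longrightarrow> app f (pair x y) = \<Phi> x y)"

definition lin3 where
  "lin3 X Y W Z \<Phi> \<longleftrightarrow> X \<in> Ob V \<and> Y \<in> Ob V \<and> W \<in> Ob V \<and>
     (\<exists>f\<in>ar ((X \<otimes> Y) \<otimes> W) Z. \<forall>x\<in>El X. \<forall>y\<in>El Y. \<forall>w\<in>El W.
        disj x y \<longrightarrow> disj x w \<longrightarrow> disj y w \<longrightarrow> app f (pair (pair x y) w) = \<Phi> x y w)"

lemma lin1I: "f \<in> ar X Z \<Longrightarrow> (\<And>x. x \<in> El X \<Longrightarrow> app f x = \<Phi> x) \<Longrightarrow> lin1 X Z \<Phi>"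
  unfolding lin1_def using ar_dom by blast

lemma lin2I:
  "\<lbrakk>X \<in> Ob V; Y \<in> Ob V; f \<in> ar (X \<otimes> Y) Z;
   (\<And>x y. x \<in> El X \<Longrightarrow> y \<in> El Y \<Longrightarrow> disj x y \<Longrightarrow> app f (pair x y) = \<Phi> x y)\<rbrakk> \<Longrightarrow> lin2 X Y Z \<Phi>"
  unfolding lin2_def by blast

lemma lin3I:
  "\<lbrakk>X \<in> Ob V; Y \<in> Ob V; W \<in> Ob V; f \<in> ar ((X \<otimes> Y) \<otimes> W) Z;
   (\<And>x y w. x \<in> El X \<Longrightarrow> y \<in> El Y \<Longrightarrow> w \<in> El W \<Longrightarrow> disj x y \<Longrightarrow> disj x w \<Longrightarrow> disj y w \<Longrightarrow>
      app f (pair (pair x y) w) = \<Phi> x y w)\<rbrakk> \<Longrightarrow> lin3 X Y W Z \<Phi>"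
  unfolding lin3_def by blast

lemma lin1_app: "f \<in> ar X Y \<Longrightarrow> lin1 X Y (app f)"
  by (auto simp: lin1_def ar_dom)

lemma lin2_app: "\<lbrakk>f \<in> ar (X \<otimes> Y) Z; X \<in> Ob V; Y \<in> Ob V\<rbrakk> \<Longrightarrow> lin2 X Y Z (\<lambda>x y. app f (pair x y))"
  by (auto simp: lin2_def)

lemma lin2_pair: "X \<in> Ob V \<Longrightarrow> Y \<in> Ob V \<Longrightarrow> lin2 X Y (X \<otimes> Y) pair"
  unfolding lin2_def by (auto intro!: bexI[of _ "\<one> (X \<otimes> Y)"] simp: app_id[of _ "X \<otimes> Y"])

lemma lin2_ap: "X \<in> Ob V \<Longrightarrow> Y \<in> Ob V \<Longrightarrow> lin2 (ihom X Y) X Y (ap X Y)"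
  unfolding lin2_def by (auto intro!: bexI[of _ "ev X Y"] simp: ap_def)

lemma lin2_post:
  assumes "lin1 Z W \<Psi>" "lin2 X Y Z \<Phi>" shows "lin2 X Y W (\<lambda>x y. \<Psi> (\<Phi> x y))"
proof -
  obtain f where f: "f \<in> ar (X \<otimes> Y) Z" "\<And>x y. \<lbrakk>x \<in> El X; y \<in> El Y; disj x y\<rbrakk> \<Longrightarrow> app f (pair x y) = \<Phi> x y"
    and o: "X \<in> Ob V" "Y \<in> Ob V" using assms(2) by (auto simp: lin2_def)
  obtain g where g: "g \<in> ar Z W" "\<And>z. z \<in> El Z \<Longrightarrow> app g z = \<Psi> z"
    using assms(1) by (auto simp: lin1_def)
  have "app (g \<cdot> f) (pair x y) = \<Psi> (\<Phi> x y)" if "x \<in> El X" "y \<in> El Y" "disj x y" for x y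
    using app_comp[OF pair_in[OF that] f(1) g(1)] g(2)[OF app_in[OF f(1) pair_in[OF that]]] f(2)[OF that] by simp
  then show ?thesis by (rule lin2I[OF o comp_in[OF f(1) g(1)]])
qed

lemma lin2_pre1:
  assumes "lin1 X' X \<Psi>" "lin2 X Y Z \<Phi>" shows "lin2 X' Y Z (\<lambda>x y. \<Phi> (\<Psi> x) y)"
proof -
  obtain f where f: "f \<in> ar (X \<otimes> Y) Z" "\<And>x y. \<lbrakk>x \<in> El X; y \<in> El Y; disj x y\<rbrakk> \<Longrightarrow> app f (pair x y) = \<Phi> x y"
    and o: "X \<in> Ob V" "Y \<in> Ob V" using assms(2) by (auto simp: lin2_def)
  obtain g where g: "g \<in> ar X' X" "\<And>z. z \<in> El X' \<Longrightarrow> app g z = \<Psi> z"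
    using assms(1) by (auto simp: lin1_def)
  note h = tens_in[OF g(1) id_in[OF o(2)]]
  have "app (f \<cdot> (g \<odot> \<one> Y)) (pair x y) = \<Phi> (\<Psi> x) y" if xy: "x \<in> El X'" "y \<in> El Y" "disj x y" for x y
  proof -
    have "app f (pair (app g x) y) = \<Phi> (app g x) y"
      by (rule f(2)[OF app_in[OF g(1) xy(1)] xy(2)]) (simp add: xy)
    then show ?thesis
      using app_comp[OF pair_in[OF that] h f(1)] app_tens[OF g(1) id_in[OF o(2)] that] app_id[OF that(2)]
        g(2)[OF that(1)] by simp
  qed
  then show ?thesis by (rule lin2I[OF ar_dom[OF g(1)] o(2) comp_in[OF h f(1)]])
qed

lemma lin2_swap:
  assumes "lin2 X Y Z \<Phi>" shows "lin2 Y X Z (\<lambda>y x. \<Phi> x y)"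
proof -
  obtain f where f: "f \<in> ar (X \<otimes> Y) Z" "\<And>x y. \<lbrakk>x \<in> El X; y \<in> El Y; disj x y\<rbrakk> \<Longrightarrow> app f (pair x y) = \<Phi> x y"
    and o: "X \<in> Ob V" "Y \<in> Ob V" using assms by (auto simp: lin2_def)
  have "app (f \<cdot> symm Y X) (pair y x) = \<Phi> x y" if xy: "y \<in> El Y" "x \<in> El X" "disj y x" for x y
    using app_comp[OF pair_in[OF that] symm_in[OF o(2,1)] f(1)] app_symm[OF that]
      f(2)[OF that(2,1)] that(3) by (simp add: disj_commute)
  then show ?thesis by (rule lin2I[OF o(2,1) comp_in[OF symm_in[OF o(2,1)] f(1)]])
qed

lemma lin2_pre2:
  assumes "lin1 Y' Y \<Psi>" "lin2 X Y Z \<Phi>" shows "lin2 X Y' Z (\<lambda>x y. \<Phi> x (\<Psi> y))"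
  using lin2_swap[OF lin2_pre1[OF assms(1) lin2_swap[OF assms(2)]]] .

lemma lin2_const:
  assumes "lin2 X Y Z \<Phi>" and c: "c \<in> El Y" "fst c = []" shows "lin1 X Z (\<lambda>x. \<Phi> x c)"
proof -
  obtain f where f: "f \<in> ar (X \<otimes> Y) Z" "\<And>x y. \<lbrakk>x \<in> El X; y \<in> El Y; disj x y\<rbrakk> \<Longrightarrow> app f (pair x y) = \<Phi> x y"
    and o: "X \<in> Ob V" "Y \<in> Ob V" using assms by (auto simp: lin2_def)
  note k = El_unit_ar[OF c]
  note r = run_isoa[OF o(1)]
  note h = tens_in[OF id_in[OF o(1)] k(1)]
  have "app (f \<cdot> ((\<one> X \<odot> snd c) \<cdot> iv (X \<otimes> \<I>) X (run X))) x = \<Phi> x c" if x: "x \<in> El X" for x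
  proof -
    show ?thesis
      using app_iv_run[OF x] app_comp[OF x comp_in[OF iv_in[OF r] h] f(1)] app_comp[OF x iv_in[OF r] h]
        app_tens[OF id_in[OF o(1)] k(1) x one_in] app_id[OF x] k(2) f(2)[OF x c(1)] c(2)
      by (simp add: disj_def)
  qed
  then show ?thesis by (rule lin1I[OF comp_in[OF comp_in[OF iv_in[OF r] h] f(1)]])
qed

lemma lin3_l:
  assumes "lin2 X Y U \<Psi>" "lin2 U W Z \<Phi>" shows "lin3 X Y W Z (\<lambda>x y w. \<Phi> (\<Psi> x y) w)"
proof -
  obtain g where g: "g \<in> ar (X \<otimes> Y) U" "\<And>x y. \<lbrakk>x \<in> El X; y \<in> El Y; disj x y\<rbrakk> \<Longrightarrow> app g (pair x y) = \<Psi> x y"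
    and o: "X \<in> Ob V" "Y \<in> Ob V" using assms(1) by (auto simp: lin2_def)
  have "lin2 (X \<otimes> Y) W Z (\<lambda>p w. \<Phi> (app g p) w)" by (rule lin2_pre1[OF lin1_app[OF g(1)] assms(2)])
  then obtain f where f: "f \<in> ar ((X \<otimes> Y) \<otimes> W) Z"
    "\<And>x y. \<lbrakk>x \<in> El (X \<otimes> Y); y \<in> El W; disj x y\<rbrakk> \<Longrightarrow> app f (pair x y) = \<Phi> (app g x) y"
    and o': "W \<in> Ob V" by (auto simp: lin2_def)
  show ?thesis by (rule lin3I[OF o o' f(1)]) (simp add: f(2) g(2))
qed

lemma lin3_swap12:
  assumes "lin3 X Y W Z \<Phi>" shows "lin3 Y X W Z (\<lambda>y x w. \<Phi> x y w)"
proof -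
  obtain f where f: "f \<in> ar ((X \<otimes> Y) \<otimes> W) Z"
    "\<And>x y w. \<lbrakk>x \<in> El X; y \<in> El Y; w \<in> El W; disj x y; disj x w; disj y w\<rbrakk> \<Longrightarrow>
       app f (pair (pair x y) w) = \<Phi> x y w"
    and o: "X \<in> Ob V" "Y \<in> Ob V" "W \<in> Ob V" using assms by (auto simp: lin3_def)
  have "lin2 (Y \<otimes> X) W Z (\<lambda>p w. app f (pair (app (symm Y X) p) w))"
    using lin2_pre1[OF lin1_app[OF symm_in[OF o(2,1)]] lin2_app[OF f(1) tens_ob[OF o(1,2)] o(3)]] .
  then obtain h where h: "h \<in> ar ((Y \<otimes> X) \<otimes> W) Z"
    "\<And>p w. \<lbrakk>p \<in> El (Y \<otimes> X); w \<in> El W; disj p w\<rbrakk> \<Longrightarrow> app h (pair p w) = app f (pair (app (symm Y X) p) w)"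
    by (auto simp: lin2_def)
  have "app h (pair (pair y x) w) = \<Phi> x y w"
    if "y \<in> El Y" "x \<in> El X" "w \<in> El W" "disj y x" "disj y w" "disj x w" for x y w
    using that by (simp add: h(2) app_symm f(2) disj_commute)
  then show ?thesis by (rule lin3I[OF o(2,1,3) h(1)])
qed

lemma lin3_swap23:
  assumes "lin3 X Y W Z \<Phi>" shows "lin3 X W Y Z (\<lambda>x w y. \<Phi> x y w)"
proof -
  obtain f where f: "f \<in> ar ((X \<otimes> Y) \<otimes> W) Z"
    "\<And>x y w. \<lbrakk>x \<in> El X; y \<in> El Y; w \<in> El W; disj x y; disj x w; disj y w\<rbrakk> \<Longrightarrow>
       app f (pair (pair x y) w) = \<Phi> x y w"
    and o: "X \<in> Ob V" "Y \<in> Ob V" "W \<in> Ob V" using assms by (auto simp: lin3_def)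
  let ?a = "assoc X W Y" and ?b = "iv ((X \<otimes> Y) \<otimes> W) (X \<otimes> (Y \<otimes> W)) (assoc X Y W)"
  let ?h = "f \<cdot> (?b \<cdot> ((\<one> X \<odot> symm W Y) \<cdot> ?a))"
  note a = assoc_in[OF o(1,3,2)] and b = iv_in[OF assoc_isoa[OF o]]
  have s: "\<one> X \<odot> symm W Y \<in> ar (X \<otimes> (W \<otimes> Y)) (X \<otimes> (Y \<otimes> W))" using o by (auto intro: tens_in)
  note c1 = comp_in[OF a s] and c2 = comp_in[OF comp_in[OF a s] b]
  have "app ?h (pair (pair x w) y) = \<Phi> x y w"
    if h: "x \<in> El X" "w \<in> El W" "y \<in> El Y" "disj x w" "disj x y" "disj w y" for x y w
  proof -
    have wy: "disj y w" using h by (simp add: disj_commute)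
    have p: "pair (pair x w) y \<in> El ((X \<otimes> W) \<otimes> Y)" using h by simp
    have "app ?h (pair (pair x w) y) = app f (app ?b (app (\<one> X \<odot> symm W Y) (app ?a (pair (pair x w) y))))"
      by (simp add: app_comp[OF p c2 f(1)] app_comp[OF p c1 b] app_comp[OF p a s])
    also have "app (\<one> X \<odot> symm W Y) (app ?a (pair (pair x w) y)) = pair x (pair y w)"
      using h by (simp add: app_assoc app_tens[OF id_in[OF o(1)] symm_in[OF o(3,2)]] app_id[OF h(1)] app_symm)
    also have "\<dots> = app (assoc X Y W) (pair (pair x y) w)" using h wy by (simp add: app_assoc)
    also have "app ?b \<dots> = pair (pair x y) w"
      by (rule app_iv(1)[OF assoc_isoa[OF o]]) (use h wy in simp)
    finally show ?thesis using f(2) h wy by simp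
  qed
  then show ?thesis by (rule lin3I[OF o(1,3,2) comp_in[OF c2 f(1)]])
qed

lemma lin2_curry:
  assumes "lin2 X Y Z \<Phi>"
  obtains f where "f \<in> ar X (ihom Y Z)"
    "\<And>x y. \<lbrakk>x \<in> El X; y \<in> El Y; disj x y\<rbrakk> \<Longrightarrow> ap Y Z (app f x) y = \<Phi> x y"
proof -
  obtain f where f: "f \<in> ar (X \<otimes> Y) Z" "\<And>x y. \<lbrakk>x \<in> El X; y \<in> El Y; disj x y\<rbrakk> \<Longrightarrow> app f (pair x y) = \<Phi> x y"
    and o: "X \<in> Ob V" "Y \<in> Ob V" using assms by (auto simp: lin2_def)
  show ?thesis by (rule that[OF vcurry_in[OF f(1) o]]) (simp add: ap_vcurry[OF f(1)] f(2))
qed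

lemma lin3_curry:
  assumes "lin3 X Y W Z \<Phi>"
  obtains f where "f \<in> ar (X \<otimes> Y) (ihom W Z)"
    "\<And>x y w. \<lbrakk>x \<in> El X; y \<in> El Y; w \<in> El W; disj x y; disj x w; disj y w\<rbrakk> \<Longrightarrow>
       ap W Z (app f (pair x y)) w = \<Phi> x y w"
proof -
  obtain f where f: "f \<in> ar ((X \<otimes> Y) \<otimes> W) Z"
    "\<And>x y w. \<lbrakk>x \<in> El X; y \<in> El Y; w \<in> El W; disj x y; disj x w; disj y w\<rbrakk> \<Longrightarrow>
       app f (pair (pair x y) w) = \<Phi> x y w"
    and o: "X \<in> Ob V" "Y \<in> Ob V" "W \<in> Ob V" using assms by (auto simp: lin3_def)
  show ?thesis by (rule that[OF vcurry_in[OF f(1) tens_ob[OF o(1,2)] o(3)]]) (simp add: ap_vcurry[OF f(1)] f(2))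
qed

lemma lin3_curry2:
  assumes "lin3 X Y W Z \<Phi>"
  obtains f where "f \<in> ar X (ihom Y (ihom W Z))"
    "\<And>x y w. \<lbrakk>x \<in> El X; y \<in> El Y; w \<in> El W; disj x y; disj x w; disj y w\<rbrakk> \<Longrightarrow>
       ap W Z (ap Y (ihom W Z) (app f x) y) w = \<Phi> x y w"
proof -
  obtain g where g: "g \<in> ar (X \<otimes> Y) (ihom W Z)"
    "\<And>x y w. \<lbrakk>x \<in> El X; y \<in> El Y; w \<in> El W; disj x y; disj x w; disj y w\<rbrakk> \<Longrightarrow>
       ap W Z (app g (pair x y)) w = \<Phi> x y w" using lin3_curry[OF assms] by blast
  have o: "X \<in> Ob V" "Y \<in> Ob V" using assms by (auto simp: lin3_def)
  show ?thesis by (rule that[OF vcurry_in[OF g(1) o]]) (simp add: ap_vcurry[OF g(1)] g(2))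
qed

end

section \<open>Enriched categories in terms of elements\<close>

context smc_closed
begin

text \<open>
  Composition, identities and the action of a functor to \<open>V\<close>, as operations on elements. With them
  the axioms of \<open>V\<close>-categories and \<open>V\<close>-functors have the form of those of ordinary categories and
  functors, for elements that are pairwise disjoint.
\<close>

definition cmp where "cmp A a b c g f = app (vcomp A a b c) (pair g f)"
definition idn where "idn A a = app (vid A a) one"
definition act where "act F a b f x = ap (fob F a) (fob F b) (app (far F a b) f) x"

lemma fst_cmp [simp]: "fst (cmp A a b c g f) = join (fst g) (fst f)"
  and fst_idn [simp]: "fst (idn A a) = []"
  and fst_act [simp]: "fst (act F a b f x) = join (fst f) (fst x)"
  by (simp_all add: cmp_def idn_def act_def)

lemma disj_cmp [simp]:
  "disj (cmp A a b c g f) x \<longleftrightarrow> disj g x \<and> disj f x"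
  "disj x (cmp A a b c g f) \<longleftrightarrow> disj x g \<and> disj x f"
  "disj (idn A a) x" "disj x (idn A a)"
  "disj (act F a b f y) x \<longleftrightarrow> disj f x \<and> disj y x"
  "disj x (act F a b f y) \<longleftrightarrow> disj x f \<and> disj x y"
  by (simp_all add: cmp_def idn_def act_def)

lemma vhom_ob [simp]: "\<lbrakk>vcategory V A; a \<in> vob A; b \<in> vob A\<rbrakk> \<Longrightarrow> vhom A a b \<in> Ob V"
  and vcomp_in: "\<lbrakk>vcategory V A; a \<in> vob A; b \<in> vob A; c \<in> vob A\<rbrakk> \<Longrightarrow>
    vcomp A a b c \<in> ar (vhom A b c \<otimes> vhom A a b) (vhom A a c)"
  and vid_in: "vcategory V A \<Longrightarrow> a \<in> vob A \<Longrightarrow> vid A a \<in> ar \<I> (vhom A a a)"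
  by (simp_all add: vcategory_def ar_def)

lemma cmp_in [simp]:
  "\<lbrakk>vcategory V A; a \<in> vob A; b \<in> vob A; c \<in> vob A;
   g \<in> El (vhom A b c); f \<in> El (vhom A a b); disj g f\<rbrakk> \<Longrightarrow> cmp A a b c g f \<in> El (vhom A a c)"
  unfolding cmp_def by (rule app_in[OF vcomp_in]) simp_all

lemma idn_in [simp]: "vcategory V A \<Longrightarrow> a \<in> vob A \<Longrightarrow> idn A a \<in> El (vhom A a a)"
  unfolding idn_def by (rule app_in[OF vid_in]) simp_all

text \<open>
  The values of the two sides of the associativity axiom. Being derived from the typing of composition
  alone, they serve both to use the axiom and to establish it.
\<close>

lemma cmp_tens_l:
  assumes "\<And>a b c. \<lbrakk>a \<in> vob A; b \<in> vob A; c \<in> vob A\<rbrakk> \<Longrightarrow>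
      vcomp A a b c \<in> ar (vhom A b c \<otimes> vhom A a b) (vhom A a c)"
    and o: "a \<in> vob A" "b \<in> vob A" "c \<in> vob A" "d \<in> vob A"
    and e: "h \<in> El (vhom A c d)" "g \<in> El (vhom A b c)" "f \<in> El (vhom A a b)" "disj h g" "disj h f" "disj g f"
    and H: "vhom A a b \<in> Ob V" "vhom A b c \<in> Ob V" "vhom A c d \<in> Ob V"
  shows "app (vcomp A a b d \<cdot> (vcomp A b c d \<odot> \<one> (vhom A a b))) (pair (pair h g) f) =
      cmp A a b d (cmp A b c d h g) f"
    and "app (vcomp A a c d \<cdot> (\<one> (vhom A c d) \<odot> vcomp A a b c) \<cdot>
          assoc (vhom A c d) (vhom A b c) (vhom A a b)) (pair (pair h g) f) =
      cmp A a c d h (cmp A a b c g f)"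
proof -
  note c = assms(1)
  have p: "pair h g \<in> El (vhom A c d \<otimes> vhom A b c)" "pair g f \<in> El (vhom A b c \<otimes> vhom A a b)"
    "pair (pair h g) f \<in> El ((vhom A c d \<otimes> vhom A b c) \<otimes> vhom A a b)"
    "pair h (pair g f) \<in> El (vhom A c d \<otimes> (vhom A b c \<otimes> vhom A a b))"
    using e by simp_all
  have d: "disj (pair h g) f" "disj h (pair g f)" using e by simp_all
  note t1 = tens_in[OF c[OF o(2-4)] id_in[OF H(1)]] and t2 = tens_in[OF id_in[OF H(3)] c[OF o(1-3)]]
  show "app (vcomp A a b d \<cdot> (vcomp A b c d \<odot> \<one> (vhom A a b))) (pair (pair h g) f) =
      cmp A a b d (cmp A b c d h g) f"
    by (simp add: app_comp[OF p(3) t1 c[OF o(1,2,4)]] app_tens[OF c[OF o(2-4)] id_in[OF H(1)] p(1) e(3) d(1)]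
        app_id[OF e(3)] cmp_def)
  show "app (vcomp A a c d \<cdot> (\<one> (vhom A c d) \<odot> vcomp A a b c) \<cdot>
          assoc (vhom A c d) (vhom A b c) (vhom A a b)) (pair (pair h g) f) =
      cmp A a c d h (cmp A a b c g f)"
    by (simp add: app_comp[OF p(3) assoc_in[OF H(3,2,1)] comp_in[OF t2 c[OF o(1,3,4)]]]
        app_assoc[OF e] app_comp[OF p(4) t2 c[OF o(1,3,4)]]
        app_tens[OF id_in[OF H(3)] c[OF o(1-3)] e(1) p(2) d(2)] app_id[OF e(1)] cmp_def)
qed

lemma cmp_assoc:
  assumes A: "vcategory V A" and o: "a \<in> vob A" "b \<in> vob A" "c \<in> vob A" "d \<in> vob A"
    and e: "h \<in> El (vhom A c d)" "g \<in> El (vhom A b c)" "f \<in> El (vhom A a b)" "disj h g" "disj h f" "disj g f"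
  shows "cmp A a b d (cmp A b c d h g) f = cmp A a c d h (cmp A a b c g f)"
proof -
  have eq: "vcomp A a b d \<cdot> (vcomp A b c d \<odot> \<one> (vhom A a b)) =
        vcomp A a c d \<cdot> (\<one> (vhom A c d) \<odot> vcomp A a b c) \<cdot>
          assoc (vhom A c d) (vhom A b c) (vhom A a b)"
    using A o unfolding vcategory_def by blast
  show ?thesis
    using cmp_tens_l[OF vcomp_in[OF A] o e] A o by (simp add: eq)
qed

lemma cmp_unit:
  assumes o: "vid A b \<in> ar \<I> (vhom A b b)" "vid A a \<in> ar \<I> (vhom A a a)"
    and c: "vcomp A a b b \<in> ar (vhom A b b \<otimes> vhom A a b) (vhom A a b)"
      "vcomp A a a b \<in> ar (vhom A a b \<otimes> vhom A a a) (vhom A a b)"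
    and f: "f \<in> El (vhom A a b)"
  shows "app (vcomp A a b b \<cdot> (vid A b \<odot> \<one> (vhom A a b))) (pair one f) = cmp A a b b (idn A b) f"
    and "app (vcomp A a a b \<cdot> (\<one> (vhom A a b) \<odot> vid A a)) (pair f one) = cmp A a a b f (idn A a)"
proof -
  note h = id_in[OF El_ob[OF f]]
  have p: "pair one f \<in> El (\<I> \<otimes> vhom A a b)" "pair f one \<in> El (vhom A a b \<otimes> \<I>)" using f by simp_all
  show "app (vcomp A a b b \<cdot> (vid A b \<odot> \<one> (vhom A a b))) (pair one f) = cmp A a b b (idn A b) f"
    by (simp add: app_comp[OF p(1) tens_in[OF o(1) h] c(1)] app_tens[OF o(1) h one_in f] app_id[OF f] cmp_def idn_def)
  show "app (vcomp A a a b \<cdot> (\<one> (vhom A a b) \<odot> vid A a)) (pair f one) = cmp A a a b f (idn A a)"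
    by (simp add: app_comp[OF p(2) tens_in[OF h o(2)] c(2)] app_tens[OF h o(2) f one_in] app_id[OF f] cmp_def idn_def)
qed

lemma cmp_idn [simp]:
  assumes A: "vcategory V A" and o: "a \<in> vob A" "b \<in> vob A" and f: "f \<in> El (vhom A a b)"
  shows "cmp A a b b (idn A b) f = f" "cmp A a a b f (idn A a) = f"
proof -
  have eq: "vcomp A a b b \<cdot> (vid A b \<odot> \<one> (vhom A a b)) = lun (vhom A a b)"
    "vcomp A a a b \<cdot> (\<one> (vhom A a b) \<odot> vid A a) = run (vhom A a b)"
    using A o unfolding vcategory_def by blast+
  note u = cmp_unit[OF vid_in[OF A o(2)] vid_in[OF A o(1)] vcomp_in[OF A o(1,2,2)] vcomp_in[OF A o(1,1,2)] f]
  show "cmp A a b b (idn A b) f = f" "cmp A a a b f (idn A a) = f"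
    using u f by (simp_all add: eq app_lun app_run)
qed

lemma vcategoryI:
  assumes H: "\<And>a b. a \<in> vob A \<Longrightarrow> b \<in> vob A \<Longrightarrow> vhom A a b \<in> Ob V"
    and I: "\<And>a. a \<in> vob A \<Longrightarrow> vid A a \<in> ar \<I> (vhom A a a)"
    and C: "\<And>a b c. \<lbrakk>a \<in> vob A; b \<in> vob A; c \<in> vob A\<rbrakk> \<Longrightarrow>
        vcomp A a b c \<in> ar (vhom A b c \<otimes> vhom A a b) (vhom A a c)"
    and assoc: "\<And>a b c d f g h. \<lbrakk>a \<in> vob A; b \<in> vob A; c \<in> vob A; d \<in> vob A;
        h \<in> El (vhom A c d); g \<in> El (vhom A b c); f \<in> El (vhom A a b);
        disj h g; disj h f; disj g f\<rbrakk> \<Longrightarrow>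
        cmp A a b d (cmp A b c d h g) f = cmp A a c d h (cmp A a b c g f)"
    and idl: "\<And>a b f. \<lbrakk>a \<in> vob A; b \<in> vob A; f \<in> El (vhom A a b)\<rbrakk> \<Longrightarrow> cmp A a b b (idn A b) f = f"
    and idr: "\<And>a b f. \<lbrakk>a \<in> vob A; b \<in> vob A; f \<in> El (vhom A a b)\<rbrakk> \<Longrightarrow> cmp A a a b f (idn A a) = f"
  shows "vcategory V A"
  unfolding vcategory_def
proof (intro conjI ballI)
  fix a b c d assume o: "a \<in> vob A" "b \<in> vob A" "c \<in> vob A" "d \<in> vob A"
  note h = H[OF o(1,2)] H[OF o(2,3)] H[OF o(3,4)]
  show "vcomp A a b d \<cdot> (vcomp A b c d \<odot> \<one> (vhom A a b)) =
        vcomp A a c d \<cdot> (\<one> (vhom A c d) \<odot> vcomp A a b c) \<cdot>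
          assoc (vhom A c d) (vhom A b c) (vhom A a b)"
    by (rule ext3[OF comp_in[OF tens_in[OF C[OF o(2-4)] id_in[OF h(1)]] C[OF o(1,2,4)]]
       comp_in[OF assoc_in[OF h(3,2,1)] comp_in[OF tens_in[OF id_in[OF h(3)] C[OF o(1-3)]] C[OF o(1,3,4)]]] h(3,2,1)])
      (simp add: cmp_tens_l[OF C o _ _ _ _ _ _ h] assoc[OF o])
next
  fix a b assume o: "a \<in> vob A" "b \<in> vob A"
  note u = cmp_unit[OF I[OF o(2)] I[OF o(1)] C[OF o(1,2,2)] C[OF o(1,1,2)]]
  note i = id_in[OF H[OF o]]
  show "vcomp A a b b \<cdot> (vid A b \<odot> \<one> (vhom A a b)) = lun (vhom A a b)"
    by (rule ext_lun[OF comp_in[OF tens_in[OF I[OF o(2)] i] C[OF o(1,2,2)]] lun_in[OF H[OF o]] H[OF o]])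
      (simp add: u idl[OF o] app_lun)
  show "vcomp A a a b \<cdot> (\<one> (vhom A a b) \<odot> vid A a) = run (vhom A a b)"
    by (rule ext_run[OF comp_in[OF tens_in[OF i I[OF o(1)]] C[OF o(1,1,2)]] run_in[OF H[OF o]] H[OF o]])
      (simp add: u idr[OF o] app_run)
qed (use H I C in \<open>auto simp: ar_def\<close>)

lemma lin2_cmp: "\<lbrakk>vcategory V A; a \<in> vob A; b \<in> vob A; c \<in> vob A\<rbrakk> \<Longrightarrow>
    lin2 (vhom A b c) (vhom A a b) (vhom A a c) (cmp A a b c)"
  by (rule lin2I[OF _ _ vcomp_in]) (simp_all add: cmp_def)

subsection \<open>Opposite\<close>

lemma vop_simps [simp]: "vob (vop V A) = vob A" "vhom (vop V A) a b = vhom A b a" "idn (vop V A) a = idn A a"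
  by (simp_all add: vop_def idn_def)

lemma cmp_vop [simp]:
  assumes A: "vcategory V A" and o: "a \<in> vob A" "b \<in> vob A" "c \<in> vob A"
    and e: "g \<in> El (vhom A c b)" "f \<in> El (vhom A b a)" "disj g f"
  shows "cmp (vop V A) a b c g f = cmp A c b a f g"
  using app_comp[OF pair_in[OF e] symm_in[OF El_ob[OF e(1)] El_ob[OF e(2)]] vcomp_in[OF A o(3,2,1)]]
    app_symm[OF e] by (simp add: cmp_def vop_def)

lemma vcategory_vop [simp]:
  assumes A: "vcategory V A" shows "vcategory V (vop V A)"
proof (rule vcategoryI)
  fix a b c assume o: "a \<in> vob (vop V A)" "b \<in> vob (vop V A)" "c \<in> vob (vop V A)"
  then have o: "a \<in> vob A" "b \<in> vob A" "c \<in> vob A" by simp_all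
  show "vcomp (vop V A) a b c \<in> ar (vhom (vop V A) b c \<otimes> vhom (vop V A) a b) (vhom (vop V A) a c)"
    using comp_in[OF symm_in vcomp_in[OF A o(3,2,1)]] A o by (simp add: vop_def)
next
  fix a b c d f g h
  assume o: "a \<in> vob (vop V A)" "b \<in> vob (vop V A)" "c \<in> vob (vop V A)" "d \<in> vob (vop V A)"
    and e: "h \<in> El (vhom (vop V A) c d)" "g \<in> El (vhom (vop V A) b c)" "f \<in> El (vhom (vop V A) a b)"
      "disj h g" "disj h f" "disj g f"
  show "cmp (vop V A) a b d (cmp (vop V A) b c d h g) f = cmp (vop V A) a c d h (cmp (vop V A) a b c g f)"
    using A o e by (simp add: cmp_assoc disj_commute)
qed (use A vid_in[OF A] in \<open>simp_all add: vop_def[of V A, THEN arg_cong[of _ _ vid]]\<close>)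

subsection \<open>Functors\<close>

lemma fob_simps [simp]: "fob (fop F) = fob F" "far (fop F) a b = far F b a"
    "fob (fcomp V G F) a = fob G (fob F a)"
  by (simp_all add: fop_def fcomp_def)

lemma fob_in [simp]: "vfunctor V A B F \<Longrightarrow> a \<in> vob A \<Longrightarrow> fob F a \<in> vob B"
  by (simp add: vfunctor_def)

lemma far_Hom: "\<lbrakk>vfunctor V A B F; a \<in> vob A; b \<in> vob A\<rbrakk> \<Longrightarrow>
    far F a b \<in> Hom V (vhom A a b) (vhom B (fob F a) (fob F b))"
  by (simp add: vfunctor_def)

context
  fixes A :: "('a, 'o, 'm) vcat" and B :: "('b, 'o, 'm) vcat" and F :: "('a, 'b, 'm) vfun"
  assumes A: "vcategory V A" and B: "vcategory V B"
begin

lemma far_in: "\<lbrakk>vfunctor V A B F; a \<in> vob A; b \<in> vob A\<rbrakk> \<Longrightarrow>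
    far F a b \<in> ar (vhom A a b) (vhom B (fob F a) (fob F b))"
  using A B by (simp add: arI far_Hom)

lemma far_app_in: "\<lbrakk>vfunctor V A B F; a \<in> vob A; b \<in> vob A; f \<in> El (vhom A a b)\<rbrakk> \<Longrightarrow>
    app (far F a b) f \<in> El (vhom B (fob F a) (fob F b))"
  by (rule app_in[OF far_in])

lemma far_idn:
  assumes F: "vfunctor V A B F" and a: "a \<in> vob A"
  shows "app (far F a a) (idn A a) = idn B (fob F a)"
proof -
  have "far F a a \<cdot> vid A a = vid B (fob F a)" using F a by (simp add: vfunctor_def)
  then show ?thesis using app_comp[OF one_in vid_in[OF A a] far_in[OF F a a]] by (simp add: idn_def)
qed

lemma far_tens:
  assumes fa: "\<And>a b. a \<in> vob A \<Longrightarrow> b \<in> vob A \<Longrightarrow> far F a b \<in> ar (vhom A a b) (vhom B (fob F a) (fob F b))"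
    and fo: "\<And>a. a \<in> vob A \<Longrightarrow> fob F a \<in> vob B"
    and o: "a \<in> vob A" "b \<in> vob A" "c \<in> vob A"
    and e: "g \<in> El (vhom A b c)" "f \<in> El (vhom A a b)" "disj g f"
  shows "app (far F a c \<cdot> vcomp A a b c) (pair g f) = app (far F a c) (cmp A a b c g f)"
    and "app (vcomp B (fob F a) (fob F b) (fob F c) \<cdot> (far F b c \<odot> far F a b)) (pair g f) =
      cmp B (fob F a) (fob F b) (fob F c) (app (far F b c) g) (app (far F a b) f)"
  using app_comp[OF pair_in[OF e] vcomp_in[OF A o] fa[OF o(1,3)]]
    app_comp[OF pair_in[OF e] tens_in[OF fa[OF o(2,3)] fa[OF o(1,2)]] vcomp_in[OF B fo[OF o(1)] fo[OF o(2)] fo[OF o(3)]]]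
    app_tens[OF fa[OF o(2,3)] fa[OF o(1,2)] e]
  by (simp_all add: cmp_def)

lemma far_cmp:
  assumes F: "vfunctor V A B F"
    and o: "a \<in> vob A" "b \<in> vob A" "c \<in> vob A"
    and e: "g \<in> El (vhom A b c)" "f \<in> El (vhom A a b)" "disj g f"
  shows "app (far F a c) (cmp A a b c g f) =
      cmp B (fob F a) (fob F b) (fob F c) (app (far F b c) g) (app (far F a b) f)"
proof -
  have "far F a c \<cdot> vcomp A a b c = vcomp B (fob F a) (fob F b) (fob F c) \<cdot> (far F b c \<odot> far F a b)"
    using F o unfolding vfunctor_def by blast
  then show ?thesis using far_tens[OF far_in[OF F] fob_in[OF F] o e] by simp
qed

lemma vfunctorI:
  assumes fo: "\<And>a. a \<in> vob A \<Longrightarrow> fob F a \<in> vob B"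
    and fa: "\<And>a b. a \<in> vob A \<Longrightarrow> b \<in> vob A \<Longrightarrow> far F a b \<in> ar (vhom A a b) (vhom B (fob F a) (fob F b))"
    and fi: "\<And>a. a \<in> vob A \<Longrightarrow> app (far F a a) (idn A a) = idn B (fob F a)"
    and fc: "\<And>a b c g f. \<lbrakk>a \<in> vob A; b \<in> vob A; c \<in> vob A;
      g \<in> El (vhom A b c); f \<in> El (vhom A a b); disj g f; disj f g\<rbrakk> \<Longrightarrow>
      app (far F a c) (cmp A a b c g f) =
      cmp B (fob F a) (fob F b) (fob F c) (app (far F b c) g) (app (far F a b) f)"
  shows "vfunctor V A B F"
  unfolding vfunctor_def
proof (intro conjI ballI)
  fix a assume a: "a \<in> vob A"
  note t = comp_in[OF vid_in[OF A a] fa[OF a a]] vid_in[OF B fo[OF a]]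
  have "snd (app (far F a a \<cdot> vid A a) one) = snd (app (vid B (fob F a)) one)"
    using fi[OF a] app_comp[OF one_in vid_in[OF A a] fa[OF a a]] by (simp add: idn_def)
  then show "far F a a \<cdot> vid A a = vid B (fob F a)"
    using comp_id[OF t(1)] comp_id[OF t(2)] by (simp add: app_def one_def)
next
  fix a b c assume o: "a \<in> vob A" "b \<in> vob A" "c \<in> vob A"
  show "far F a c \<cdot> vcomp A a b c = vcomp B (fob F a) (fob F b) (fob F c) \<cdot> (far F b c \<odot> far F a b)"
    by (rule ext2[OF comp_in[OF vcomp_in[OF A o] fa[OF o(1,3)]]
       comp_in[OF tens_in[OF fa[OF o(2,3)] fa[OF o(1,2)]] vcomp_in[OF B fo[OF o(1)] fo[OF o(2)] fo[OF o(3)]]]])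
      (use A o in \<open>simp_all add: far_tens[OF fa fo o] fc[OF o]\<close>)
qed (use fo fa in \<open>auto simp: ar_def\<close>)

end

lemma far_fcomp:
  assumes "f \<in> El (vhom A a b)" "far F a b \<in> ar (vhom A a b) (vhom B (fob F a) (fob F b))"
    "far G (fob F a) (fob F b) \<in> ar (vhom B (fob F a) (fob F b)) Z"
  shows "app (far (fcomp V G F) a b) f = app (far G (fob F a) (fob F b)) (app (far F a b) f)"
  using app_comp[OF assms] by (simp add: fcomp_def)

lemma vfunctor_fcomp:
  assumes A: "vcategory V A" and B: "vcategory V B" and C: "vcategory V C"
    and F: "vfunctor V A B F" and G: "vfunctor V B C G"
  shows "vfunctor V A C (fcomp V G F)"
proof (rule vfunctorI[OF A C])
  fix a b assume o: "a \<in> vob A" "b \<in> vob A"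
  note t = far_in[OF A B F o] far_in[OF B C G fob_in[OF F o(1)] fob_in[OF F o(2)]]
  show "far (fcomp V G F) a b \<in> ar (vhom A a b) (vhom C (fob (fcomp V G F) a) (fob (fcomp V G F) b))"
    using comp_in[OF t] by (simp add: fcomp_def)
next
  fix a assume a: "a \<in> vob A"
  note t = far_in[OF A B F a a] far_in[OF B C G fob_in[OF F a] fob_in[OF F a]]
  show "app (far (fcomp V G F) a a) (idn A a) = idn C (fob (fcomp V G F) a)"
    using far_fcomp[OF idn_in[OF A a] t] far_idn[OF A B F a] far_idn[OF B C G fob_in[OF F a]] by simp
next
  fix a b c g f assume o: "a \<in> vob A" "b \<in> vob A" "c \<in> vob A"
    and e: "g \<in> El (vhom A b c)" "f \<in> El (vhom A a b)" "disj g f"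
  note tt = far_in[OF A B F] far_in[OF B C G fob_in[OF F] fob_in[OF F]]
  show "app (far (fcomp V G F) a c) (cmp A a b c g f) =
    cmp C (fob (fcomp V G F) a) (fob (fcomp V G F) b) (fob (fcomp V G F) c)
     (app (far (fcomp V G F) b c) g) (app (far (fcomp V G F) a b) f)"
    using A F o e far_fcomp[OF cmp_in[OF A o e] tt(1)[OF o(1,3)] tt(2)[OF o(1,3)]]
      far_fcomp[OF e(1) tt(1)[OF o(2,3)] tt(2)[OF o(2,3)]] far_fcomp[OF e(2) tt(1)[OF o(1,2)] tt(2)[OF o(1,2)]]
      far_cmp[OF A B F o e] far_app_in[OF A B F o(2,3) e(1)] far_app_in[OF A B F o(1,2) e(2)]
    by (simp add: far_cmp[OF B C G fob_in[OF F o(1)] fob_in[OF F o(2)] fob_in[OF F o(3)]])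
qed (use F G in simp)

lemma vfunctor_fop:
  assumes A: "vcategory V A" and B: "vcategory V B" and F: "vfunctor V A B F"
  shows "vfunctor V (vop V A) (vop V B) (fop F)"
proof (rule vfunctorI)
  fix a b c g f assume o: "a \<in> vob (vop V A)" "b \<in> vob (vop V A)" "c \<in> vob (vop V A)"
    and e: "g \<in> El (vhom (vop V A) b c)" "f \<in> El (vhom (vop V A) a b)" "disj g f" "disj f g"
  show "app (far (fop F) a c) (cmp (vop V A) a b c g f) =
       cmp (vop V B) (fob (fop F) a) (fob (fop F) b) (fob (fop F) c) (app (far (fop F) b c) g) (app (far (fop F) a b) f)"
    using A B F o e far_cmp[OF A B F, of c b a f g] far_app_in[OF A B F] by simp
qed (use A B F in \<open>simp_all add: far_in[OF A B F] far_idn[OF A B F]\<close>)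

subsection \<open>The base as an enriched category\<close>

lemma vself_simps [simp]: "vob (vself V) = Ob V" "vhom (vself V) = ihom"
  by (simp_all add: vself_def)

lemma vself_arrows:
  assumes o: "X \<in> Ob V" "Y \<in> Ob V" "Z \<in> Ob V"
  shows vcomp_vself_in: "vcomp (vself V) X Y Z \<in> ar (ihom Y Z \<otimes> ihom X Y) (ihom X Z)"
    and cmp_vself_in [simp]: "\<lbrakk>g \<in> El (ihom Y Z); f \<in> El (ihom X Y); disj g f\<rbrakk> \<Longrightarrow>
       cmp (vself V) X Y Z g f \<in> El (ihom X Z)"
    and ap_cmp_vself [simp]: "\<lbrakk>g \<in> El (ihom Y Z); f \<in> El (ihom X Y); x \<in> El X;
       disj g f; disj g x; disj f x\<rbrakk> \<Longrightarrow>
       ap X Z (cmp (vself V) X Y Z g f) x = ap Y Z g (ap X Y f x)"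
proof -
  let ?m = "ev Y Z \<cdot> (\<one> (ihom Y Z) \<odot> ev X Y) \<cdot> assoc (ihom Y Z) (ihom X Y) X"
  note a = assoc_in[OF ihom_ob[OF o(2,3)] ihom_ob[OF o(1,2)] o(1)]
  note b = tens_in[OF id_in[OF ihom_ob[OF o(2,3)]] ev_in[OF o(1,2)]]
  note c = ev_in[OF o(2,3)]
  note m = comp_in[OF a comp_in[OF b c]]
  have v: "vcomp (vself V) X Y Z = vcurry V (ihom Y Z \<otimes> ihom X Y) X Z ?m" by (simp add: vself_def)
  show "vcomp (vself V) X Y Z \<in> ar (ihom Y Z \<otimes> ihom X Y) (ihom X Z)"
    unfolding v by (rule vcurry_in[OF m]) (use o in simp_all)
  then show "\<lbrakk>g \<in> El (ihom Y Z); f \<in> El (ihom X Y); disj g f\<rbrakk> \<Longrightarrow>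
       cmp (vself V) X Y Z g f \<in> El (ihom X Z)"
    unfolding cmp_def by (rule app_in) simp
  assume e: "g \<in> El (ihom Y Z)" "f \<in> El (ihom X Y)" "x \<in> El X" and d: "disj g f" "disj g x" "disj f x"
  have p: "pair g f \<in> El (ihom Y Z \<otimes> ihom X Y)" "pair (pair g f) x \<in> El ((ihom Y Z \<otimes> ihom X Y) \<otimes> X)"
    "pair g (pair f x) \<in> El (ihom Y Z \<otimes> (ihom X Y \<otimes> X))" "pair f x \<in> El (ihom X Y \<otimes> X)"
    using e d by simp_all
  have "ap X Z (cmp (vself V) X Y Z g f) x = app ?m (pair (pair g f) x)"
    unfolding cmp_def v by (rule ap_vcurry[OF m p(1) e(3)]) (use d in simp)
  also have "\<dots> = ap Y Z g (ap X Y f x)"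
    using app_comp[OF p(2) a comp_in[OF b c]] app_assoc[OF e d] app_comp[OF p(3) b c]
      app_tens[OF id_in[OF ihom_ob[OF o(2,3)]] ev_in[OF o(1,2)] e(1) p(4)] app_id[OF e(1)] d
    by (simp add: ap_def)
  finally show "ap X Z (cmp (vself V) X Y Z g f) x = ap Y Z g (ap X Y f x)" .
qed

lemma vid_vself_in: "X \<in> Ob V \<Longrightarrow> vid (vself V) X \<in> ar \<I> (ihom X X)"
  by (simp add: vself_def vcurry_in)

lemma ap_idn_vself [simp]: "x \<in> El X \<Longrightarrow> ap X X (idn (vself V) X) x = x"
  using ap_vcurry[OF lun_in one_in] El_ob[of x X] by (simp add: vself_def idn_def app_lun)

lemma vcategory_vself [simp]: "vcategory V (vself V)"
proof (rule vcategoryI)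
  fix a b c d f g h
  assume o: "a \<in> vob (vself V)" "b \<in> vob (vself V)" "c \<in> vob (vself V)" "d \<in> vob (vself V)"
    and e: "h \<in> El (vhom (vself V) c d)" "g \<in> El (vhom (vself V) b c)" "f \<in> El (vhom (vself V) a b)"
      "disj h g" "disj h f" "disj g f"
  show "cmp (vself V) a b d (cmp (vself V) b c d h g) f = cmp (vself V) a c d h (cmp (vself V) a b c g f)"
    by (rule ext_ihom[of _ a d]) (use o e in \<open>simp_all add: join_ac\<close>)
next
  fix a b f assume o: "a \<in> vob (vself V)" "b \<in> vob (vself V)" and f: "f \<in> El (vhom (vself V) a b)"
  have i: "idn (vself V) a \<in> El (ihom a a)" "idn (vself V) b \<in> El (ihom b b)"
    using o app_in[OF vid_vself_in one_in] by (simp_all add: idn_def)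
  show "cmp (vself V) a b b (idn (vself V) b) f = f"
    by (rule ext_ihom[of _ a b]) (use o f i in simp_all)
  show "cmp (vself V) a a b f (idn (vself V) a) = f"
    by (rule ext_ihom[of _ a b]) (use o f i in simp_all)
qed (simp_all add: vcomp_vself_in vid_vself_in)

text \<open>
  The data of a functor \<open>A \<rightarrow> V\<close> without functoriality, which is all that wedges and ends depend on.
\<close>

definition vgraph where
  "vgraph A F \<longleftrightarrow> (\<forall>a\<in>vob A. fob F a \<in> Ob V) \<and>
     (\<forall>a\<in>vob A. \<forall>b\<in>vob A. far F a b \<in> ar (vhom A a b) (ihom (fob F a) (fob F b)))"

lemma vgraph_fob [simp]: "vgraph A F \<Longrightarrow> a \<in> vob A \<Longrightarrow> fob F a \<in> Ob V"
  and vgraph_far: "\<lbrakk>vgraph A F; a \<in> vob A; b \<in> vob A\<rbrakk> \<Longrightarrow> far F a b \<in> ar (vhom A a b) (ihom (fob F a) (fob F b))"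
  by (simp_all add: vgraph_def)

lemma vgraph_far_app [simp]: "\<lbrakk>vgraph A F; a \<in> vob A; b \<in> vob A; f \<in> El (vhom A a b)\<rbrakk> \<Longrightarrow>
    app (far F a b) f \<in> El (ihom (fob F a) (fob F b))"
  by (rule app_in[OF vgraph_far])

lemma act_in [simp]: "\<lbrakk>vgraph A F; a \<in> vob A; b \<in> vob A; f \<in> El (vhom A a b);
    x \<in> El (fob F a); disj f x\<rbrakk> \<Longrightarrow> act F a b f x \<in> El (fob F b)"
  unfolding act_def by (rule ap_in) simp_all

lemma lin2_act: "\<lbrakk>vgraph A F; a \<in> vob A; b \<in> vob A\<rbrakk> \<Longrightarrow>
    lin2 (vhom A a b) (fob F a) (fob F b) (act F a b)"
  unfolding act_def by (rule lin2_pre1[OF lin1_app lin2_ap]) (simp_all add: vgraph_far)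

lemma vfunctor_vgraph: "vcategory V A \<Longrightarrow> vfunctor V A (vself V) F \<Longrightarrow> vgraph A F"
  using far_in[OF _ vcategory_vself] fob_in[of A "vself V" F] unfolding vgraph_def by fastforce

lemma act_idn:
  assumes A: "vcategory V A" and F: "vfunctor V A (vself V) F" and a: "a \<in> vob A" and x: "x \<in> El (fob F a)"
  shows "act F a a (idn A a) x = x"
  using far_idn[OF A vcategory_vself F a] x by (simp add: act_def)

lemma act_cmp:
  assumes A: "vcategory V A" and F: "vfunctor V A (vself V) F"
    and o: "a \<in> vob A" "b \<in> vob A" "c \<in> vob A"
    and e: "g \<in> El (vhom A b c)" "f \<in> El (vhom A a b)" "x \<in> El (fob F a)" "disj g f" "disj g x" "disj f x"
  shows "act F a c (cmp A a b c g f) x = act F b c g (act F a b f x)"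
proof -
  note G = vfunctor_vgraph[OF A F]
  show ?thesis using far_cmp[OF A vcategory_vself F o e(1,2,4)] e o G by (simp add: act_def)
qed

lemma vfunctor_vselfI:
  assumes A: "vcategory V A" and G: "vgraph A F"
    and i: "\<And>a x. a \<in> vob A \<Longrightarrow> x \<in> El (fob F a) \<Longrightarrow> act F a a (idn A a) x = x"
    and c: "\<And>a b c f g x. \<lbrakk>a \<in> vob A; b \<in> vob A; c \<in> vob A;
      g \<in> El (vhom A b c); f \<in> El (vhom A a b); x \<in> El (fob F a); disj g f; disj f g;
      disj g x; disj x g; disj f x; disj x f\<rbrakk> \<Longrightarrow>
      act F a c (cmp A a b c g f) x = act F b c g (act F a b f x)"
  shows "vfunctor V A (vself V) F"
proof (rule vfunctorI[OF A vcategory_vself])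
  fix a assume a: "a \<in> vob A"
  show "app (far F a a) (idn A a) = idn (vself V) (fob F a)"
    by (rule ext_ihom[of _ "fob F a" "fob F a"])
      (use a G A i[OF a] in \<open>simp_all add: act_def idn_in[of "vself V", simplified]\<close>)
next
  fix a b d g f assume o: "a \<in> vob A" "b \<in> vob A" "d \<in> vob A"
    and e: "g \<in> El (vhom A b d)" "f \<in> El (vhom A a b)" "disj g f" "disj f g"
  show "app (far F a d) (cmp A a b d g f) =
       cmp (vself V) (fob F a) (fob F b) (fob F d) (app (far F b d) g) (app (far F a b) f)"
    by (rule ext_ihom[of _ "fob F a" "fob F d"])
      (use o e G A c[OF o e(1,2)] in \<open>simp_all add: act_def\<close>)
qed (use G in \<open>simp_all add: vgraph_far\<close>)

subsection \<open>Representables\<close>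

lemma homfun_fob [simp]: "fob (homfun V K X) = vhom K X"
  by (simp add: homfun_def)

lemma vgraph_homfun [simp]: "vcategory V K \<Longrightarrow> X \<in> vob K \<Longrightarrow> vgraph K (homfun V K X)"
  by (simp add: vgraph_def homfun_def vcurry_in vcomp_in)

lemma act_homfun [simp]:
  assumes K: "vcategory V K" and o: "X \<in> vob K" "a \<in> vob K" "b \<in> vob K"
    and e: "f \<in> El (vhom K a b)" "g \<in> El (vhom K X a)" "disj f g"
  shows "act (homfun V K X) a b f g = cmp K X a b f g"
  using ap_vcurry[OF vcomp_in[OF K o] e] by (simp add: act_def homfun_def cmp_def)

lemma vfunctor_homfun [simp]:
  assumes K: "vcategory V K" and X: "X \<in> vob K"
  shows "vfunctor V K (vself V) (homfun V K X)"
  by (rule vfunctor_vselfI) (use K X in \<open>simp_all add: cmp_assoc\<close>)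

lemma act_fcomp:
  assumes A: "vcategory V A" and B: "vcategory V B" and F: "vfunctor V A B F" and G: "vgraph B G"
    and o: "a \<in> vob A" "b \<in> vob A" and e: "f \<in> El (vhom A a b)"
  shows "act (fcomp V G F) a b f x = act G (fob F a) (fob F b) (app (far F a b) f) x"
  using far_fcomp[OF e far_in[OF A B F o] vgraph_far[OF G]] F o by (simp add: act_def)

lemma vgraph_fcomp:
  assumes A: "vcategory V A" and B: "vcategory V B" and F: "vfunctor V A B F" and G: "vgraph B G"
  shows "vgraph A (fcomp V G F)"
  unfolding vgraph_def
proof (intro conjI ballI)
  fix a b assume o: "a \<in> vob A" "b \<in> vob A"
  show "far (fcomp V G F) a b \<in> ar (vhom A a b) (ihom (fob (fcomp V G F) a) (fob (fcomp V G F) b))"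
    using comp_in[OF far_in[OF A B F o] vgraph_far[OF G]] F o by (simp add: fcomp_def)
qed (use F G in simp)

subsection \<open>Wedges and natural transformations\<close>

text \<open>
  The two arrows \<open>N \<otimes> A(a,b) \<rightarrow> [Fa,Gb]\<close> of a wedge and their values. Evaluated at an element of
  \<open>Fa\<close> as well, they say that a wedge is a natural transformation with a parameter in \<open>N\<close>
  (\<open>wedgeI\<close>, \<open>wedge_nat\<close>).
\<close>

lemma wedge_arrows:
  assumes F: "vgraph A F" and G: "vgraph A G" and N: "N \<in> Ob V"
    and p': "\<forall>a\<in>vob A. \<pi> a \<in> ar N (ihom (fob F a) (fob G a))"
    and o: "a \<in> vob A" "b \<in> vob A"
  shows "vcomp (vself V) (fob F a) (fob F b) (fob G b) \<cdot> (\<pi> b \<odot> far F a b) \<in> ar (N \<otimes> vhom A a b) (ihom (fob F a) (fob G b))"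
    and "vcomp (vself V) (fob F a) (fob G a) (fob G b) \<cdot> (far G a b \<odot> \<pi> a) \<cdot> symm N (vhom A a b) \<in> ar (N \<otimes> vhom A a b) (ihom (fob F a) (fob G b))"
    and "\<lbrakk>n \<in> El N; f \<in> El (vhom A a b); disj n f\<rbrakk> \<Longrightarrow>
      app (vcomp (vself V) (fob F a) (fob F b) (fob G b) \<cdot> (\<pi> b \<odot> far F a b)) (pair n f) =
      cmp (vself V) (fob F a) (fob F b) (fob G b) (app (\<pi> b) n) (app (far F a b) f)"
    and "\<lbrakk>n \<in> El N; f \<in> El (vhom A a b); disj n f\<rbrakk> \<Longrightarrow>
      app (vcomp (vself V) (fob F a) (fob G a) (fob G b) \<cdot> (far G a b \<odot> \<pi> a) \<cdot> symm N (vhom A a b)) (pair n f) =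
      cmp (vself V) (fob F a) (fob G a) (fob G b) (app (far G a b) f) (app (\<pi> a) n)"
proof -
  note p = p'[rule_format]
  have ob: "fob F a \<in> Ob V" "fob F b \<in> Ob V" "fob G a \<in> Ob V" "fob G b \<in> Ob V" using F G o by simp_all
  note h = ar_dom[OF vgraph_far[OF F o]]
  note c1 = vcomp_vself_in[OF ob(1,2,4)] and c2 = vcomp_vself_in[OF ob(1,3,4)]
  note t1 = tens_in[OF p[OF o(2)] vgraph_far[OF F o]] and t2 = tens_in[OF vgraph_far[OF G o] p[OF o(1)]]
  note s = symm_in[OF N h]
  show "vcomp (vself V) (fob F a) (fob F b) (fob G b) \<cdot> (\<pi> b \<odot> far F a b) \<in> ar (N \<otimes> vhom A a b) (ihom (fob F a) (fob G b))"
    by (rule comp_in[OF t1 c1])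
  show "vcomp (vself V) (fob F a) (fob G a) (fob G b) \<cdot> (far G a b \<odot> \<pi> a) \<cdot> symm N (vhom A a b) \<in> ar (N \<otimes> vhom A a b) (ihom (fob F a) (fob G b))"
    by (rule comp_in[OF s comp_in[OF t2 c2]])
  assume e: "n \<in> El N" "f \<in> El (vhom A a b)" "disj n f"
  then have e': "disj f n" by (simp add: disj_commute)
  show "app (vcomp (vself V) (fob F a) (fob F b) (fob G b) \<cdot> (\<pi> b \<odot> far F a b)) (pair n f) =
      cmp (vself V) (fob F a) (fob F b) (fob G b) (app (\<pi> b) n) (app (far F a b) f)"
    using app_comp[OF pair_in[OF e] t1 c1] app_tens[OF p[OF o(2)] vgraph_far[OF F o] e] by (simp add: cmp_def)
  show "app (vcomp (vself V) (fob F a) (fob G a) (fob G b) \<cdot> (far G a b \<odot> \<pi> a) \<cdot> symm N (vhom A a b)) (pair n f) =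
      cmp (vself V) (fob F a) (fob G a) (fob G b) (app (far G a b) f) (app (\<pi> a) n)"
    using app_comp[OF pair_in[OF e] s comp_in[OF t2 c2]] app_comp[OF pair_in[OF e(2,1) e'] t2 c2]
      app_symm[OF e] app_tens[OF vgraph_far[OF G o] p[OF o(1)] e(2,1) e'] by (simp add: cmp_def)
qed

lemma wedgeI:
  assumes F: "vgraph A F" and G: "vgraph A G" and N: "N \<in> Ob V"
    and p: "\<And>a. a \<in> vob A \<Longrightarrow> \<pi> a \<in> ar N (ihom (fob F a) (fob G a))"
    and eq: "\<And>a b n f x. \<lbrakk>a \<in> vob A; b \<in> vob A; n \<in> El N; f \<in> El (vhom A a b); x \<in> El (fob F a);
      disj n f; disj f n; disj n x; disj x n; disj f x; disj x f\<rbrakk> \<Longrightarrow>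
      ap (fob F b) (fob G b) (app (\<pi> b) n) (act F a b f x) =
      act G a b f (ap (fob F a) (fob G a) (app (\<pi> a) n) x)"
  shows "wedge V A F G N \<pi>"
  unfolding wedge_def
proof (intro conjI ballI)
  fix a b assume o: "a \<in> vob A" "b \<in> vob A"
  have p': "\<forall>a\<in>vob A. \<pi> a \<in> ar N (ihom (fob F a) (fob G a))" using p by blast
  note w = wedge_arrows[OF F G N p' o]
  show "vcomp (vself V) (fob F a) (fob F b) (fob G b) \<cdot> (\<pi> b \<odot> far F a b) =
        vcomp (vself V) (fob F a) (fob G a) (fob G b) \<cdot> (far G a b \<odot> \<pi> a) \<cdot> symm N (vhom A a b)"
  proof (rule ext2[OF w(1,2) N ar_dom[OF vgraph_far[OF F o]]])
    fix n f assume e: "n \<in> El N" "f \<in> El (vhom A a b)" "disj n f" "disj f n"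
    have m: "app (\<pi> a) n \<in> El (ihom (fob F a) (fob G a))" "app (\<pi> b) n \<in> El (ihom (fob F b) (fob G b))"
      using app_in[OF p e(1)] o by blast+
    show "app (vcomp (vself V) (fob F a) (fob F b) (fob G b) \<cdot> (\<pi> b \<odot> far F a b)) (pair n f) =
      app (vcomp (vself V) (fob F a) (fob G a) (fob G b) \<cdot> (far G a b \<odot> \<pi> a) \<cdot> symm N (vhom A a b)) (pair n f)"
      unfolding w(3)[OF e(1-3)] w(4)[OF e(1-3)]
    proof (rule ext_ihom[of _ "fob F a" "fob G b"])
      fix x assume x: "x \<in> El (fob F a)"
        "disj (cmp (vself V) (fob F a) (fob F b) (fob G b) (app (\<pi> b) n) (app (far F a b) f)) x"
        "disj x (cmp (vself V) (fob F a) (fob F b) (fob G b) (app (\<pi> b) n) (app (far F a b) f))"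
      show "ap (fob F a) (fob G b) (cmp (vself V) (fob F a) (fob F b) (fob G b) (app (\<pi> b) n) (app (far F a b) f)) x =
         ap (fob F a) (fob G b) (cmp (vself V) (fob F a) (fob G a) (fob G b) (app (far G a b) f) (app (\<pi> a) n)) x"
        using eq[OF o e(1,2) x(1)] x e o F G m by (simp add: act_def)
    qed (use F G o e m in \<open>simp_all add: join_ac\<close>)
  qed
qed (use N p in \<open>auto simp: ar_def\<close>)

lemma wedge_ob: "wedge V A F G N \<pi> \<Longrightarrow> N \<in> Ob V"
  by (simp add: wedge_def)

lemma wedge_in:
  assumes "vgraph A F" "vgraph A G" "wedge V A F G N \<pi>" "a \<in> vob A"
  shows "\<pi> a \<in> ar N (ihom (fob F a) (fob G a))"
  using assms by (simp add: wedge_def ar_def)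

lemma wedge_nat:
  assumes F: "vgraph A F" and G: "vgraph A G" and W: "wedge V A F G N \<pi>"
    and o: "a \<in> vob A" "b \<in> vob A" and e: "n \<in> El N" "f \<in> El (vhom A a b)" "x \<in> El (fob F a)"
    and d: "disj n f" "disj n x" "disj f x"
  shows "ap (fob F b) (fob G b) (app (\<pi> b) n) (act F a b f x) =
      act G a b f (ap (fob F a) (fob G a) (app (\<pi> a) n) x)"
proof -
  note p = wedge_in[OF F G W]
  have p': "\<forall>a\<in>vob A. \<pi> a \<in> ar N (ihom (fob F a) (fob G a))" using p by blast
  note w = wedge_arrows[OF F G wedge_ob[OF W] p' o]
  have "vcomp (vself V) (fob F a) (fob F b) (fob G b) \<cdot> (\<pi> b \<odot> far F a b) =
        vcomp (vself V) (fob F a) (fob G a) (fob G b) \<cdot> (far G a b \<odot> \<pi> a) \<cdot> symm N (vhom A a b)"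
    using W o unfolding wedge_def by blast
  then have "cmp (vself V) (fob F a) (fob F b) (fob G b) (app (\<pi> b) n) (app (far F a b) f) =
    cmp (vself V) (fob F a) (fob G a) (fob G b) (app (far G a b) f) (app (\<pi> a) n)" (is "?l = ?r")
    using w(3,4)[OF e(1,2) d(1)] by simp
  then have "ap (fob F a) (fob G b) ?l x = ap (fob F a) (fob G b) ?r x" by simp
  then show ?thesis
    using F G o e d app_in[OF p[OF o(1)] e(1)] app_in[OF p[OF o(2)] e(1)]
    by (simp add: act_def disj_commute)
qed

lemma vnat_arrows:
  assumes F: "vgraph A F" and G: "vgraph A G"
    and p': "\<forall>a\<in>vob A. \<alpha> a \<in> ar (fob F a) (fob G a)" and o: "a \<in> vob A" "b \<in> vob A"
  shows "\<alpha> b \<cdot> vuncurry V (fob F a) (fob F b) (far F a b) \<in> ar (vhom A a b \<otimes> fob F a) (fob G b)"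
    "vuncurry V (fob G a) (fob G b) (far G a b) \<cdot> (\<one> (vhom A a b) \<odot> \<alpha> a) \<in> ar (vhom A a b \<otimes> fob F a) (fob G b)"
    "\<lbrakk>f \<in> El (vhom A a b); x \<in> El (fob F a); disj f x\<rbrakk> \<Longrightarrow>
      app (\<alpha> b \<cdot> vuncurry V (fob F a) (fob F b) (far F a b)) (pair f x) = app (\<alpha> b) (act F a b f x)"
    "\<lbrakk>f \<in> El (vhom A a b); x \<in> El (fob F a); disj f x\<rbrakk> \<Longrightarrow>
      app (vuncurry V (fob G a) (fob G b) (far G a b) \<cdot> (\<one> (vhom A a b) \<odot> \<alpha> a)) (pair f x) = act G a b f (app (\<alpha> a) x)"
proof -
  note p = p'[rule_format]
  have ob: "fob F a \<in> Ob V" "fob F b \<in> Ob V" "fob G a \<in> Ob V" "fob G b \<in> Ob V" using F G o by simp_all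
  note u = vuncurry_in[OF vgraph_far[OF F o] ob(1,2)] vuncurry_in[OF vgraph_far[OF G o] ob(3,4)]
  note i = id_in[OF ar_dom[OF vgraph_far[OF F o]]]
  note t = tens_in[OF i p[OF o(1)]]
  show "\<alpha> b \<cdot> vuncurry V (fob F a) (fob F b) (far F a b) \<in> ar (vhom A a b \<otimes> fob F a) (fob G b)"
    by (rule comp_in[OF u(1) p[OF o(2)]])
  show "vuncurry V (fob G a) (fob G b) (far G a b) \<cdot> (\<one> (vhom A a b) \<odot> \<alpha> a) \<in> ar (vhom A a b \<otimes> fob F a) (fob G b)"
    by (rule comp_in[OF t u(2)])
  assume e: "f \<in> El (vhom A a b)" "x \<in> El (fob F a)" "disj f x"
  show "app (\<alpha> b \<cdot> vuncurry V (fob F a) (fob F b) (far F a b)) (pair f x) = app (\<alpha> b) (act F a b f x)"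
    using app_comp[OF pair_in[OF e] u(1) p[OF o(2)]] app_vuncurry[OF vgraph_far[OF F o] ob(1,2) e] by (simp add: act_def)
  show "app (vuncurry V (fob G a) (fob G b) (far G a b) \<cdot> (\<one> (vhom A a b) \<odot> \<alpha> a)) (pair f x) = act G a b f (app (\<alpha> a) x)"
    using app_comp[OF pair_in[OF e] t u(2)] app_tens[OF i p[OF o(1)] e] app_id[OF e(1)]
      app_vuncurry[OF vgraph_far[OF G o] ob(3,4) e(1) app_in[OF p[OF o(1)] e(2)]] e(3) by (simp add: act_def)
qed

lemma vnatI:
  assumes F: "vgraph A F" and G: "vgraph A G"
    and p: "\<And>a. a \<in> vob A \<Longrightarrow> \<alpha> a \<in> ar (fob F a) (fob G a)"
    and eq: "\<And>a b f x. \<lbrakk>a \<in> vob A; b \<in> vob A; f \<in> El (vhom A a b); x \<in> El (fob F a); disj f x;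
      disj x f\<rbrakk> \<Longrightarrow> app (\<alpha> b) (act F a b f x) = act G a b f (app (\<alpha> a) x)"
  shows "vnat V A F G \<alpha>"
  unfolding vnat_def
proof (intro conjI ballI)
  fix a b assume o: "a \<in> vob A" "b \<in> vob A"
  have p': "\<forall>a\<in>vob A. \<alpha> a \<in> ar (fob F a) (fob G a)" using p by blast
  note w = vnat_arrows[OF F G p' o]
  show "\<alpha> b \<cdot> vuncurry V (fob F a) (fob F b) (far F a b) =
     vuncurry V (fob G a) (fob G b) (far G a b) \<cdot> (\<one> (vhom A a b) \<odot> \<alpha> a)"
    by (rule ext2[OF w(1,2)]) (use F o ar_dom[OF vgraph_far[OF F o]] in \<open>simp_all add: w(3,4) eq[OF o]\<close>)
qed (use p in \<open>auto simp: ar_def\<close>)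

lemma vnat_in:
  assumes "vgraph A F" "vgraph A G" "vnat V A F G \<alpha>" "a \<in> vob A"
  shows "\<alpha> a \<in> ar (fob F a) (fob G a)"
  using assms by (simp add: vnat_def ar_def)

lemma vnat_nat:
  assumes F: "vgraph A F" and G: "vgraph A G" and N: "vnat V A F G \<alpha>"
    and o: "a \<in> vob A" "b \<in> vob A" and e: "f \<in> El (vhom A a b)" "x \<in> El (fob F a)" "disj f x"
  shows "app (\<alpha> b) (act F a b f x) = act G a b f (app (\<alpha> a) x)"
proof -
  have p': "\<forall>a\<in>vob A. \<alpha> a \<in> ar (fob F a) (fob G a)" using vnat_in[OF F G N] by blast
  note w = vnat_arrows[OF F G p' o]
  have "\<alpha> b \<cdot> vuncurry V (fob F a) (fob F b) (far F a b) =
     vuncurry V (fob G a) (fob G b) (far G a b) \<cdot> (\<one> (vhom A a b) \<odot> \<alpha> a)"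
    using N o unfolding vnat_def by blast
  then show ?thesis using w(3,4)[OF e] by simp
qed

end

section \<open>Limits of parallel pairs\<close>

lemma finite_of_lepoll: "A \<lesssim> B \<Longrightarrow> finite B \<Longrightarrow> finite A"
  unfolding lepoll_def using inj_on_finite by blast

text \<open>
  The larger of two sets, if infinite, is equipollent to its square.
\<close>

lemma lesspoll_Times:
  fixes A :: "'a set" and B :: "'b set"
  assumes U: "infinite (UNIV :: 'u set)" and A: "A \<prec> (UNIV :: 'u set)" and B: "B \<prec> (UNIV :: 'u set)"
  shows "A \<times> B \<prec> (UNIV :: 'u set)"
proof (cases "finite A \<and> finite B")
  case True
  then show ?thesis using U by (simp add: finite_lesspoll_infinite)
next
  case False
  have sq: "C \<times> C \<approx> C" if "infinite C" for C :: "'x set"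
    using card_of_Times_same_infinite[OF that] by (simp add: eqpoll_iff_card_of_ordIso)
  have tot: "A \<lesssim> B \<or> B \<lesssim> A"
    unfolding lepoll_def card_of_ordLeq by (rule ordLeq_total) (rule card_of_Well_order)+
  show ?thesis
  proof (cases "A \<lesssim> B")
    case True
    then have "infinite B" using False finite_of_lepoll by blast
    have "A \<times> B \<lesssim> B \<times> B" using True by (intro times_lepoll_mono lepoll_refl)
    then have "A \<times> B \<lesssim> B" using lepoll_trans2 sq[OF \<open>infinite B\<close>] by blast
    then show ?thesis using B lesspoll_trans1 by blast
  next
    case F: False
    then have l: "B \<lesssim> A" using tot by blast
    then have "infinite A" using False finite_of_lepoll by blast
    have "A \<times> B \<lesssim> A \<times> A" using l by (intro times_lepoll_mono lepoll_refl)
    then have "A \<times> B \<lesssim> A" using lepoll_trans2 sq[OF \<open>infinite A\<close>] by blast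
    then show ?thesis using A lesspoll_trans1 by blast
  qed
qed

definition opcat :: "('o, 'm, 'z) cat_scheme \<Rightarrow> ('o, 'm) cat" where
  "opcat C = \<lparr>Ob = Ob C, Hom = (\<lambda>x y. Hom C y x), Comp = (\<lambda>g f. Comp C f g), Id = Id C\<rparr>"

lemma opcat_simps [simp]:
  "Ob (opcat C) = Ob C" "Hom (opcat C) x y = Hom C y x" "Comp (opcat C) g f = Comp C f g" "Id (opcat C) = Id C"
  by (simp_all add: opcat_def)

lemma category_opcat: "category C \<Longrightarrow> category (opcat C)"
  by (simp add: category_def)

lemma cocomplete_opcat:
  assumes "cocomplete TYPE('u) C" shows "complete TYPE('u) (opcat C)"
  unfolding complete_def
proof (intro allI impI)
  fix J :: "('u, 'u) cat" and F0 F1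
  assume J: "small_category J" and D: "diagram J (opcat C) F0 F1"
  have J': "small_category (opcat J)"
  proof -
    have "(\<Union>i\<in>Ob (opcat J). \<Union>j\<in>Ob (opcat J). Hom (opcat J) i j) = (\<Union>i\<in>Ob J. \<Union>j\<in>Ob J. Hom J i j)"
      by auto
    then show ?thesis using J category_opcat[of J] unfolding small_category_def by simp
  qed
  have D': "diagram (opcat J) C F0 F1" using D by (simp add: diagram_def)
  have c: "cocone (opcat J) C F0 F1 L p \<longleftrightarrow> cone J (opcat C) F0 F1 L p" for L p
    by (auto simp: cone_def cocone_def)
  have "\<exists>L p. cocone (opcat J) C F0 F1 L p \<and>
     (\<forall>X q. cocone (opcat J) C F0 F1 X q \<longrightarrow>
        (\<exists>!k. k \<in> Hom C L X \<and> (\<forall>i\<in>Ob (opcat J). Comp C k (p i) = q i)))"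
    using assms J' D' unfolding cocomplete_def by blast
  then show "\<exists>L p. cone J (opcat C) F0 F1 L p \<and>
     (\<forall>X q. cone J (opcat C) F0 F1 X q \<longrightarrow>
        (\<exists>!k. k \<in> Hom (opcat C) X L \<and> (\<forall>i\<in>Ob J. Comp (opcat C) (p i) k = q i)))"
    by (simp only: c opcat_simps)
qed

text \<open>
  Completeness refers to shapes whose objects and arrows are elements of \<open>'u\<close>; a shape of any other
  types is carried over along injections of its sets of objects and arrows into \<open>'u\<close>.
\<close>

lemma complete_transport:
  fixes J :: "('x, 'y) cat" and C :: "('o, 'm, 'z) cat_scheme"
  assumes C: "complete TYPE('u) C" and J: "category J" and D: "diagram J C F0 F1"
    and so: "Ob J \<prec> (UNIV :: 'u set)" and sm: "(\<Union>i\<in>Ob J. \<Union>j\<in>Ob J. Hom J i j) \<prec> (UNIV :: 'u set)"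
  shows "\<exists>L p. cone J C F0 F1 L p \<and>
     (\<forall>X q. cone J C F0 F1 X q \<longrightarrow> (\<exists>!k. k \<in> Hom C X L \<and> (\<forall>i\<in>Ob J. Comp C (p i) k = q i)))"
proof -
  let ?M = "\<Union>i\<in>Ob J. \<Union>j\<in>Ob J. Hom J i j"
  obtain e :: "'x \<Rightarrow> 'u" where e: "inj_on e (Ob J)" using so by (auto simp: lesspoll_def lepoll_def)
  obtain m :: "'y \<Rightarrow> 'u" where m: "inj_on m ?M" using sm by (auto simp: lesspoll_def lepoll_def)
  define e' where "e' = inv_into (Ob J) e"
  define m' where "m' = inv_into ?M m"
  have e' [simp]: "e' (e x) = x" if "x \<in> Ob J" for x using e that by (simp add: e'_def)
  have m' [simp]: "m' (m u) = u" if "x \<in> Ob J" "y \<in> Ob J" "u \<in> Hom J x y" for x y u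
    unfolding m'_def by (rule inv_into_f_f[OF m]) (use that in blast)
  define J' :: "('u, 'u) cat" where
    "J' = \<lparr>Ob = e ` Ob J, Hom = (\<lambda>i j. m ` Hom J (e' i) (e' j)),
       Comp = (\<lambda>g f. m (Comp J (m' g) (m' f))), Id = (\<lambda>i. m (Id J (e' i)))\<rparr>"
  have J'_simps: "Ob J' = e ` Ob J" "\<And>i j. Hom J' i j = m ` Hom J (e' i) (e' j)"
    "\<And>g f. Comp J' g f = m (Comp J (m' g) (m' f))" "\<And>i. Id J' i = m (Id J (e' i))"
    by (simp_all add: J'_def)
  have Jid: "Id J x \<in> Hom J x x" if "x \<in> Ob J" for x using J that by (simp add: category_def)
  have Jc: "Comp J g f \<in> Hom J x z" if "x \<in> Ob J" "y \<in> Ob J" "z \<in> Ob J" "f \<in> Hom J x y" "g \<in> Hom J y z" for x y z f g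
    using J that unfolding category_def by blast
  have cJ': "category J'"
    unfolding category_def J'_simps
  proof (intro conjI ballI; (elim imageE)?; hypsubst?)
    fix x assume "x \<in> Ob J" then show "m (Id J (e' (e x))) \<in> m ` Hom J (e' (e x)) (e' (e x))"
      by (simp add: Jid)
  next
    fix x y z f g assume o: "x \<in> Ob J" "y \<in> Ob J" "z \<in> Ob J"
      and "f \<in> Hom J (e' (e x)) (e' (e y))" "g \<in> Hom J (e' (e y)) (e' (e z))"
    then have h: "f \<in> Hom J x y" "g \<in> Hom J y z" by simp_all
    show "m (Comp J (m' (m g)) (m' (m f))) \<in> m ` Hom J (e' (e x)) (e' (e z))"
      using Jc[OF o h] o h by simp
  next
    fix x y f assume o: "x \<in> Ob J" "y \<in> Ob J" and "f \<in> Hom J (e' (e x)) (e' (e y))"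
    then have h: "f \<in> Hom J x y" by simp
    then have "Comp J f (Id J x) = f" "Comp J (Id J y) f = f" using J o by (simp_all add: category_def)
    then show "m (Comp J (m' (m f)) (m' (m (Id J (e' (e x)))))) = m f"
      "m (Comp J (m' (m (Id J (e' (e y))))) (m' (m f))) = m f"
      using o h Jid by simp_all
  next
    fix w x y z f g h assume o: "w \<in> Ob J" "x \<in> Ob J" "y \<in> Ob J" "z \<in> Ob J"
      and "f \<in> Hom J (e' (e w)) (e' (e x))" "g \<in> Hom J (e' (e x)) (e' (e y))" "h \<in> Hom J (e' (e y)) (e' (e z))"
    then have a: "f \<in> Hom J w x" "g \<in> Hom J x y" "h \<in> Hom J y z" by simp_all
    have "Comp J h (Comp J g f) = Comp J (Comp J h g) f" using J o a unfolding category_def by blast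
    then show "m (Comp J (m' (m h)) (m' (m (Comp J (m' (m g)) (m' (m f)))))) =
      m (Comp J (m' (m (Comp J (m' (m h)) (m' (m g))))) (m' (m f)))"
      using Jc[OF o(1,2,3) a(1,2)] Jc[OF o(2,3,4) a(2,3)] o a by simp
  qed
  have MM: "(\<Union>i\<in>Ob J'. \<Union>j\<in>Ob J'. Hom J' i j) = m ` ?M"
    unfolding J'_simps by (auto simp: image_UN)
  have "small (e ` Ob J)" "small (m ` ?M)"
    unfolding small_def by (rule lesspoll_trans1[OF image_lepoll so] lesspoll_trans1[OF image_lepoll sm])+
  then have sJ': "small_category J'"
    unfolding small_category_def MM using cJ' by (simp only: J'_simps simp_thms)
  have D': "diagram J' C (\<lambda>i. F0 (e' i)) (\<lambda>u. F1 (m' u))"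
    unfolding diagram_def J'_simps
  proof (intro conjI ballI; (elim imageE)?; hypsubst?)
    fix x y z f g assume o: "x \<in> Ob J" "y \<in> Ob J" "z \<in> Ob J"
      and "f \<in> Hom J (e' (e x)) (e' (e y))" "g \<in> Hom J (e' (e y)) (e' (e z))"
    then have h: "f \<in> Hom J x y" "g \<in> Hom J y z" by simp_all
    have "F1 (Comp J g f) = Comp C (F1 g) (F1 f)" using D o h unfolding diagram_def by blast
    then show "F1 (m' (m (Comp J (m' (m g)) (m' (m f))))) = Comp C (F1 (m' (m g))) (F1 (m' (m f)))"
      using Jc[OF o h] o h by simp
  next
    fix x y f assume o: "x \<in> Ob J" "y \<in> Ob J" and "f \<in> Hom J (e' (e x)) (e' (e y))"
    then show "F1 (m' (m f)) \<in> Hom C (F0 (e' (e x))) (F0 (e' (e y)))"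
      using D by (auto simp: diagram_def)
  qed (use D Jid in \<open>auto simp: diagram_def\<close>)
  have cone: "cone J' C (\<lambda>i. F0 (e' i)) (\<lambda>u. F1 (m' u)) L p \<longleftrightarrow> cone J C F0 F1 L (\<lambda>x. p (e x))" for L p
  proof -
    have "(\<forall>i\<in>e ` Ob J. \<forall>j\<in>e ` Ob J. \<forall>u\<in>m ` Hom J (e' i) (e' j). Comp C (F1 (m' u)) (p i) = p j) \<longleftrightarrow>
      (\<forall>x\<in>Ob J. \<forall>y\<in>Ob J. \<forall>u\<in>Hom J x y. Comp C (F1 u) (p (e x)) = p (e y))"
      by (simp cong: ball_cong)
    then show ?thesis unfolding cone_def J'_simps by simp
  qed
  have "\<exists>L p. cone J' C (\<lambda>i. F0 (e' i)) (\<lambda>u. F1 (m' u)) L p \<and>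
     (\<forall>X q. cone J' C (\<lambda>i. F0 (e' i)) (\<lambda>u. F1 (m' u)) X q \<longrightarrow>
       (\<exists>!k. k \<in> Hom C X L \<and> (\<forall>i\<in>Ob J'. Comp C (p i) k = q i)))"
    using C sJ' D' unfolding complete_def by blast
  then obtain L p where L: "cone J C F0 F1 L (\<lambda>x. p (e x))"
    and U: "\<And>X q. cone J' C (\<lambda>i. F0 (e' i)) (\<lambda>u. F1 (m' u)) X q \<Longrightarrow>
       \<exists>!k. k \<in> Hom C X L \<and> (\<forall>i\<in>Ob J'. Comp C (p i) k = q i)"
    unfolding cone by blast
  show ?thesis
  proof (intro exI[of _ L] exI[of _ "\<lambda>x. p (e x)"] conjI allI impI)
    fix X q assume q: "cone J C F0 F1 X q"
    have "cone J C F0 F1 X (\<lambda>x. q (e' (e x)))"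
      using q Jid unfolding cone_def by auto
    then have "\<exists>!k. k \<in> Hom C X L \<and> (\<forall>i\<in>Ob J'. Comp C (p i) k = q (e' i))"
      using U[of X "\<lambda>i. q (e' i)"] by (simp add: cone)
    then show "\<exists>!k. k \<in> Hom C X L \<and> (\<forall>i\<in>Ob J. Comp C (p (e i)) k = q i)"
      unfolding J'_simps by simp
  qed (rule L)
qed

text \<open>
  Ends are limits of this kind: \<open>X a = [Fa,Ga]\<close> and \<open>Y a b = [A(a,b),[Fa,Gb]]\<close>. In the opposite
  category they are coends.
\<close>

lemma limit_of_parallel_pairs:
  fixes C :: "('o, 'm, 'z) cat_scheme" and S :: "'u set"
  assumes U: "infinite (UNIV :: 'u set)" and C: "complete TYPE('u) C" and cat: "category C" and S: "small S"
    and X: "\<And>a. a \<in> S \<Longrightarrow> X a \<in> Ob C" and Y: "\<And>a b. a \<in> S \<Longrightarrow> b \<in> S \<Longrightarrow> Y a b \<in> Ob C"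
    and l: "\<And>a b. a \<in> S \<Longrightarrow> b \<in> S \<Longrightarrow> l a b \<in> Hom C (X a) (Y a b)"
    and r: "\<And>a b. a \<in> S \<Longrightarrow> b \<in> S \<Longrightarrow> r a b \<in> Hom C (X b) (Y a b)"
  defines "fork \<equiv> \<lambda>L p. L \<in> Ob C \<and> (\<forall>a\<in>S. p a \<in> Hom C L (X a)) \<and>
      (\<forall>a\<in>S. \<forall>b\<in>S. Comp C (l a b) (p a) = Comp C (r a b) (p b))"
  shows "\<exists>L p. fork L p \<and> (\<forall>Z q. fork Z q \<longrightarrow> (\<exists>!k. k \<in> Hom C Z L \<and> (\<forall>a\<in>S. Comp C (p a) k = q a)))"
proof -
  \<comment> \<open>The objects are the indices of the \<open>X a\<close> and of the \<open>Y a b\<close>. An arrow records its ends and which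
    of \<open>l a b\<close>, \<open>r a b\<close> it stands for: otherwise these two would coincide for \<open>a = b\<close>, and the sets of
    arrows would not be disjoint.\<close>
  define J :: "('u + 'u \<times> 'u, ('u + 'u \<times> 'u) \<times> ('u + 'u \<times> 'u) \<times> bool) cat" where
    "J = \<lparr>Ob = Inl ` S \<union> Inr ` (S \<times> S),
       Hom = (\<lambda>x y. {(x', y', c). x' = x \<and> y' = y \<and>
          ((x = y \<and> \<not> c) \<or> (\<exists>a b. y = Inr (a, b) \<and> (x = Inl a \<and> \<not> c \<or> x = Inl b \<and> c)))}),
       Comp = (\<lambda>g f. (fst f, fst (snd g), snd (snd g) \<or> snd (snd f))),
       Id = (\<lambda>x. (x, x, False))\<rparr>"
  define F0 where "F0 x = (case x of Inl a \<Rightarrow> X a | Inr (a, b) \<Rightarrow> Y a b)" for x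
  define F1 where "F1 u = (case u of (x, y, c) \<Rightarrow> if x = y then Id C (F0 x) else
     (case y of Inl a \<Rightarrow> undefined | Inr (a, b) \<Rightarrow> if c then r a b else l a b))" for u
  have J_simps: "Ob J = Inl ` S \<union> Inr ` (S \<times> S)"
    "\<And>x y. Hom J x y = {(x', y', c). x' = x \<and> y' = y \<and>
          ((x = y \<and> \<not> c) \<or> (\<exists>a b. y = Inr (a, b) \<and> (x = Inl a \<and> \<not> c \<or> x = Inl b \<and> c)))}"
    "\<And>g f. Comp J g f = (fst f, fst (snd g), snd (snd g) \<or> snd (snd f))"
    "\<And>x. Id J x = (x, x, False)"
    by (simp_all add: J_def)
  have cJ: "category J" unfolding category_def J_simps by auto
  have F0: "F0 x \<in> Ob C" if "x \<in> Ob J" for x using that X Y by (auto simp: J_simps F0_def)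
  have idC: "Id C Z \<in> Hom C Z Z" if "Z \<in> Ob C" for Z using cat that by (simp add: category_def)
  have idl: "Comp C f (Id C Z) = f" and idr: "Comp C (Id C W) f = f"
    if "Z \<in> Ob C" "W \<in> Ob C" "f \<in> Hom C Z W" for f Z W using cat that by (simp_all add: category_def)
  have D: "diagram J C F0 F1"
    unfolding diagram_def
  proof (intro conjI ballI)
    show F1: "F1 u \<in> Hom C (F0 x) (F0 y)" if "x \<in> Ob J" "y \<in> Ob J" "u \<in> Hom J x y" for x y u
      using that l r idC X Y by (auto simp: J_simps F0_def F1_def split: if_splits)
    show "F1 (Comp J v u) = Comp C (F1 v) (F1 u)"
      if o: "x \<in> Ob J" "y \<in> Ob J" "z \<in> Ob J" and h: "u \<in> Hom J x y" "v \<in> Hom J y z" for x y z u v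
    proof -
      have "x = y \<or> y = z" using h by (auto simp: J_simps)
      then show ?thesis
      proof
        assume "x = y"
        then have u: "u = (y, y, False)" using h by (auto simp: J_simps)
        have "Comp J v u = v" using u h(2) by (auto simp: J_simps)
        moreover have "F1 u = Id C (F0 y)" by (simp add: u F1_def)
        ultimately show ?thesis using idl[OF F0[OF o(2)] F0[OF o(3)] F1[OF o(2,3) h(2)]] by simp
      next
        assume "y = z"
        then have v: "v = (y, y, False)" using h by (auto simp: J_simps)
        have "Comp J v u = u" using v h(1) by (auto simp: J_simps)
        moreover have "F1 v = Id C (F0 y)" by (simp add: v F1_def)
        ultimately show ?thesis using idr[OF F0[OF o(1)] F0[OF o(2)] F1[OF o(1,2) h(1)]] by simp
      qed
    qed
  qed (use F0 in \<open>auto simp: J_simps F1_def\<close>)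
  have S': "S \<prec> (UNIV :: 'u set)" using S by (simp add: small_def)
  have B: "(UNIV :: bool set) \<prec> (UNIV :: 'u set)" using U by (simp add: finite_lesspoll_infinite)
  have sO: "Ob J \<prec> (UNIV :: 'u set)"
  proof -
    let ?f = "\<lambda>x. case x of Inl a \<Rightarrow> (True, a, a) | Inr (a, b) \<Rightarrow> (False, a, b)"
    have "inj_on ?f (Ob J)" "?f ` Ob J \<subseteq> UNIV \<times> (S \<times> S)"
      by (auto simp: J_simps inj_on_def)
    then have "Ob J \<lesssim> (UNIV :: bool set) \<times> (S \<times> S)" unfolding lepoll_def by blast
    then show ?thesis using lesspoll_trans1 lesspoll_Times[OF U B lesspoll_Times[OF U S' S']] by blast
  qed
  have sM: "(\<Union>i\<in>Ob J. \<Union>j\<in>Ob J. Hom J i j) \<prec> (UNIV :: 'u set)"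
  proof -
    have "(\<Union>i\<in>Ob J. \<Union>j\<in>Ob J. Hom J i j) \<subseteq> Ob J \<times> (Ob J \<times> UNIV)"
      by (auto simp: J_simps(2))
    then show ?thesis
      using lesspoll_trans1[OF subset_imp_lepoll] lesspoll_Times[OF U sO lesspoll_Times[OF U sO B]] by blast
  qed
  \<comment> \<open>A fork is a cone without its components at the \<open>Y a b\<close>, which are determined by the others.\<close>
  define ex where "ex q x = (case x of Inl a \<Rightarrow> q a | Inr (a, b) \<Rightarrow> Comp C (l a b) (q a))" for q x
  have compC: "Comp C g f \<in> Hom C P R" if "P \<in> Ob C" "Q \<in> Ob C" "R \<in> Ob C" "f \<in> Hom C P Q" "g \<in> Hom C Q R" for P Q R f g
    using cat that unfolding category_def by blast
  have assocC: "Comp C h (Comp C g f) = Comp C (Comp C h g) f"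
    if "O1 \<in> Ob C" "O2 \<in> Ob C" "O3 \<in> Ob C" "O4 \<in> Ob C" "f \<in> Hom C O1 O2" "g \<in> Hom C O2 O3" "h \<in> Hom C O3 O4"
    for f g h O1 O2 O3 O4
    using cat that unfolding category_def by blast
  have cone_ex: "cone J C F0 F1 L (ex q)" if "fork L q" for L q
    unfolding cone_def
  proof (intro conjI ballI)
    show "L \<in> Ob C" using that by (simp add: fork_def)
    have q: "q a \<in> Hom C L (X a)" if "a \<in> S" for a using \<open>fork L q\<close> that by (simp add: fork_def)
    have lq: "Comp C (l a b) (q a) \<in> Hom C L (Y a b)" if "a \<in> S" "b \<in> S" for a b
      using compC[OF \<open>L \<in> Ob C\<close> X[OF that(1)] Y[OF that] q[OF that(1)] l[OF that]] .
    show ex: "ex q x \<in> Hom C L (F0 x)" if "x \<in> Ob J" for x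
      using that q lq by (auto simp: J_simps ex_def F0_def)
    show "Comp C (F1 u) (ex q x) = ex q y" if o: "x \<in> Ob J" "y \<in> Ob J" and u: "u \<in> Hom J x y" for x y u
    proof (cases "x = y")
      case True
      then show ?thesis using u idr[OF \<open>L \<in> Ob C\<close> F0[OF o(1)] ex[OF o(1)]] by (auto simp: J_simps F1_def)
    next
      case False
      then obtain a b c where y: "y = Inr (a, b)" "u = (x, y, c)" "x = Inl a \<and> \<not> c \<or> x = Inl b \<and> c"
        using u by (auto simp: J_simps)
      have "a \<in> S" "b \<in> S" using o y by (auto simp: J_simps)
      then have "Comp C (l a b) (q a) = Comp C (r a b) (q b)" using that \<open>fork L q\<close> by (simp add: fork_def)
      then show ?thesis using y by (auto simp: F1_def ex_def)
    qed
  qed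
  have fork_cone: "fork L (\<lambda>a. p (Inl a)) \<and> (\<forall>a\<in>S. \<forall>b\<in>S. p (Inr (a, b)) = Comp C (l a b) (p (Inl a)))"
    if c: "cone J C F0 F1 L p" for L p
  proof -
    have 1: "p (Inr (a, b)) = Comp C (l a b) (p (Inl a))" "p (Inr (a, b)) = Comp C (r a b) (p (Inl b))"
      if "a \<in> S" "b \<in> S" for a b
    proof -
      have "(Inl a, Inr (a, b), False) \<in> Hom J (Inl a) (Inr (a, b))" "(Inl b, Inr (a, b), True) \<in> Hom J (Inl b) (Inr (a, b))"
        "Inl a \<in> Ob J" "Inl b \<in> Ob J" "Inr (a, b) \<in> Ob J"
        using that by (auto simp: J_simps)
      then have "Comp C (F1 (Inl a, Inr (a, b), False)) (p (Inl a)) = p (Inr (a, b))"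
        "Comp C (F1 (Inl b, Inr (a, b), True)) (p (Inl b)) = p (Inr (a, b))"
        using c unfolding cone_def by blast+
      then show "p (Inr (a, b)) = Comp C (l a b) (p (Inl a))" "p (Inr (a, b)) = Comp C (r a b) (p (Inl b))"
        by (simp_all add: F1_def)
    qed
    have "p (Inl a) \<in> Hom C L (X a)" if "a \<in> S" for a
    proof -
      have "Inl a \<in> Ob J" using that by (simp add: J_simps)
      then have "p (Inl a) \<in> Hom C L (F0 (Inl a))" using c unfolding cone_def by blast
      then show ?thesis by (simp add: F0_def)
    qed
    moreover have "Comp C (l a b) (p (Inl a)) = Comp C (r a b) (p (Inl b))" if "a \<in> S" "b \<in> S" for a b
      using 1(1)[OF that] 1(2)[OF that] by (rule subst)
    ultimately show ?thesis using c 1(1) unfolding fork_def cone_def by blast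
  qed
  obtain L p where L: "cone J C F0 F1 L p"
    and univ: "\<And>X q. cone J C F0 F1 X q \<Longrightarrow> \<exists>!k. k \<in> Hom C X L \<and> (\<forall>i\<in>Ob J. Comp C (p i) k = q i)"
    using complete_transport[OF C cJ D sO sM] by blast
  note pL = fork_cone[OF L]
  show ?thesis
  proof (intro exI[of _ L] exI[of _ "\<lambda>a. p (Inl a)"] conjI allI impI)
    show "fork L (\<lambda>a. p (Inl a))" using pL by blast
    fix Z q assume q: "fork Z q"
    have iff: "(\<forall>i\<in>Ob J. Comp C (p i) k = ex q i) \<longleftrightarrow> (\<forall>a\<in>S. Comp C (p (Inl a)) k = q a)"
      if k: "k \<in> Hom C Z L" for k
    proof
      assume h: "\<forall>i\<in>Ob J. Comp C (p i) k = ex q i"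
      show "\<forall>a\<in>S. Comp C (p (Inl a)) k = q a"
      proof
        fix a assume "a \<in> S" then have "Inl a \<in> Ob J" by (simp add: J_simps)
        then have "Comp C (p (Inl a)) k = ex q (Inl a)" using h by blast
        then show "Comp C (p (Inl a)) k = q a" by (simp add: ex_def)
      qed
    next
      assume h: "\<forall>a\<in>S. Comp C (p (Inl a)) k = q a"
      show "\<forall>i\<in>Ob J. Comp C (p i) k = ex q i"
      proof
        fix i assume i: "i \<in> Ob J"
        show "Comp C (p i) k = ex q i"
        proof (cases i)
          case (Inl a) then show ?thesis using i h by (auto simp: J_simps ex_def)
        next
          case (Inr ab)
          then obtain a b where ab: "i = Inr (a, b)" "a \<in> S" "b \<in> S" using i by (auto simp: J_simps)
          have t: "Z \<in> Ob C" "L \<in> Ob C" "X a \<in> Ob C" "Y a b \<in> Ob C" "p (Inl a) \<in> Hom C L (X a)"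
            using q pL X Y ab by (simp_all add: fork_def)
          have "Comp C (p i) k = Comp C (Comp C (l a b) (p (Inl a))) k" using pL ab by simp
          also have "\<dots> = Comp C (l a b) (Comp C (p (Inl a)) k)"
            by (rule assocC[OF t(1-4) k t(5) l[OF ab(2,3)], symmetric])
          also have "\<dots> = ex q i" using h ab by (simp add: ex_def)
          finally show ?thesis .
        qed
      qed
    qed
    show "\<exists>!k. k \<in> Hom C Z L \<and> (\<forall>a\<in>S. Comp C (p (Inl a)) k = q a)"
      using univ[OF cone_ex[OF q]] by (simp add: iff cong: conj_cong)
  qed
qed

section \<open>Ends and functor categories\<close>

context smc_closed begin

text \<open>
  Out of a tensor product, naturality needs checking at pairs only; out of \<open>\<I>\<close>, only at \<open>one\<close>.
\<close>

lemma wedgeI2: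
  assumes F: "vgraph A F" and G: "vgraph A G" and N: "N \<in> Ob V" and M: "M \<in> Ob V"
    and p: "\<And>a. a \<in> vob A \<Longrightarrow> \<pi> a \<in> ar (N \<otimes> M) (ihom (fob F a) (fob G a))"
    and eq: "\<And>a b n m f x. \<lbrakk>a \<in> vob A; b \<in> vob A; n \<in> El N; m \<in> El M;
      f \<in> El (vhom A a b); x \<in> El (fob F a); disj n m; disj m n;
      disj n f; disj f n; disj n x; disj x n; disj m f; disj f m; disj m x; disj x m;
      disj f x; disj x f\<rbrakk> \<Longrightarrow>
      ap (fob F b) (fob G b) (app (\<pi> b) (pair n m)) (act F a b f x) =
      act G a b f (ap (fob F a) (fob G a) (app (\<pi> a) (pair n m)) x)"
  shows "wedge V A F G (N \<otimes> M) \<pi>"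
  unfolding wedge_def
proof (intro conjI ballI)
  fix a b assume o: "a \<in> vob A" "b \<in> vob A"
  have p': "\<forall>a\<in>vob A. \<pi> a \<in> ar (N \<otimes> M) (ihom (fob F a) (fob G a))" using p by blast
  note w = wedge_arrows[OF F G tens_ob[OF N M] p' o]
  show "vcomp (vself V) (fob F a) (fob F b) (fob G b) \<cdot> (\<pi> b \<odot> far F a b) =
        vcomp (vself V) (fob F a) (fob G a) (fob G b) \<cdot> (far G a b \<odot> \<pi> a) \<cdot> symm (N \<otimes> M) (vhom A a b)"
  proof (rule ext3[OF w(1,2) N M ar_dom[OF vgraph_far[OF F o]]])
    fix n m f assume e: "n \<in> El N" "m \<in> El M" "f \<in> El (vhom A a b)"
      "disj n m" "disj m n" "disj n f" "disj f n" "disj m f" "disj f m"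
    let ?nm = "pair n m"
    have nm: "?nm \<in> El (N \<otimes> M)" "disj ?nm f" using e by simp_all
    have m: "app (\<pi> a) ?nm \<in> El (ihom (fob F a) (fob G a))" "app (\<pi> b) ?nm \<in> El (ihom (fob F b) (fob G b))"
      using app_in[OF p nm(1)] o by blast+
    show "app (vcomp (vself V) (fob F a) (fob F b) (fob G b) \<cdot> (\<pi> b \<odot> far F a b)) (pair ?nm f) =
      app (vcomp (vself V) (fob F a) (fob G a) (fob G b) \<cdot> (far G a b \<odot> \<pi> a) \<cdot> symm (N \<otimes> M) (vhom A a b)) (pair ?nm f)"
      unfolding w(3)[OF nm(1) e(3) nm(2)] w(4)[OF nm(1) e(3) nm(2)]
    proof (rule ext_ihom[of _ "fob F a" "fob G b"])
      fix x assume x: "x \<in> El (fob F a)"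
        "disj (cmp (vself V) (fob F a) (fob F b) (fob G b) (app (\<pi> b) ?nm) (app (far F a b) f)) x"
        "disj x (cmp (vself V) (fob F a) (fob F b) (fob G b) (app (\<pi> b) ?nm) (app (far F a b) f))"
      show "ap (fob F a) (fob G b) (cmp (vself V) (fob F a) (fob F b) (fob G b) (app (\<pi> b) ?nm) (app (far F a b) f)) x =
         ap (fob F a) (fob G b) (cmp (vself V) (fob F a) (fob G a) (fob G b) (app (far G a b) f) (app (\<pi> a) ?nm)) x"
        using eq[OF o e(1,2,3) x(1)] x e o F G m by (simp add: act_def)
    qed (use F G o e m in \<open>simp_all add: join_ac\<close>)
  qed
qed (use N M p in \<open>auto simp: ar_def\<close>)

lemma wedge_unitI:
  assumes F: "vgraph A F" and G: "vgraph A G"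
    and p: "\<And>a. a \<in> vob A \<Longrightarrow> \<pi> a \<in> ar \<I> (ihom (fob F a) (fob G a))"
    and eq: "\<And>a b f x. \<lbrakk>a \<in> vob A; b \<in> vob A;
      f \<in> El (vhom A a b); x \<in> El (fob F a); disj f x; disj x f\<rbrakk> \<Longrightarrow>
      ap (fob F b) (fob G b) (app (\<pi> b) one) (act F a b f x) =
      act G a b f (ap (fob F a) (fob G a) (app (\<pi> a) one) x)"
  shows "wedge V A F G \<I> \<pi>"
  unfolding wedge_def
proof (intro conjI ballI)
  fix a b assume o: "a \<in> vob A" "b \<in> vob A"
  have p': "\<forall>a\<in>vob A. \<pi> a \<in> ar \<I> (ihom (fob F a) (fob G a))" using p by blast
  note w = wedge_arrows[OF F G unit_ob p' o]
  show "vcomp (vself V) (fob F a) (fob F b) (fob G b) \<cdot> (\<pi> b \<odot> far F a b) =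
        vcomp (vself V) (fob F a) (fob G a) (fob G b) \<cdot> (far G a b \<odot> \<pi> a) \<cdot> symm \<I> (vhom A a b)"
  proof (rule ext_lun[OF w(1,2) ar_dom[OF vgraph_far[OF F o]]])
    fix f assume e: "f \<in> El (vhom A a b)"
    have m: "app (\<pi> a) one \<in> El (ihom (fob F a) (fob G a))" "app (\<pi> b) one \<in> El (ihom (fob F b) (fob G b))"
      using app_in[OF p one_in] o by blast+
    show "app (vcomp (vself V) (fob F a) (fob F b) (fob G b) \<cdot> (\<pi> b \<odot> far F a b)) (pair one f) =
      app (vcomp (vself V) (fob F a) (fob G a) (fob G b) \<cdot> (far G a b \<odot> \<pi> a) \<cdot> symm \<I> (vhom A a b)) (pair one f)"
      unfolding w(3)[OF one_in e disj_simps(5)] w(4)[OF one_in e disj_simps(5)]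
    proof (rule ext_ihom[of _ "fob F a" "fob G b"])
      fix x assume x: "x \<in> El (fob F a)"
        "disj (cmp (vself V) (fob F a) (fob F b) (fob G b) (app (\<pi> b) one) (app (far F a b) f)) x"
        "disj x (cmp (vself V) (fob F a) (fob F b) (fob G b) (app (\<pi> b) one) (app (far F a b) f))"
      show "ap (fob F a) (fob G b) (cmp (vself V) (fob F a) (fob F b) (fob G b) (app (\<pi> b) one) (app (far F a b) f)) x =
         ap (fob F a) (fob G b) (cmp (vself V) (fob F a) (fob G a) (fob G b) (app (far G a b) f) (app (\<pi> a) one)) x"
        using eq[OF o e x(1)] x e o F G m by (simp add: act_def)
    qed (use F G o e m in \<open>simp_all add: join_ac\<close>)
  qed
qed (use p in \<open>auto simp: ar_def\<close>)

lemma small_vcategory_D [simp]: "small_vcategory V A \<Longrightarrow> vcategory V A"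
  by (simp add: small_vcategory_def)

lemma small_vcategory_vop [simp]: "small_vcategory V A \<Longrightarrow> small_vcategory V (vop V A)"
  by (simp add: small_vcategory_def)

end

text \<open>
  The parameter \<open>U\<close> only fixes the type \<open>'u\<close>, which measures smallness.
\<close>

locale bicomplete_smc = smc_closed V for V :: "('o, 'm) smc" (structure) +
  fixes U :: "'u itself"
  assumes infinite_universe: "infinite (UNIV :: 'u set)"
    and complete: "complete TYPE('u) V"
    and cocomplete: "cocomplete TYPE('u) V"
begin

text \<open>
  The arrows \<open>l a b\<close> and \<open>r a b\<close> from \<open>[Fa,Ga]\<close> and \<open>[Fb,Gb]\<close> to \<open>[A(a,b),[Fa,Gb]]\<close> are the actions
  of \<open>A(a,b)\<close> on \<open>G\<close> and on \<open>F\<close>; a wedge is a family that equalises them.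
\<close>

lemma end_exists:
  fixes A :: "('u, 'o, 'm) vcat"
  assumes A: "small_vcategory V A" and F: "vgraph A F" and G: "vgraph A G"
  shows "\<exists>N \<pi>. is_end V A F G N \<pi>"
proof -
  let ?S = "vob A"
  have S: "small ?S" using A by (simp add: small_vcategory_def)
  let ?X = "\<lambda>a. ihom (fob F a) (fob G a)"
  let ?Y = "\<lambda>a b. ihom (vhom A a b) (ihom (fob F a) (fob G b))"
  have "\<exists>h. a \<in> ?S \<longrightarrow> b \<in> ?S \<longrightarrow> h \<in> ar (?X a) (?Y a b) \<and>
     (\<forall>k f x. k \<in> El (?X a) \<longrightarrow> f \<in> El (vhom A a b) \<longrightarrow> x \<in> El (fob F a) \<longrightarrow> disj k f \<longrightarrow> disj k x \<longrightarrow> disj f x \<longrightarrow>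
       ap (fob F a) (fob G b) (ap (vhom A a b) (ihom (fob F a) (fob G b)) (app h k) f) x =
       act G a b f (ap (fob F a) (fob G a) k x))" for a b
  proof (cases "a \<in> ?S \<and> b \<in> ?S")
    case True
    then have o: "a \<in> ?S" "b \<in> ?S" by simp_all
    have "lin3 (?X a) (vhom A a b) (fob F a) (fob G b) (\<lambda>k f x. act G a b f (ap (fob F a) (fob G a) k x))"
      using lin3_swap23[OF lin3_l[OF lin2_ap lin2_swap[OF lin2_act[OF G o]]]] F G o by simp
    then show ?thesis by (rule lin3_curry2) blast
  qed blast
  then obtain l where l: "\<And>a b. a \<in> ?S \<Longrightarrow> b \<in> ?S \<Longrightarrow> l a b \<in> ar (?X a) (?Y a b)"
    and l': "\<And>a b k f x. \<lbrakk>a \<in> ?S; b \<in> ?S; k \<in> El (?X a); f \<in> El (vhom A a b); x \<in> El (fob F a);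
      disj k f; disj k x; disj f x\<rbrakk> \<Longrightarrow>
       ap (fob F a) (fob G b) (ap (vhom A a b) (ihom (fob F a) (fob G b)) (app (l a b) k) f) x =
       act G a b f (ap (fob F a) (fob G a) k x)" by metis
  have "\<exists>h. a \<in> ?S \<longrightarrow> b \<in> ?S \<longrightarrow> h \<in> ar (?X b) (?Y a b) \<and>
     (\<forall>k f x. k \<in> El (?X b) \<longrightarrow> f \<in> El (vhom A a b) \<longrightarrow> x \<in> El (fob F a) \<longrightarrow> disj k f \<longrightarrow> disj k x \<longrightarrow> disj f x \<longrightarrow>
       ap (fob F a) (fob G b) (ap (vhom A a b) (ihom (fob F a) (fob G b)) (app h k) f) x =
       ap (fob F b) (fob G b) k (act F a b f x))" for a b
  proof (cases "a \<in> ?S \<and> b \<in> ?S")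
    case True
    then have o: "a \<in> ?S" "b \<in> ?S" by simp_all
    have "lin3 (?X b) (vhom A a b) (fob F a) (fob G b) (\<lambda>k f x. ap (fob F b) (fob G b) k (act F a b f x))"
      using lin3_swap12[OF lin3_swap23[OF lin3_l[OF lin2_act[OF F o] lin2_swap[OF lin2_ap]]]] F G o by simp
    then show ?thesis by (rule lin3_curry2) blast
  qed blast
  then obtain r where r: "\<And>a b. a \<in> ?S \<Longrightarrow> b \<in> ?S \<Longrightarrow> r a b \<in> ar (?X b) (?Y a b)"
    and r': "\<And>a b k f x. \<lbrakk>a \<in> ?S; b \<in> ?S; k \<in> El (?X b); f \<in> El (vhom A a b); x \<in> El (fob F a);
      disj k f; disj k x; disj f x\<rbrakk> \<Longrightarrow>
       ap (fob F a) (fob G b) (ap (vhom A a b) (ihom (fob F a) (fob G b)) (app (r a b) k) f) x =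
       ap (fob F b) (fob G b) k (act F a b f x)" by metis
  have iff: "wedge V A F G L p \<longleftrightarrow> L \<in> Ob V \<and> (\<forall>a\<in>?S. p a \<in> Hom V L (?X a)) \<and>
      (\<forall>a\<in>?S. \<forall>b\<in>?S. l a b \<cdot> p a = r a b \<cdot> p b)" for L p
  proof
    assume w: "wedge V A F G L p"
    note p = wedge_in[OF F G w]
    have "l a b \<cdot> p a = r a b \<cdot> p b" if o: "a \<in> ?S" "b \<in> ?S" for a b
    proof (rule ext1[OF comp_in[OF p[OF o(1)] l[OF o]] comp_in[OF p[OF o(2)] r[OF o]]])
      fix n assume n: "n \<in> El L"
      note pn = app_in[OF p[OF o(1)] n] app_in[OF p[OF o(2)] n]
      note ln = app_in[OF l[OF o] pn(1)] and rn = app_in[OF r[OF o] pn(2)]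
      have ob: "vhom A a b \<in> Ob V" "fob F a \<in> Ob V" "fob G b \<in> Ob V" using F G A o by simp_all
      have "app (l a b) (app (p a) n) = app (r a b) (app (p b) n)"
      proof (rule ext_ihom[OF ln rn])
        fix f assume f: "f \<in> El (vhom A a b)" "disj (app (l a b) (app (p a) n)) f" "disj f (app (l a b) (app (p a) n))"
        show "ap (vhom A a b) (ihom (fob F a) (fob G b)) (app (l a b) (app (p a) n)) f =
          ap (vhom A a b) (ihom (fob F a) (fob G b)) (app (r a b) (app (p b) n)) f"
          by (rule ext_ihom[of _ "fob F a" "fob G b"])
            (use ob f o pn ln rn n in \<open>simp_all add: l' r' wedge_nat[OF F G w o]\<close>)
      qed (use ob in simp_all)
      then show "app (l a b \<cdot> p a) n = app (r a b \<cdot> p b) n"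
        by (simp add: app_comp[OF n p[OF o(1)] l[OF o]] app_comp[OF n p[OF o(2)] r[OF o]])
    qed
    then show "L \<in> Ob V \<and> (\<forall>a\<in>?S. p a \<in> Hom V L (?X a)) \<and> (\<forall>a\<in>?S. \<forall>b\<in>?S. l a b \<cdot> p a = r a b \<cdot> p b)"
      using wedge_ob[OF w] ar_Hom[OF p] by blast
  next
    assume h: "L \<in> Ob V \<and> (\<forall>a\<in>?S. p a \<in> Hom V L (?X a)) \<and> (\<forall>a\<in>?S. \<forall>b\<in>?S. l a b \<cdot> p a = r a b \<cdot> p b)"
    have p: "p a \<in> ar L (?X a)" if "a \<in> ?S" for a using h that F G by (simp add: ar_def)
    show "wedge V A F G L p"
    proof (rule wedgeI[OF F G _ p])
      fix a b n f x assume o: "a \<in> ?S" "b \<in> ?S" and e: "n \<in> El L" "f \<in> El (vhom A a b)" "x \<in> El (fob F a)"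
        and d: "disj n f" "disj n x" "disj f x"
      have "app (l a b) (app (p a) n) = app (r a b) (app (p b) n)"
        using h o app_comp[OF e(1) p[OF o(1)] l[OF o]] app_comp[OF e(1) p[OF o(2)] r[OF o]] by metis
      then show "ap (fob F b) (fob G b) (app (p b) n) (act F a b f x) = act G a b f (ap (fob F a) (fob G a) (app (p a) n) x)"
        using l'[OF o app_in[OF p[OF o(1)] e(1)] e(2,3)] r'[OF o app_in[OF p[OF o(2)] e(1)] e(2,3)] d by simp
    qed (use h in simp)
  qed
  have "\<exists>L p. wedge V A F G L p \<and> (\<forall>Z q. wedge V A F G Z q \<longrightarrow>
      (\<exists>!k. k \<in> Hom V Z L \<and> (\<forall>a\<in>?S. p a \<cdot> k = q a)))"
    unfolding iff
    by (rule limit_of_parallel_pairs[OF infinite_universe complete cat S, where X = ?X and Y = ?Y])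
      (use F G A in \<open>simp_all add: ar_Hom[OF l] ar_Hom[OF r]\<close>)
  then show ?thesis unfolding is_end_def .
qed

lemma is_end:
  fixes A :: "('u, 'o, 'm) vcat"
  assumes A: "small_vcategory V A" and F: "vgraph A F" and G: "vgraph A G"
  shows "is_end V A F G (natob V A F G) (proj V A F G)"
proof -
  have "\<exists>z. case z of (N, \<pi>) \<Rightarrow> is_end V A F G N \<pi>" using end_exists[OF assms] by simp
  from someI_ex[OF this] show ?thesis
    unfolding natob_def proj_def the_end_def case_prod_unfold .
qed

text \<open>
  The component at \<open>a\<close> of an element \<open>\<tau>\<close> of \<open>[A,V](F,G)\<close>, applied to an element \<open>x\<close> of \<open>Fa\<close>. Elements
  of the end are thus handled as natural transformations.
\<close>

definition nt where "nt A F G a \<tau> x = ap (fob F a) (fob G a) (app (proj V A F G a) \<tau>) x"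

lemma disj_nt [simp]: "disj (nt A F G a \<tau> x) y \<longleftrightarrow> disj \<tau> y \<and> disj x y"
    "disj y (nt A F G a \<tau> x) \<longleftrightarrow> disj y \<tau> \<and> disj y x"
  by (simp_all add: nt_def)

context
  fixes A :: "('u, 'o, 'm) vcat" and F G :: "('u, 'o, 'm) vfun"
  assumes A: "small_vcategory V A" and F: "vgraph A F" and G: "vgraph A G"
begin

lemma natob_wedge: "wedge V A F G (natob V A F G) (proj V A F G)"
  using is_end[OF A F G] by (simp add: is_end_def)

lemma natob_ob: "natob V A F G \<in> Ob V"
  using natob_wedge by (rule wedge_ob)

lemma proj_in: "a \<in> vob A \<Longrightarrow> proj V A F G a \<in> ar (natob V A F G) (ihom (fob F a) (fob G a))"
  by (rule wedge_in[OF F G natob_wedge])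

lemma proj_app_in: "a \<in> vob A \<Longrightarrow> \<tau> \<in> El (natob V A F G) \<Longrightarrow> app (proj V A F G a) \<tau> \<in> El (ihom (fob F a) (fob G a))"
  by (rule app_in[OF proj_in])

lemma nt_in: "\<lbrakk>a \<in> vob A; \<tau> \<in> El (natob V A F G); x \<in> El (fob F a); disj \<tau> x\<rbrakk> \<Longrightarrow>
    nt A F G a \<tau> x \<in> El (fob G a)"
  unfolding nt_def by (rule ap_in) (use F G in \<open>simp_all add: proj_app_in\<close>)

lemma nt_nat: "\<lbrakk>a \<in> vob A; b \<in> vob A; \<tau> \<in> El (natob V A F G); f \<in> El (vhom A a b);
    x \<in> El (fob F a); disj \<tau> f; disj \<tau> x; disj f x\<rbrakk> \<Longrightarrow>
    nt A F G b \<tau> (act F a b f x) = act G a b f (nt A F G a \<tau> x)"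
  unfolding nt_def by (rule wedge_nat[OF F G natob_wedge])

lemma lin2_nt: "a \<in> vob A \<Longrightarrow> lin2 (natob V A F G) (fob F a) (fob G a) (nt A F G a)"
  unfolding nt_def by (rule lin2_pre1[OF lin1_app[OF proj_in] lin2_ap]) (use F G in simp_all)

lemma into_end_ex1:
  assumes w: "wedge V A F G X q"
  shows "\<exists>!k. k \<in> Hom V X (natob V A F G) \<and> (\<forall>a\<in>vob A. proj V A F G a \<cdot> k = q a)"
  using is_end[OF A F G] w by (simp add: is_end_def)

lemma into_end:
  assumes w: "wedge V A F G X q"
  shows into_end_in: "into_end V A F G X q \<in> ar X (natob V A F G)"
    and proj_into_end: "a \<in> vob A \<Longrightarrow> n \<in> El X \<Longrightarrow>
      app (proj V A F G a) (app (into_end V A F G X q) n) = app (q a) n"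
    and nt_into_end: "a \<in> vob A \<Longrightarrow> n \<in> El X \<Longrightarrow>
      nt A F G a (app (into_end V A F G X q) n) x = ap (fob F a) (fob G a) (app (q a) n) x"
proof -
  have k: "into_end V A F G X q \<in> Hom V X (natob V A F G) \<and>
      (\<forall>a\<in>vob A. proj V A F G a \<cdot> into_end V A F G X q = q a)"
    unfolding into_end_def by (rule theI'[OF into_end_ex1[OF w]])
  then show 1: "into_end V A F G X q \<in> ar X (natob V A F G)"
    using wedge_ob[OF w] natob_ob by (simp add: ar_def)
  assume a: "a \<in> vob A" and n: "n \<in> El X"
  show 2: "app (proj V A F G a) (app (into_end V A F G X q) n) = app (q a) n"
    using app_comp[OF n 1 proj_in[OF a]] k a by simp
  show "nt A F G a (app (into_end V A F G X q) n) x = ap (fob F a) (fob G a) (app (q a) n) x"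
    by (simp add: nt_def 2)
qed

lemma ext_natob:
  assumes s: "\<sigma> \<in> El (natob V A F G)" and t: "\<tau> \<in> El (natob V A F G)" and st: "fst \<sigma> = fst \<tau>"
    and eq: "\<And>a x. \<lbrakk>a \<in> vob A; x \<in> El (fob F a); disj \<sigma> x; disj x \<sigma>; disj \<tau> x; disj x \<tau>\<rbrakk> \<Longrightarrow>
      nt A F G a \<sigma> x = nt A F G a \<tau> x"
  shows "\<sigma> = \<tau>"
proof (rule prod_eqI[OF st])
  let ?X = "stage_ob (fst \<sigma>)" and ?q = "\<lambda>a. proj V A F G a \<cdot> snd \<sigma>"
  note sa = El_ar[OF s] and ta = El_ar[OF t, folded st]
  have q: "?q a \<in> ar ?X (ihom (fob F a) (fob G a))" if "a \<in> vob A" for a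
    by (rule comp_in[OF sa proj_in[OF that]])
  have w: "wedge V A F G ?X ?q"
  proof (rule wedgeI[OF F G ar_dom[OF sa] q])
    fix a b n f x assume o: "a \<in> vob A" "b \<in> vob A" and e: "n \<in> El ?X" "f \<in> El (vhom A a b)" "x \<in> El (fob F a)"
      and d: "disj n f" "disj n x" "disj f x"
    show "ap (fob F b) (fob G b) (app (?q b) n) (act F a b f x) = act G a b f (ap (fob F a) (fob G a) (app (?q a) n) x)"
      using wedge_nat[OF F G natob_wedge o app_in[OF sa e(1)] e(2,3)] d
      by (simp add: app_comp[OF e(1) sa proj_in] o)
  qed
  have "app (proj V A F G a) \<sigma> = app (proj V A F G a) \<tau>" if a: "a \<in> vob A" for a
    by (rule ext_ihom[of _ "fob F a" "fob G a"])
      (use eq[OF a] a s t st F G in \<open>simp_all add: proj_app_in nt_def\<close>)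
  then have "proj V A F G a \<cdot> snd \<tau> = ?q a" if "a \<in> vob A" for a
    using that by (auto simp: app_def)
  then show "snd \<sigma> = snd \<tau>"
    using into_end_ex1[OF w] ar_Hom[OF sa] ar_Hom[OF ta] by blast
qed

lemma ext_natob_ar:
  assumes h: "h \<in> ar X (natob V A F G)" and k: "k \<in> ar X (natob V A F G)"
    and eq: "\<And>a n x. \<lbrakk>a \<in> vob A; n \<in> El X; x \<in> El (fob F a); disj n x; disj x n\<rbrakk> \<Longrightarrow>
      nt A F G a (app h n) x = nt A F G a (app k n) x"
  shows "h = k"
proof (rule ext1[OF h k])
  fix n assume n: "n \<in> El X"
  show "app h n = app k n"
    by (rule ext_natob[OF app_in[OF h n] app_in[OF k n]]) (simp_all add: eq n)
qed

lemma wedge_comp: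
  assumes k: "k \<in> ar X (natob V A F G)"
  shows "wedge V A F G X (\<lambda>a. proj V A F G a \<cdot> k)"
proof (rule wedgeI[OF F G ar_dom[OF k]])
  fix a b n f x assume o: "a \<in> vob A" "b \<in> vob A" and e: "n \<in> El X" "f \<in> El (vhom A a b)" "x \<in> El (fob F a)"
    and d: "disj n f" "disj n x" "disj f x"
  show "ap (fob F b) (fob G b) (app (proj V A F G b \<cdot> k) n) (act F a b f x) =
      act G a b f (ap (fob F a) (fob G a) (app (proj V A F G a \<cdot> k) n) x)"
    using wedge_nat[OF F G natob_wedge o app_in[OF k e(1)] e(2,3)] d
    by (simp add: app_comp[OF e(1) k proj_in] o)
qed (rule comp_in[OF k proj_in])

end

subsection \<open>Functor categories\<close>

lemma funcat_simps [simp]: "vob (funcat V A) = {F. vfunctor V A (vself V) F}" "vhom (funcat V A) F G = natob V A F G"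
  by (simp_all add: funcat_def)

context
  fixes A :: "('u, 'o, 'm) vcat"
  assumes A: "small_vcategory V A"
begin

lemma graphA: "vfunctor V A (vself V) F \<Longrightarrow> vgraph A F"
  by (rule vfunctor_vgraph[OF small_vcategory_D[OF A]])

lemma wedge_vcomp_funcat:
  assumes F: "vgraph A F" and G: "vgraph A G" and H: "vgraph A H"
  shows "wedge V A F H (natob V A G H \<otimes> natob V A F G)
      (\<lambda>a. vcomp (vself V) (fob F a) (fob G a) (fob H a) \<cdot> (proj V A G H a \<odot> proj V A F G a))" (is "wedge V A F H ?N ?q")
    and "\<lbrakk>a \<in> vob A; \<sigma> \<in> El (natob V A G H); \<tau> \<in> El (natob V A F G); disj \<sigma> \<tau>;
      x \<in> El (fob F a); disj \<sigma> x; disj \<tau> x\<rbrakk> \<Longrightarrow>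
      ap (fob F a) (fob H a) (app (vcomp (vself V) (fob F a) (fob G a) (fob H a) \<cdot> (proj V A G H a \<odot> proj V A F G a))
         (pair \<sigma> \<tau>)) x = nt A G H a \<sigma> (nt A F G a \<tau> x)"
proof -
  note ob = natob_ob[OF A G H] natob_ob[OF A F G]
  have q: "?q a \<in> ar ?N (ihom (fob F a) (fob H a))" if "a \<in> vob A" for a
    using F G H that by (auto intro!: comp_in[OF tens_in[OF proj_in[OF A G H that] proj_in[OF A F G that]] vcomp_vself_in])
  show *: "ap (fob F a) (fob H a) (app (?q a) (pair \<sigma> \<tau>)) x = nt A G H a \<sigma> (nt A F G a \<tau> x)"
    if a: "a \<in> vob A" and e: "\<sigma> \<in> El (natob V A G H)" "\<tau> \<in> El (natob V A F G)" "disj \<sigma> \<tau>"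
      and x: "x \<in> El (fob F a)" "disj \<sigma> x" "disj \<tau> x" for a \<sigma> \<tau> x
  proof -
    note pa = proj_in[OF A G H a] proj_in[OF A F G a]
    have fo: "fob F a \<in> Ob V" "fob G a \<in> Ob V" "fob H a \<in> Ob V" using F G H a by simp_all
    have "app (?q a) (pair \<sigma> \<tau>) = cmp (vself V) (fob F a) (fob G a) (fob H a) (app (proj V A G H a) \<sigma>) (app (proj V A F G a) \<tau>)"
      using app_comp[OF pair_in[OF e] tens_in[OF pa] vcomp_vself_in[OF fo]] app_tens[OF pa e] by (simp add: cmp_def)
    then show ?thesis
      using ap_cmp_vself[OF fo app_in[OF pa(1) e(1)] app_in[OF pa(2) e(2)] x(1)] e x by (simp add: nt_def)
  qed
  show "wedge V A F H ?N ?q"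
    by (rule wedgeI2[OF F H ob q])
      (use F G H A in \<open>simp_all add: * nt_nat[OF A] nt_in[OF A]\<close>)
qed

lemma vcomp_funcat_in:
  assumes "vgraph A F" "vgraph A G" "vgraph A H"
  shows "vcomp (funcat V A) F G H \<in> ar (natob V A G H \<otimes> natob V A F G) (natob V A F H)"
  using into_end_in[OF A assms(1,3) wedge_vcomp_funcat(1)[OF assms]] by (simp add: funcat_def)

lemma cmp_funcat_in:
  assumes F: "vgraph A F" and G: "vgraph A G" and H: "vgraph A H"
    and e: "\<sigma> \<in> El (natob V A G H)" "\<tau> \<in> El (natob V A F G)" "disj \<sigma> \<tau>"
  shows "cmp (funcat V A) F G H \<sigma> \<tau> \<in> El (natob V A F H)"
  unfolding cmp_def by (rule app_in[OF vcomp_funcat_in[OF F G H] pair_in[OF e]])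

lemma nt_cmp_funcat:
  assumes F: "vgraph A F" and G: "vgraph A G" and H: "vgraph A H" and a: "a \<in> vob A"
    and e: "\<sigma> \<in> El (natob V A G H)" "\<tau> \<in> El (natob V A F G)" "disj \<sigma> \<tau>"
    and x: "x \<in> El (fob F a)" "disj \<sigma> x" "disj \<tau> x"
  shows "nt A F H a (cmp (funcat V A) F G H \<sigma> \<tau>) x = nt A G H a \<sigma> (nt A F G a \<tau> x)"
proof -
  have "cmp (funcat V A) F G H \<sigma> \<tau> = app (into_end V A F H (natob V A G H \<otimes> natob V A F G)
      (\<lambda>a. vcomp (vself V) (fob F a) (fob G a) (fob H a) \<cdot> (proj V A G H a \<odot> proj V A F G a))) (pair \<sigma> \<tau>)"
    by (simp add: cmp_def funcat_def)
  then show ?thesis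
    using nt_into_end[OF A F H wedge_vcomp_funcat(1)[OF F G H] a pair_in[OF e]] wedge_vcomp_funcat(2)[OF F G H a e x] by simp
qed

lemma wedge_vid_funcat:
  assumes F: "vgraph A F" shows "wedge V A F F \<I> (\<lambda>a. vid (vself V) (fob F a))"
proof (rule wedge_unitI[OF F F])
  fix a b f x assume "a \<in> vob A" "b \<in> vob A" "f \<in> El (vhom A a b)" "x \<in> El (fob F a)" "disj f x"
  then show "ap (fob F b) (fob F b) (app (vid (vself V) (fob F b)) one) (act F a b f x) =
      act F a b f (ap (fob F a) (fob F a) (app (vid (vself V) (fob F a)) one) x)"
    using F by (simp add: idn_def[symmetric])
qed (use F in \<open>simp add: vid_vself_in\<close>)

lemma vid_funcat_in: "vgraph A F \<Longrightarrow> vid (funcat V A) F \<in> ar \<I> (natob V A F F)"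
  using into_end_in[OF A _ _ wedge_vid_funcat] by (simp add: funcat_def)

lemma nt_idn_funcat:
  assumes F: "vgraph A F" and a: "a \<in> vob A" and x: "x \<in> El (fob F a)"
  shows "nt A F F a (idn (funcat V A) F) x = x"
proof -
  have "idn (funcat V A) F = app (into_end V A F F \<I> (\<lambda>a. vid (vself V) (fob F a))) one"
    by (simp add: idn_def funcat_def)
  then show ?thesis using nt_into_end[OF A F F wedge_vid_funcat[OF F] a one_in] x by (simp add: idn_def[symmetric])
qed

lemma vcategory_funcat: "vcategory V (funcat V A)"
proof (rule vcategoryI)
  fix F G H K \<rho> \<sigma> \<tau>
  assume o: "F \<in> vob (funcat V A)" "G \<in> vob (funcat V A)" "H \<in> vob (funcat V A)" "K \<in> vob (funcat V A)"
    and e: "\<rho> \<in> El (vhom (funcat V A) H K)" "\<sigma> \<in> El (vhom (funcat V A) G H)" "\<tau> \<in> El (vhom (funcat V A) F G)"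
      "disj \<rho> \<sigma>" "disj \<rho> \<tau>" "disj \<sigma> \<tau>"
  have g: "vgraph A F" "vgraph A G" "vgraph A H" "vgraph A K" using o graphA by simp_all
  show "cmp (funcat V A) F G K (cmp (funcat V A) G H K \<rho> \<sigma>) \<tau> = cmp (funcat V A) F H K \<rho> (cmp (funcat V A) F G H \<sigma> \<tau>)"
    by (rule ext_natob[OF A g(1,4)])
      (use g e in \<open>simp_all add: cmp_funcat_in nt_cmp_funcat nt_in[OF A] join_assoc\<close>)
next
  fix F G \<tau> assume o: "F \<in> vob (funcat V A)" "G \<in> vob (funcat V A)" and t: "\<tau> \<in> El (vhom (funcat V A) F G)"
  have g: "vgraph A F" "vgraph A G" using o graphA by simp_all
  have i: "idn (funcat V A) F \<in> El (natob V A F F)" "idn (funcat V A) G \<in> El (natob V A G G)"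
    unfolding idn_def by (rule app_in[OF vid_funcat_in one_in], rule g)+
  show "cmp (funcat V A) F G G (idn (funcat V A) G) \<tau> = \<tau>"
    by (rule ext_natob[OF A g]) (use g t i in \<open>simp_all add: cmp_funcat_in nt_cmp_funcat nt_in[OF A] nt_idn_funcat\<close>)
  show "cmp (funcat V A) F F G \<tau> (idn (funcat V A) F) = \<tau>"
    by (rule ext_natob[OF A g]) (use g t i in \<open>simp_all add: cmp_funcat_in nt_cmp_funcat nt_in[OF A] nt_idn_funcat\<close>)
qed (auto simp: graphA natob_ob[OF A] vid_funcat_in vcomp_funcat_in)

end

end

section \<open>Weighted limits as universal units\<close>

context smc_closed begin

lemma unnm:
  assumes k: "k \<in> ar \<I> (ihom X Y)" and X: "X \<in> Ob V" and Y: "Y \<in> Ob V"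
  shows unnm_in: "unnm V X Y k \<in> ar X Y"
    and app_unnm: "x \<in> El X \<Longrightarrow> app (unnm V X Y k) x = ap X Y (app k one) x"
proof -
  note i = iv_in[OF lun_isoa[OF X]] and u = vuncurry_in[OF k X Y]
  show "unnm V X Y k \<in> ar X Y" unfolding unnm_def by (rule comp_in[OF i u])
  show "app (unnm V X Y k) x = ap X Y (app k one) x" if "x \<in> El X"
    by (simp add: unnm_def app_comp[OF that i u] app_iv_lun[OF that] app_vuncurry[OF k X Y one_in that])
qed

lemma nm:
  assumes f: "f \<in> ar X Y"
  shows nm_in: "nm V X Y f \<in> ar \<I> (ihom X Y)"
    and ap_nm: "x \<in> El X \<Longrightarrow> ap X Y (app (nm V X Y f) one) x = app f x"
proof -
  note X = ar_dom[OF f]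
  note h = comp_in[OF lun_in[OF X] f]
  show "nm V X Y f \<in> ar \<I> (ihom X Y)" unfolding nm_def by (rule vcurry_in[OF h unit_ob X])
  show "ap X Y (app (nm V X Y f) one) x = app f x" if x: "x \<in> El X"
    using ap_vcurry[OF h one_in x] app_comp[OF pair_in[OF one_in x] lun_in[OF X] f] by (simp add: nm_def app_lun x)
qed

text \<open>
  A wedge \<open>\<pi>\<close> from \<open>\<psi>\<close> to \<open>K(X,D-)\<close> with parameter object \<open>N\<close> amounts to an arrow
  \<open>N \<rightarrow> [A,V](\<psi>, K(X,D-))\<close>. It fits \<open>k : N \<rightarrow> K(X,L)\<close> if it arises by composing the cone \<open>u\<close> with \<open>k\<close>.
\<close>

definition fits where
  "fits A K \<psi> D L u X N \<pi> k \<longleftrightarrow> (\<forall>a\<in>vob A. \<forall>n\<in>El N. \<forall>p\<in>El (fob \<psi> a). disj n p \<longrightarrow>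
     ap (fob \<psi> a) (vhom K X (fob D a)) (app (\<pi> a) n) p = cmp K X L (fob D a) (app (u a) p) (app k n))"

definition weighted_cone where
  "weighted_cone A K \<psi> D L u \<longleftrightarrow> L \<in> vob K \<and>
     (\<forall>a\<in>vob A. u a \<in> ar (fob \<psi> a) (vhom K L (fob D a))) \<and>
     (\<forall>a\<in>vob A. \<forall>b\<in>vob A. \<forall>f\<in>El (vhom A a b). \<forall>p\<in>El (fob \<psi> a). disj f p \<longrightarrow>
        app (u b) (act \<psi> a b f p) = cmp K L (fob D a) (fob D b) (app (far D a b) f) (app (u a) p))"

text \<open>
  The cone \<open>u : \<psi> \<rightarrow> K(L,D-)\<close> is the unit of a limit if \<open>K(X,L) \<rightarrow> [A,V](\<psi>, K(X,D-))\<close>, composition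
  with \<open>u\<close>, is an isomorphism for all \<open>X\<close>. By the Yoneda lemma in \<open>V\<close> this is said with arrows
  out of an arbitrary \<open>N\<close>, which avoids the end on the right.
\<close>

definition limit_unit where
  "limit_unit A K \<psi> D L u \<longleftrightarrow> weighted_cone A K \<psi> D L u \<and>
     (\<forall>X\<in>vob K. \<forall>N \<pi>. wedge V A \<psi> (fcomp V (homfun V K X) D) N \<pi> \<longrightarrow>
        (\<exists>!k. k \<in> ar N (vhom K X L) \<and> fits A K \<psi> D L u X N \<pi> k))"

lemma cone_ob: "weighted_cone A K \<psi> D L u \<Longrightarrow> L \<in> vob K"
  and cone_in: "weighted_cone A K \<psi> D L u \<Longrightarrow> a \<in> vob A \<Longrightarrow> u a \<in> ar (fob \<psi> a) (vhom K L (fob D a))"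
  and cone_nat: "\<lbrakk>weighted_cone A K \<psi> D L u; a \<in> vob A; b \<in> vob A; f \<in> El (vhom A a b);
    p \<in> El (fob \<psi> a); disj f p\<rbrakk> \<Longrightarrow>
    app (u b) (act \<psi> a b f p) = cmp K L (fob D a) (fob D b) (app (far D a b) f) (app (u a) p)"
  and limit_unit_cone: "limit_unit A K \<psi> D L u \<Longrightarrow> weighted_cone A K \<psi> D L u"
  and limit_unit_ex1: "\<lbrakk>limit_unit A K \<psi> D L u; X \<in> vob K; wedge V A \<psi> (fcomp V (homfun V K X) D) N \<pi>\<rbrakk> \<Longrightarrow>
    \<exists>!k. k \<in> ar N (vhom K X L) \<and> fits A K \<psi> D L u X N \<pi> k"
  by (simp_all add: limit_unit_def weighted_cone_def)

lemmas limit_unit_ob = limit_unit_cone[THEN cone_ob]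
  and limit_unit_in = limit_unit_cone[THEN cone_in]
  and limit_unit_nat = limit_unit_cone[THEN cone_nat]

end

context bicomplete_smc begin

context
  fixes A :: "('u, 'o, 'm) vcat" and K :: "('k, 'o, 'm) vcat" and \<psi> :: "('u, 'o, 'm) weight"
    and D :: "('u, 'k, 'm) vfun"
  assumes A: "small_vcategory V A" and K: "vcategory V K" and psi: "vgraph A \<psi>" and D: "vfunctor V A K D"
begin

abbreviation KD where "KD X \<equiv> fcomp V (homfun V K X) D"

lemma vgraph_KD: "X \<in> vob K \<Longrightarrow> vgraph A (KD X)"
  by (rule vgraph_fcomp[OF small_vcategory_D[OF A] K D]) (simp add: K)

lemma act_KD: "\<lbrakk>X \<in> vob K; a \<in> vob A; b \<in> vob A; f \<in> El (vhom A a b); g \<in> El (vhom K X (fob D a));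
    disj f g\<rbrakk> \<Longrightarrow> act (KD X) a b f g = cmp K X (fob D a) (fob D b) (app (far D a b) f) g"
  using act_fcomp[OF small_vcategory_D[OF A] K D] K D far_app_in[OF small_vcategory_D[OF A] K D] by simp

text \<open>
  Every \<open>k : N \<rightarrow> K(X,L)\<close> has a wedge that fits it: naturality is that of the cone.
\<close>

lemma cone_wedge:
  assumes u: "weighted_cone A K \<psi> D L u" and X: "X \<in> vob K" and k: "k \<in> ar N (vhom K X L)"
  obtains q where "wedge V A \<psi> (KD X) N q" "fits A K \<psi> D L u X N q k"
proof -
  note L = cone_ob[OF u] and ui = cone_in[OF u]
  have "\<exists>h. a \<in> vob A \<longrightarrow> h \<in> ar N (ihom (fob \<psi> a) (vhom K X (fob D a))) \<and>
     (\<forall>n p. n \<in> El N \<longrightarrow> p \<in> El (fob \<psi> a) \<longrightarrow> disj n p \<longrightarrow>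
       ap (fob \<psi> a) (vhom K X (fob D a)) (app h n) p = cmp K X L (fob D a) (app (u a) p) (app k n))" for a
  proof (cases "a \<in> vob A")
    case a: True
    have "lin2 N (fob \<psi> a) (vhom K X (fob D a)) (\<lambda>n p. cmp K X L (fob D a) (app (u a) p) (app k n))"
      by (rule lin2_pre1[OF lin1_app[OF k] lin2_swap[OF lin2_pre1[OF lin1_app[OF ui[OF a]] lin2_cmp]]])
        (use K L D a X in simp_all)
    then show ?thesis by (rule lin2_curry) blast
  qed blast
  then obtain q where q: "\<And>a. a \<in> vob A \<Longrightarrow> q a \<in> ar N (ihom (fob \<psi> a) (vhom K X (fob D a)))"
    and q': "\<And>a n p. \<lbrakk>a \<in> vob A; n \<in> El N; p \<in> El (fob \<psi> a); disj n p\<rbrakk> \<Longrightarrow>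
       ap (fob \<psi> a) (vhom K X (fob D a)) (app (q a) n) p = cmp K X L (fob D a) (app (u a) p) (app k n)" by metis
  have "wedge V A \<psi> (KD X) N q"
  proof (rule wedgeI[OF psi vgraph_KD[OF X] ar_dom[OF k]])
    fix a b n f x assume o: "a \<in> vob A" "b \<in> vob A" and h: "n \<in> El N" "f \<in> El (vhom A a b)" "x \<in> El (fob \<psi> a)"
      and d: "disj n f" "disj f n" "disj n x" "disj x n" "disj f x" "disj x f"
    have m: "app (u a) x \<in> El (vhom K L (fob D a))" "app k n \<in> El (vhom K X L)"
      using app_in[OF ui[OF o(1)] h(3)] app_in[OF k h(1)] .
    show "ap (fob \<psi> b) (fob (KD X) b) (app (q b) n) (act \<psi> a b f x) =
      act (KD X) a b f (ap (fob \<psi> a) (fob (KD X) a) (app (q a) n) x)"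
      using o h d X K L D psi m
      by (simp add: q' cone_nat[OF u] act_KD far_app_in[OF small_vcategory_D[OF A] K D] cmp_assoc)
  qed (use q in simp)
  moreover have "fits A K \<psi> D L u X N q k" unfolding fits_def using q' by simp
  ultimately show ?thesis by (rule that)
qed

lemma wedge_nerve:
  assumes X: "X \<in> vob K" and Y: "Y \<in> vob K"
  shows "wedge V A (KD X) (KD Y) (vhom K Y X) (\<lambda>a. far (homfun V (vop V K) (fob D a)) X Y)"
proof (rule wedgeI[OF vgraph_KD[OF X] vgraph_KD[OF Y]])
  have *: "vgraph (vop V K) (homfun V (vop V K) (fob D a))" if "a \<in> vob A" for a
    using K D that by simp
  fix a assume a: "a \<in> vob A"
  show "far (homfun V (vop V K) (fob D a)) X Y \<in> ar (vhom K Y X) (ihom (fob (KD X) a) (fob (KD Y) a))"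
    using vgraph_far[OF *[OF a], of X Y] X Y by simp
next
  fix a b n f x assume o: "a \<in> vob A" "b \<in> vob A" and e: "n \<in> El (vhom K Y X)" "f \<in> El (vhom A a b)" "x \<in> El (fob (KD X) a)"
    and d: "disj n f" "disj f n" "disj n x" "disj x n" "disj f x" "disj x f"
  have **: "ap (vhom K X (fob D a)) (vhom K Y (fob D a)) (app (far (homfun V (vop V K) (fob D a)) X Y) n) y
      = cmp K Y X (fob D a) y n" if "a \<in> vob A" "y \<in> El (vhom K X (fob D a))" "disj n y" for a y
    using act_homfun[of "vop V K" "fob D a" X Y n y] K X Y D that e by (simp add: act_def)
  show "ap (fob (KD X) b) (fob (KD Y) b) (app (far (homfun V (vop V K) (fob D b)) X Y) n) (act (KD X) a b f x) =
    act (KD Y) a b f (ap (fob (KD X) a) (fob (KD Y) a) (app (far (homfun V (vop V K) (fob D a)) X Y) n) x)"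
    using o e d X Y K D by (simp add: ** act_KD far_app_in[OF small_vcategory_D[OF A] K D] cmp_assoc)
qed (use K X Y in simp)

lemma nerve_far:
  assumes X: "X \<in> vob K" and Y: "Y \<in> vob K"
  shows nerve_far_in: "far (nerve V A K D) X Y \<in> ar (vhom K Y X) (natob V A (KD X) (KD Y))"
    and nt_nerve: "\<lbrakk>a \<in> vob A; h \<in> El (vhom K Y X); g \<in> El (vhom K X (fob D a)); disj h g\<rbrakk> \<Longrightarrow>
      nt A (KD X) (KD Y) a (app (far (nerve V A K D) X Y) h) g = cmp K Y X (fob D a) g h"
proof -
  note w = wedge_nerve[OF X Y]
  have f: "far (nerve V A K D) X Y = into_end V A (KD X) (KD Y) (vhom K Y X) (\<lambda>a. far (homfun V (vop V K) (fob D a)) X Y)"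
    by (simp add: nerve_def)
  show "far (nerve V A K D) X Y \<in> ar (vhom K Y X) (natob V A (KD X) (KD Y))"
    unfolding f by (rule into_end_in[OF A vgraph_KD[OF X] vgraph_KD[OF Y] w])
  show "nt A (KD X) (KD Y) a (app (far (nerve V A K D) X Y) h) g = cmp K Y X (fob D a) g h"
    if "a \<in> vob A" "h \<in> El (vhom K Y X)" "g \<in> El (vhom K X (fob D a))" "disj h g"
    unfolding f using nt_into_end[OF A vgraph_KD[OF X] vgraph_KD[OF Y] w that(1,2)]
      act_homfun[of "vop V K" "fob D a" X Y h g] K X Y D that by (simp add: act_def)
qed

lemma KD_vob: "X \<in> vob K \<Longrightarrow> KD X \<in> vob (funcat V A)"
  using vfunctor_fcomp[OF small_vcategory_D[OF A] K vcategory_vself D] K by simp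

abbreviation psiKD where "psiKD \<equiv> fcomp V (homfun V (funcat V A) \<psi>) (nerve V A K D)"

lemma fob_nerve [simp]: "fob (nerve V A K D) X = KD X"
  by (simp add: nerve_def)

lemma wlim_graphs:
  assumes psi': "vfunctor V A (vself V) \<psi>"
  shows vgraph_psiKD: "vgraph (vop V K) psiKD"
    and act_psiKD: "\<lbrakk>X \<in> vob K; Y \<in> vob K; h \<in> El (vhom K Y X); z \<in> El (natob V A \<psi> (KD X)); disj h z\<rbrakk> \<Longrightarrow>
      act psiKD X Y h z = cmp (funcat V A) \<psi> (KD X) (KD Y) (app (far (nerve V A K D) X Y) h) z"
proof -
  have g: "vgraph (funcat V A) (homfun V (funcat V A) \<psi>)" using vcategory_funcat[OF A] psi' by simp
  have f: "far (nerve V A K D) X Y \<in> ar (vhom (vop V K) X Y) (vhom (funcat V A) (fob (nerve V A K D) X) (fob (nerve V A K D) Y))"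
    "fob (nerve V A K D) X \<in> vob (funcat V A)" "fob (nerve V A K D) Y \<in> vob (funcat V A)"
    "far (homfun V (funcat V A) \<psi>) (fob (nerve V A K D) X) (fob (nerve V A K D) Y) \<in>
       ar (vhom (funcat V A) (fob (nerve V A K D) X) (fob (nerve V A K D) Y)) (ihom (fob psiKD X) (fob psiKD Y))"
    if "X \<in> vob K" "Y \<in> vob K" for X Y
    using nerve_far_in[OF that] KD_vob that vgraph_far[OF g, of "KD X" "KD Y"] by simp_all
  show "vgraph (vop V K) psiKD"
    unfolding vgraph_def
  proof (intro conjI ballI)
    fix X assume "X \<in> vob (vop V K)" then show "fob psiKD X \<in> Ob V" using natob_ob[OF A psi vgraph_KD] by simp
  next
    fix X Y assume "X \<in> vob (vop V K)" "Y \<in> vob (vop V K)"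
    then have "X \<in> vob K" "Y \<in> vob K" by simp_all
    from comp_in[OF f(1)[OF this] f(4)[OF this]]
    show "far psiKD X Y \<in> ar (vhom (vop V K) X Y) (ihom (fob psiKD X) (fob psiKD Y))" by (simp add: fcomp_def)
  qed
  assume o: "X \<in> vob K" "Y \<in> vob K" and e: "h \<in> El (vhom K Y X)" "z \<in> El (natob V A \<psi> (KD X))" "disj h z"
  have "app (far psiKD X Y) h = app (far (homfun V (funcat V A) \<psi>) (KD X) (KD Y)) (app (far (nerve V A K D) X Y) h)"
    using far_fcomp[OF _ f(1)[OF o] f(4)[OF o]] e by simp
  then show "act psiKD X Y h z = cmp (funcat V A) \<psi> (KD X) (KD Y) (app (far (nerve V A K D) X Y) h) z"
    using act_homfun[of "funcat V A" \<psi> "KD X" "KD Y" "app (far (nerve V A K D) X Y) h" z]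
      vcategory_funcat[OF A] psi' KD_vob o app_in[OF nerve_far_in[OF o] e(1)] e by (simp add: act_def)
qed

context
  assumes psi': "vfunctor V A (vself V) \<psi>"
begin

context
  fixes L \<theta>
  assumes lim: "is_wlim V A K \<psi> D L \<theta>"
begin

lemma wlim_ob: "L \<in> vob K"
  using lim by (simp add: is_wlim_def)

lemma wlim_isoa: "X \<in> vob K \<Longrightarrow> \<theta> X \<in> isoa (vhom K X L) (natob V A \<psi> (KD X))"
  by (rule isoaI') (use lim K natob_ob[OF A psi vgraph_KD] in \<open>simp_all add: is_wlim_def\<close>)

lemma wlim_nat:
  assumes o: "X \<in> vob K" "Y \<in> vob K" and h: "h \<in> El (vhom K Y X)" and x: "x \<in> El (vhom K X L)" and a: "a \<in> vob A"
    and p: "p \<in> El (fob \<psi> a)" and d: "disj h x" "disj h p" "disj x p"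
  shows "nt A \<psi> (KD Y) a (app (\<theta> Y) (cmp K Y X L x h)) p = cmp K Y X (fob D a) (nt A \<psi> (KD X) a (app (\<theta> X) x) p) h"
proof -
  have n: "vnat V (vop V K) (homfun V (vop V K) L) psiKD \<theta>" using lim by (simp add: is_wlim_def)
  have g: "vgraph (vop V K) (homfun V (vop V K) L)" using K wlim_ob by simp
  have t: "app (\<theta> X) x \<in> El (natob V A \<psi> (KD X))" by (rule app_in[OF isoa_ar[OF wlim_isoa[OF o(1)]] x])
  have "app (\<theta> Y) (cmp K Y X L x h) = act psiKD X Y h (app (\<theta> X) x)"
    using vnat_nat[OF g vgraph_psiKD[OF psi'] n, of X Y h x] o h x d K wlim_ob by simp
  also have "\<dots> = cmp (funcat V A) \<psi> (KD X) (KD Y) (app (far (nerve V A K D) X Y) h) (app (\<theta> X) x)"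
    using act_psiKD[OF psi' o h t] d by simp
  finally show ?thesis
    using nt_cmp_funcat[OF A psi vgraph_KD[OF o(1)] vgraph_KD[OF o(2)] a app_in[OF nerve_far_in[OF o] h] t]
      nt_nerve[OF o a h] nt_in[OF A psi vgraph_KD[OF o(1)] a t p] p d by simp
qed

lemma cylinder:
  assumes X: "X \<in> vob K" and k: "k \<in> ar \<I> (vhom K X L)" and a: "a \<in> vob A"
  shows cylinder_in: "cylinder V A K \<psi> D \<theta> X k a \<in> ar (fob \<psi> a) (vhom K X (fob D a))"
    and app_cylinder: "p \<in> El (fob \<psi> a) \<Longrightarrow>
      app (cylinder V A K \<psi> D \<theta> X k a) p = nt A \<psi> (KD X) a (app (\<theta> X) (app k one)) p"
proof -
  note t = isoa_ar[OF wlim_isoa[OF X]] and pr = proj_in[OF A psi vgraph_KD[OF X] a]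
  note c = comp_in[OF k comp_in[OF t pr]]
  have ob: "fob \<psi> a \<in> Ob V" "vhom K X (fob D a) \<in> Ob V" using psi K D X a by simp_all
  show "cylinder V A K \<psi> D \<theta> X k a \<in> ar (fob \<psi> a) (vhom K X (fob D a))"
    unfolding cylinder_def by (rule unnm_in) (use c ob in simp_all)
  show "app (cylinder V A K \<psi> D \<theta> X k a) p = nt A \<psi> (KD X) a (app (\<theta> X) (app k one)) p" if "p \<in> El (fob \<psi> a)"
    unfolding cylinder_def
    using app_unnm[OF c[simplified] ob that] app_comp[OF one_in k comp_in[OF t pr]] app_comp[OF app_in[OF k one_in] t pr]
    by (simp add: nt_def)
qed

lemma lim_unit_in: "a \<in> vob A \<Longrightarrow> lim_unit V A K \<psi> D L \<theta> a \<in> ar (fob \<psi> a) (vhom K L (fob D a))"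
  unfolding lim_unit_def by (rule cylinder_in[OF wlim_ob vid_in[OF K wlim_ob]])

lemma app_lim_unit: "a \<in> vob A \<Longrightarrow> p \<in> El (fob \<psi> a) \<Longrightarrow>
    app (lim_unit V A K \<psi> D L \<theta> a) p = nt A \<psi> (KD L) a (app (\<theta> L) (idn K L)) p"
  unfolding lim_unit_def using app_cylinder[OF wlim_ob vid_in[OF K wlim_ob]] by (simp add: idn_def)

text \<open>
  The Yoneda lemma for the representation \<open>\<theta>\<close>: naturality along \<open>h\<close>, applied to the identity of \<open>L\<close>,
  shows that \<open>\<theta>\<close> is composition with its unit.
\<close>

lemma nt_wlim:
  assumes X: "X \<in> vob K" and h: "h \<in> El (vhom K X L)" and a: "a \<in> vob A" and p: "p \<in> El (fob \<psi> a)" and d: "disj h p"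
  shows "nt A \<psi> (KD X) a (app (\<theta> X) h) p = cmp K X L (fob D a) (app (lim_unit V A K \<psi> D L \<theta> a) p) h"
  using wlim_nat[OF wlim_ob X h idn_in[OF K wlim_ob] a p] d K X h wlim_ob by (simp add: app_lim_unit[OF a p])

lemma app_cylinder_unit:
  assumes X: "X \<in> vob K" and k: "k \<in> ar \<I> (vhom K X L)" and a: "a \<in> vob A" and p: "p \<in> El (fob \<psi> a)"
  shows "app (cylinder V A K \<psi> D \<theta> X k a) p = cmp K X L (fob D a) (app (lim_unit V A K \<psi> D L \<theta> a) p) (app k one)"
  using app_cylinder[OF X k a p] nt_wlim[OF X app_in[OF k one_in] a p] by simp

text \<open>
  Through the end, a wedge from \<open>\<psi>\<close> to \<open>K(X,D-)\<close> is an arrow \<open>m\<close> out of \<open>N\<close>, and the arrow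
  that it fits is \<open>\<theta>\<^sub>X\<inverse> m\<close>.
\<close>

lemma limit_unit_of_wlim: "limit_unit A K \<psi> D L (lim_unit V A K \<psi> D L \<theta>)"
  unfolding limit_unit_def weighted_cone_def
proof (intro conjI ballI allI impI)
  let ?u = "lim_unit V A K \<psi> D L \<theta>"
  have il: "app (\<theta> L) (idn K L) \<in> El (natob V A \<psi> (KD L))"
    by (rule app_in[OF isoa_ar[OF wlim_isoa[OF wlim_ob]] idn_in[OF K wlim_ob]])
  show "L \<in> vob K" by (rule wlim_ob)
  show "?u a \<in> ar (fob \<psi> a) (vhom K L (fob D a))" if "a \<in> vob A" for a using lim_unit_in[OF that] .
  fix a b f p assume o: "a \<in> vob A" "b \<in> vob A" and e: "f \<in> El (vhom A a b)" "p \<in> El (fob \<psi> a)" "disj f p"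
  show "app (?u b) (act \<psi> a b f p) = cmp K L (fob D a) (fob D b) (app (far D a b) f) (app (?u a) p)"
    using nt_nat[OF A psi vgraph_KD[OF wlim_ob] o il e(1,2)] e psi o wlim_ob
      act_KD[OF wlim_ob o e(1)] app_in[OF lim_unit_in[OF o(1)] e(2)]
    by (simp add: app_lim_unit[symmetric] disj_def)
next
  let ?u = "lim_unit V A K \<psi> D L \<theta>"
  fix X N \<pi> assume X: "X \<in> vob K" and w: "wedge V A \<psi> (KD X) N \<pi>"
  note g = vgraph_KD[OF X]
  let ?m = "into_end V A \<psi> (KD X) N \<pi>"
  note m = into_end_in[OF A psi g w] and t = wlim_isoa[OF X]
  show "\<exists>!k. k \<in> ar N (vhom K X L) \<and> fits A K \<psi> D L ?u X N \<pi> k"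
  proof (rule ex1I, intro conjI)
    let ?k = "iv (vhom K X L) (natob V A \<psi> (KD X)) (\<theta> X) \<cdot> ?m"
    show k: "?k \<in> ar N (vhom K X L)" by (rule comp_in[OF m iv_in[OF t]])
    show "fits A K \<psi> D L ?u X N \<pi> ?k"
      unfolding fits_def
    proof (intro ballI impI)
      fix a n p assume a: "a \<in> vob A" and n: "n \<in> El N" and p: "p \<in> El (fob \<psi> a)" and d: "disj n p"
      have "app (\<theta> X) (app ?k n) = app ?m n"
        using app_comp[OF n m iv_in[OF t]] app_iv(2)[OF t app_in[OF m n]] by simp
      then show "ap (fob \<psi> a) (vhom K X (fob D a)) (app (\<pi> a) n) p = cmp K X L (fob D a) (app (?u a) p) (app ?k n)"
        using nt_wlim[OF X app_in[OF k n] a p] d nt_into_end[OF A psi g w a n, of p] by simp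
    qed
    fix k' assume k': "k' \<in> ar N (vhom K X L) \<and> fits A K \<psi> D L ?u X N \<pi> k'"
    then have k'': "k' \<in> ar N (vhom K X L)" by simp
    have "\<theta> X \<cdot> k' = \<theta> X \<cdot> ?k"
    proof (rule ext_natob_ar[OF A psi g comp_in[OF k'' isoa_ar[OF t]] comp_in[OF k isoa_ar[OF t]]])
      fix a n p assume a: "a \<in> vob A" and n: "n \<in> El N" and p: "p \<in> El (fob \<psi> a)" and d: "disj n p"
      have "app (\<theta> X) (app ?k n) = app ?m n"
        using app_comp[OF n m iv_in[OF t]] app_iv(2)[OF t app_in[OF m n]] by simp
      then show "nt A \<psi> (KD X) a (app (\<theta> X \<cdot> k') n) p = nt A \<psi> (KD X) a (app (\<theta> X \<cdot> ?k) n) p"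
        using k' a n p d nt_wlim[OF X app_in[OF k'' n] a p] nt_into_end[OF A psi g w a n, of p]
        by (simp add: fits_def app_comp[OF n k'' isoa_ar[OF t]] app_comp[OF n k isoa_ar[OF t]])
    qed
    then show "k' = ?k" by (rule iso_mono[OF t k'' k])
  qed
qed

end

text \<open>
  The universal property for \<open>N = [A,V](\<psi>, K(X,D-))\<close> and the wedge of projections yields the inverse
  of composition with \<open>u\<close>.
\<close>

lemma wlim_of_limit_unit:
  assumes u: "limit_unit A K \<psi> D L u"
  shows "\<exists>\<theta>. is_wlim V A K \<psi> D L \<theta> \<and> (\<forall>a\<in>vob A. lim_unit V A K \<psi> D L \<theta> a = u a)"
proof -
  note L = limit_unit_ob[OF u] and ui = limit_unit_in[OF u]
  have "\<exists>q. X \<in> vob K \<longrightarrow> wedge V A \<psi> (KD X) (vhom K X L) q \<and> fits A K \<psi> D L u X (vhom K X L) q (\<one> (vhom K X L))" for X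
    using cone_wedge[OF limit_unit_cone[OF u] _ id_in] K L by (metis vhom_ob)
  then obtain q where w: "\<And>X. X \<in> vob K \<Longrightarrow> wedge V A \<psi> (KD X) (vhom K X L) (q X)"
    and qf: "\<And>X. X \<in> vob K \<Longrightarrow> fits A K \<psi> D L u X (vhom K X L) (q X) (\<one> (vhom K X L))" by metis
  have q': "ap (fob \<psi> a) (vhom K X (fob D a)) (app (q X a) n) p = cmp K X L (fob D a) (app (u a) p) n"
    if "X \<in> vob K" "a \<in> vob A" "n \<in> El (vhom K X L)" "p \<in> El (fob \<psi> a)" "disj n p" for X a n p
    using qf[OF that(1)] that by (simp add: fits_def app_id)
  define \<theta> where "\<theta> X = into_end V A \<psi> (KD X) (vhom K X L) (q X)" for X
  have t: "\<theta> X \<in> ar (vhom K X L) (natob V A \<psi> (KD X))" if X: "X \<in> vob K" for X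
    unfolding \<theta>_def by (rule into_end_in[OF A psi vgraph_KD[OF X] w[OF X]])
  have t': "nt A \<psi> (KD X) a (app (\<theta> X) n) p = cmp K X L (fob D a) (app (u a) p) n"
    if "X \<in> vob K" "a \<in> vob A" "n \<in> El (vhom K X L)" "p \<in> El (fob \<psi> a)" "disj n p" for X a n p
    using nt_into_end[OF A psi vgraph_KD[OF that(1)] w[OF that(1)] that(2,3)] q'[OF that] by (simp add: \<theta>_def)
  have iso: "\<theta> X \<in> isoa (vhom K X L) (natob V A \<psi> (KD X))" if X: "X \<in> vob K" for X
  proof -
    note g = vgraph_KD[OF X]
    obtain k where k: "k \<in> ar (natob V A \<psi> (KD X)) (vhom K X L)"
      and kf: "fits A K \<psi> D L u X (natob V A \<psi> (KD X)) (proj V A \<psi> (KD X)) k"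
      using limit_unit_ex1[OF u X natob_wedge[OF A psi g]] by blast
    have "\<theta> X \<cdot> k = \<one> (natob V A \<psi> (KD X))"
    proof (rule ext_natob_ar[OF A psi g comp_in[OF k t[OF X]] id_in[OF ar_dom[OF k]]])
      fix a n p assume a: "a \<in> vob A" and n: "n \<in> El (natob V A \<psi> (KD X))" and p: "p \<in> El (fob \<psi> a)" and d: "disj n p"
      show "nt A \<psi> (KD X) a (app (\<theta> X \<cdot> k) n) p = nt A \<psi> (KD X) a (app (\<one> (natob V A \<psi> (KD X))) n) p"
        using kf a n p d t'[OF X a app_in[OF k n] p]
        by (simp add: fits_def app_comp[OF n k t[OF X]] app_id[OF n] nt_def)
    qed
    moreover have "k \<cdot> \<theta> X = \<one> (vhom K X L)"
    proof -
      have "fits A K \<psi> D L u X (vhom K X L) (q X) (k \<cdot> \<theta> X)"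
        unfolding fits_def
      proof (intro ballI impI)
        fix a n p assume a: "a \<in> vob A" and n: "n \<in> El (vhom K X L)" and p: "p \<in> El (fob \<psi> a)" and d: "disj n p"
        have "ap (fob \<psi> a) (vhom K X (fob D a)) (app (q X a) n) p = nt A \<psi> (KD X) a (app (\<theta> X) n) p"
          using q'[OF X a n p d] t'[OF X a n p d] by simp
        then show "ap (fob \<psi> a) (vhom K X (fob D a)) (app (q X a) n) p = cmp K X L (fob D a) (app (u a) p) (app (k \<cdot> \<theta> X) n)"
          using kf a p d app_in[OF t[OF X] n] by (simp add: fits_def app_comp[OF n t[OF X] k] nt_def)
      qed
      moreover note qf[OF X]
      ultimately show ?thesis
        using limit_unit_ex1[OF u X w[OF X]] comp_in[OF t[OF X] k] id_in[OF ar_cod[OF k]] by blast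
    qed
    ultimately show ?thesis using isoaI[OF t[OF X] k] by blast
  qed
  have lim: "is_wlim V A K \<psi> D L \<theta>"
    unfolding is_wlim_def
  proof (intro conjI ballI)
    show "L \<in> vob K" by (rule L)
    show "iso V (vhom K X L) (natob V A \<psi> (KD X)) (\<theta> X)" if "X \<in> vob K" for X
      using isoa_iso[OF iso[OF that]] .
    show "vnat V (vop V K) (homfun V (vop V K) L) psiKD \<theta>"
    proof (rule vnatI[OF _ vgraph_psiKD[OF psi']])
      show "vgraph (vop V K) (homfun V (vop V K) L)" using K L by simp
      fix X Y h x assume "X \<in> vob (vop V K)" "Y \<in> vob (vop V K)" "h \<in> El (vhom (vop V K) X Y)"
        "x \<in> El (fob (homfun V (vop V K) L) X)" "disj h x" "disj x h"
      then have o: "X \<in> vob K" "Y \<in> vob K" and e: "h \<in> El (vhom K Y X)" "x \<in> El (vhom K X L)" "disj h x" "disj x h"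
        by simp_all
      note tx = app_in[OF t[OF o(1)] e(2)] and ny = app_in[OF nerve_far_in[OF o] e(1)]
      have c: "cmp K Y X L x h \<in> El (vhom K Y L)" using K o L e by simp
      have "app (\<theta> Y) (cmp K Y X L x h) = cmp (funcat V A) \<psi> (KD X) (KD Y) (app (far (nerve V A K D) X Y) h) (app (\<theta> X) x)"
      proof (rule ext_natob[OF A psi vgraph_KD[OF o(2)] app_in[OF t[OF o(2)] c]])
        show "cmp (funcat V A) \<psi> (KD X) (KD Y) (app (far (nerve V A K D) X Y) h) (app (\<theta> X) x) \<in> El (natob V A \<psi> (KD Y))"
          by (rule cmp_funcat_in[OF A psi vgraph_KD[OF o(1)] vgraph_KD[OF o(2)] ny tx]) (simp add: e)
        fix a p assume a: "a \<in> vob A" and p: "p \<in> El (fob \<psi> a)" and "disj (app (\<theta> Y) (cmp K Y X L x h)) p"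
          "disj p (app (\<theta> Y) (cmp K Y X L x h))"
        then have d: "disj h p" "disj x p" "disj p h" "disj p x" by simp_all
        have m: "app (u a) p \<in> El (vhom K L (fob D a))" by (rule app_in[OF ui[OF a] p])
        show "nt A \<psi> (KD Y) a (app (\<theta> Y) (cmp K Y X L x h)) p =
           nt A \<psi> (KD Y) a (cmp (funcat V A) \<psi> (KD X) (KD Y) (app (far (nerve V A K D) X Y) h) (app (\<theta> X) x)) p"
          using nt_cmp_funcat[OF A psi vgraph_KD[OF o(1)] vgraph_KD[OF o(2)] a ny tx _ p] a p d e o K D L m
          by (simp add: t' nt_nerve cmp_assoc)
      qed (simp add: join_ac)
      then show "app (\<theta> Y) (act (homfun V (vop V K) L) X Y h x) = act psiKD X Y h (app (\<theta> X) x)"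
        using act_psiKD[OF psi' o e(1) tx] e o K L by simp
    qed (use t in simp)
  qed
  moreover have "lim_unit V A K \<psi> D L \<theta> a = u a" if a: "a \<in> vob A" for a
  proof (rule ext1[OF lim_unit_in[OF lim a] ui[OF a]])
    fix p assume p: "p \<in> El (fob \<psi> a)"
    show "app (lim_unit V A K \<psi> D L \<theta> a) p = app (u a) p"
      using app_lim_unit[OF lim a p] t'[OF L a idn_in[OF K L] p] K L D a app_in[OF ui[OF a] p] by simp
  qed
  ultimately show ?thesis by blast
qed

end
end
end

context bicomplete_smc begin

text \<open>
  The components of a limit cone are jointly monic, also on elements: an element \<open>k\<close> is an arrow out
  of its stage, and that arrow is determined by the wedge that fits it.
\<close>

lemma limit_unit_ext:
  fixes A :: "('u, 'o, 'm) vcat" and K :: "('k, 'o, 'm) vcat"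
  assumes A: "small_vcategory V A" and K: "vcategory V K" and psi: "vgraph A \<psi>" and D: "vfunctor V A K D"
    and u: "limit_unit A K \<psi> D L u" and X: "X \<in> vob K"
    and k: "k \<in> El (vhom K X L)" and k': "k' \<in> El (vhom K X L)" and st: "fst k = fst k'"
    and eq: "\<And>a p. \<lbrakk>a \<in> vob A; p \<in> El (fob \<psi> a); disj k p; disj p k; disj k' p; disj p k'\<rbrakk> \<Longrightarrow>
      cmp K X L (fob D a) (app (u a) p) k = cmp K X L (fob D a) (app (u a) p) k'"
  shows "k = k'"
proof -
  let ?N = "stage_ob (fst k)"
  note L = limit_unit_ob[OF u] and ui = limit_unit_in[OF u]
  note ka = El_ar[OF k] and ka' = El_ar[OF k', folded st]
  have N: "?N \<in> Ob V" using ar_dom[OF ka] .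
  \<comment> \<open>The identity, as an element at the stage of \<open>k\<close>: \<open>k\<close> and \<open>k'\<close> are images of it.\<close>
  let ?e = "(fst k, \<one> ?N)"
  have e: "?e \<in> El ?N" using N El_stage[OF k] by (simp add: El_def)
  have ke: "app (snd k) ?e = k" "app (snd k') ?e = k'"
    using comp_id[OF ka] comp_id[OF ka'] st by (simp_all add: app_def prod_eq_iff)
  obtain q where w: "wedge V A \<psi> (fcomp V (homfun V K X) D) ?N q" and qf: "fits A K \<psi> D L u X ?N q (snd k)"
    by (rule cone_wedge[OF A K psi D limit_unit_cone[OF u] X ka])
  obtain q' where w': "wedge V A \<psi> (fcomp V (homfun V K X) D) ?N q'" and qf': "fits A K \<psi> D L u X ?N q' (snd k')"
    by (rule cone_wedge[OF A K psi D limit_unit_cone[OF u] X ka'])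
  note g = vgraph_KD[OF A K psi D X]
  have "q a = q' a" if a: "a \<in> vob A" for a
  proof -
    have q: "q a \<in> ar ?N (ihom (fob \<psi> a) (vhom K X (fob D a)))" "q' a \<in> ar ?N (ihom (fob \<psi> a) (vhom K X (fob D a)))"
      using wedge_in[OF psi g w a] wedge_in[OF psi g w' a] by simp_all
    have "app (q a) ?e = app (q' a) ?e"
    proof (rule ext_ihom[OF app_in[OF q(1) e] app_in[OF q(2) e]])
      fix x assume x: "x \<in> El (fob \<psi> a)" and d: "disj (app (q a) ?e) x" "disj x (app (q a) ?e)"
      have "disj ?e x" using d by simp
      moreover have "disj k x" "disj x k" "disj k' x" "disj x k'" using d st by (simp_all add: disj_def)
      ultimately show "ap (fob \<psi> a) (vhom K X (fob D a)) (app (q a) ?e) x = ap (fob \<psi> a) (vhom K X (fob D a)) (app (q' a) ?e) x"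
        using qf qf' a e x eq[OF a x] ke by (simp add: fits_def)
    qed (use a psi K D X in simp_all)
    then show ?thesis using comp_id[OF q(1)] comp_id[OF q(2)] by (simp add: app_def)
  qed
  then have "fits A K \<psi> D L u X ?N q (snd k')" using qf' by (simp add: fits_def)
  then have "snd k = snd k'" using qf limit_unit_ex1[OF u X w] ka ka' by blast
  then show ?thesis using st by (simp add: prod_eq_iff)
qed

section \<open>Weighted colimits in the base\<close>

context
  fixes E :: "('u, 'o, 'm) vcat" and \<phi> F :: "('u, 'o, 'm) vfun"
  assumes E: "small_vcategory V E" and phi: "vfunctor V (vop V E) (vself V) \<phi>" and F: "vfunctor V E (vself V) F"
begin

text \<open>
  \<open>\<phi> \<star> F\<close> is the limit of \<open>F\<^sup>o\<^sup>p\<close> in \<open>V\<^sup>o\<^sup>p\<close>, so its wedges go from \<open>\<phi>\<close> to \<open>[F-,X]\<close>.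
\<close>

abbreviation hom_into where "hom_into X \<equiv> fcomp V (homfun V (vop V (vself V)) X) (fop F)"

lemma col_E: "vcategory V E" and col_A: "small_vcategory V (vop V E)" and col_K: "vcategory V (vop V (vself V))"
  and col_psi: "vgraph (vop V E) \<phi>" and col_F: "vgraph E F"
  and col_D: "vfunctor V (vop V E) (vop V (vself V)) (fop F)"
  using E phi F by (simp_all add: vfunctor_vgraph vfunctor_fop)

lemma col_ob [simp]: "e \<in> vob E \<Longrightarrow> fob \<phi> e \<in> Ob V" "e \<in> vob E \<Longrightarrow> fob F e \<in> Ob V"
  using col_psi col_F by simp_all

lemma col_far [simp]: "\<lbrakk>a \<in> vob E; b \<in> vob E; f \<in> El (vhom E a b)\<rbrakk> \<Longrightarrow> app (far F a b) f \<in> El (ihom (fob F a) (fob F b))"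
  using col_F by simp

lemma act_phi_in [simp]: "\<lbrakk>a \<in> vob E; b \<in> vob E; f \<in> El (vhom E b a); p \<in> El (fob \<phi> a); disj f p\<rbrakk> \<Longrightarrow>
   act \<phi> a b f p \<in> El (fob \<phi> b)"
  using act_in[OF col_psi, of a b f p] by simp

lemma hom_into_graph: "X \<in> Ob V \<Longrightarrow> vgraph (vop V E) (hom_into X)"
  by (rule vgraph_KD[OF col_A col_K col_psi col_D]) simp

lemma ap_act_hom_into:
  assumes X: "X \<in> Ob V" and o: "a \<in> vob E" "b \<in> vob E" and f: "f \<in> El (vhom E b a)" and g: "g \<in> El (ihom (fob F a) X)"
    and x: "x \<in> El (fob F b)" and d: "disj f g" "disj f x" "disj g x"
  shows "ap (fob F b) X (act (hom_into X) a b f g) x = ap (fob F a) X g (act F b a f x)"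
proof -
  have d': "disj g f" using d by (simp add: disj_commute)
  have "act (hom_into X) a b f g = cmp (vself V) (fob F b) (fob F a) X g (app (far F b a) f)"
    using act_KD[OF col_A col_K col_psi col_D, of X a b f g] X o f g d d' by simp
  then show ?thesis using o X f g x d d' by (simp add: act_def)
qed

lemma hom_into_wedgeI:
  assumes X: "X \<in> Ob V" and N: "N \<in> Ob V" and p: "\<And>a. a \<in> vob E \<Longrightarrow> \<pi> a \<in> ar N (ihom (fob \<phi> a) (ihom (fob F a) X))"
    and eq: "\<And>a b n f p x. \<lbrakk>a \<in> vob E; b \<in> vob E; n \<in> El N; f \<in> El (vhom E b a); p \<in> El (fob \<phi> a);
      x \<in> El (fob F b); disj n f; disj f n; disj n p; disj p n; disj n x; disj x n;
      disj f p; disj p f; disj f x; disj x f; disj p x; disj x p\<rbrakk> \<Longrightarrow>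
      ap (fob F b) X (ap (fob \<phi> b) (ihom (fob F b) X) (app (\<pi> b) n) (act \<phi> a b f p)) x =
      ap (fob F a) X (ap (fob \<phi> a) (ihom (fob F a) X) (app (\<pi> a) n) p) (act F b a f x)"
  shows "wedge V (vop V E) \<phi> (hom_into X) N \<pi>"
proof (rule wedgeI[OF col_psi hom_into_graph[OF X] N])
  fix a b n f p assume "a \<in> vob (vop V E)" "b \<in> vob (vop V E)" and n: "n \<in> El N" and "f \<in> El (vhom (vop V E) a b)"
    and q: "p \<in> El (fob \<phi> a)" and d: "disj n f" "disj f n" "disj n p" "disj p n" "disj f p" "disj p f"
  then have o: "a \<in> vob E" "b \<in> vob E" and f: "f \<in> El (vhom E b a)" by simp_all
  note m = app_in[OF assms(3)[OF o(1)] n] app_in[OF assms(3)[OF o(2)] n]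
  have g: "act (hom_into X) a b f (ap (fob \<phi> a) (ihom (fob F a) X) (app (\<pi> a) n) p) \<in> El (ihom (fob F b) X)"
    using act_in[OF hom_into_graph[OF X], of a b f "ap (fob \<phi> a) (ihom (fob F a) X) (app (\<pi> a) n) p"] o f q m d X by simp
  show "ap (fob \<phi> b) (fob (hom_into X) b) (app (\<pi> b) n) (act \<phi> a b f p) =
    act (hom_into X) a b f (ap (fob \<phi> a) (fob (hom_into X) a) (app (\<pi> a) n) p)"
    unfolding fob_simps homfun_fob vop_simps vself_simps
  proof (rule ext_ihom[OF _ g])
    fix x assume x: "x \<in> El (fob F b)" and "disj (ap (fob \<phi> b) (ihom (fob F b) X) (app (\<pi> b) n) (act \<phi> a b f p)) x"
      "disj x (ap (fob \<phi> b) (ihom (fob F b) X) (app (\<pi> b) n) (act \<phi> a b f p))"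
    then have d': "disj n x" "disj f x" "disj p x" "disj x n" "disj x f" "disj x p" by simp_all
    show "ap (fob F b) X (ap (fob \<phi> b) (ihom (fob F b) X) (app (\<pi> b) n) (act \<phi> a b f p)) x =
      ap (fob F b) X (act (hom_into X) a b f (ap (fob \<phi> a) (ihom (fob F a) X) (app (\<pi> a) n) p)) x"
      using eq[OF o n f q x] ap_act_hom_into[OF X o f _ x] o m q d d' X by simp
  qed (use o m f q d X in \<open>simp_all add: join_ac\<close>)
qed (use p in simp)

lemma hom_into_wedge_unitI:
  assumes X: "X \<in> Ob V" and p: "\<And>a. a \<in> vob E \<Longrightarrow> \<pi> a \<in> ar \<I> (ihom (fob \<phi> a) (ihom (fob F a) X))"
    and eq: "\<And>a b f p x. \<lbrakk>a \<in> vob E; b \<in> vob E; f \<in> El (vhom E b a); p \<in> El (fob \<phi> a);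
      x \<in> El (fob F b); disj f p; disj p f; disj f x; disj x f; disj p x; disj x p\<rbrakk> \<Longrightarrow>
      ap (fob F b) X (ap (fob \<phi> b) (ihom (fob F b) X) (app (\<pi> b) one) (act \<phi> a b f p)) x =
      ap (fob F a) X (ap (fob \<phi> a) (ihom (fob F a) X) (app (\<pi> a) one) p) (act F b a f x)"
  shows "wedge V (vop V E) \<phi> (hom_into X) \<I> \<pi>"
proof (rule wedge_unitI[OF col_psi hom_into_graph[OF X]])
  fix a b f p assume "a \<in> vob (vop V E)" "b \<in> vob (vop V E)" and "f \<in> El (vhom (vop V E) a b)"
    and q: "p \<in> El (fob \<phi> a)" and d: "disj f p" "disj p f"
  then have o: "a \<in> vob E" "b \<in> vob E" and f: "f \<in> El (vhom E b a)" by simp_all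
  note m = app_in[OF assms(2)[OF o(1)] one_in] app_in[OF assms(2)[OF o(2)] one_in]
  have g: "act (hom_into X) a b f (ap (fob \<phi> a) (ihom (fob F a) X) (app (\<pi> a) one) p) \<in> El (ihom (fob F b) X)"
    using act_in[OF hom_into_graph[OF X], of a b f "ap (fob \<phi> a) (ihom (fob F a) X) (app (\<pi> a) one) p"] o f q m d X by simp
  show "ap (fob \<phi> b) (fob (hom_into X) b) (app (\<pi> b) one) (act \<phi> a b f p) =
    act (hom_into X) a b f (ap (fob \<phi> a) (fob (hom_into X) a) (app (\<pi> a) one) p)"
    unfolding fob_simps homfun_fob vop_simps vself_simps
  proof (rule ext_ihom[OF _ g])
    fix x assume x: "x \<in> El (fob F b)" and "disj (ap (fob \<phi> b) (ihom (fob F b) X) (app (\<pi> b) one) (act \<phi> a b f p)) x"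
      "disj x (ap (fob \<phi> b) (ihom (fob F b) X) (app (\<pi> b) one) (act \<phi> a b f p))"
    then have d': "disj f x" "disj p x" "disj x f" "disj x p" by simp_all
    show "ap (fob F b) X (ap (fob \<phi> b) (ihom (fob F b) X) (app (\<pi> b) one) (act \<phi> a b f p)) x =
      ap (fob F b) X (act (hom_into X) a b f (ap (fob \<phi> a) (ihom (fob F a) X) (app (\<pi> a) one) p)) x"
      using eq[OF o f q x] ap_act_hom_into[OF X o f _ x] o m q d d' X by simp
  qed (use o m f q d X in \<open>simp_all add: join_ac\<close>)
qed (use p in simp)

lemma hom_into_wedge_nat:
  assumes X: "X \<in> Ob V" and w: "wedge V (vop V E) \<phi> (hom_into X) N \<pi>"
  shows hom_into_wedge_in: "a \<in> vob E \<Longrightarrow> \<pi> a \<in> ar N (ihom (fob \<phi> a) (ihom (fob F a) X))"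
    and "\<lbrakk>a \<in> vob E; b \<in> vob E; n \<in> El N; f \<in> El (vhom E b a); p \<in> El (fob \<phi> a);
      x \<in> El (fob F b); disj n f; disj n p; disj n x; disj f p; disj f x; disj p x\<rbrakk> \<Longrightarrow>
      ap (fob F b) X (ap (fob \<phi> b) (ihom (fob F b) X) (app (\<pi> b) n) (act \<phi> a b f p)) x =
      ap (fob F a) X (ap (fob \<phi> a) (ihom (fob F a) X) (app (\<pi> a) n) p) (act F b a f x)"
proof -
  show pi: "\<pi> a \<in> ar N (ihom (fob \<phi> a) (ihom (fob F a) X))" if "a \<in> vob E" for a
    using wedge_in[OF col_psi hom_into_graph[OF X] w, of a] that by simp
  assume o: "a \<in> vob E" "b \<in> vob E" and n: "n \<in> El N" and f: "f \<in> El (vhom E b a)" and p: "p \<in> El (fob \<phi> a)"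
    and x: "x \<in> El (fob F b)" and d: "disj n f" "disj n p" "disj n x" "disj f p" "disj f x" "disj p x"
  then have d': "disj f n" by (simp add: disj_commute)
  show "ap (fob F b) X (ap (fob \<phi> b) (ihom (fob F b) X) (app (\<pi> b) n) (act \<phi> a b f p)) x =
      ap (fob F a) X (ap (fob \<phi> a) (ihom (fob F a) X) (app (\<pi> a) n) p) (act F b a f x)"
    using wedge_nat[OF col_psi hom_into_graph[OF X] w, of a b n f p] ap_act_hom_into[OF X o f _ x, of "ap (fob \<phi> a) (ihom (fob F a) X) (app (\<pi> a) n) p"]
      o n f p x d d' X app_in[OF pi[OF o(1)] n] by simp
qed

text \<open>
  The colimit is the coend of the \<open>\<phi>a \<otimes> Fa\<close>, a colimit of parallel pairs
  \<open>(\<phi>a \<otimes> E(b,a)) \<otimes> Fb \<rightarrow> \<phi>a \<otimes> Fa, \<phi>b \<otimes> Fb\<close>. Its universal property in \<open>V\<close> only concerns arrows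
  \<open>C \<rightarrow> Z\<close>; the enriched one, about arrows \<open>N \<rightarrow> [C,X]\<close>, is the case \<open>Z = [N,X]\<close>.
\<close>

lemma wcolim_exists: "\<exists>C \<theta>. is_wcolim V E (vself V) \<phi> F C \<theta>"
proof -
  let ?S = "vob E"
  have S: "small ?S" using E by (simp add: small_vcategory_def)
  let ?X = "\<lambda>a. fob \<phi> a \<otimes> fob F a"
  let ?Y = "\<lambda>a b. (fob \<phi> a \<otimes> vhom E b a) \<otimes> fob F b"
  have "\<exists>h. a \<in> ?S \<longrightarrow> b \<in> ?S \<longrightarrow> h \<in> ar (?Y a b) (?X a) \<and>
     (\<forall>p\<in>El (fob \<phi> a). \<forall>f\<in>El (vhom E b a). \<forall>x\<in>El (fob F b). disj p f \<longrightarrow> disj p x \<longrightarrow> disj f x \<longrightarrow>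
       app h (pair (pair p f) x) = pair p (act F b a f x))" for a b
  proof (cases "a \<in> ?S \<and> b \<in> ?S")
    case True
    then have o: "a \<in> ?S" "b \<in> ?S" by simp_all
    have "lin3 (fob \<phi> a) (vhom E b a) (fob F b) (?X a) (\<lambda>p f x. pair p (act F b a f x))"
      using lin3_swap12[OF lin3_swap23[OF lin3_l[OF lin2_act[OF col_F o(2,1)] lin2_swap[OF lin2_pair]]]] o by simp
    then show ?thesis unfolding lin3_def by blast
  qed blast
  then obtain l where l: "\<And>a b. a \<in> ?S \<Longrightarrow> b \<in> ?S \<Longrightarrow> l a b \<in> ar (?Y a b) (?X a)"
    and l': "\<And>a b p f x. \<lbrakk>a \<in> ?S; b \<in> ?S; p \<in> El (fob \<phi> a); f \<in> El (vhom E b a); x \<in> El (fob F b);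
      disj p f; disj p x; disj f x\<rbrakk> \<Longrightarrow> app (l a b) (pair (pair p f) x) = pair p (act F b a f x)" by metis
  have "\<exists>h. a \<in> ?S \<longrightarrow> b \<in> ?S \<longrightarrow> h \<in> ar (?Y a b) (?X b) \<and>
     (\<forall>p\<in>El (fob \<phi> a). \<forall>f\<in>El (vhom E b a). \<forall>x\<in>El (fob F b). disj p f \<longrightarrow> disj p x \<longrightarrow> disj f x \<longrightarrow>
       app h (pair (pair p f) x) = pair (act \<phi> a b f p) x)" for a b
  proof (cases "a \<in> ?S \<and> b \<in> ?S")
    case True
    then have o: "a \<in> ?S" "b \<in> ?S" by simp_all
    have "lin3 (fob \<phi> a) (vhom E b a) (fob F b) (?X b) (\<lambda>p f x. pair (act \<phi> a b f p) x)"
      using lin3_l[OF lin2_swap[OF lin2_act[OF col_psi, of a b]] lin2_pair] o by simp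
    then show ?thesis unfolding lin3_def by blast
  qed blast
  then obtain r where r: "\<And>a b. a \<in> ?S \<Longrightarrow> b \<in> ?S \<Longrightarrow> r a b \<in> ar (?Y a b) (?X b)"
    and r': "\<And>a b p f x. \<lbrakk>a \<in> ?S; b \<in> ?S; p \<in> El (fob \<phi> a); f \<in> El (vhom E b a); x \<in> El (fob F b);
      disj p f; disj p x; disj f x\<rbrakk> \<Longrightarrow> app (r a b) (pair (pair p f) x) = pair (act \<phi> a b f p) x" by metis
  have Eo: "vhom E a b \<in> Ob V" if "a \<in> ?S" "b \<in> ?S" for a b using col_E that by simp
  have "\<exists>C i. (C \<in> Ob (opcat V) \<and> (\<forall>a\<in>?S. i a \<in> Hom (opcat V) C (?X a)) \<and>
      (\<forall>a\<in>?S. \<forall>b\<in>?S. Comp (opcat V) (l a b) (i a) = Comp (opcat V) (r a b) (i b))) \<and>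
    (\<forall>Z q. (Z \<in> Ob (opcat V) \<and> (\<forall>a\<in>?S. q a \<in> Hom (opcat V) Z (?X a)) \<and>
      (\<forall>a\<in>?S. \<forall>b\<in>?S. Comp (opcat V) (l a b) (q a) = Comp (opcat V) (r a b) (q b))) \<longrightarrow>
      (\<exists>!k. k \<in> Hom (opcat V) Z C \<and> (\<forall>a\<in>?S. Comp (opcat V) (i a) k = q a)))"
    by (rule limit_of_parallel_pairs[OF infinite_universe cocomplete_opcat[OF cocomplete] category_opcat[OF cat] S, where Y = ?Y])
      (simp_all add: Eo ar_Hom[OF l] ar_Hom[OF r])
  then obtain C i where Ci: "C \<in> Ob V \<and> (\<forall>a\<in>?S. i a \<in> Hom V (?X a) C) \<and> (\<forall>a\<in>?S. \<forall>b\<in>?S. i a \<cdot> l a b = i b \<cdot> r a b)"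
    and univ0: "\<forall>Z q. (Z \<in> Ob V \<and> (\<forall>a\<in>?S. q a \<in> Hom V (?X a) Z) \<and> (\<forall>a\<in>?S. \<forall>b\<in>?S. q a \<cdot> l a b = q b \<cdot> r a b)) \<longrightarrow>
      (\<exists>!k. k \<in> Hom V C Z \<and> (\<forall>a\<in>?S. k \<cdot> i a = q a))"
    unfolding opcat_simps by (elim exE conjE) (rule that, intro conjI; assumption)
  have C: "C \<in> Ob V" and i2: "\<And>a b. a \<in> ?S \<Longrightarrow> b \<in> ?S \<Longrightarrow> i a \<cdot> l a b = i b \<cdot> r a b" using Ci by blast+
  have univ: "\<exists>!k. k \<in> Hom V C Z \<and> (\<forall>a\<in>?S. k \<cdot> i a = q a)"
    if "Z \<in> Ob V" "\<And>a. a \<in> ?S \<Longrightarrow> q a \<in> Hom V (?X a) Z"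
      "\<And>a b. a \<in> ?S \<Longrightarrow> b \<in> ?S \<Longrightarrow> q a \<cdot> l a b = q b \<cdot> r a b" for Z q
    using univ0[rule_format, of Z q] that by blast
  have i: "\<And>a. a \<in> ?S \<Longrightarrow> i a \<in> ar (?X a) C" using Ci by (simp add: ar_def)
  have i': "app (i b) (pair (act \<phi> a b f p) x) = app (i a) (pair p (act F b a f x))"
    if o: "a \<in> ?S" "b \<in> ?S" and e: "p \<in> El (fob \<phi> a)" "f \<in> El (vhom E b a)" "x \<in> El (fob F b)"
      and d: "disj p f" "disj p x" "disj f x" for a b f p x
  proof -
    have z: "pair (pair p f) x \<in> El (?Y a b)" using e d by simp
    show ?thesis
      using app_comp[OF z l[OF o] i[OF o(1)]] app_comp[OF z r[OF o] i[OF o(2)]] i2[OF o] l'[OF o e d] r'[OF o e d] by simp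
  qed
  have "\<exists>h. a \<in> ?S \<longrightarrow> h \<in> ar (fob \<phi> a) (ihom (fob F a) C) \<and>
    (\<forall>p x. p \<in> El (fob \<phi> a) \<longrightarrow> x \<in> El (fob F a) \<longrightarrow> disj p x \<longrightarrow> ap (fob F a) C (app h p) x = app (i a) (pair p x))" for a
  proof (cases "a \<in> ?S")
    case True
    have "lin2 (fob \<phi> a) (fob F a) C (\<lambda>p x. app (i a) (pair p x))" using lin2_app[OF i] True by simp
    then show ?thesis by (rule lin2_curry) blast
  qed blast
  then obtain s where s: "\<And>a. a \<in> ?S \<Longrightarrow> s a \<in> ar (fob \<phi> a) (ihom (fob F a) C)"
    and s': "\<And>a p x. \<lbrakk>a \<in> ?S; p \<in> El (fob \<phi> a); x \<in> El (fob F a); disj p x\<rbrakk> \<Longrightarrow>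
       ap (fob F a) C (app (s a) p) x = app (i a) (pair p x)" by metis
  have sp: "app (s a) p \<in> El (ihom (fob F a) C)" if "a \<in> ?S" "p \<in> El (fob \<phi> a)" for a p using app_in[OF s] that by blast
  have "limit_unit (vop V E) (vop V (vself V)) \<phi> (fop F) C s"
    unfolding limit_unit_def weighted_cone_def
  proof (intro conjI ballI allI impI)
    fix a b f p assume "a \<in> vob (vop V E)" "b \<in> vob (vop V E)" "f \<in> El (vhom (vop V E) a b)" and p: "p \<in> El (fob \<phi> a)"
      and d: "disj f p"
    then have o: "a \<in> ?S" "b \<in> ?S" and f: "f \<in> El (vhom E b a)" and d': "disj p f" by (simp_all add: disj_commute)
    have "app (s b) (act \<phi> a b f p) = cmp (vself V) (fob F b) (fob F a) C (app (s a) p) (app (far F b a) f)"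
    proof (rule ext_ihom[of _ "fob F b" C])
      fix x assume x: "x \<in> El (fob F b)" and "disj (app (s b) (act \<phi> a b f p)) x" "disj x (app (s b) (act \<phi> a b f p))"
      then show "ap (fob F b) C (app (s b) (act \<phi> a b f p)) x =
        ap (fob F b) C (cmp (vself V) (fob F b) (fob F a) C (app (s a) p) (app (far F b a) f)) x"
        using o f p d d' C sp[OF o(1) p] i'[OF o p f x] col_F by (simp add: s' act_def[of F, symmetric])
    qed (use o f p d d' C sp in \<open>simp_all add: join_ac\<close>)
    then show "app (s b) (act \<phi> a b f p) = cmp (vop V (vself V)) C (fob (fop F) a) (fob (fop F) b) (app (far (fop F) a b) f) (app (s a) p)"
      using o f p d d' C sp[OF o(1) p] by simp
  next
    fix X N \<pi> assume "X \<in> vob (vop V (vself V))" and w: "wedge V (vop V E) \<phi> (hom_into X) N \<pi>"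
    then have X: "X \<in> Ob V" by simp
    note N = wedge_ob[OF w]
    note pi = hom_into_wedge_in[OF X w]
    have "\<exists>h. a \<in> ?S \<longrightarrow> h \<in> ar (?X a) (ihom N X) \<and>
      (\<forall>p x n. p \<in> El (fob \<phi> a) \<longrightarrow> x \<in> El (fob F a) \<longrightarrow> n \<in> El N \<longrightarrow> disj p x \<longrightarrow> disj p n \<longrightarrow> disj x n \<longrightarrow>
         ap N X (app h (pair p x)) n = ap (fob F a) X (ap (fob \<phi> a) (ihom (fob F a) X) (app (\<pi> a) n) p) x)" for a
    proof (cases "a \<in> ?S")
      case True
      have "lin3 (fob \<phi> a) (fob F a) N X (\<lambda>p x n. ap (fob F a) X (ap (fob \<phi> a) (ihom (fob F a) X) (app (\<pi> a) n) p) x)"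
        using lin3_swap23[OF lin3_swap12[OF lin3_l[OF lin2_pre1[OF lin1_app[OF pi[OF True]] lin2_ap] lin2_ap]]] True X by simp
      then show ?thesis by (rule lin3_curry) blast
    qed blast
    then obtain q where q: "\<And>a. a \<in> ?S \<Longrightarrow> q a \<in> ar (?X a) (ihom N X)"
      and q': "\<And>a p x n. \<lbrakk>a \<in> ?S; p \<in> El (fob \<phi> a); x \<in> El (fob F a); n \<in> El N; disj p x; disj p n; disj x n\<rbrakk> \<Longrightarrow>
         ap N X (app (q a) (pair p x)) n = ap (fob F a) X (ap (fob \<phi> a) (ihom (fob F a) X) (app (\<pi> a) n) p) x" by metis
    have "q a \<cdot> l a b = q b \<cdot> r a b" if o: "a \<in> ?S" "b \<in> ?S" for a b
    proof (rule ext3[OF comp_in[OF l[OF o] q[OF o(1)]] comp_in[OF r[OF o] q[OF o(2)]]])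
      fix p f x assume e: "p \<in> El (fob \<phi> a)" "f \<in> El (vhom E b a)" "x \<in> El (fob F b)"
        and d: "disj p f" "disj f p" "disj p x" "disj x p" "disj f x" "disj x f"
      have z: "pair (pair p f) x \<in> El (?Y a b)" using e d by simp
      have fx: "act F b a f x \<in> El (fob F a)" using col_F o e d by simp
      have t: "app (q a) (pair p (act F b a f x)) \<in> El (ihom N X)" "app (q b) (pair (act \<phi> a b f p) x) \<in> El (ihom N X)"
        by (rule app_in[OF q[OF o(1)]], use e d fx in simp) (rule app_in[OF q[OF o(2)]], use e d o in simp)
      have "app (q a) (pair p (act F b a f x)) = app (q b) (pair (act \<phi> a b f p) x)"
      proof (rule ext_ihom[OF t N X])
        fix n assume n: "n \<in> El N" and "disj (app (q a) (pair p (act F b a f x))) n" "disj n (app (q a) (pair p (act F b a f x)))"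
        then have d': "disj p n" "disj f n" "disj x n" "disj n p" "disj n f" "disj n x" by simp_all
        show "ap N X (app (q a) (pair p (act F b a f x))) n = ap N X (app (q b) (pair (act \<phi> a b f p) x)) n"
          using q'[OF o(1) e(1) fx n] q'[OF o(2) act_phi_in[OF o e(2,1)] e(3) n] hom_into_wedge_nat(2)[OF X w o n e(2,1,3)] d d' by simp
      qed (simp add: join_ac)
      then show "app (q a \<cdot> l a b) (pair (pair p f) x) = app (q b \<cdot> r a b) (pair (pair p f) x)"
        using app_comp[OF z l[OF o] q[OF o(1)]] app_comp[OF z r[OF o] q[OF o(2)]] l'[OF o e] r'[OF o e] d by simp
    qed (use o Eo in simp_all)
    then have ex1: "\<exists>!k. k \<in> Hom V C (ihom N X) \<and> (\<forall>a\<in>?S. k \<cdot> i a = q a)"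
      by (intro univ) (use N X ar_Hom[OF q] in simp_all)
    then obtain k0 where "k0 \<in> Hom V C (ihom N X)" and k0i: "\<And>a. a \<in> ?S \<Longrightarrow> k0 \<cdot> i a = q a" by blast
    then have k0: "k0 \<in> ar C (ihom N X)" using C N X by (simp add: ar_def)
    have "lin2 N C X (\<lambda>n c. ap N X (app k0 c) n)"
      by (rule lin2_swap[OF lin2_pre1[OF lin1_app[OF k0] lin2_ap[OF N X]]])
    then obtain k where k: "k \<in> ar N (ihom C X)" and k': "\<And>n c. \<lbrakk>n \<in> El N; c \<in> El C; disj n c\<rbrakk> \<Longrightarrow> ap C X (app k n) c = ap N X (app k0 c) n"
      by (rule lin2_curry) blast
    have fits_iff: "fits (vop V E) (vop V (vself V)) \<phi> (fop F) C s X N \<pi> k \<longleftrightarrow>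
      (\<forall>a\<in>?S. \<forall>n\<in>El N. \<forall>p\<in>El (fob \<phi> a). \<forall>x\<in>El (fob F a). disj n p \<longrightarrow> disj n x \<longrightarrow> disj p x \<longrightarrow>
        ap C X (app k n) (app (i a) (pair p x)) = ap (fob F a) X (ap (fob \<phi> a) (ihom (fob F a) X) (app (\<pi> a) n) p) x)" (is "?l \<longleftrightarrow> ?r")
      if k: "k \<in> ar N (ihom C X)" for k
    proof
      assume f: ?l
      show ?r
      proof (intro ballI impI)
        fix a n p x assume e: "a \<in> ?S" "n \<in> El N" "p \<in> El (fob \<phi> a)" "x \<in> El (fob F a)" and d: "disj n p" "disj n x" "disj p x"
        have d': "disj p n" using d by (simp add: disj_commute)
        have "ap (fob \<phi> a) (ihom (fob F a) X) (app (\<pi> a) n) p = cmp (vself V) (fob F a) C X (app k n) (app (s a) p)"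
          using f e d d' X C sp[OF e(1,3)] app_in[OF k e(2)] by (simp add: fits_def)
        then show "ap C X (app k n) (app (i a) (pair p x)) = ap (fob F a) X (ap (fob \<phi> a) (ihom (fob F a) X) (app (\<pi> a) n) p) x"
          using e d X C sp[OF e(1,3)] app_in[OF k e(2)] by (simp add: s')
      qed
    next
      assume f: ?r
      show ?l unfolding fits_def
      proof (intro ballI impI)
        fix a n p assume "a \<in> vob (vop V E)" and e: "n \<in> El N" "p \<in> El (fob \<phi> a)" and d: "disj n p"
        then have a: "a \<in> ?S" by simp
        have d': "disj p n" using d by (simp add: disj_commute)
        have "ap (fob \<phi> a) (ihom (fob F a) X) (app (\<pi> a) n) p = cmp (vself V) (fob F a) C X (app k n) (app (s a) p)"
          by (rule ext_ihom[of _ "fob F a" X])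
            (use f a e d d' X C sp[OF a e(2)] app_in[OF k e(1)] app_in[OF pi[OF a] e(1)] in \<open>simp_all add: s'\<close>)
        then show "ap (fob \<phi> a) (vhom (vop V (vself V)) X (fob (fop F) a)) (app (\<pi> a) n) p =
          cmp (vop V (vself V)) X C (fob (fop F) a) (app (s a) p) (app k n)"
          using a e d d' X C sp[OF a e(2)] app_in[OF k e(1)] by simp
      qed
    qed
    have ip: "app (i a) (pair p x) \<in> El C" if "a \<in> ?S" "p \<in> El (fob \<phi> a)" "x \<in> El (fob F a)" "disj p x" for a p x
      using app_in[OF i pair_in] that by blast
    show "\<exists>!k. k \<in> ar N (vhom (vop V (vself V)) X C) \<and> fits (vop V E) (vop V (vself V)) \<phi> (fop F) C s X N \<pi> k"
      unfolding vop_simps vself_simps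
    proof (rule ex1I, intro conjI)
      show "k \<in> ar N (ihom C X)" by (rule k)
      show "fits (vop V E) (vop V (vself V)) \<phi> (fop F) C s X N \<pi> k"
        unfolding fits_iff[OF k]
      proof (intro ballI impI)
        fix a n p x assume e: "a \<in> ?S" "n \<in> El N" "p \<in> El (fob \<phi> a)" "x \<in> El (fob F a)" and d: "disj n p" "disj n x" "disj p x"
        have d': "disj p n" "disj x n" using d by (simp_all add: disj_commute)
        have "app k0 (app (i a) (pair p x)) = app (q a) (pair p x)"
          using app_comp[OF pair_in[OF e(3,4) d(3)] i[OF e(1)] k0] k0i[OF e(1)] by simp
        then show "ap C X (app k n) (app (i a) (pair p x)) = ap (fob F a) X (ap (fob \<phi> a) (ihom (fob F a) X) (app (\<pi> a) n) p) x"
          using k'[OF e(2) ip[OF e(1,3,4) d(3)]] q'[OF e(1,3,4,2)] d d' by simp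
      qed
      fix h assume h': "h \<in> ar N (ihom C X) \<and> fits (vop V E) (vop V (vself V)) \<phi> (fop F) C s X N \<pi> h"
      then have h: "h \<in> ar N (ihom C X)" by simp
      have "lin2 C N X (\<lambda>c n. ap C X (app h n) c)"
        by (rule lin2_swap[OF lin2_pre1[OF lin1_app[OF h] lin2_ap[OF C X]]])
      then obtain h0 where h0: "h0 \<in> ar C (ihom N X)" and h0': "\<And>c n. \<lbrakk>c \<in> El C; n \<in> El N; disj c n\<rbrakk> \<Longrightarrow> ap N X (app h0 c) n = ap C X (app h n) c"
        by (rule lin2_curry) blast
      have "h0 \<cdot> i a = q a" if a: "a \<in> ?S" for a
      proof (rule ext2[OF comp_in[OF i[OF a] h0] q[OF a]])
        fix p x assume e: "p \<in> El (fob \<phi> a)" "x \<in> El (fob F a)" "disj p x" "disj x p"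
        note px = pair_in[OF e(1-3)]
        have "app h0 (app (i a) (pair p x)) = app (q a) (pair p x)"
        proof (rule ext_ihom[OF app_in[OF h0 ip[OF a e(1-3)]] app_in[OF q[OF a] px] N X])
          fix n assume n: "n \<in> El N" and "disj (app h0 (app (i a) (pair p x))) n" "disj n (app h0 (app (i a) (pair p x)))"
          then have d: "disj p n" "disj x n" "disj n p" "disj n x" by simp_all
          show "ap N X (app h0 (app (i a) (pair p x))) n = ap N X (app (q a) (pair p x)) n"
            using h' a n e d h0'[OF ip[OF a e(1-3)] n] q'[OF a e(1,2) n] by (simp add: fits_iff[OF h])
        qed simp
        then show "app (h0 \<cdot> i a) (pair p x) = app (q a) (pair p x)" using app_comp[OF px i[OF a] h0] by simp
      qed (use a in simp_all)
      then have "h0 = k0" using ex1 ar_Hom[OF h0] ar_Hom[OF k0] k0i by blast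
      show "h = k"
      proof (rule ext1[OF h k])
        fix n assume n: "n \<in> El N"
        show "app h n = app k n"
        proof (rule ext_ihom[OF app_in[OF h n] app_in[OF k n] C X])
          fix c assume c: "c \<in> El C" and "disj (app h n) c" "disj c (app h n)"
          then show "ap C X (app h n) c = ap C X (app k n) c"
            using h0'[OF c n] k'[OF n c] \<open>h0 = k0\<close> by simp
        qed simp
      qed
    qed
  qed (use C s in simp_all)
  from wlim_of_limit_unit[OF col_A col_K col_psi col_D phi this]
  show ?thesis unfolding is_wcolim_def by blast
qed

end
end

section \<open>The Yoneda embedding\<close>

context smc_closed begin

lemma ihom_post:
  assumes f: "f \<in> ar X Y" and W: "W \<in> Ob V"
  shows ihom_post_in: "ihom_post V W X Y f \<in> ar (ihom W X) (ihom W Y)"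
    and ap_ihom_post: "\<lbrakk>h \<in> El (ihom W X); w \<in> El W; disj h w\<rbrakk> \<Longrightarrow>
      ap W Y (app (ihom_post V W X Y f) h) w = app f (ap W X h w)"
proof -
  note X = ar_dom[OF f] and e = ev_in[OF W ar_dom[OF f]]
  note c = comp_in[OF e f]
  show "ihom_post V W X Y f \<in> ar (ihom W X) (ihom W Y)"
    unfolding ihom_post_def by (rule vcurry_in[OF c ihom_ob[OF W X] W])
  show "ap W Y (app (ihom_post V W X Y f) h) w = app f (ap W X h w)"
    if "h \<in> El (ihom W X)" "w \<in> El W" "disj h w"
    unfolding ihom_post_def using ap_vcurry[OF c that] app_comp[OF pair_in[OF that] e f] by (simp add: ap_def)
qed

text \<open>
  \<open>(E\<^sup>o\<^sup>p)\<^sup>o\<^sup>p\<close> need not be the record \<open>E\<close>: its composition is that of \<open>E\<close> after a double symmetry, which is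
  invisible on elements.
\<close>

lemma vfunctor_vop_vop:
  assumes E: "vcategory V E" and B: "vcategory V B" and F: "vfunctor V (vop V (vop V E)) B F"
  shows "vfunctor V E B F"
proof (rule vfunctorI[OF E B])
  have E': "vcategory V (vop V (vop V E))" using E by simp
  fix a b assume "a \<in> vob E" "b \<in> vob E"
  then show "far F a b \<in> ar (vhom E a b) (vhom B (fob F a) (fob F b))" using far_in[OF E' B F, of a b] by simp
next
  have E': "vcategory V (vop V (vop V E))" using E by simp
  fix a b c g f assume o: "a \<in> vob E" "b \<in> vob E" "c \<in> vob E" and e: "g \<in> El (vhom E b c)" "f \<in> El (vhom E a b)"
    "disj g f" "disj f g"
  then show "app (far F a c) (cmp E a b c g f) = cmp B (fob F a) (fob F b) (fob F c) (app (far F b c) g) (app (far F a b) f)"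
    using far_cmp[OF E' B F, of a b c g f] E by simp
next
  have E': "vcategory V (vop V (vop V E))" using E by simp
  show "app (far F a a) (idn E a) = idn B (fob F a)" if "a \<in> vob E" for a
    using far_idn[OF E' B F, of a] that by simp
qed (use fob_in[OF F] in simp)

end

context bicomplete_smc begin

context
  fixes E :: "('u, 'o, 'm) vcat"
  assumes E: "small_vcategory V E"
begin

lemma yoneda_far:
  assumes o: "a \<in> vob E" "b \<in> vob E"
  shows yoneda_far_in: "far (yoneda V E) a b \<in> ar (vhom E b a) (natob V E (homfun V E a) (homfun V E b))"
    and nt_yoneda: "\<lbrakk>c \<in> vob E; f \<in> El (vhom E b a); g \<in> El (vhom E a c); disj f g\<rbrakk> \<Longrightarrow>
      nt E (homfun V E a) (homfun V E b) c (app (far (yoneda V E) a b) f) g = cmp E b a c g f"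
proof -
  have E': "vcategory V E" using E by simp
  have g: "vgraph E (homfun V E e)" "vgraph (vop V E) (homfun V (vop V E) e)" if "e \<in> vob E" for e using E' that by simp_all
  have *: "ap (vhom E a c) (vhom E b c) (app (far (homfun V (vop V E) c) a b) f) g = cmp E b a c g f"
    if "c \<in> vob E" "f \<in> El (vhom E b a)" "g \<in> El (vhom E a c)" "disj f g" for c f g
    using act_homfun[of "vop V E" c a b f g] E' o that by (simp add: act_def)
  have w: "wedge V E (homfun V E a) (homfun V E b) (vhom E b a) (\<lambda>c. far (homfun V (vop V E) c) a b)"
  proof (rule wedgeI[OF g(1)[OF o(1)] g(1)[OF o(2)]])
    show "far (homfun V (vop V E) c) a b \<in> ar (vhom E b a) (ihom (fob (homfun V E a) c) (fob (homfun V E b) c))" if "c \<in> vob E" for c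
      using vgraph_far[OF g(2)[OF that], of a b] o by simp
    fix c d n f x assume "c \<in> vob E" "d \<in> vob E" "n \<in> El (vhom E b a)" "f \<in> El (vhom E c d)" "x \<in> El (fob (homfun V E a) c)"
      "disj n f" "disj f n" "disj n x" "disj x n" "disj f x" "disj x f"
    then show "ap (fob (homfun V E a) d) (fob (homfun V E b) d) (app (far (homfun V (vop V E) d) a b) n) (act (homfun V E a) c d f x) =
      act (homfun V E b) c d f (ap (fob (homfun V E a) c) (fob (homfun V E b) c) (app (far (homfun V (vop V E) c) a b) n) x)"
      using o E' by (simp add: * cmp_assoc)
  qed (use E' o in simp)
  have f: "far (yoneda V E) a b = into_end V E (homfun V E a) (homfun V E b) (vhom E b a) (\<lambda>c. far (homfun V (vop V E) c) a b)"
    by (simp add: yoneda_def)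
  show "far (yoneda V E) a b \<in> ar (vhom E b a) (natob V E (homfun V E a) (homfun V E b))"
    unfolding f by (rule into_end_in[OF E g(1)[OF o(1)] g(1)[OF o(2)] w])
  show "nt E (homfun V E a) (homfun V E b) c (app (far (yoneda V E) a b) f) g = cmp E b a c g f"
    if "c \<in> vob E" "f \<in> El (vhom E b a)" "g \<in> El (vhom E a c)" "disj f g"
    unfolding f using nt_into_end[OF E g(1)[OF o(1)] g(1)[OF o(2)] w that(1,2), of g] * that by simp
qed

lemma fob_yoneda [simp]: "fob (yoneda V E) = homfun V E"
  by (simp add: yoneda_def)

lemma vfunctor_yoneda: "vfunctor V (vop V E) (funcat V E) (yoneda V E)"
proof -
  have E': "vcategory V E" using E by simp
  have g: "vgraph E (homfun V E e)" if "e \<in> vob E" for e using E' that by simp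
  show ?thesis
  proof (rule vfunctorI)
    fix a assume "a \<in> vob (vop V E)"
    then have a: "a \<in> vob E" by simp
    have i: "idn E a \<in> El (vhom E a a)" using E' a by simp
    have i': "idn (funcat V E) (homfun V E a) \<in> El (natob V E (homfun V E a) (homfun V E a))"
      using idn_in[OF vcategory_funcat[OF E], of "homfun V E a"] E' a by simp
    show "app (far (yoneda V E) a a) (idn (vop V E) a) = idn (funcat V E) (fob (yoneda V E) a)"
      unfolding vop_simps fob_yoneda
      by (rule ext_natob[OF E g[OF a] g[OF a] app_in[OF yoneda_far_in[OF a a] i] i'])
        (use a E' i g in \<open>simp_all add: nt_yoneda nt_idn_funcat[OF E]\<close>)
  next
    fix a b c h f assume "a \<in> vob (vop V E)" "b \<in> vob (vop V E)" "c \<in> vob (vop V E)"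
      and "h \<in> El (vhom (vop V E) b c)" "f \<in> El (vhom (vop V E) a b)" and d: "disj h f" "disj f h"
    then have o: "a \<in> vob E" "b \<in> vob E" "c \<in> vob E" and e: "h \<in> El (vhom E c b)" "f \<in> El (vhom E b a)" by simp_all
    note y = app_in[OF yoneda_far_in[OF o(2,3)] e(1)] app_in[OF yoneda_far_in[OF o(1,2)] e(2)]
    have fh: "cmp E c b a f h \<in> El (vhom E c a)" using o e d E' by simp
    note ff = app_in[OF yoneda_far_in[OF o(1,3)] fh]
    have c: "cmp (funcat V E) (homfun V E a) (homfun V E b) (homfun V E c) (app (far (yoneda V E) b c) h) (app (far (yoneda V E) a b) f)
       \<in> El (natob V E (homfun V E a) (homfun V E c))"
      by (rule cmp_funcat_in[OF E g[OF o(1)] g[OF o(2)] g[OF o(3)] y]) (simp add: d)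
    have "app (far (yoneda V E) a c) (cmp E c b a f h) =
      cmp (funcat V E) (homfun V E a) (homfun V E b) (homfun V E c) (app (far (yoneda V E) b c) h) (app (far (yoneda V E) a b) f)"
    proof (rule ext_natob[OF E g[OF o(1)] g[OF o(3)] ff c])
      fix z x assume z: "z \<in> vob E" and x: "x \<in> El (fob (homfun V E a) z)"
        and "disj (app (far (yoneda V E) a c) (cmp E c b a f h)) x" "disj x (app (far (yoneda V E) a c) (cmp E c b a f h))"
      then have x: "x \<in> El (vhom E a z)" and d': "disj h x" "disj f x" "disj x h" "disj x f" by simp_all
      show "nt E (homfun V E a) (homfun V E c) z (app (far (yoneda V E) a c) (cmp E c b a f h)) x =
        nt E (homfun V E a) (homfun V E c) z (cmp (funcat V E) (homfun V E a) (homfun V E b) (homfun V E c)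
          (app (far (yoneda V E) b c) h) (app (far (yoneda V E) a b) f)) x"
        using nt_cmp_funcat[OF E g[OF o(1)] g[OF o(2)] g[OF o(3)] z y, of x] o e d d' x z E'
          nt_yoneda[OF o(1,3) z fh x] nt_yoneda[OF o(1,2) z e(2) x] nt_yoneda[OF o(2,3) z e(1), of "cmp E b a z x f"]
        by (simp add: cmp_assoc)
    qed (simp add: join_ac)
    then show "app (far (yoneda V E) a c) (cmp (vop V E) a b c h f) = cmp (funcat V E) (fob (yoneda V E) a) (fob (yoneda V E) b) (fob (yoneda V E) c)
      (app (far (yoneda V E) b c) h) (app (far (yoneda V E) a b) f)"
      using o e d E' by simp
  qed (use E' vcategory_funcat[OF E] yoneda_far_in in simp_all)
qed

end

section \<open>Colimits with a fixed weight\<close>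

context
  fixes E :: "('u, 'o, 'm) vcat" and \<phi> :: "('u, 'o, 'm) vfun"
  assumes E: "small_vcategory V E" and phi: "vfunctor V (vop V E) (vself V) \<phi>"
begin

text \<open>
  The insertion \<open>\<phi>e \<otimes> Fe \<rightarrow> \<phi> \<star> F\<close>. The elements \<open>su F e p x\<close> behave like the classes \<open>p \<otimes> x\<close> in a tensor
  product of modules: they are balanced (\<open>su_nat\<close>), they determine an arrow out of \<open>\<phi> \<star> F\<close>
  (\<open>su_ext\<close>), and a balanced bilinear function defines one (\<open>su_desc\<close>).
\<close>

definition su where "su F e p x = ap (fob F e) (star_ob V E \<phi> F) (app (star_unit V E \<phi> F e) p) x"

lemma disj_su [simp]: "disj (su F e p x) y \<longleftrightarrow> disj p y \<and> disj x y" "disj y (su F e p x) \<longleftrightarrow> disj y p \<and> disj y x"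
  by (simp_all add: su_def)

context
  fixes F :: "('u, 'o, 'm) vfun"
  assumes F: "vfunctor V E (vself V) F"
begin

lemmas col = col_A[OF E phi F] col_K[OF E phi F] col_psi[OF E phi F] col_D[OF E phi F] phi

lemma star_wlim: "is_wlim V (vop V E) (vop V (vself V)) \<phi> (fop F) (star_ob V E \<phi> F) (star_rep V E \<phi> F)"
proof -
  have "\<exists>z. case z of (C, \<theta>) \<Rightarrow> is_wcolim V E (vself V) \<phi> F C \<theta>" using wcolim_exists[OF E phi F] by simp
  from someI_ex[OF this] have "is_wcolim V E (vself V) \<phi> F (star_ob V E \<phi> F) (star_rep V E \<phi> F)"
    unfolding star_ob_def star_rep_def the_star_def case_prod_unfold .
  then show ?thesis by (simp add: is_wcolim_def)
qed

lemma star_limit: "limit_unit (vop V E) (vop V (vself V)) \<phi> (fop F) (star_ob V E \<phi> F) (star_unit V E \<phi> F)"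
  unfolding star_unit_def by (rule limit_unit_of_wlim[OF col star_wlim])

lemma star_ob_in: "star_ob V E \<phi> F \<in> Ob V"
  using limit_unit_ob[OF star_limit] by simp

lemma star_unit_in: "e \<in> vob E \<Longrightarrow> star_unit V E \<phi> F e \<in> ar (fob \<phi> e) (ihom (fob F e) (star_ob V E \<phi> F))"
  using limit_unit_in[OF star_limit, of e] by simp

lemma star_unit_app: "e \<in> vob E \<Longrightarrow> p \<in> El (fob \<phi> e) \<Longrightarrow> app (star_unit V E \<phi> F e) p \<in> El (ihom (fob F e) (star_ob V E \<phi> F))"
  by (rule app_in[OF star_unit_in])

lemma lin2_su: "e \<in> vob E \<Longrightarrow> lin2 (fob \<phi> e) (fob F e) (star_ob V E \<phi> F) (su F e)"
  unfolding su_def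
  by (rule lin2_pre1[OF lin1_app[OF star_unit_in] lin2_ap]) (use star_ob_in col_ob[OF E phi F] in simp_all)

lemma su_in: "\<lbrakk>e \<in> vob E; p \<in> El (fob \<phi> e); x \<in> El (fob F e); disj p x\<rbrakk> \<Longrightarrow> su F e p x \<in> El (star_ob V E \<phi> F)"
  unfolding su_def by (rule ap_in) (use star_ob_in star_unit_app col_ob[OF E phi F] in simp_all)

lemma su_nat:
  assumes o: "a \<in> vob E" "b \<in> vob E" and e: "f \<in> El (vhom E b a)" "p \<in> El (fob \<phi> a)" "x \<in> El (fob F b)"
    and d: "disj f p" "disj f x" "disj p x"
  shows "su F b (act \<phi> a b f p) x = su F a p (act F b a f x)"
proof -
  have d': "disj p f" using d by (simp add: disj_commute)
  have g: "app (far F b a) f \<in> El (ihom (fob F b) (fob F a))" using col_far[OF E phi F o(2,1) e(1)] .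
  have "app (star_unit V E \<phi> F b) (act \<phi> a b f p) =
      cmp (vself V) (fob F b) (fob F a) (star_ob V E \<phi> F) (app (star_unit V E \<phi> F a) p) (app (far F b a) f)"
    using limit_unit_nat[OF star_limit, of a b f p] o e d d' g star_ob_in star_unit_app[OF o(1) e(2)] col_ob[OF E phi F] by simp
  then show ?thesis
    using o e d d' g star_ob_in star_unit_app[OF o(1) e(2)] col_ob[OF E phi F] by (simp add: su_def act_def[of F])
qed

lemma star_fits:
  assumes X: "X \<in> Ob V" and a: "a \<in> vob E" and p: "p \<in> El (fob \<phi> a)" and k: "k \<in> El (ihom (star_ob V E \<phi> F) X)"
    and d: "disj p k"
  shows "cmp (vop V (vself V)) X (star_ob V E \<phi> F) (fob F a) (app (star_unit V E \<phi> F a) p) k =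
      cmp (vself V) (fob F a) (star_ob V E \<phi> F) X k (app (star_unit V E \<phi> F a) p)"
  using star_ob_in star_unit_app[OF a p] col_ob[OF E phi F] assms by simp

lemma su_ext:
  assumes X: "X \<in> Ob V" and k: "k \<in> El (ihom (star_ob V E \<phi> F) X)" and k': "k' \<in> El (ihom (star_ob V E \<phi> F) X)"
    and st: "fst k = fst k'"
    and eq: "\<And>e p x. \<lbrakk>e \<in> vob E; p \<in> El (fob \<phi> e); x \<in> El (fob F e); disj p x; disj x p; disj k p; disj p k;
      disj k x; disj x k\<rbrakk> \<Longrightarrow> ap (star_ob V E \<phi> F) X k (su F e p x) = ap (star_ob V E \<phi> F) X k' (su F e p x)"
  shows "k = k'"
proof (rule limit_unit_ext[OF col(1-4) star_limit _ _ _ st])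
  fix a p assume "a \<in> vob (vop V E)" and p: "p \<in> El (fob \<phi> a)" and d: "disj k p" "disj p k" "disj k' p" "disj p k'"
  then have a: "a \<in> vob E" by simp
  have "cmp (vself V) (fob F a) (star_ob V E \<phi> F) X k (app (star_unit V E \<phi> F a) p) =
    cmp (vself V) (fob F a) (star_ob V E \<phi> F) X k' (app (star_unit V E \<phi> F a) p)"
  proof (rule ext_ihom[of _ "fob F a" X])
    fix x assume x: "x \<in> El (fob F a)" and "disj (cmp (vself V) (fob F a) (star_ob V E \<phi> F) X k (app (star_unit V E \<phi> F a) p)) x"
      "disj x (cmp (vself V) (fob F a) (star_ob V E \<phi> F) X k (app (star_unit V E \<phi> F a) p))"
    then have d': "disj k x" "disj p x" "disj x k" "disj x p" by simp_all
    have d'': "disj k' x" using d'(1) st by (simp add: disj_def)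
    show "ap (fob F a) X (cmp (vself V) (fob F a) (star_ob V E \<phi> F) X k (app (star_unit V E \<phi> F a) p)) x =
      ap (fob F a) X (cmp (vself V) (fob F a) (star_ob V E \<phi> F) X k' (app (star_unit V E \<phi> F a) p)) x"
      using eq[OF a p x] d d' d'' k k' X star_ob_in star_unit_app[OF a p] col_ob[OF E phi F] a x by (simp add: su_def)
  qed (use d k k' X st star_ob_in star_unit_app[OF a p] col_ob[OF E phi F] a in simp_all)
  then show "cmp (vop V (vself V)) X (star_ob V E \<phi> F) (fob (fop F) a) (app (star_unit V E \<phi> F a) p) k =
     cmp (vop V (vself V)) X (star_ob V E \<phi> F) (fob (fop F) a) (app (star_unit V E \<phi> F a) p) k'"
    using star_fits[OF X a p k d(2)] star_fits[OF X a p k' d(4)] by simp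
qed (use X k k' in simp_all)

lemma su_ext_ar:
  assumes X: "X \<in> Ob V" and h: "h \<in> ar N (ihom (star_ob V E \<phi> F) X)" and k: "k \<in> ar N (ihom (star_ob V E \<phi> F) X)"
    and eq: "\<And>n e p x. \<lbrakk>n \<in> El N; e \<in> vob E; p \<in> El (fob \<phi> e); x \<in> El (fob F e); disj p x; disj x p; disj n p; disj p n;
      disj n x; disj x n\<rbrakk> \<Longrightarrow> ap (star_ob V E \<phi> F) X (app h n) (su F e p x) = ap (star_ob V E \<phi> F) X (app k n) (su F e p x)"
  shows "h = k"
proof (rule ext1[OF h k])
  fix n assume n: "n \<in> El N"
  show "app h n = app k n"
    by (rule su_ext[OF X app_in[OF h n] app_in[OF k n]]) (simp_all add: eq n)
qed

lemma su_desc: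
  assumes X: "X \<in> Ob V" and w: "wedge V (vop V E) \<phi> (fcomp V (homfun V (vop V (vself V)) X) (fop F)) N \<pi>"
  obtains k where "k \<in> ar N (ihom (star_ob V E \<phi> F) X)"
    "\<And>n e p x. \<lbrakk>n \<in> El N; e \<in> vob E; p \<in> El (fob \<phi> e); x \<in> El (fob F e); disj n p; disj n x; disj p x\<rbrakk> \<Longrightarrow>
      ap (star_ob V E \<phi> F) X (app k n) (su F e p x) = ap (fob F e) X (ap (fob \<phi> e) (ihom (fob F e) X) (app (\<pi> e) n) p) x"
proof -
  obtain k where k: "k \<in> ar N (ihom (star_ob V E \<phi> F) X)"
    and f: "fits (vop V E) (vop V (vself V)) \<phi> (fop F) (star_ob V E \<phi> F) (star_unit V E \<phi> F) X N \<pi> k"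
    using limit_unit_ex1[OF star_limit _ w] X by auto
  show ?thesis
  proof (rule that[OF k])
    fix n e p x assume n: "n \<in> El N" and e: "e \<in> vob E" and p: "p \<in> El (fob \<phi> e)" and x: "x \<in> El (fob F e)"
      and d: "disj n p" "disj n x" "disj p x"
    have d': "disj p n" using d by (simp add: disj_commute)
    have "ap (fob \<phi> e) (ihom (fob F e) X) (app (\<pi> e) n) p =
       cmp (vself V) (fob F e) (star_ob V E \<phi> F) X (app k n) (app (star_unit V E \<phi> F e) p)"
      using f e n p d star_fits[OF X e p app_in[OF k n]] d' by (simp add: fits_def)
    then show "ap (star_ob V E \<phi> F) X (app k n) (su F e p x) = ap (fob F e) X (ap (fob \<phi> e) (ihom (fob F e) X) (app (\<pi> e) n) p) x"
      using X star_ob_in star_unit_app[OF e p] col_ob[OF E phi F] e n p x d app_in[OF k n] by (simp add: su_def)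
  qed
qed

lemma ap_nt_star:
  assumes X: "X \<in> Ob V" and e: "e \<in> vob E" and p: "p \<in> El (fob \<phi> e)" and k: "k \<in> El (ihom (star_ob V E \<phi> F) X)"
    and x: "x \<in> El (fob F e)" and d: "disj k p" "disj k x" "disj p x"
  shows "ap (fob F e) X (nt (vop V E) \<phi> (fcomp V (homfun V (vop V (vself V)) X) (fop F)) e (app (star_rep V E \<phi> F X) k) p) x =
     ap (star_ob V E \<phi> F) X k (su F e p x)"
proof -
  have d': "disj p k" using d by (simp add: disj_commute)
  show ?thesis
    using nt_wlim[OF col star_wlim, of X k e p] star_fits[OF X e p k d'] X e p k x d star_ob_in star_unit_app[OF e p] col_ob[OF E phi F]
    by (simp add: star_unit_def[symmetric] su_def)
qed

end

text \<open>
  \<open>\<phi> \<star> \<tau>\<close> sends \<open>p \<otimes> x\<close> to \<open>p \<otimes> \<tau>x\<close>.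
\<close>

lemma star_far:
  assumes F: "vfunctor V E (vself V) F" and G: "vfunctor V E (vself V) G"
  shows star_far_in: "far (star V E \<phi>) F G \<in> ar (natob V E F G) (ihom (star_ob V E \<phi> F) (star_ob V E \<phi> G))"
    and ap_star_far: "\<lbrakk>\<tau> \<in> El (natob V E F G); e \<in> vob E; p \<in> El (fob \<phi> e); x \<in> El (fob F e);
      disj \<tau> p; disj \<tau> x; disj p x\<rbrakk> \<Longrightarrow>
      ap (star_ob V E \<phi> F) (star_ob V E \<phi> G) (app (far (star V E \<phi>) F G) \<tau>) (su F e p x) = su G e p (nt E F G e \<tau> x)"
proof -
  let ?N = "natob V E F G" and ?C = "star_ob V E \<phi> F" and ?X = "star_ob V E \<phi> G"
  let ?H = "fcomp V (homfun V (vop V (vself V)) ?X) (fop F)"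
  have gF: "vgraph E F" and gG: "vgraph E G" using vfunctor_vgraph[of E] E F G by simp_all
  have X: "?X \<in> Ob V" and C: "?C \<in> Ob V" using star_ob_in F G by blast+
  have N: "?N \<in> Ob V" by (rule natob_ob[OF E gF gG])
  have o: "fob \<phi> e \<in> Ob V" "fob F e \<in> Ob V" "fob G e \<in> Ob V" if "e \<in> vob E" for e
    using that col_ob[OF E phi F] col_ob[OF E phi G] by blast+
  note nin = nt_in[OF E gF gG]
  let ?r = "\<lambda>e. vcurry V ?N (fob \<phi> e) (ihom (fob F e) ?X)
     (vcomp (vop V (vself V)) ?X (fob G e) (fob F e) \<cdot> (proj V E F G e \<odot> star_unit V E \<phi> G e))"
  have r: "?r e \<in> ar ?N (ihom (fob \<phi> e) (ihom (fob F e) ?X))"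
    and r': "\<And>\<tau> p x. \<lbrakk>\<tau> \<in> El ?N; p \<in> El (fob \<phi> e); x \<in> El (fob F e); disj \<tau> p; disj \<tau> x; disj p x\<rbrakk> \<Longrightarrow>
      ap (fob F e) ?X (ap (fob \<phi> e) (ihom (fob F e) ?X) (app (?r e) \<tau>) p) x = su G e p (nt E F G e \<tau> x)"
    if e: "e \<in> vob E" for e
  proof -
    note t = tens_in[OF proj_in[OF E gF gG e] star_unit_in[OF G e]]
    have v: "vcomp (vop V (vself V)) ?X (fob G e) (fob F e) \<in> ar (ihom (fob F e) (fob G e) \<otimes> ihom (fob G e) ?X) (ihom (fob F e) ?X)"
      using vcomp_in[of "vop V (vself V)" ?X "fob G e" "fob F e"] X o[OF e] by simp
    note c = comp_in[OF t v]
    show "?r e \<in> ar ?N (ihom (fob \<phi> e) (ihom (fob F e) ?X))" by (rule vcurry_in[OF c N o(1)[OF e]])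
    fix \<tau> p x assume h: "\<tau> \<in> El ?N" "p \<in> El (fob \<phi> e)" "x \<in> El (fob F e)" and d: "disj \<tau> p" "disj \<tau> x" "disj p x"
    have d': "disj p \<tau>" using d by (simp add: disj_commute)
    have "ap (fob \<phi> e) (ihom (fob F e) ?X) (app (?r e) \<tau>) p =
      cmp (vop V (vself V)) ?X (fob G e) (fob F e) (app (proj V E F G e) \<tau>) (app (star_unit V E \<phi> G e) p)"
      using ap_vcurry[OF c h(1,2) d(1)] app_comp[OF pair_in[OF h(1,2) d(1)] t v]
        app_tens[OF proj_in[OF E gF gG e] star_unit_in[OF G e] h(1,2) d(1)] by (simp add: cmp_def)
    then show "ap (fob F e) ?X (ap (fob \<phi> e) (ihom (fob F e) ?X) (app (?r e) \<tau>) p) x = su G e p (nt E F G e \<tau> x)"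
      using h d d' X o[OF e] proj_app_in[OF E gF gG e h(1)] star_unit_app[OF G e h(2)] by (simp add: su_def nt_def)
  qed
  let ?l = "\<lambda>k e. proj V (vop V E) \<phi> ?H e \<cdot> star_rep V E \<phi> F ?X \<cdot> k"
  have gphi: "vgraph (vop V E) \<phi>" and gH: "vgraph (vop V E) ?H"
    using col_psi[OF E phi F] hom_into_graph[OF E phi F X] by blast+
  have iso: "star_rep V E \<phi> F ?X \<in> ar (ihom ?C ?X) (natob V (vop V E) \<phi> ?H)"
    using isoa_ar[OF wlim_isoa[OF col[OF F] star_wlim[OF F], of ?X]] X by simp
  have l: "?l k e \<in> ar ?N (ihom (fob \<phi> e) (ihom (fob F e) ?X))"
    and l': "\<And>\<tau> p x. \<lbrakk>\<tau> \<in> El ?N; p \<in> El (fob \<phi> e); x \<in> El (fob F e); disj \<tau> p; disj \<tau> x; disj p x\<rbrakk> \<Longrightarrow>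
      ap (fob F e) ?X (ap (fob \<phi> e) (ihom (fob F e) ?X) (app (?l k e) \<tau>) p) x = ap ?C ?X (app k \<tau>) (su F e p x)"
    if e: "e \<in> vob E" and k: "k \<in> ar ?N (ihom ?C ?X)" for e k
  proof -
    have pr: "proj V (vop V E) \<phi> ?H e \<in> ar (natob V (vop V E) \<phi> ?H) (ihom (fob \<phi> e) (ihom (fob F e) ?X))"
      using proj_in[OF _ gphi gH, of e] E e by simp
    show "?l k e \<in> ar ?N (ihom (fob \<phi> e) (ihom (fob F e) ?X))" by (rule comp_in[OF k comp_in[OF iso pr]])
    fix \<tau> p x assume h: "\<tau> \<in> El ?N" "p \<in> El (fob \<phi> e)" "x \<in> El (fob F e)" and d: "disj \<tau> p" "disj \<tau> x" "disj p x"
    show "ap (fob F e) ?X (ap (fob \<phi> e) (ihom (fob F e) ?X) (app (?l k e) \<tau>) p) x = ap ?C ?X (app k \<tau>) (su F e p x)"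
      using ap_nt_star[OF F X e h(2) app_in[OF k h(1)] h(3)] d
        app_comp[OF h(1) k comp_in[OF iso pr]] app_comp[OF app_in[OF k h(1)] iso pr] by (simp add: nt_def)
  qed
  have iff: "(\<forall>e\<in>vob E. ?l k e = ?r e) \<longleftrightarrow> (\<forall>\<tau>\<in>El ?N. \<forall>e\<in>vob E. \<forall>p\<in>El (fob \<phi> e). \<forall>x\<in>El (fob F e).
      disj \<tau> p \<longrightarrow> disj \<tau> x \<longrightarrow> disj p x \<longrightarrow> ap ?C ?X (app k \<tau>) (su F e p x) = su G e p (nt E F G e \<tau> x))" (is "?L \<longleftrightarrow> ?R")
    if k: "k \<in> ar ?N (ihom ?C ?X)" for k
  proof
    assume L: ?L
    show ?R
    proof (intro ballI impI)
      fix \<tau> e p x assume h: "\<tau> \<in> El ?N" "e \<in> vob E" "p \<in> El (fob \<phi> e)" "x \<in> El (fob F e)" "disj \<tau> p" "disj \<tau> x" "disj p x"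
      show "ap ?C ?X (app k \<tau>) (su F e p x) = su G e p (nt E F G e \<tau> x)"
        using L h(2) l'[OF h(2) k h(1,3-7)] r'[OF h(2) h(1,3-7)] by simp
    qed
  next
    assume R: ?R
    show ?L
    proof
      fix e assume e: "e \<in> vob E"
      show "?l k e = ?r e"
      proof (rule ext1[OF l[OF e k] r[OF e]])
        fix \<tau> assume t: "\<tau> \<in> El ?N"
        note lr = app_in[OF l[OF e k] t] app_in[OF r[OF e] t]
        show "app (?l k e) \<tau> = app (?r e) \<tau>"
        proof (rule ext_ihom[OF lr])
          fix p assume p: "p \<in> El (fob \<phi> e)" and "disj (app (?l k e) \<tau>) p" "disj p (app (?l k e) \<tau>)"
          then have d: "disj \<tau> p" "disj p \<tau>" by simp_all
          show "ap (fob \<phi> e) (ihom (fob F e) ?X) (app (?l k e) \<tau>) p = ap (fob \<phi> e) (ihom (fob F e) ?X) (app (?r e) \<tau>) p"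
          proof (rule ext_ihom[of _ "fob F e" ?X])
            fix x assume x: "x \<in> El (fob F e)" and "disj (ap (fob \<phi> e) (ihom (fob F e) ?X) (app (?l k e) \<tau>) p) x"
              "disj x (ap (fob \<phi> e) (ihom (fob F e) ?X) (app (?l k e) \<tau>) p)"
            then have d': "disj \<tau> x" "disj p x" by simp_all
            show "ap (fob F e) ?X (ap (fob \<phi> e) (ihom (fob F e) ?X) (app (?l k e) \<tau>) p) x =
              ap (fob F e) ?X (ap (fob \<phi> e) (ihom (fob F e) ?X) (app (?r e) \<tau>) p) x"
              using l'[OF e k t p x d(1) d'] r'[OF e t p x d(1) d'] R t e p x d d' by simp
          qed (use lr p d X o[OF e] in simp_all)
        qed (use X o[OF e] in simp_all)
      qed
    qed
  qed
  have w: "wedge V (vop V E) \<phi> ?H ?N ?r"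
  proof (rule hom_into_wedgeI[OF E phi F X N r])
    fix a b n f p x assume h: "a \<in> vob E" "b \<in> vob E" "n \<in> El ?N" "f \<in> El (vhom E b a)" "p \<in> El (fob \<phi> a)" "x \<in> El (fob F b)"
      and d: "disj n f" "disj f n" "disj n p" "disj p n" "disj n x" "disj x n" "disj f p" "disj p f" "disj f x" "disj x f" "disj p x" "disj x p"
    have s: "act \<phi> a b f p \<in> El (fob \<phi> b)" "act F b a f x \<in> El (fob F a)"
      using act_phi_in[OF E phi F h(1,2,4,5) d(7)] gF h d by simp_all
    show "ap (fob F b) ?X (ap (fob \<phi> b) (ihom (fob F b) ?X) (app (?r b) n) (act \<phi> a b f p)) x =
      ap (fob F a) ?X (ap (fob \<phi> a) (ihom (fob F a) ?X) (app (?r a) n) p) (act F b a f x)"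
      using r'[OF h(2,3) s(1) h(6)] r'[OF h(1,3,5) s(2)] h d nt_nat[OF E gF gG h(2,1,3,4,6)]
        su_nat[OF G h(1,2,4,5) nin[OF h(2,3,6)]] by simp
  qed
  from su_desc[OF F X w] obtain k where k: "k \<in> ar ?N (ihom ?C ?X)"
    and k': "\<And>n e p x. \<lbrakk>n \<in> El ?N; e \<in> vob E; p \<in> El (fob \<phi> e); x \<in> El (fob F e); disj n p; disj n x; disj p x\<rbrakk> \<Longrightarrow>
      ap ?C ?X (app k n) (su F e p x) = ap (fob F e) ?X (ap (fob \<phi> e) (ihom (fob F e) ?X) (app (?r e) n) p) x" by blast
  have ex1: "\<exists>!k. k \<in> Hom V ?N (ihom ?C ?X) \<and> (\<forall>e\<in>vob E. ?l k e = ?r e)"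
  proof (rule ex1I, intro conjI)
    show "k \<in> Hom V ?N (ihom ?C ?X)" using ar_Hom[OF k] .
    show kk: "\<forall>e\<in>vob E. ?l k e = ?r e" unfolding iff[OF k] using k' r' by simp
    fix h assume h0: "h \<in> Hom V ?N (ihom ?C ?X) \<and> (\<forall>e\<in>vob E. ?l h e = ?r e)"
    then have h: "h \<in> ar ?N (ihom ?C ?X)" using N C X by (simp add: ar_def)
    show "h = k"
      by (rule su_ext_ar[OF F X h k]) (use h0 kk in \<open>simp add: iff[OF h] iff[OF k]\<close>)
  qed
  have fs: "far (star V E \<phi>) F G = (THE k. k \<in> Hom V ?N (ihom ?C ?X) \<and> (\<forall>e\<in>vob E. ?l k e = ?r e))"
    by (simp add: star_def)
  have th: "far (star V E \<phi>) F G \<in> Hom V ?N (ihom ?C ?X) \<and> (\<forall>e\<in>vob E. ?l (far (star V E \<phi>) F G) e = ?r e)"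
    unfolding fs by (rule theI'[OF ex1])
  then show 1: "far (star V E \<phi>) F G \<in> ar ?N (ihom ?C ?X)" using N C X by (simp add: ar_def)
  show "\<lbrakk>\<tau> \<in> El ?N; e \<in> vob E; p \<in> El (fob \<phi> e); x \<in> El (fob F e);
      disj \<tau> p; disj \<tau> x; disj p x\<rbrakk> \<Longrightarrow>
      ap ?C ?X (app (far (star V E \<phi>) F G) \<tau>) (su F e p x) = su G e p (nt E F G e \<tau> x)"
    using th unfolding iff[OF 1] by blast
qed

text \<open>
  \<open>\<phi> \<star> Ye \<cong> \<phi>e\<close> sends \<open>p \<otimes> g\<close>, with \<open>g\<close> in \<open>E(e,c)\<close>, to the image of \<open>p\<close> under \<open>\<phi>g\<close>.
\<close>

lemma star_yoneda:
  assumes e: "e \<in> vob E"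
  shows star_yoneda_in: "star_yoneda V E \<phi> e \<in> ar (star_ob V E \<phi> (homfun V E e)) (fob \<phi> e)"
    and app_star_yoneda: "\<lbrakk>c \<in> vob E; p \<in> El (fob \<phi> c); g \<in> El (vhom E e c); disj p g\<rbrakk> \<Longrightarrow>
      app (star_yoneda V E \<phi> e) (su (homfun V E e) c p g) = act \<phi> c e g p"
proof -
  let ?Y = "homfun V E e" and ?X = "fob \<phi> e"
  let ?C = "star_ob V E \<phi> ?Y"
  let ?H = "fcomp V (homfun V (vop V (vself V)) ?X) (fop ?Y)"
  have E': "vcategory V E" using E by simp
  have F: "vfunctor V E (vself V) ?Y" using E' e by simp
  have gphi: "vgraph (vop V E) \<phi>" by (rule col_psi[OF E phi F])
  have o: "fob \<phi> c \<in> Ob V" "vhom E e c \<in> Ob V" if "c \<in> vob E" for c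
    using that e E' gphi by simp_all
  have X: "?X \<in> Ob V" and C: "?C \<in> Ob V" using o[OF e] star_ob_in[OF F] by simp_all
  let ?m = "\<lambda>c. vuncurry V (fob \<phi> c) ?X (far \<phi> c e) \<cdot> symm (fob \<phi> c) (vhom E e c)"
  let ?r = "\<lambda>c. vcurry V (fob \<phi> c) (vhom E e c) ?X (?m c)"
  have r: "?r c \<in> ar (fob \<phi> c) (ihom (vhom E e c) ?X)"
    and r': "\<And>p g. \<lbrakk>p \<in> El (fob \<phi> c); g \<in> El (vhom E e c); disj p g\<rbrakk> \<Longrightarrow> ap (vhom E e c) ?X (app (?r c) p) g = act \<phi> c e g p"
    if c: "c \<in> vob E" for c
  proof -
    have f: "far \<phi> c e \<in> ar (vhom E e c) (ihom (fob \<phi> c) ?X)" using vgraph_far[OF gphi, of c e] c e by simp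
    note s = symm_in[OF o[OF c]] and v = vuncurry_in[OF f o(1)[OF c] X]
    note m = comp_in[OF s v]
    show "?r c \<in> ar (fob \<phi> c) (ihom (vhom E e c) ?X)" by (rule vcurry_in[OF m o[OF c]])
    fix p g assume h: "p \<in> El (fob \<phi> c)" "g \<in> El (vhom E e c)" "disj p g"
    then have d: "disj g p" by (simp add: disj_commute)
    show "ap (vhom E e c) ?X (app (?r c) p) g = act \<phi> c e g p"
      using ap_vcurry[OF m h] app_comp[OF pair_in[OF h] s v] app_symm[OF h] app_vuncurry[OF f o(1)[OF c] X h(2,1) d] by (simp add: act_def)
  qed
  let ?l = "\<lambda>k c. cylinder V (vop V E) (vop V (vself V)) \<phi> (fop ?Y) (star_rep V E \<phi> ?Y) ?X (nm V ?C ?X k) c"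
  have l: "?l k c \<in> ar (fob \<phi> c) (ihom (vhom E e c) ?X)"
    and l': "\<And>p g. \<lbrakk>p \<in> El (fob \<phi> c); g \<in> El (vhom E e c); disj p g\<rbrakk> \<Longrightarrow> ap (vhom E e c) ?X (app (?l k c) p) g = app k (su ?Y c p g)"
    if c: "c \<in> vob E" and k: "k \<in> ar ?C ?X" for c k
  proof -
    have kk: "nm V ?C ?X k \<in> ar \<I> (vhom (vop V (vself V)) ?X ?C)" using nm_in[OF k] by simp
    show "?l k c \<in> ar (fob \<phi> c) (ihom (vhom E e c) ?X)"
      using cylinder_in[OF col[OF F] star_wlim[OF F] _ kk, of c] X c by simp
    fix p g assume h: "p \<in> El (fob \<phi> c)" "g \<in> El (vhom E e c)" "disj p g"
    have "app (?l k c) p = nt (vop V E) \<phi> ?H c (app (star_rep V E \<phi> ?Y ?X) (app (nm V ?C ?X k) one)) p"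
      using app_cylinder[OF col[OF F] star_wlim[OF F] _ kk, of c p] X c h by simp
    then show "ap (vhom E e c) ?X (app (?l k c) p) g = app k (su ?Y c p g)"
      using ap_nt_star[OF F X c h(1) app_in[OF nm_in[OF k] one_in], of g] h ap_nm[OF k su_in[OF F c h(1)]] by simp
  qed
  have iff: "(\<forall>c\<in>vob E. ?l k c = ?r c) \<longleftrightarrow> (\<forall>c\<in>vob E. \<forall>p\<in>El (fob \<phi> c). \<forall>g\<in>El (vhom E e c). disj p g \<longrightarrow>
      app k (su ?Y c p g) = act \<phi> c e g p)" (is "?L \<longleftrightarrow> ?R") if k: "k \<in> ar ?C ?X" for k
  proof
    assume L: ?L
    show ?R
    proof (intro ballI impI)
      fix c p g assume h: "c \<in> vob E" "p \<in> El (fob \<phi> c)" "g \<in> El (vhom E e c)" "disj p g"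
      show "app k (su ?Y c p g) = act \<phi> c e g p" using L h(1) l'[OF h(1) k h(2-4)] r'[OF h] by simp
    qed
  next
    assume R: ?R
    show ?L
    proof
      fix c assume c: "c \<in> vob E"
      show "?l k c = ?r c"
      proof (rule ext1[OF l[OF c k] r[OF c]])
        fix p assume p: "p \<in> El (fob \<phi> c)"
        show "app (?l k c) p = app (?r c) p"
          by (rule ext_ihom[OF app_in[OF l[OF c k] p] app_in[OF r[OF c] p]])
            (use o[OF c] X R c p in \<open>simp_all add: l'[OF c k] r'[OF c]\<close>)
      qed
    qed
  qed
  let ?n = "\<lambda>c. nm V (fob \<phi> c) (ihom (vhom E e c) ?X) (?r c)"
  have w: "wedge V (vop V E) \<phi> ?H \<I> ?n"
  proof (rule hom_into_wedge_unitI[OF E phi F X])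
    show "?n a \<in> ar \<I> (ihom (fob \<phi> a) (ihom (fob ?Y a) ?X))" if "a \<in> vob E" for a
      using nm_in[OF r[OF that]] by simp
    fix a b f p x assume o': "a \<in> vob E" "b \<in> vob E" and h: "f \<in> El (vhom E b a)" "p \<in> El (fob \<phi> a)" "x \<in> El (fob ?Y b)"
      and d: "disj f p" "disj p f" "disj f x" "disj x f" "disj p x" "disj x p"
    have x: "x \<in> El (vhom E e b)" using h by simp
    have q: "act \<phi> a b f p \<in> El (fob \<phi> b)" by (rule act_phi_in[OF E phi F o' h(1,2) d(1)])
    have fx: "cmp E e b a f x \<in> El (vhom E e a)" using o' e E' h x d by simp
    have "act \<phi> b e x (act \<phi> a b f p) = act \<phi> a e (cmp E e b a f x) p"
      using act_cmp[OF _ phi, of a b e x f p] o' e E' h x d by simp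
    then show "ap (fob ?Y b) ?X (ap (fob \<phi> b) (ihom (fob ?Y b) ?X) (app (?n b) one) (act \<phi> a b f p)) x =
      ap (fob ?Y a) ?X (ap (fob \<phi> a) (ihom (fob ?Y a) ?X) (app (?n a) one) p) (act ?Y b a f x)"
      using ap_nm[OF r[OF o'(1)] h(2)] ap_nm[OF r[OF o'(2)] q] r'[OF o'(1) h(2) fx] r'[OF o'(2) q x] o' e E' h x d by simp
  qed
  from su_desc[OF F X w] obtain k0 where k0: "k0 \<in> ar \<I> (ihom ?C ?X)"
    and k0': "\<And>n c p x. \<lbrakk>n \<in> El \<I>; c \<in> vob E; p \<in> El (fob \<phi> c); x \<in> El (fob ?Y c); disj n p; disj n x; disj p x\<rbrakk> \<Longrightarrow>
      ap ?C ?X (app k0 n) (su ?Y c p x) = ap (fob ?Y c) ?X (ap (fob \<phi> c) (ihom (fob ?Y c) ?X) (app (?n c) n) p) x" by blast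
  let ?k = "unnm V ?C ?X k0"
  have k: "?k \<in> ar ?C ?X" by (rule unnm_in[OF k0 C X])
  have ex1: "\<exists>!k. k \<in> Hom V ?C ?X \<and> (\<forall>c\<in>vob E. ?l k c = ?r c)"
  proof (rule ex1I, intro conjI)
    show "?k \<in> Hom V ?C ?X" using ar_Hom[OF k] .
    show kk: "\<forall>c\<in>vob E. ?l ?k c = ?r c"
      unfolding iff[OF k]
    proof (intro ballI impI)
      fix c p g assume h: "c \<in> vob E" "p \<in> El (fob \<phi> c)" "g \<in> El (vhom E e c)" "disj p g"
      show "app ?k (su ?Y c p g) = act \<phi> c e g p"
        using app_unnm[OF k0 C X su_in[OF F h(1,2) _ h(4)]] k0'[OF one_in h(1,2), of g] ap_nm[OF r[OF h(1)] h(2)] r'[OF h] h by simp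
    qed
    fix h assume h0: "h \<in> Hom V ?C ?X \<and> (\<forall>c\<in>vob E. ?l h c = ?r c)"
    then have h: "h \<in> ar ?C ?X" using C X by (simp add: ar_def)
    have "app (nm V ?C ?X h) one = app (nm V ?C ?X ?k) one"
    proof (rule su_ext[OF F X app_in[OF nm_in[OF h] one_in] app_in[OF nm_in[OF k] one_in]])
      fix c p x assume a: "c \<in> vob E" "p \<in> El (fob \<phi> c)" "x \<in> El (fob ?Y c)" "disj p x"
      show "ap ?C ?X (app (nm V ?C ?X h) one) (su ?Y c p x) = ap ?C ?X (app (nm V ?C ?X ?k) one) (su ?Y c p x)"
        using ap_nm[OF h su_in[OF F a]] ap_nm[OF k su_in[OF F a]] h0 kk a by (simp add: iff[OF h] iff[OF k])
    qed simp
    then have eq: "ap ?C ?X (app (nm V ?C ?X h) one) c = ap ?C ?X (app (nm V ?C ?X ?k) one) c" for c by simp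
    show "h = ?k"
      by (rule ext1[OF h k]) (use eq in \<open>simp only: ap_nm[OF h, symmetric] ap_nm[OF k, symmetric]\<close>)
  qed
  have fs: "star_yoneda V E \<phi> e = (THE k. k \<in> Hom V ?C ?X \<and> (\<forall>c\<in>vob E. ?l k c = ?r c))"
    by (simp add: star_yoneda_def)
  have th: "star_yoneda V E \<phi> e \<in> Hom V ?C ?X \<and> (\<forall>c\<in>vob E. ?l (star_yoneda V E \<phi> e) c = ?r c)"
    unfolding fs by (rule theI'[OF ex1])
  then show 1: "star_yoneda V E \<phi> e \<in> ar ?C ?X" using C X by (simp add: ar_def)
  show "\<lbrakk>c \<in> vob E; p \<in> El (fob \<phi> c); g \<in> El (vhom E e c); disj p g\<rbrakk> \<Longrightarrow>
      app (star_yoneda V E \<phi> e) (su (homfun V E e) c p g) = act \<phi> c e g p"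
    using th unfolding iff[OF 1] by blast
qed

text \<open>
  The arrow \<open>[E,V](L,Ye) \<rightarrow> [\<phi> \<star> L, \<phi> \<star> Ye] \<cong> [\<phi> \<star> L, \<phi>e]\<close>. Composed with the unit of the limit \<open>L = {\<alpha>,Y}\<close>
  it gives the cylinder \<open>\<alpha> \<rightarrow> [\<phi> \<star> L, \<phi>-]\<close> which defines the canonical morphism \<open>\<phi> \<star> {\<alpha>,Y} \<rightarrow> {\<alpha>,\<phi>}\<close>;
  \<open>om_nat\<close> is what makes it natural.
\<close>

definition om where
  "om L e = ihom_post V (star_ob V E \<phi> L) (star_ob V E \<phi> (homfun V E e)) (fob \<phi> e) (star_yoneda V E \<phi> e) \<cdot>
     far (star V E \<phi>) L (homfun V E e)"

lemma om:
  assumes L: "vfunctor V E (vself V) L" and e: "e \<in> vob E"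
  shows om_in: "om L e \<in> ar (natob V E L (homfun V E e)) (ihom (star_ob V E \<phi> L) (fob \<phi> e))"
    and ap_om: "\<lbrakk>\<tau> \<in> El (natob V E L (homfun V E e)); c \<in> vob E; p \<in> El (fob \<phi> c); l \<in> El (fob L c);
      disj \<tau> p; disj \<tau> l; disj p l\<rbrakk> \<Longrightarrow>
      ap (star_ob V E \<phi> L) (fob \<phi> e) (app (om L e) \<tau>) (su L c p l) = act \<phi> c e (nt E L (homfun V E e) c \<tau> l) p"
proof -
  have Y: "vfunctor V E (vself V) (homfun V E e)" using E e by simp
  have g: "vgraph E L" "vgraph E (homfun V E e)" using vfunctor_vgraph[of E] E L Y by simp_all
  note p = ihom_post_in[OF star_yoneda_in[OF e] star_ob_in[OF L]] and s = star_far_in[OF L Y]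
  show "om L e \<in> ar (natob V E L (homfun V E e)) (ihom (star_ob V E \<phi> L) (fob \<phi> e))"
    unfolding om_def by (rule comp_in[OF s p])
  assume h: "\<tau> \<in> El (natob V E L (homfun V E e))" "c \<in> vob E" "p \<in> El (fob \<phi> c)" "l \<in> El (fob L c)"
    and d: "disj \<tau> p" "disj \<tau> l" "disj p l"
  have d': "disj p \<tau>" using d by (simp add: disj_commute)
  have n: "nt E L (homfun V E e) c \<tau> l \<in> El (vhom E e c)" using nt_in[OF E g h(2,1,4) d(2)] by simp
  show "ap (star_ob V E \<phi> L) (fob \<phi> e) (app (om L e) \<tau>) (su L c p l) = act \<phi> c e (nt E L (homfun V E e) c \<tau> l) p"
    unfolding om_def
    using app_comp[OF h(1) s p] ap_ihom_post[OF star_yoneda_in[OF e] star_ob_in[OF L] app_in[OF s h(1)] su_in[OF L h(2-4) d(3)]]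
      ap_star_far[OF L Y h d] app_star_yoneda[OF e h(2,3) n] d d' by simp
qed

lemma om_nat:
  assumes L: "vfunctor V E (vself V) L" and o: "e \<in> vob E" "e' \<in> vob E"
    and t: "\<tau> \<in> El (natob V E L (homfun V E e))" and f: "f \<in> El (vhom E e' e)" and d: "disj f \<tau>"
  shows "app (om L e') (cmp (funcat V E) L (homfun V E e) (homfun V E e') (app (far (yoneda V E) e e') f) \<tau>) =
     cmp (vself V) (star_ob V E \<phi> L) (fob \<phi> e) (fob \<phi> e') (app (far \<phi> e e') f) (app (om L e) \<tau>)"
proof -
  have E': "vcategory V E" using E by simp
  have Y: "vfunctor V E (vself V) (homfun V E e)" using E' o by simp
  have g: "vgraph E L" "vgraph E (homfun V E e)" "vgraph E (homfun V E e')" using vfunctor_vgraph[of E] E L o by simp_all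
  have gphi: "vgraph (vop V E) \<phi>" by (rule col_psi[OF E phi Y])
  note y = app_in[OF yoneda_far_in[OF E o] f]
  have d0: "disj (app (far (yoneda V E) e e') f) \<tau>" using d by simp
  let ?c = "cmp (funcat V E) L (homfun V E e) (homfun V E e') (app (far (yoneda V E) e e') f) \<tau>"
  note c = cmp_funcat_in[OF E g y t d0]
  note ot = app_in[OF om_in[OF L o(1)] t] and oc = app_in[OF om_in[OF L o(2)] c]
  have ob: "fob \<phi> e \<in> Ob V" "fob \<phi> e' \<in> Ob V" "star_ob V E \<phi> L \<in> Ob V" using gphi o star_ob_in[OF L] by simp_all
  have ff: "app (far \<phi> e e') f \<in> El (ihom (fob \<phi> e) (fob \<phi> e'))" using vgraph_far_app[OF gphi, of e e' f] o f by simp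
  show ?thesis
  proof (rule su_ext[OF L ob(2) oc])
    show "cmp (vself V) (star_ob V E \<phi> L) (fob \<phi> e) (fob \<phi> e') (app (far \<phi> e e') f) (app (om L e) \<tau>) \<in> El (ihom (star_ob V E \<phi> L) (fob \<phi> e'))"
      using ob ff ot d by simp
    fix z p x assume h: "z \<in> vob E" "p \<in> El (fob \<phi> z)" "x \<in> El (fob L z)" "disj p x" "disj x p"
      and "disj (app (om L e') ?c) p" "disj p (app (om L e') ?c)" "disj (app (om L e') ?c) x" "disj x (app (om L e') ?c)"
    then have d': "disj f p" "disj \<tau> p" "disj p f" "disj p \<tau>" "disj f x" "disj \<tau> x" "disj x f" "disj x \<tau>" by simp_all
    let ?g = "nt E L (homfun V E e) z \<tau> x"
    have gi: "?g \<in> El (vhom E e z)" using nt_in[OF E g(1,2) h(1) t h(3)] d' by simp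
    have "ap (star_ob V E \<phi> L) (fob \<phi> e') (app (om L e') ?c) (su L z p x) = act \<phi> z e' (nt E L (homfun V E e') z ?c x) p"
      using ap_om[OF L o(2) c h(1-3)] d' h by simp
    also have "nt E L (homfun V E e') z ?c x = cmp E e' e z ?g f"
      using nt_cmp_funcat[OF E g h(1) y t d0 h(3)] nt_yoneda[OF E o h(1) f gi] d d' by simp
    also have "act \<phi> z e' (cmp E e' e z ?g f) p = act \<phi> e e' f (act \<phi> z e ?g p)"
      using act_cmp[OF _ phi, of z e e' f ?g p] E' o h f gi d d' by simp
    also have "\<dots> = ap (star_ob V E \<phi> L) (fob \<phi> e') (cmp (vself V) (star_ob V E \<phi> L) (fob \<phi> e) (fob \<phi> e') (app (far \<phi> e e') f) (app (om L e) \<tau>)) (su L z p x)"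
      using ap_om[OF L o(1) t h(1-3)] su_in[OF L h(1-4)] ob ff ot d d' h by (simp add: act_def)
    finally show "ap (star_ob V E \<phi> L) (fob \<phi> e') (app (om L e') ?c) (su L z p x) =
      ap (star_ob V E \<phi> L) (fob \<phi> e') (cmp (vself V) (star_ob V E \<phi> L) (fob \<phi> e) (fob \<phi> e') (app (far \<phi> e e') f) (app (om L e) \<tau>)) (su L z p x)" .
  qed simp
qed

end
end

section \<open>Restriction along a left Kan extension\<close>

context smc_closed begin

text \<open>
  \<open>K(X,-)\<cdot>(S\<cdot>T\<^sup>o\<^sup>p)\<close> and \<open>(K(X,-)\<cdot>S)\<cdot>T\<^sup>o\<^sup>p\<close> need not be equal as records, but act alike on
  elements; that is enough for their wedges to be the same.
\<close>

lemma wedge_cong: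
  assumes F: "vgraph A F" and G: "vgraph A G" and G': "vgraph A G'"
    and fo: "\<And>a. a \<in> vob A \<Longrightarrow> fob G a = fob G' a"
    and ac: "\<And>a b f x. \<lbrakk>a \<in> vob A; b \<in> vob A; f \<in> El (vhom A a b); x \<in> El (fob G a); disj f x\<rbrakk> \<Longrightarrow>
      act G a b f x = act G' a b f x"
    and w: "wedge V A F G N \<pi>"
  shows "wedge V A F G' N \<pi>"
proof (rule wedgeI[OF F G' wedge_ob[OF w]])
  note p = wedge_in[OF F G w]
  show "\<pi> a \<in> ar N (ihom (fob F a) (fob G' a))" if "a \<in> vob A" for a using p[OF that] fo[OF that] by simp
  fix a b n f x assume o: "a \<in> vob A" "b \<in> vob A" and e: "n \<in> El N" "f \<in> El (vhom A a b)" "x \<in> El (fob F a)"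
    and d: "disj n f" "disj f n" "disj n x" "disj x n" "disj f x" "disj x f"
  have m: "ap (fob F a) (fob G a) (app (\<pi> a) n) x \<in> El (fob G a)"
    using app_in[OF p[OF o(1)] e(1)] F G o e d by simp
  show "ap (fob F b) (fob G' b) (app (\<pi> b) n) (act F a b f x) = act G' a b f (ap (fob F a) (fob G' a) (app (\<pi> a) n) x)"
    using wedge_nat[OF F G w o e] ac[OF o e(2) m] d o by (simp add: fo)
qed

end

context bicomplete_smc begin

text \<open>
  The wedge \<open>\<sigma>\<close> out of \<open>\<psi>\<close> is the restriction along \<open>\<eta>\<close> of the wedge \<open>\<pi>\<close> out of \<open>\<alpha>\<close>.
\<close>

definition restricts where
  "restricts D T \<psi> \<alpha> \<eta> G N \<pi> \<sigma> \<longleftrightarrow> (\<forall>d\<in>vob D. \<forall>n\<in>El N. \<forall>p\<in>El (fob \<psi> d). disj n p \<longrightarrow>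
     ap (fob \<alpha> (fob T d)) (fob G (fob T d)) (app (\<pi> (fob T d)) n) (app (\<eta> d) p) =
     ap (fob \<psi> d) (fob G (fob T d)) (app (\<sigma> d) n) p)"

text \<open>
  \<open>\<eta> : \<psi> \<rightarrow> \<alpha>T\<^sup>o\<^sup>p\<close> exhibits \<open>\<alpha>\<close> as \<open>Lan\<close> of \<open>\<psi>\<close> along \<open>T\<^sup>o\<^sup>p\<close>: restriction along \<open>\<eta>\<close> is an isomorphism
  \<open>[E\<^sup>o\<^sup>p,V](\<alpha>,G) \<cong> [D\<^sup>o\<^sup>p,V](\<psi>,GT\<^sup>o\<^sup>p)\<close> for all \<open>G\<close>, stated as existence and uniqueness of extensions of
  wedges with an arbitrary parameter object.
\<close>

definition lan where
  "lan E D T \<psi> \<alpha> \<eta> \<longleftrightarrow>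
     (\<forall>d\<in>vob D. \<eta> d \<in> ar (fob \<psi> d) (fob \<alpha> (fob T d))) \<and>
     (\<forall>d\<in>vob D. \<forall>d'\<in>vob D. \<forall>f\<in>El (vhom D d' d). \<forall>p\<in>El (fob \<psi> d). disj f p \<longrightarrow>
        app (\<eta> d') (act \<psi> d d' f p) = act \<alpha> (fob T d) (fob T d') (app (far T d' d) f) (app (\<eta> d) p)) \<and>
     (\<forall>G N \<sigma>. vfunctor V (vop V E) (vself V) G \<longrightarrow> wedge V (vop V D) \<psi> (fcomp V G (fop T)) N \<sigma> \<longrightarrow>
        (\<exists>\<pi>. wedge V (vop V E) \<alpha> G N \<pi> \<and> restricts D T \<psi> \<alpha> \<eta> G N \<pi> \<sigma>)) \<and>
     (\<forall>G N \<sigma> \<pi> \<pi>'. vfunctor V (vop V E) (vself V) G \<longrightarrow> wedge V (vop V D) \<psi> (fcomp V G (fop T)) N \<sigma> \<longrightarrow>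
        wedge V (vop V E) \<alpha> G N \<pi> \<longrightarrow> wedge V (vop V E) \<alpha> G N \<pi>' \<longrightarrow>
        restricts D T \<psi> \<alpha> \<eta> G N \<pi> \<sigma> \<longrightarrow> restricts D T \<psi> \<alpha> \<eta> G N \<pi>' \<sigma> \<longrightarrow> (\<forall>e\<in>vob E. \<pi> e = \<pi>' e))"

lemma lan_in: "lan E D T \<psi> \<alpha> \<eta> \<Longrightarrow> d \<in> vob D \<Longrightarrow> \<eta> d \<in> ar (fob \<psi> d) (fob \<alpha> (fob T d))"
  and lan_nat: "\<lbrakk>lan E D T \<psi> \<alpha> \<eta>; d \<in> vob D; d' \<in> vob D; f \<in> El (vhom D d' d); p \<in> El (fob \<psi> d); disj f p\<rbrakk> \<Longrightarrow>
      app (\<eta> d') (act \<psi> d d' f p) = act \<alpha> (fob T d) (fob T d') (app (far T d' d) f) (app (\<eta> d) p)"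
  and lan_extend: "\<lbrakk>lan E D T \<psi> \<alpha> \<eta>; vfunctor V (vop V E) (vself V) G; wedge V (vop V D) \<psi> (fcomp V G (fop T)) N \<sigma>\<rbrakk> \<Longrightarrow>
        \<exists>\<pi>. wedge V (vop V E) \<alpha> G N \<pi> \<and> restricts D T \<psi> \<alpha> \<eta> G N \<pi> \<sigma>"
  by (simp_all add: lan_def)

lemma lan_unique: "\<lbrakk>lan E D T \<psi> \<alpha> \<eta>; vfunctor V (vop V E) (vself V) G; wedge V (vop V D) \<psi> (fcomp V G (fop T)) N \<sigma>;
    wedge V (vop V E) \<alpha> G N \<pi>;
    wedge V (vop V E) \<alpha> G N \<pi>'; restricts D T \<psi> \<alpha> \<eta> G N \<pi> \<sigma>; restricts D T \<psi> \<alpha> \<eta> G N \<pi>' \<sigma>; e \<in> vob E\<rbrakk> \<Longrightarrow> \<pi> e = \<pi>' e"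
  unfolding lan_def by blast

context
  fixes E D :: "('u, 'o, 'm) vcat" and T :: "('u, 'u, 'm) vfun" and \<psi> :: "('u, 'o, 'm) vfun"
  assumes E: "small_vcategory V E" and D: "small_vcategory V D" and T: "vfunctor V D E T"
    and psi: "vfunctor V (vop V D) (vself V) \<psi>"
begin

lemma lE: "vcategory V E" and lD: "vcategory V D" and lE': "vcategory V (vop V E)" and lD': "vcategory V (vop V D)"
  and sE: "small_vcategory V (vop V E)" and sD: "small_vcategory V (vop V D)"
  and lpsi: "vgraph (vop V D) \<psi>" and lT: "vfunctor V (vop V D) (vop V E) (fop T)"
  using E D T psi vfunctor_vgraph[OF _ psi] vfunctor_fop[of D E T] by simp_all

lemma T_ob [simp]: "d \<in> vob D \<Longrightarrow> fob T d \<in> vob E"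
  using T by simp

lemma T_far [simp]: "\<lbrakk>d \<in> vob D; d' \<in> vob D; f \<in> El (vhom D d d')\<rbrakk> \<Longrightarrow> app (far T d d') f \<in> El (vhom E (fob T d) (fob T d'))"
  by (rule far_app_in[OF lD lE T])

lemma psi_ob [simp]: "d \<in> vob D \<Longrightarrow> fob \<psi> d \<in> Ob V"
  using lpsi by simp

lemma act_psi_in [simp]: "\<lbrakk>d \<in> vob D; d' \<in> vob D; f \<in> El (vhom D d' d); p \<in> El (fob \<psi> d); disj f p\<rbrakk> \<Longrightarrow>
    act \<psi> d d' f p \<in> El (fob \<psi> d')"
  using act_in[OF lpsi, of d d' f p] by simp

lemma graph_GT: "vgraph (vop V E) G \<Longrightarrow> vgraph (vop V D) (fcomp V G (fop T))"
  by (rule vgraph_fcomp[OF lD' lE' lT])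

lemma act_GT: "\<lbrakk>vgraph (vop V E) G; d \<in> vob D; d' \<in> vob D; f \<in> El (vhom D d' d)\<rbrakk> \<Longrightarrow>
    act (fcomp V G (fop T)) d d' f x = act G (fob T d) (fob T d') (app (far T d' d) f) x"
  using act_fcomp[OF lD' lE' lT, of G d d' f x] by simp

lemma wedge_GT_nat:
  assumes G: "vgraph (vop V E) G" and w: "wedge V (vop V D) \<psi> (fcomp V G (fop T)) N \<sigma>"
    and o: "d \<in> vob D" "d' \<in> vob D" and e: "n \<in> El N" "f \<in> El (vhom D d' d)" "p \<in> El (fob \<psi> d)"
    and dj: "disj n f" "disj n p" "disj f p"
  shows "ap (fob \<psi> d') (fob G (fob T d')) (app (\<sigma> d') n) (act \<psi> d d' f p) =
    act G (fob T d) (fob T d') (app (far T d' d) f) (ap (fob \<psi> d) (fob G (fob T d)) (app (\<sigma> d) n) p)"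
  using wedge_nat[OF lpsi graph_GT[OF G] w, of d d' n f p] o e dj by (simp add: act_GT[OF G])

lemma wedge_GT_in:
  assumes G: "vgraph (vop V E) G" and w: "wedge V (vop V D) \<psi> (fcomp V G (fop T)) N \<sigma>" and o: "d \<in> vob D"
  shows "\<sigma> d \<in> ar N (ihom (fob \<psi> d) (fob G (fob T d)))"
  using wedge_in[OF lpsi graph_GT[OF G] w, of d] o by simp

lemma wedge_GTI:
  assumes G: "vgraph (vop V E) G" and N: "N \<in> Ob V"
    and s: "\<And>d. d \<in> vob D \<Longrightarrow> \<sigma> d \<in> ar N (ihom (fob \<psi> d) (fob G (fob T d)))"
    and eq: "\<And>d d' n f p. \<lbrakk>d \<in> vob D; d' \<in> vob D; n \<in> El N; f \<in> El (vhom D d' d); p \<in> El (fob \<psi> d);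
      disj n f; disj f n; disj n p; disj p n; disj f p; disj p f\<rbrakk> \<Longrightarrow>
      ap (fob \<psi> d') (fob G (fob T d')) (app (\<sigma> d') n) (act \<psi> d d' f p) =
      act G (fob T d) (fob T d') (app (far T d' d) f) (ap (fob \<psi> d) (fob G (fob T d)) (app (\<sigma> d) n) p)"
  shows "wedge V (vop V D) \<psi> (fcomp V G (fop T)) N \<sigma>"
  by (rule wedgeI[OF lpsi graph_GT[OF G] N]) (use s eq in \<open>simp_all add: act_GT[OF G]\<close>)

context
  fixes \<alpha> :: "('u, 'o, 'm) vfun" and \<eta> :: "'u \<Rightarrow> 'm"
  assumes alpha: "vfunctor V (vop V E) (vself V) \<alpha>" and lan: "lan E D T \<psi> \<alpha> \<eta>"
begin

lemma lalpha: "vgraph (vop V E) \<alpha>"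
  by (rule vfunctor_vgraph[OF lE' alpha])

lemma alpha_ob [simp]: "e \<in> vob E \<Longrightarrow> fob \<alpha> e \<in> Ob V"
  using lalpha by simp

lemma eta_app [simp]: "d \<in> vob D \<Longrightarrow> p \<in> El (fob \<psi> d) \<Longrightarrow> app (\<eta> d) p \<in> El (fob \<alpha> (fob T d))"
  by (rule app_in[OF lan_in[OF lan]])

lemma restriction_exists:
  assumes G: "vgraph (vop V E) G" and w: "wedge V (vop V E) \<alpha> G N \<pi>"
  shows "\<exists>\<sigma>. wedge V (vop V D) \<psi> (fcomp V G (fop T)) N \<sigma> \<and> restricts D T \<psi> \<alpha> \<eta> G N \<pi> \<sigma>"
proof -
  have pi: "\<pi> e \<in> ar N (ihom (fob \<alpha> e) (fob G e))" if "e \<in> vob E" for e using wedge_in[OF lalpha G w] that by simp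
  have ob: "fob G e \<in> Ob V" if "e \<in> vob E" for e using G that by simp
  have "\<exists>h. d \<in> vob D \<longrightarrow> h \<in> ar N (ihom (fob \<psi> d) (fob G (fob T d))) \<and> (\<forall>n p. n \<in> El N \<longrightarrow> p \<in> El (fob \<psi> d) \<longrightarrow> disj n p \<longrightarrow>
     ap (fob \<psi> d) (fob G (fob T d)) (app h n) p =
     ap (fob \<alpha> (fob T d)) (fob G (fob T d)) (app (\<pi> (fob T d)) n) (app (\<eta> d) p))" for d
  proof (cases "d \<in> vob D")
    case True
    have "lin2 N (fob \<psi> d) (fob G (fob T d)) (\<lambda>n p. ap (fob \<alpha> (fob T d)) (fob G (fob T d)) (app (\<pi> (fob T d)) n) (app (\<eta> d) p))"
      by (rule lin2_pre2[OF lin1_app[OF lan_in[OF lan True]] lin2_pre1[OF lin1_app[OF pi] lin2_ap]]) (use True ob in simp_all)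
    then show ?thesis by (rule lin2_curry) blast
  qed blast
  then obtain \<sigma> where s: "\<And>d. d \<in> vob D \<Longrightarrow> \<sigma> d \<in> ar N (ihom (fob \<psi> d) (fob G (fob T d)))"
    and s': "\<And>d n p. \<lbrakk>d \<in> vob D; n \<in> El N; p \<in> El (fob \<psi> d); disj n p\<rbrakk> \<Longrightarrow>
      ap (fob \<psi> d) (fob G (fob T d)) (app (\<sigma> d) n) p =
      ap (fob \<alpha> (fob T d)) (fob G (fob T d)) (app (\<pi> (fob T d)) n) (app (\<eta> d) p)" by metis
  have "wedge V (vop V D) \<psi> (fcomp V G (fop T)) N \<sigma>"
  proof (rule wedge_GTI[OF G wedge_ob[OF w] s])
    fix d d' n f p assume h: "d \<in> vob D" "d' \<in> vob D" "n \<in> El N" "f \<in> El (vhom D d' d)" "p \<in> El (fob \<psi> d)"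
      and dj: "disj n f" "disj f n" "disj n p" "disj p n" "disj f p" "disj p f"
    show "ap (fob \<psi> d') (fob G (fob T d')) (app (\<sigma> d') n) (act \<psi> d d' f p) =
      act G (fob T d) (fob T d') (app (far T d' d) f) (ap (fob \<psi> d) (fob G (fob T d)) (app (\<sigma> d) n) p)"
      using h dj wedge_nat[OF lalpha G w, of "fob T d" "fob T d'" n "app (far T d' d) f" "app (\<eta> d) p"]
      by (simp add: s' lan_nat[OF lan])
  qed
  then show ?thesis using s' by (auto simp: restricts_def)
qed

context
  fixes K :: "('k, 'o, 'm) vcat" and S :: "('u, 'k, 'm) vfun"
  assumes K: "vcategory V K" and S: "vfunctor V (vop V E) K S"
begin

lemma ST: "vfunctor V (vop V D) K (fcomp V S (fop T))"
  by (rule vfunctor_fcomp[OF lD' lE' K lT S])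

lemma far_ST: "\<lbrakk>d \<in> vob D; d' \<in> vob D; f \<in> El (vhom D d' d)\<rbrakk> \<Longrightarrow>
    app (far (fcomp V S (fop T)) d d') f = app (far S (fob T d) (fob T d')) (app (far T d' d) f)"
  using far_fcomp[of f "vop V D" d d' "fop T" "vop V E" S] far_in[OF lD' lE' lT, of d d'] far_in[OF lE' K S, of "fob T d" "fob T d'"] by simp

abbreviation KS where "KS X \<equiv> fcomp V (homfun V K X) S"

lemma KS_functor: "X \<in> vob K \<Longrightarrow> vfunctor V (vop V E) (vself V) (KS X)"
  by (rule vfunctor_fcomp[OF lE' K vcategory_vself S]) (simp add: K)

lemma KS_graph: "X \<in> vob K \<Longrightarrow> vgraph (vop V E) (KS X)"
  by (rule vfunctor_vgraph[OF lE' KS_functor])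

lemma act_KS: "\<lbrakk>X \<in> vob K; e \<in> vob E; e' \<in> vob E; f \<in> El (vhom E e' e); g \<in> El (vhom K X (fob S e));
    disj f g\<rbrakk> \<Longrightarrow> act (KS X) e e' f g = cmp K X (fob S e) (fob S e') (app (far S e e') f) g"
  using act_KD[OF sE K lalpha S, of X e e' f g] by simp

lemma act_KST:
  assumes X: "X \<in> vob K" and o: "d \<in> vob D" "d' \<in> vob D" and f: "f \<in> El (vhom D d' d)" and g: "g \<in> El (vhom K X (fob S (fob T d)))"
    and dj: "disj f g"
  shows "act (fcomp V (homfun V K X) (fcomp V S (fop T))) d d' f g = act (fcomp V (KS X) (fop T)) d d' f g"
  using act_KD[OF sD K lpsi ST X, of d d' f g] act_KS[OF X, of "fob T d" "fob T d'" "app (far T d' d) f" g] o f g dj X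
  by (simp add: act_GT[OF KS_graph] far_ST)

text \<open>
  The left side occurs in the definition of \<open>{\<psi>, ST\<^sup>o\<^sup>p}\<close>, the right side in the universal property of
  \<open>\<alpha>\<close> for the functor \<open>K(X,S-)\<close>.
\<close>

lemma wedge_KST_iff:
  assumes X: "X \<in> vob K"
  shows "wedge V (vop V D) \<psi> (fcomp V (homfun V K X) (fcomp V S (fop T))) N \<sigma> \<longleftrightarrow>
    wedge V (vop V D) \<psi> (fcomp V (KS X) (fop T)) N \<sigma>"
proof -
  note g = vgraph_KD[OF sD K lpsi ST X] graph_GT[OF KS_graph[OF X]]
  show ?thesis
  proof
    assume w: "wedge V (vop V D) \<psi> (fcomp V (homfun V K X) (fcomp V S (fop T))) N \<sigma>"
    show "wedge V (vop V D) \<psi> (fcomp V (KS X) (fop T)) N \<sigma>"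
      by (rule wedge_cong[OF lpsi g(1,2) _ _ w]) (use act_KST[OF X] in simp_all)
  next
    assume w: "wedge V (vop V D) \<psi> (fcomp V (KS X) (fop T)) N \<sigma>"
    show "wedge V (vop V D) \<psi> (fcomp V (homfun V K X) (fcomp V S (fop T))) N \<sigma>"
      by (rule wedge_cong[OF lpsi g(2,1) _ _ w]) (use act_KST[OF X] in simp_all)
  qed
qed

lemma restricted_fits:
  assumes v: "weighted_cone (vop V E) K \<alpha> S L v" and u: "\<And>d. d \<in> vob D \<Longrightarrow> u d = v (fob T d) \<cdot> \<eta> d"
    and d: "d \<in> vob D" and p: "p \<in> El (fob \<psi> d)"
  shows "app (u d) p = app (v (fob T d)) (app (\<eta> d) p)"
  using app_comp[OF p lan_in[OF lan d] cone_in[OF v]] u d by simp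

lemma fits_restrict:
  assumes v: "weighted_cone (vop V E) K \<alpha> S L v" and u: "\<And>d. d \<in> vob D \<Longrightarrow> u d = v (fob T d) \<cdot> \<eta> d"
    and r: "restricts D T \<psi> \<alpha> \<eta> (KS X) N \<pi> \<sigma>" and f: "fits (vop V E) K \<alpha> S L v X N \<pi> k"
  shows "fits (vop V D) K \<psi> (fcomp V S (fop T)) L u X N \<sigma> k"
  unfolding fits_def
proof (intro ballI impI)
  fix d n p assume "d \<in> vob (vop V D)" and h: "n \<in> El N" "p \<in> El (fob \<psi> d)" "disj n p"
  then have d: "d \<in> vob D" by simp
  show "ap (fob \<psi> d) (vhom K X (fob (fcomp V S (fop T)) d)) (app (\<sigma> d) n) p =
    cmp K X L (fob (fcomp V S (fop T)) d) (app (u d) p) (app k n)"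
    using f r d h restricted_fits[OF v u d h(2)] by (simp add: fits_def restricts_def)
qed

text \<open>
  The wedge that fits \<open>k\<close> for the cone \<open>v\<close> has the same restriction as \<open>\<pi>\<close>, so it is \<open>\<pi>\<close>.
\<close>

lemma fits_extend:
  assumes X: "X \<in> vob K" and v: "weighted_cone (vop V E) K \<alpha> S L v" and u: "\<And>d. d \<in> vob D \<Longrightarrow> u d = v (fob T d) \<cdot> \<eta> d"
    and w: "wedge V (vop V E) \<alpha> (KS X) N \<pi>" and s: "wedge V (vop V D) \<psi> (fcomp V (KS X) (fop T)) N \<sigma>"
    and r: "restricts D T \<psi> \<alpha> \<eta> (KS X) N \<pi> \<sigma>" and k: "k \<in> ar N (vhom K X L)"
    and f: "fits (vop V D) K \<psi> (fcomp V S (fop T)) L u X N \<sigma> k"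
  shows "fits (vop V E) K \<alpha> S L v X N \<pi> k"
proof -
  obtain \<pi>' where w': "wedge V (vop V E) \<alpha> (KS X) N \<pi>'" and f': "fits (vop V E) K \<alpha> S L v X N \<pi>' k"
    by (rule cone_wedge[OF sE K lalpha S v X k])
  have "restricts D T \<psi> \<alpha> \<eta> (KS X) N \<pi>' \<sigma>"
    unfolding restricts_def
  proof (intro ballI impI)
    fix d n p assume d: "d \<in> vob D" and h: "n \<in> El N" "p \<in> El (fob \<psi> d)" "disj n p"
    show "ap (fob \<alpha> (fob T d)) (fob (KS X) (fob T d)) (app (\<pi>' (fob T d)) n) (app (\<eta> d) p) =
      ap (fob \<psi> d) (fob (KS X) (fob T d)) (app (\<sigma> d) n) p"
      using f f' d h restricted_fits[OF v u d h(2)] by (simp add: fits_def)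
  qed
  then have "\<pi> e = \<pi>' e" if "e \<in> vob E" for e
    using lan_unique[OF lan KS_functor[OF X] s w w' r _ that] by blast
  then show ?thesis using f' by (simp add: fits_def)
qed

text \<open>
  Wedges from \<open>\<alpha>\<close> to \<open>K(X,S-)\<close> correspond to wedges from \<open>\<psi>\<close> to \<open>K(X,ST\<^sup>o\<^sup>p-)\<close>, and corresponding wedges
  fit the same arrows. Hence \<open>{\<alpha>,S}\<close> is also \<open>{\<psi>,ST\<^sup>o\<^sup>p}\<close>.
\<close>

lemma limit_unit_restrict:
  assumes v: "limit_unit (vop V E) K \<alpha> S L v"
  shows "limit_unit (vop V D) K \<psi> (fcomp V S (fop T)) L (\<lambda>d. v (fob T d) \<cdot> \<eta> d)"
    (is "limit_unit _ _ _ _ _ ?u")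
proof -
  note vc = limit_unit_cone[OF v] and L = limit_unit_ob[OF v]
  note app_u = restricted_fits[OF vc, of ?u, OF refl]
  show ?thesis
    unfolding limit_unit_def weighted_cone_def
  proof (intro conjI ballI allI impI)
    show "L \<in> vob K" by (rule L)
    show "?u d \<in> ar (fob \<psi> d) (vhom K L (fob (fcomp V S (fop T)) d))" if "d \<in> vob (vop V D)" for d
      using comp_in[OF lan_in[OF lan] cone_in[OF vc]] that by simp
    fix d d' f p assume "d \<in> vob (vop V D)" "d' \<in> vob (vop V D)" "f \<in> El (vhom (vop V D) d d')" and p: "p \<in> El (fob \<psi> d)" "disj f p"
    then have o: "d \<in> vob D" "d' \<in> vob D" and f: "f \<in> El (vhom D d' d)" by simp_all
    show "app (?u d') (act \<psi> d d' f p) = cmp K L (fob (fcomp V S (fop T)) d) (fob (fcomp V S (fop T)) d')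
      (app (far (fcomp V S (fop T)) d d') f) (app (?u d) p)"
      using o f p app_u[OF o(1) p(1)] app_u[OF o(2) act_psi_in[OF o f p]] cone_nat[OF vc, of "fob T d" "fob T d'" "app (far T d' d) f" "app (\<eta> d) p"]
      by (simp add: lan_nat[OF lan] far_ST)
  next
    fix X N \<sigma> assume X: "X \<in> vob K" and w: "wedge V (vop V D) \<psi> (fcomp V (homfun V K X) (fcomp V S (fop T))) N \<sigma>"
    then obtain \<pi> where p: "wedge V (vop V E) \<alpha> (KS X) N \<pi>" and r: "restricts D T \<psi> \<alpha> \<eta> (KS X) N \<pi> \<sigma>"
      using lan_extend[OF lan KS_functor[OF X]] by (auto simp: wedge_KST_iff)
    have "fits (vop V D) K \<psi> (fcomp V S (fop T)) L ?u X N \<sigma> k \<longleftrightarrow> fits (vop V E) K \<alpha> S L v X N \<pi> k"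
      if "k \<in> ar N (vhom K X L)" for k
      using fits_restrict[OF vc refl r] fits_extend[OF X vc refl p w[unfolded wedge_KST_iff[OF X]] r that] by blast
    then show "\<exists>!k. k \<in> ar N (vhom K X L) \<and> fits (vop V D) K \<psi> (fcomp V S (fop T)) L ?u X N \<sigma> k"
      using limit_unit_ex1[OF v X p] by blast
  qed
qed

text \<open>
  Conversely, a limit \<open>{\<psi>,ST\<^sup>o\<^sup>p}\<close> is a limit \<open>{\<alpha>,S}\<close>; its unit is the extension along \<open>\<eta>\<close> of the given
  unit, regarded as a wedge with parameter object \<open>\<I>\<close>.
\<close>

lemma limit_unit_extend:
  assumes u: "limit_unit (vop V D) K \<psi> (fcomp V S (fop T)) L u"
  shows "\<exists>v. limit_unit (vop V E) K \<alpha> S L v \<and> (\<forall>d\<in>vob D. v (fob T d) \<cdot> \<eta> d = u d)"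
proof -
  note uc = limit_unit_cone[OF u] and L = limit_unit_ob[OF u]
  note KSL = KS_graph[OF L]
  obtain \<sigma> where "wedge V (vop V D) \<psi> (fcomp V (homfun V K L) (fcomp V S (fop T))) \<I> \<sigma>"
    and sf: "fits (vop V D) K \<psi> (fcomp V S (fop T)) L u L \<I> \<sigma> (vid K L)"
    by (rule cone_wedge[OF sD K lpsi ST uc L vid_in[OF K L]])
  then obtain \<pi> where p: "wedge V (vop V E) \<alpha> (KS L) \<I> \<pi>" and r: "restricts D T \<psi> \<alpha> \<eta> (KS L) \<I> \<pi> \<sigma>"
    using lan_extend[OF lan KS_functor[OF L]] by (auto simp: wedge_KST_iff[OF L])
  have pi: "\<pi> e \<in> ar \<I> (ihom (fob \<alpha> e) (vhom K L (fob S e)))" if "e \<in> vob E" for e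
    using wedge_in[OF lalpha KSL p, of e] that by simp
  have ob: "vhom K L (fob S e) \<in> Ob V" if "e \<in> vob E" for e using KSL that by (metis fob_simps(3) homfun_fob vgraph_fob vop_simps(1))
  define v where "v e = unnm V (fob \<alpha> e) (vhom K L (fob S e)) (\<pi> e)" for e
  have v: "v e \<in> ar (fob \<alpha> e) (vhom K L (fob S e))" if "e \<in> vob E" for e
    unfolding v_def by (rule unnm_in[OF pi[OF that]]) (use that ob in simp_all)
  have v': "app (v e) q = ap (fob \<alpha> e) (vhom K L (fob S e)) (app (\<pi> e) one) q" if "e \<in> vob E" "q \<in> El (fob \<alpha> e)" for e q
    unfolding v_def by (rule app_unnm[OF pi[OF that(1)] _ _ that(2)]) (use that ob in simp_all)
  have vc: "weighted_cone (vop V E) K \<alpha> S L v"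
    unfolding weighted_cone_def
  proof (intro conjI ballI impI)
    show "L \<in> vob K" by (rule L)
    show "v e \<in> ar (fob \<alpha> e) (vhom K L (fob S e))" if "e \<in> vob (vop V E)" for e using v that by simp
    fix e e' f q assume "e \<in> vob (vop V E)" "e' \<in> vob (vop V E)" "f \<in> El (vhom (vop V E) e e')" and q: "q \<in> El (fob \<alpha> e)" "disj f q"
    then have o: "e \<in> vob E" "e' \<in> vob E" and f: "f \<in> El (vhom E e' e)" by simp_all
    have m: "ap (fob \<alpha> e) (vhom K L (fob S e)) (app (\<pi> e) one) q \<in> El (vhom K L (fob S e))"
      using app_in[OF pi[OF o(1)] one_in] o q ob by simp
    have aq: "act \<alpha> e e' f q \<in> El (fob \<alpha> e')" using act_in[OF lalpha, of e e' f q] o f q by simp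
    show "app (v e') (act \<alpha> e e' f q) = cmp K L (fob S e) (fob S e') (app (far S e e') f) (app (v e) q)"
      using wedge_nat[OF lalpha KSL p, of e e' one f q] o f q v'[OF o(1) q(1)] v'[OF o(2) aq] act_KS[OF L o f m] by simp
  qed
  have vu: "v (fob T d) \<cdot> \<eta> d = u d" if d: "d \<in> vob D" for d
  proof (rule ext1)
    show "v (fob T d) \<cdot> \<eta> d \<in> ar (fob \<psi> d) (vhom K L (fob S (fob T d)))" using comp_in[OF lan_in[OF lan d] v] d by simp
    show ud: "u d \<in> ar (fob \<psi> d) (vhom K L (fob S (fob T d)))" using cone_in[OF uc, of d] d by simp
    fix p assume h: "p \<in> El (fob \<psi> d)"
    have i: "app (vid K L) one = idn K L" by (simp add: idn_def)
    have up: "app (u d) p \<in> El (vhom K L (fob S (fob T d)))" by (rule app_in[OF ud h])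
    have "app (v (fob T d) \<cdot> \<eta> d) p = app (v (fob T d)) (app (\<eta> d) p)"
      using app_comp[OF h lan_in[OF lan d] v] d by simp
    also have "\<dots> = ap (fob \<psi> d) (vhom K L (fob S (fob T d))) (app (\<sigma> d) one) p"
      using r d h by (simp add: v' restricts_def)
    also have "\<dots> = app (u d) p"
      using sf d h up K L S by (simp add: fits_def i)
    finally show "app (v (fob T d) \<cdot> \<eta> d) p = app (u d) p" .
  qed
  have "limit_unit (vop V E) K \<alpha> S L v"
    unfolding limit_unit_def
  proof (intro conjI ballI allI impI)
    fix X N \<pi> assume X: "X \<in> vob K" and w: "wedge V (vop V E) \<alpha> (KS X) N \<pi>"
    obtain \<sigma> where s: "wedge V (vop V D) \<psi> (fcomp V (KS X) (fop T)) N \<sigma>" and r: "restricts D T \<psi> \<alpha> \<eta> (KS X) N \<pi> \<sigma>"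
      using restriction_exists[OF KS_graph[OF X] w] by blast
    have "fits (vop V D) K \<psi> (fcomp V S (fop T)) L u X N \<sigma> k \<longleftrightarrow> fits (vop V E) K \<alpha> S L v X N \<pi> k"
      if "k \<in> ar N (vhom K X L)" for k
      using fits_restrict[OF vc vu[symmetric] r] fits_extend[OF X vc vu[symmetric] w s r that] by blast
    then show "\<exists>!k. k \<in> ar N (vhom K X L) \<and> fits (vop V E) K \<alpha> S L v X N \<pi> k"
      using limit_unit_ex1[OF u X] s by (metis wedge_KST_iff[OF X])
  qed (rule vc)
  then show ?thesis using vu by blast
qed

end

text \<open>
  Natural transformations \<open>\<alpha> \<rightarrow> G\<close> are wedges with parameter object \<open>\<I>\<close>, so they are determined by their
  restrictions along \<open>\<eta>\<close>. This is what allows equations of cylinders to be checked on \<open>\<psi>\<close>.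
\<close>

lemma lan_nat_unique:
  assumes G: "vfunctor V (vop V E) (vself V) G"
    and x: "\<And>e. e \<in> vob E \<Longrightarrow> x e \<in> ar (fob \<alpha> e) (fob G e)" and y: "\<And>e. e \<in> vob E \<Longrightarrow> y e \<in> ar (fob \<alpha> e) (fob G e)"
    and xn: "\<And>e e' f q. \<lbrakk>e \<in> vob E; e' \<in> vob E; f \<in> El (vhom E e' e); q \<in> El (fob \<alpha> e); disj f q; disj q f\<rbrakk> \<Longrightarrow>
      app (x e') (act \<alpha> e e' f q) = act G e e' f (app (x e) q)"
    and yn: "\<And>e e' f q. \<lbrakk>e \<in> vob E; e' \<in> vob E; f \<in> El (vhom E e' e); q \<in> El (fob \<alpha> e); disj f q; disj q f\<rbrakk> \<Longrightarrow>
      app (y e') (act \<alpha> e e' f q) = act G e e' f (app (y e) q)"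
    and eq: "\<And>d p. d \<in> vob D \<Longrightarrow> p \<in> El (fob \<psi> d) \<Longrightarrow> app (x (fob T d)) (app (\<eta> d) p) = app (y (fob T d)) (app (\<eta> d) p)"
    and e: "e \<in> vob E"
  shows "x e = y e"
proof -
  note gG = vfunctor_vgraph[OF lE' G]
  have n: "ap (fob \<alpha> e) (fob G e) (app (nm V (fob \<alpha> e) (fob G e) (z e)) one) q = app (z e) q"
    if "e \<in> vob E" "\<And>e. e \<in> vob E \<Longrightarrow> z e \<in> ar (fob \<alpha> e) (fob G e)" "q \<in> El (fob \<alpha> e)" for e q z
    using ap_nm[OF that(2)[OF that(1)] that(3)] .
  have aq: "act \<alpha> e e' f q \<in> El (fob \<alpha> e')" if "e \<in> vob E" "e' \<in> vob E" "f \<in> El (vhom E e' e)" "q \<in> El (fob \<alpha> e)" "disj f q" for e e' f q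
    using act_in[OF lalpha, of e e' f q] that by simp
  have w: "wedge V (vop V E) \<alpha> G \<I> (\<lambda>e. nm V (fob \<alpha> e) (fob G e) (z e))"
    if z: "\<And>e. e \<in> vob E \<Longrightarrow> z e \<in> ar (fob \<alpha> e) (fob G e)"
      "\<And>e e' f q. \<lbrakk>e \<in> vob E; e' \<in> vob E; f \<in> El (vhom E e' e); q \<in> El (fob \<alpha> e); disj f q; disj q f\<rbrakk> \<Longrightarrow>
      app (z e') (act \<alpha> e e' f q) = act G e e' f (app (z e) q)" for z
    by (rule wedge_unitI[OF lalpha gG]) (use z nm_in n aq in simp_all)
  obtain \<sigma> where s: "restricts D T \<psi> \<alpha> \<eta> G \<I> (\<lambda>e. nm V (fob \<alpha> e) (fob G e) (x e)) \<sigma>"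
    and sw: "wedge V (vop V D) \<psi> (fcomp V G (fop T)) \<I> \<sigma>"
    using restriction_exists[OF gG w[OF x xn]] by blast
  \<comment> \<open>A restriction concerns all elements \<open>n\<close> of \<open>\<I>\<close>, not only \<open>one\<close>; \<open>n\<close> is absorbed by \<open>lun\<close>.\<close>
  have lun: "ap X Z (app (nm V X Z h) n) q = app h (app (lun X) (pair n q))"
    if "h \<in> ar X Z" "n \<in> El \<I>" "q \<in> El X" "disj n q" for X Z h n q
    using ap_vcurry[OF comp_in[OF lun_in that(1)] that(2-4)] app_comp[OF pair_in[OF that(2-4)] lun_in that(1)] ar_dom[OF that(1)]
    by (simp add: nm_def)
  have lun_eta: "app (lun Z) (pair n (app h p)) = app h (app (lun X) (pair n p))"
    if "h \<in> ar X Z" "n \<in> El \<I>" "p \<in> El X" "disj n p" for X Z h n p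
  proof -
    have X: "X \<in> Ob V" and Z: "Z \<in> Ob V" using ar_dom[OF that(1)] ar_cod[OF that(1)] .
    have np: "pair n p \<in> El (\<I> \<otimes> X)" using that by simp
    have "app (lun Z) (pair n (app h p)) = app (lun Z) (app (\<one> \<I> \<odot> h) (pair n p))"
      using app_tens[OF id_in[OF unit_ob] that] app_id[OF that(2)] by simp
    also have "\<dots> = app (lun Z \<cdot> (\<one> \<I> \<odot> h)) (pair n p)"
      using app_comp[OF np tens_in[OF id_in[OF unit_ob] that(1)] lun_in[OF Z]] by simp
    also have "\<dots> = app h (app (lun X) (pair n p))"
      using app_comp[OF np lun_in[OF X] that(1)] by (simp add: lun_nat[OF that(1)])
    finally show ?thesis .
  qed
  have "restricts D T \<psi> \<alpha> \<eta> G \<I> (\<lambda>e. nm V (fob \<alpha> e) (fob G e) (y e)) \<sigma>"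
    unfolding restricts_def
  proof (intro ballI impI)
    fix d n p assume d: "d \<in> vob D" and h: "n \<in> El \<I>" "p \<in> El (fob \<psi> d)" "disj n p"
    have lp: "app (lun (fob \<psi> d)) (pair n p) \<in> El (fob \<psi> d)" using app_in[OF lun_in pair_in[OF h]] d by simp
    have ep: "app (\<eta> d) p \<in> El (fob \<alpha> (fob T d))" and ed: "disj n (app (\<eta> d) p)" using d h by simp_all
    have "ap (fob \<alpha> (fob T d)) (fob G (fob T d)) (app (nm V (fob \<alpha> (fob T d)) (fob G (fob T d)) (y (fob T d))) n) (app (\<eta> d) p)
      = ap (fob \<alpha> (fob T d)) (fob G (fob T d)) (app (nm V (fob \<alpha> (fob T d)) (fob G (fob T d)) (x (fob T d))) n) (app (\<eta> d) p)"
      using lun[OF x h(1) ep ed] lun[OF y h(1) ep ed] eq[OF d lp] d by (simp add: lun_eta[OF lan_in[OF lan d] h])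
    then show "ap (fob \<alpha> (fob T d)) (fob G (fob T d)) (app (nm V (fob \<alpha> (fob T d)) (fob G (fob T d)) (y (fob T d))) n) (app (\<eta> d) p)
      = ap (fob \<psi> d) (fob G (fob T d)) (app (\<sigma> d) n) p"
      using s d h by (simp add: restricts_def)
  qed
  from lan_unique[OF lan G sw w[OF x xn] w[OF y yn] s this e]
  have m: "nm V (fob \<alpha> e) (fob G e) (x e) = nm V (fob \<alpha> e) (fob G e) (y e)" by simp
  show ?thesis
  proof (rule ext1[OF x[OF e] y[OF e]])
    fix q assume q: "q \<in> El (fob \<alpha> e)"
    show "app (x e) q = app (y e) q" using ap_nm[OF x[OF e] q] ap_nm[OF y[OF e] q] m by simp
  qed
qed

end

section \<open>Left Kan extensions as weighted colimits\<close>

text \<open>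
  The colimit \<open>\<psi> \<star> YT\<close> in \<open>[E\<^sup>o\<^sup>p,V]\<close> is a limit in \<open>[E\<^sup>o\<^sup>p,V]\<^sup>o\<^sup>p\<close>: its cones have components
  \<open>\<psi>d \<rightarrow> [E\<^sup>o\<^sup>p,V](Y(Td),\<alpha>)\<close>. By the Yoneda lemma these are arrows \<open>\<psi>d \<rightarrow> \<alpha>(Td)\<close>, and the universal property
  of the colimit becomes that of the left Kan extension. In the lemmas below \<open>w\<close> and \<open>\<eta>\<close>, as well as
  \<open>\<sigma>'\<close> and \<open>\<sigma>\<close>, correspond to each other in this way.
\<close>

abbreviation FC where "FC \<equiv> funcat V (vop V E)"
abbreviation YY where "YY \<equiv> yoneda V (vop V E)"
abbreviation Yo where "Yo t \<equiv> homfun V (vop V E) t"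
abbreviation YG where "YG G d \<equiv> natob V (vop V E) (Yo (fob T d)) G"
abbreviation at_id where "at_id G d \<tau> \<equiv> nt (vop V E) (Yo (fob T d)) G (fob T d) \<tau> (idn E (fob T d))"
abbreviation homY where "homY G \<equiv> fcomp V (homfun V (vop V FC) G) (fop (fcomp V YY T))"

lemma FC: "vcategory V FC" and YY: "vfunctor V E FC YY"
  using vcategory_funcat[OF sE] vfunctor_vop_vop[OF lE vcategory_funcat[OF sE] vfunctor_yoneda[OF sE]] by blast+

lemma Yo_graph: "t \<in> vob E \<Longrightarrow> vgraph (vop V E) (Yo t)"
  by (rule vgraph_homfun[OF lE']) simp

lemma yoneda_nt:
  assumes G: "vgraph (vop V E) G" and t: "t \<in> vob E" and h: "\<tau> \<in> El (natob V (vop V E) (Yo t) G)"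
    and c: "c \<in> vob E" and g: "g \<in> El (vhom E c t)" and d: "disj \<tau> g"
  shows "nt (vop V E) (Yo t) G c \<tau> g = act G t c g (nt (vop V E) (Yo t) G t \<tau> (idn E t))"
  using nt_nat[OF sE Yo_graph[OF t] G, of t c \<tau> g "idn E t"] assms lE by simp

lemma yoneda_ext:
  assumes G: "vgraph (vop V E) G" and t: "t \<in> vob E" and h: "\<sigma> \<in> El (natob V (vop V E) (Yo t) G)" "\<tau> \<in> El (natob V (vop V E) (Yo t) G)"
    and st: "fst \<sigma> = fst \<tau>"
    and eq: "nt (vop V E) (Yo t) G t \<sigma> (idn E t) = nt (vop V E) (Yo t) G t \<tau> (idn E t)"
  shows "\<sigma> = \<tau>"
proof (rule ext_natob[OF sE Yo_graph[OF t] G h st])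
  fix c g assume "c \<in> vob (vop V E)" "g \<in> El (fob (Yo t) c)" and d: "disj \<sigma> g" "disj \<tau> g"
  then have c: "c \<in> vob E" and g: "g \<in> El (vhom E c t)" by simp_all
  show "nt (vop V E) (Yo t) G c \<sigma> g = nt (vop V E) (Yo t) G c \<tau> g"
    using yoneda_nt[OF G t h(1) c g d(1)] yoneda_nt[OF G t h(2) c g d(2)] eq by simp
qed

lemma yoneda_lift:
  assumes G: "vfunctor V (vop V E) (vself V) G" and t: "t \<in> vob E" and s: "s \<in> ar M (fob G t)"
  obtains s' where "s' \<in> ar M (natob V (vop V E) (Yo t) G)"
    "\<And>m. m \<in> El M \<Longrightarrow> nt (vop V E) (Yo t) G t (app s' m) (idn E t) = app s m"
proof -
  note gG = vfunctor_vgraph[OF lE' G]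
  have M: "M \<in> Ob V" using ar_dom[OF s] .
  have "\<exists>h. c \<in> vob E \<longrightarrow> h \<in> ar M (ihom (vhom E c t) (fob G c)) \<and> (\<forall>m g. m \<in> El M \<longrightarrow> g \<in> El (vhom E c t) \<longrightarrow> disj m g \<longrightarrow>
     ap (vhom E c t) (fob G c) (app h m) g = act G t c g (app s m))" for c
  proof (cases "c \<in> vob E")
    case True
    have "lin2 M (vhom E c t) (fob G c) (\<lambda>m g. act G t c g (app s m))"
      using lin2_swap[OF lin2_pre2[OF lin1_app[OF s] lin2_act[OF gG, of t c]]] t True by simp
    then show ?thesis by (rule lin2_curry) blast
  qed blast
  then obtain q where q: "\<And>c. c \<in> vob E \<Longrightarrow> q c \<in> ar M (ihom (vhom E c t) (fob G c))"
    and q': "\<And>c m g. \<lbrakk>c \<in> vob E; m \<in> El M; g \<in> El (vhom E c t); disj m g\<rbrakk> \<Longrightarrow>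
       ap (vhom E c t) (fob G c) (app (q c) m) g = act G t c g (app s m)" by metis
  have w: "wedge V (vop V E) (Yo t) G M q"
  proof (rule wedgeI[OF Yo_graph[OF t] gG M])
    show "q c \<in> ar M (ihom (fob (Yo t) c) (fob G c))" if "c \<in> vob (vop V E)" for c using q that by simp
    fix a b n f x assume "a \<in> vob (vop V E)" "b \<in> vob (vop V E)" and n: "n \<in> El M" and "f \<in> El (vhom (vop V E) a b)" "x \<in> El (fob (Yo t) a)"
      and d: "disj n f" "disj f n" "disj n x" "disj x n" "disj f x" "disj x f"
    then have o: "a \<in> vob E" "b \<in> vob E" and f: "f \<in> El (vhom E b a)" and x: "x \<in> El (vhom E a t)" by simp_all
    have m: "app s n \<in> El (fob G t)" by (rule app_in[OF s n])
    have fx: "cmp E b a t x f \<in> El (vhom E b t)" using o t f x d lE by simp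
    show "ap (fob (Yo t) b) (fob G b) (app (q b) n) (act (Yo t) a b f x) = act G a b f (ap (fob (Yo t) a) (fob G a) (app (q a) n) x)"
      using o t f x d n m fx lE act_cmp[OF lE' G, of t a b f x "app s n"] by (simp add: q')
  qed
  show ?thesis
  proof (rule that[OF into_end_in[OF sE Yo_graph[OF t] gG w]])
    fix m assume m: "m \<in> El M"
    show "nt (vop V E) (Yo t) G t (app (into_end V (vop V E) (Yo t) G M q) m) (idn E t) = app s m"
      using nt_into_end[OF sE Yo_graph[OF t] gG w _ m, of t "idn E t"] q'[OF t m, of "idn E t"] t lE act_idn[OF lE' G, of t] app_in[OF s m] by simp
  qed
qed

lemma YT: "vfunctor V D FC (fcomp V YY T)"
  by (rule vfunctor_fcomp[OF lD lE FC T YY])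

lemma YT_op: "vfunctor V (vop V D) (vop V FC) (fop (fcomp V YY T))"
  by (rule vfunctor_fop[OF lD FC YT])

lemma fob_YY [simp]: "fob YY = homfun V (vop V E)"
  by (rule fob_yoneda[OF sE])

lemma far_YT:
  assumes o: "d \<in> vob D" "d' \<in> vob D" and f: "f \<in> El (vhom D d' d)"
  shows "app (far (fcomp V YY T) d' d) f \<in> El (natob V (vop V E) (Yo (fob T d')) (Yo (fob T d)))"
    and "nt (vop V E) (Yo (fob T d')) (Yo (fob T d)) (fob T d') (app (far (fcomp V YY T) d' d) f) (idn E (fob T d')) = app (far T d' d) f"
proof -
  show "app (far (fcomp V YY T) d' d) f \<in> El (natob V (vop V E) (Yo (fob T d')) (Yo (fob T d)))"
    using far_app_in[OF lD FC YT o(2,1) f] by simp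
  have "app (far (fcomp V YY T) d' d) f = app (far YY (fob T d') (fob T d)) (app (far T d' d) f)"
    using far_fcomp[OF f far_in[OF lD lE T o(2,1)] far_in[OF lE FC YY]] o by simp
  then show "nt (vop V E) (Yo (fob T d')) (Yo (fob T d)) (fob T d') (app (far (fcomp V YY T) d' d) f) (idn E (fob T d')) = app (far T d' d) f"
    using nt_yoneda[OF sE, of "fob T d'" "fob T d" "fob T d'" "app (far T d' d) f" "idn E (fob T d')"] o f lE by simp
qed

text \<open>
  Both sides of the first equation are natural transformations out of \<open>Y(Td')\<close>; they are compared at
  the identity of \<open>Td'\<close>.
\<close>

lemma presheaf_cone_nat_iff:
  assumes G: "vfunctor V (vop V E) (vself V) G" and o: "d \<in> vob D" "d' \<in> vob D" and f: "f \<in> El (vhom D d' d)"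
    and s: "\<sigma> \<in> El (YG G d)" and t: "\<tau> \<in> El (YG G d')"
    and st: "fst \<tau> = join (fst f) (fst \<sigma>)" and dj: "disj f \<sigma>"
  shows "\<tau> = cmp (vop V FC) G (Yo (fob T d)) (Yo (fob T d')) (app (far (fop (fcomp V YY T)) d d') f) \<sigma> \<longleftrightarrow>
    at_id G d' \<tau> =
    act G (fob T d) (fob T d') (app (far T d' d) f) (at_id G d \<sigma>)" (is "_ = ?c \<longleftrightarrow> _")
proof -
  note gG = vfunctor_vgraph[OF lE' G]
  have T': "fob T d \<in> vob E" "fob T d' \<in> vob E" using o by simp_all
  note gY = Yo_graph[OF T'(1)] Yo_graph[OF T'(2)]
  note y = far_YT[OF o f]
  have d': "disj \<sigma> (app (far (fcomp V YY T) d' d) f)" "disj \<sigma> f" using dj by (simp_all add: disj_commute)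
  have FCob: "G \<in> vob FC" "Yo (fob T d) \<in> vob FC" "Yo (fob T d') \<in> vob FC" using G T' lE' by simp_all
  have c: "?c = cmp FC (Yo (fob T d')) (Yo (fob T d)) G \<sigma> (app (far (fcomp V YY T) d' d) f)"
    using cmp_vop[OF FC FCob, of "app (far (fcomp V YY T) d' d) f" \<sigma>] y s dj by simp
  have cin: "?c \<in> El (YG G d')"
    unfolding c by (rule cmp_funcat_in[OF sE gY(2,1) gG s y(1) d'(1)])
  have ft: "app (far T d' d) f \<in> El (vhom E (fob T d') (fob T d))" using o f by simp
  have i: "idn E (fob T d') \<in> El (fob (Yo (fob T d')) (fob T d'))" using T' lE by simp
  have "at_id G d' ?c =
     nt (vop V E) (Yo (fob T d)) G (fob T d') \<sigma> (app (far T d' d) f)"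
    unfolding c using nt_cmp_funcat[OF sE gY(2,1) gG _ s y(1) d'(1) i] T' y(2) by simp
  also have "\<dots> = act G (fob T d) (fob T d') (app (far T d' d) f) (at_id G d \<sigma>)"
    by (rule yoneda_nt[OF gG T'(1) s T'(2) ft]) (simp add: d')
  finally have n: "at_id G d' ?c =
    act G (fob T d) (fob T d') (app (far T d' d) f) (at_id G d \<sigma>)" .
  have fst_c: "fst \<tau> = fst ?c" using st by simp
  show ?thesis
  proof
    assume "\<tau> = ?c" then show "at_id G d' \<tau> =
      act G (fob T d) (fob T d') (app (far T d' d) f) (at_id G d \<sigma>)"
      using n by simp
  next
    assume "at_id G d' \<tau> =
      act G (fob T d) (fob T d') (app (far T d' d) f) (at_id G d \<sigma>)"
    then show "\<tau> = ?c" using yoneda_ext[OF gG T'(2) t cin fst_c] n by simp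
  qed
qed

context
  fixes \<alpha> :: "('u, 'o, 'm) vfun" and \<eta> w :: "'u \<Rightarrow> 'm"
  assumes alpha: "vfunctor V (vop V E) (vself V) \<alpha>"
    and w: "\<And>d. d \<in> vob D \<Longrightarrow> w d \<in> ar (fob \<psi> d) (YG \<alpha> d)"
    and eta: "\<And>d. d \<in> vob D \<Longrightarrow> \<eta> d \<in> ar (fob \<psi> d) (fob \<alpha> (fob T d))"
    and w_eta: "\<And>d p. d \<in> vob D \<Longrightarrow> p \<in> El (fob \<psi> d) \<Longrightarrow>
      at_id \<alpha> d (app (w d) p) = app (\<eta> d) p"
begin

lemma galpha: "vgraph (vop V E) \<alpha>"
  by (rule vfunctor_vgraph[OF lE' alpha])

lemma FC': "vcategory V (vop V FC)"
  using FC by simp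

lemma w_app: "d \<in> vob D \<Longrightarrow> p \<in> El (fob \<psi> d) \<Longrightarrow> app (w d) p \<in> El (YG \<alpha> d)"
  by (rule app_in[OF w])

lemma presheaf_cone_iff:
  "weighted_cone (vop V D) (vop V FC) \<psi> (fop (fcomp V YY T)) \<alpha> w \<longleftrightarrow>
    (\<forall>d\<in>vob D. \<forall>d'\<in>vob D. \<forall>f\<in>El (vhom D d' d). \<forall>p\<in>El (fob \<psi> d). disj f p \<longrightarrow>
        app (\<eta> d') (act \<psi> d d' f p) = act \<alpha> (fob T d) (fob T d') (app (far T d' d) f) (app (\<eta> d) p))"
proof -
  have "app (w d') (act \<psi> d d' f p) =
      cmp (vop V FC) \<alpha> (Yo (fob T d)) (Yo (fob T d')) (app (far (fop (fcomp V YY T)) d d') f) (app (w d) p) \<longleftrightarrow>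
      app (\<eta> d') (act \<psi> d d' f p) = act \<alpha> (fob T d) (fob T d') (app (far T d' d) f) (app (\<eta> d) p)"
    if h: "d \<in> vob D" "d' \<in> vob D" "f \<in> El (vhom D d' d)" "p \<in> El (fob \<psi> d)" "disj f p" for d d' f p
    using presheaf_cone_nat_iff[OF alpha h(1-3) w_app[OF h(1,4)] w_app[OF h(2) act_psi_in[OF h]]] h
      w_eta[OF h(1,4)] w_eta[OF h(2) act_psi_in[OF h]] by simp
  then show ?thesis
    unfolding weighted_cone_def using alpha w lE' by simp
qed

lemma presheaf_lower:
  assumes G: "vgraph (vop V E) G" and s: "\<And>d. d \<in> vob D \<Longrightarrow> \<sigma>' d \<in> ar N (ihom (fob \<psi> d) (YG G d))"
  shows "\<exists>\<sigma>. \<forall>d\<in>vob D. \<sigma> d \<in> ar N (ihom (fob \<psi> d) (fob G (fob T d))) \<and> (\<forall>n\<in>El N. \<forall>p\<in>El (fob \<psi> d). disj n p \<longrightarrow>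
    ap (fob \<psi> d) (fob G (fob T d)) (app (\<sigma> d) n) p = at_id G d (ap (fob \<psi> d) (YG G d) (app (\<sigma>' d) n) p))"
proof -
  have "\<exists>h. d \<in> vob D \<longrightarrow> h \<in> ar N (ihom (fob \<psi> d) (fob G (fob T d))) \<and> (\<forall>n\<in>El N. \<forall>p\<in>El (fob \<psi> d). disj n p \<longrightarrow>
    ap (fob \<psi> d) (fob G (fob T d)) (app h n) p = at_id G d (ap (fob \<psi> d) (YG G d) (app (\<sigma>' d) n) p))" for d
  proof (cases "d \<in> vob D")
    case d: True
    have i: "idn E (fob T d) \<in> El (fob (Yo (fob T d)) (fob T d))" using d lE by simp
    note gY = Yo_graph[OF T_ob[OF d]]
    have "lin1 (YG G d) (fob G (fob T d)) (\<lambda>\<tau>. at_id G d \<tau>)"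
      by (rule lin2_const[OF lin2_nt[OF sE gY G] i]) (use d in simp_all)
    from lin2_post[OF this lin2_pre1[OF lin1_app[OF s[OF d]] lin2_ap[OF psi_ob[OF d] natob_ob[OF sE gY G]]]]
    show ?thesis by (rule lin2_curry) blast
  qed blast
  then show ?thesis by metis
qed

lemma presheaf_raise:
  assumes G: "vfunctor V (vop V E) (vself V) G" and s: "\<And>d. d \<in> vob D \<Longrightarrow> \<sigma> d \<in> ar N (ihom (fob \<psi> d) (fob G (fob T d)))"
  shows "\<exists>\<sigma>'. \<forall>d\<in>vob D. \<sigma>' d \<in> ar N (ihom (fob \<psi> d) (YG G d)) \<and> (\<forall>n\<in>El N. \<forall>p\<in>El (fob \<psi> d). disj n p \<longrightarrow>
    ap (fob \<psi> d) (fob G (fob T d)) (app (\<sigma> d) n) p = at_id G d (ap (fob \<psi> d) (YG G d) (app (\<sigma>' d) n) p))"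
proof -
  note gG = vfunctor_vgraph[OF lE' G]
  have "\<exists>h. d \<in> vob D \<longrightarrow> h \<in> ar N (ihom (fob \<psi> d) (YG G d)) \<and> (\<forall>n\<in>El N. \<forall>p\<in>El (fob \<psi> d). disj n p \<longrightarrow>
    ap (fob \<psi> d) (fob G (fob T d)) (app (\<sigma> d) n) p = at_id G d (ap (fob \<psi> d) (YG G d) (app h n) p))" for d
  proof (cases "d \<in> vob D")
    case d: True
    have ob: "fob \<psi> d \<in> Ob V" "fob G (fob T d) \<in> Ob V" "N \<in> Ob V" using d gG ar_dom[OF s[OF d]] by simp_all
    obtain h where h: "h \<in> ar (N \<otimes> fob \<psi> d) (YG G d)"
      and h': "\<And>m. m \<in> El (N \<otimes> fob \<psi> d) \<Longrightarrow> at_id G d (app h m) =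
        app (vuncurry V (fob \<psi> d) (fob G (fob T d)) (\<sigma> d)) m"
      by (rule yoneda_lift[OF G T_ob[OF d] vuncurry_in[OF s[OF d] ob(1,2)]]) (rule that)
    show ?thesis
      by (rule exI[of _ "vcurry V N (fob \<psi> d) (YG G d) h"])
        (use ob d in \<open>simp add: vcurry_in[OF h] ap_vcurry[OF h] h' app_vuncurry[OF s]\<close>)
  qed blast
  then show ?thesis by metis
qed

context
  fixes G :: "('u, 'o, 'm) vfun" and N :: 'o and \<sigma> \<sigma>' :: "'u \<Rightarrow> 'm"
  assumes G: "vfunctor V (vop V E) (vself V) G" and N: "N \<in> Ob V"
    and s: "\<forall>d\<in>vob D. \<sigma> d \<in> ar N (ihom (fob \<psi> d) (fob G (fob T d)))"
    and s': "\<forall>d\<in>vob D. \<sigma>' d \<in> ar N (ihom (fob \<psi> d) (YG G d))"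
    and ss: "\<forall>d\<in>vob D. \<forall>n\<in>El N. \<forall>p\<in>El (fob \<psi> d). disj n p \<longrightarrow>
      ap (fob \<psi> d) (fob G (fob T d)) (app (\<sigma> d) n) p = at_id G d (ap (fob \<psi> d) (YG G d) (app (\<sigma>' d) n) p)"
begin

lemma gG: "vgraph (vop V E) G"
  by (rule vfunctor_vgraph[OF lE' G])

lemma GFC: "G \<in> vob (vop V FC)"
  using G by simp

lemma s'_app: "\<lbrakk>d \<in> vob D; n \<in> El N; p \<in> El (fob \<psi> d); disj n p\<rbrakk> \<Longrightarrow>
    ap (fob \<psi> d) (YG G d) (app (\<sigma>' d) n) p \<in> El (YG G d)"
  using app_in[OF s'[rule_format]] natob_ob[OF sE Yo_graph gG] by simp

lemma presheaf_wedge_iff: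
  "wedge V (vop V D) \<psi> (homY G) N \<sigma>' \<longleftrightarrow>
   wedge V (vop V D) \<psi> (fcomp V G (fop T)) N \<sigma>"
proof -
  note g = vgraph_KD[OF sD FC' lpsi YT_op GFC]
  have fob: "fob (homY G) d = YG G d" for d by simp
  have eq: "ap (fob \<psi> d') (YG G d') (app (\<sigma>' d') n) (act \<psi> d d' f p) =
      act (homY G) d d' f
        (ap (fob \<psi> d) (YG G d) (app (\<sigma>' d) n) p) \<longleftrightarrow>
    ap (fob \<psi> d') (fob G (fob T d')) (app (\<sigma> d') n) (act \<psi> d d' f p) =
      act G (fob T d) (fob T d') (app (far T d' d) f) (ap (fob \<psi> d) (fob G (fob T d)) (app (\<sigma> d) n) p)"
    if h: "d \<in> vob D" "d' \<in> vob D" "n \<in> El N" "f \<in> El (vhom D d' d)" "p \<in> El (fob \<psi> d)"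
      "disj n f" "disj f n" "disj n p" "disj p n" "disj f p" "disj p f" for d d' n f p
  proof -
    note q = act_psi_in[OF h(1,2,4,5,10)]
    note a = s'_app[OF h(1,3,5,8)] s'_app[OF h(2,3) q]
    have "act (homY G) d d' f
        (ap (fob \<psi> d) (YG G d) (app (\<sigma>' d) n) p) =
      cmp (vop V FC) G (Yo (fob T d)) (Yo (fob T d')) (app (far (fop (fcomp V YY T)) d d') f)
        (ap (fob \<psi> d) (YG G d) (app (\<sigma>' d) n) p)"
      using act_KD[OF sD FC' lpsi YT_op GFC, of d d' f] h a by simp
    then show ?thesis
      using presheaf_cone_nat_iff[OF G h(1,2,4) a] h q ss by (simp add: join_ac)
  qed
  show ?thesis
  proof
    assume W: "wedge V (vop V D) \<psi> (homY G) N \<sigma>'"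
    show "wedge V (vop V D) \<psi> (fcomp V G (fop T)) N \<sigma>"
    proof (rule wedge_GTI[OF gG N])
      fix d d' n f p assume h: "d \<in> vob D" "d' \<in> vob D" "n \<in> El N" "f \<in> El (vhom D d' d)" "p \<in> El (fob \<psi> d)"
        "disj n f" "disj f n" "disj n p" "disj p n" "disj f p" "disj p f"
      then show "ap (fob \<psi> d') (fob G (fob T d')) (app (\<sigma> d') n) (act \<psi> d d' f p) =
        act G (fob T d) (fob T d') (app (far T d' d) f) (ap (fob \<psi> d) (fob G (fob T d)) (app (\<sigma> d) n) p)"
        using wedge_nat[OF lpsi g W, of d d' n f p] eq[OF h] by simp
    qed (use s in blast)
  next
    assume W: "wedge V (vop V D) \<psi> (fcomp V G (fop T)) N \<sigma>"
    show "wedge V (vop V D) \<psi> (homY G) N \<sigma>'"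
    proof (rule wedgeI[OF lpsi g N])
      fix d assume "d \<in> vob (vop V D)"
      then show "\<sigma>' d \<in> ar N (ihom (fob \<psi> d) (fob (homY G) d))"
        using s' by simp
    next
      fix d d' n f p assume "d \<in> vob (vop V D)" "d' \<in> vob (vop V D)" "n \<in> El N" "f \<in> El (vhom (vop V D) d d')" "p \<in> El (fob \<psi> d)"
        "disj n f" "disj f n" "disj n p" "disj p n" "disj f p" "disj p f"
      then have h: "d \<in> vob D" "d' \<in> vob D" "n \<in> El N" "f \<in> El (vhom D d' d)" "p \<in> El (fob \<psi> d)"
        "disj n f" "disj f n" "disj n p" "disj p n" "disj f p" "disj p f" by simp_all
      show "ap (fob \<psi> d') (fob (homY G) d') (app (\<sigma>' d') n) (act \<psi> d d' f p) =
        act (homY G) d d' f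
          (ap (fob \<psi> d) (fob (homY G) d) (app (\<sigma>' d) n) p)"
        using eq[OF h] wedge_GT_nat[OF gG W h(1-5,6,8,10)] unfolding fob by simp
    qed
  qed
qed

lemma presheaf_cmp_iff:
  assumes d: "d \<in> vob D" and k: "\<kappa> \<in> El (natob V (vop V E) \<alpha> G)" and p: "p \<in> El (fob \<psi> d)" and dj: "disj \<kappa> p"
    and t: "\<tau> \<in> El (YG G d)" and st: "fst \<tau> = join (fst \<kappa>) (fst p)"
  shows "\<tau> = cmp (vop V FC) G \<alpha> (Yo (fob T d)) (app (w d) p) \<kappa> \<longleftrightarrow>
    at_id G d \<tau> = nt (vop V E) \<alpha> G (fob T d) \<kappa> (app (\<eta> d) p)"
proof -
  have T': "fob T d \<in> vob E" using d by simp
  have dj': "disj p \<kappa>" using dj by (simp add: disj_commute)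
  note wp = w_app[OF d p]
  have c: "cmp (vop V FC) G \<alpha> (Yo (fob T d)) (app (w d) p) \<kappa> = cmp FC (Yo (fob T d)) \<alpha> G \<kappa> (app (w d) p)"
    using cmp_vop[OF FC, of G \<alpha> "Yo (fob T d)" "app (w d) p" \<kappa>] G alpha lE' T' wp k dj' by simp
  have dw: "disj \<kappa> (app (w d) p)" using dj by simp
  have cin: "cmp FC (Yo (fob T d)) \<alpha> G \<kappa> (app (w d) p) \<in> El (YG G d)"
    by (rule cmp_funcat_in[OF sE Yo_graph[OF T'] galpha gG k wp dw])
  have i: "idn E (fob T d) \<in> El (fob (Yo (fob T d)) (fob T d))" using T' lE by simp
  have n: "at_id G d (cmp FC (Yo (fob T d)) \<alpha> G \<kappa> (app (w d) p)) =
    nt (vop V E) \<alpha> G (fob T d) \<kappa> (app (\<eta> d) p)"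
    using nt_cmp_funcat[OF sE Yo_graph[OF T'] galpha gG _ k wp dw i] T' w_eta[OF d p] by simp
  show ?thesis
    unfolding c using yoneda_ext[OF gG T' t cin] st n by auto
qed

lemma presheaf_fits_iff:
  assumes k: "k \<in> ar N (natob V (vop V E) \<alpha> G)"
  shows "fits (vop V D) (vop V FC) \<psi> (fop (fcomp V YY T)) \<alpha> w G N \<sigma>' k \<longleftrightarrow>
    restricts D T \<psi> \<alpha> \<eta> G N (\<lambda>e. proj V (vop V E) \<alpha> G e \<cdot> k) \<sigma>"
proof -
  have "ap (fob \<psi> d) (YG G d) (app (\<sigma>' d) n) p = cmp (vop V FC) G \<alpha> (Yo (fob T d)) (app (w d) p) (app k n) \<longleftrightarrow>
    ap (fob \<alpha> (fob T d)) (fob G (fob T d)) (app (proj V (vop V E) \<alpha> G (fob T d) \<cdot> k) n) (app (\<eta> d) p) =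
      ap (fob \<psi> d) (fob G (fob T d)) (app (\<sigma> d) n) p"
    if h: "d \<in> vob D" "n \<in> El N" "p \<in> El (fob \<psi> d)" "disj n p" for d n p
    using presheaf_cmp_iff[OF h(1) app_in[OF k h(2)] h(3) _ s'_app[OF h]] h ss
      app_comp[OF h(2) k proj_in[OF sE galpha gG, of "fob T d"]] by (auto simp: nt_def)
  then show ?thesis by (simp add: fits_def restricts_def)
qed

end

lemma proj_comp_into_end:
  assumes G: "vgraph (vop V E) G" and w: "wedge V (vop V E) \<alpha> G N \<pi>" and e: "e \<in> vob E"
  shows "proj V (vop V E) \<alpha> G e \<cdot> into_end V (vop V E) \<alpha> G N \<pi> = \<pi> e"
  by (rule ext1[OF comp_in[OF into_end_in[OF sE galpha G w] proj_in[OF sE galpha G]] wedge_in[OF galpha G w]])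
    (use e in \<open>simp_all add: app_comp[OF _ into_end_in[OF sE galpha G w] proj_in[OF sE galpha G]] proj_into_end[OF sE galpha G w]\<close>)

text \<open>
  The wedges from \<open>\<alpha>\<close> to \<open>G\<close> are the composites of the projections with an arrow \<open>k\<close> into \<open>[E\<^sup>o\<^sup>p,V](\<alpha>,G)\<close>,
  and such a wedge restricts to \<open>\<sigma>\<close> exactly if the wedge \<open>\<sigma>'\<close> that corresponds to \<open>\<sigma>\<close> fits \<open>k\<close>.
\<close>

lemma lan_of_limit_unit:
  assumes u: "limit_unit (vop V D) (vop V FC) \<psi> (fop (fcomp V YY T)) \<alpha> w"
  shows "lan E D T \<psi> \<alpha> \<eta>"
proof -
  have ex1: "\<exists>!k. k \<in> ar N (natob V (vop V E) \<alpha> G) \<and> restricts D T \<psi> \<alpha> \<eta> G N (\<lambda>e. proj V (vop V E) \<alpha> G e \<cdot> k) \<sigma>"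
    if G: "vfunctor V (vop V E) (vself V) G" and W: "wedge V (vop V D) \<psi> (fcomp V G (fop T)) N \<sigma>" for G N \<sigma>
  proof -
    note gG = vfunctor_vgraph[OF lE' G]
    have s: "\<forall>d\<in>vob D. \<sigma> d \<in> ar N (ihom (fob \<psi> d) (fob G (fob T d)))" using wedge_GT_in[OF gG W] by blast
    obtain \<sigma>' where s': "\<forall>d\<in>vob D. \<sigma>' d \<in> ar N (ihom (fob \<psi> d) (YG G d))"
      and ss: "\<forall>d\<in>vob D. \<forall>n\<in>El N. \<forall>p\<in>El (fob \<psi> d). disj n p \<longrightarrow>
      ap (fob \<psi> d) (fob G (fob T d)) (app (\<sigma> d) n) p = at_id G d (ap (fob \<psi> d) (YG G d) (app (\<sigma>' d) n) p)"
      using presheaf_raise[OF G, of \<sigma> N] s by blast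
    note x = G wedge_ob[OF W] s s' ss
    have "\<exists>!k. k \<in> ar N (vhom (vop V FC) G \<alpha>) \<and> fits (vop V D) (vop V FC) \<psi> (fop (fcomp V YY T)) \<alpha> w G N \<sigma>' k"
      by (rule limit_unit_ex1[OF u]) (use G presheaf_wedge_iff[OF x] W in simp_all)
    then show ?thesis by (simp add: presheaf_fits_iff[OF x] cong: conj_cong)
  qed
  show ?thesis
    unfolding lan_def
  proof (intro conjI)
    show "\<forall>d\<in>vob D. \<eta> d \<in> ar (fob \<psi> d) (fob \<alpha> (fob T d))" using eta by blast
    show "\<forall>d\<in>vob D. \<forall>d'\<in>vob D. \<forall>f\<in>El (vhom D d' d). \<forall>p\<in>El (fob \<psi> d). disj f p \<longrightarrow>
        app (\<eta> d') (act \<psi> d d' f p) = act \<alpha> (fob T d) (fob T d') (app (far T d' d) f) (app (\<eta> d) p)"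
      using limit_unit_cone[OF u] presheaf_cone_iff by blast
    show "\<forall>G N \<sigma>. vfunctor V (vop V E) (vself V) G \<longrightarrow> wedge V (vop V D) \<psi> (fcomp V G (fop T)) N \<sigma> \<longrightarrow>
        (\<exists>\<pi>. wedge V (vop V E) \<alpha> G N \<pi> \<and> restricts D T \<psi> \<alpha> \<eta> G N \<pi> \<sigma>)"
      using ex1 wedge_comp[OF sE galpha vfunctor_vgraph[OF lE']] by meson
    show "\<forall>G N \<sigma> \<pi> \<pi>'. vfunctor V (vop V E) (vself V) G \<longrightarrow> wedge V (vop V D) \<psi> (fcomp V G (fop T)) N \<sigma> \<longrightarrow>
        wedge V (vop V E) \<alpha> G N \<pi> \<longrightarrow> wedge V (vop V E) \<alpha> G N \<pi>' \<longrightarrow>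
        restricts D T \<psi> \<alpha> \<eta> G N \<pi> \<sigma> \<longrightarrow> restricts D T \<psi> \<alpha> \<eta> G N \<pi>' \<sigma> \<longrightarrow> (\<forall>e\<in>vob E. \<pi> e = \<pi>' e)"
    proof (intro allI impI ballI)
      fix G N \<sigma> \<pi> \<pi>' e assume G: "vfunctor V (vop V E) (vself V) G" and W: "wedge V (vop V D) \<psi> (fcomp V G (fop T)) N \<sigma>"
        and p: "wedge V (vop V E) \<alpha> G N \<pi>" "wedge V (vop V E) \<alpha> G N \<pi>'"
        and r: "restricts D T \<psi> \<alpha> \<eta> G N \<pi> \<sigma>" "restricts D T \<psi> \<alpha> \<eta> G N \<pi>' \<sigma>" and e: "e \<in> vob E"
      note gG = vfunctor_vgraph[OF lE' G]
      note pk = proj_comp_into_end[OF gG p(1)] proj_comp_into_end[OF gG p(2)]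
      have "into_end V (vop V E) \<alpha> G N \<pi> = into_end V (vop V E) \<alpha> G N \<pi>'"
        by (rule Uniq_D[OF ex1[OF G W, unfolded ex1_iff_ex_Uniq, THEN conjunct2]])
          (use r pk in \<open>simp_all add: restricts_def into_end_in[OF sE galpha gG p(1)] into_end_in[OF sE galpha gG p(2)]\<close>)
      then show "\<pi> e = \<pi>' e" using pk[OF e] by simp
    qed
  qed
qed

lemma limit_unit_of_lan:
  assumes lan: "lan E D T \<psi> \<alpha> \<eta>"
  shows "limit_unit (vop V D) (vop V FC) \<psi> (fop (fcomp V YY T)) \<alpha> w"
  unfolding limit_unit_def
proof (intro conjI ballI allI impI)
  show "weighted_cone (vop V D) (vop V FC) \<psi> (fop (fcomp V YY T)) \<alpha> w"
    unfolding presheaf_cone_iff using lan by (simp add: lan_def)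
  fix G N \<sigma>' assume "G \<in> vob (vop V FC)"
    and W: "wedge V (vop V D) \<psi> (homY G) N \<sigma>'"
  then have G: "vfunctor V (vop V E) (vself V) G" by simp
  note gG = vfunctor_vgraph[OF lE' G]
  have "vgraph (vop V D) (homY G)"
    by (rule vgraph_KD[OF sD FC' lpsi YT_op]) (use G in simp)
  from wedge_in[OF lpsi this W]
  have s': "\<forall>d\<in>vob D. \<sigma>' d \<in> ar N (ihom (fob \<psi> d) (YG G d))" by simp
  obtain \<sigma> where s: "\<forall>d\<in>vob D. \<sigma> d \<in> ar N (ihom (fob \<psi> d) (fob G (fob T d)))"
    and ss: "\<forall>d\<in>vob D. \<forall>n\<in>El N. \<forall>p\<in>El (fob \<psi> d). disj n p \<longrightarrow>
      ap (fob \<psi> d) (fob G (fob T d)) (app (\<sigma> d) n) p = at_id G d (ap (fob \<psi> d) (YG G d) (app (\<sigma>' d) n) p)"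
    using presheaf_lower[OF gG, of \<sigma>' N] s' by blast
  note x = G wedge_ob[OF W] s s' ss
  obtain \<pi> where p: "wedge V (vop V E) \<alpha> G N \<pi>" and r: "restricts D T \<psi> \<alpha> \<eta> G N \<pi> \<sigma>"
    using lan_extend[OF lan G] W presheaf_wedge_iff[OF x] by blast
  note k = into_end_in[OF sE galpha gG p]
  note pk = proj_comp_into_end[OF gG p]
  show "\<exists>!k. k \<in> ar N (vhom (vop V FC) G \<alpha>) \<and> fits (vop V D) (vop V FC) \<psi> (fop (fcomp V YY T)) \<alpha> w G N \<sigma>' k"
  proof (rule ex1I, intro conjI)
    show "into_end V (vop V E) \<alpha> G N \<pi> \<in> ar N (vhom (vop V FC) G \<alpha>)" using k by simp
    show "fits (vop V D) (vop V FC) \<psi> (fop (fcomp V YY T)) \<alpha> w G N \<sigma>' (into_end V (vop V E) \<alpha> G N \<pi>)"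
      unfolding presheaf_fits_iff[OF x k] using r pk by (simp add: restricts_def)
    fix h assume h0: "h \<in> ar N (vhom (vop V FC) G \<alpha>) \<and> fits (vop V D) (vop V FC) \<psi> (fop (fcomp V YY T)) \<alpha> w G N \<sigma>' h"
    then have h: "h \<in> ar N (natob V (vop V E) \<alpha> G)" by simp
    have r': "restricts D T \<psi> \<alpha> \<eta> G N (\<lambda>e. proj V (vop V E) \<alpha> G e \<cdot> h) \<sigma>" using h0 presheaf_fits_iff[OF x h] by simp
    have ph: "proj V (vop V E) \<alpha> G e \<cdot> h = \<pi> e" if "e \<in> vob E" for e
      using lan_unique[OF lan G presheaf_wedge_iff[OF x, THEN iffD1, OF W] wedge_comp[OF sE galpha gG h] p r' r that] .
    show "h = into_end V (vop V E) \<alpha> G N \<pi>"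
      using into_end_ex1[OF sE galpha gG p] ar_Hom[OF h] ar_Hom[OF k] ph pk by (metis vop_simps(1))
  qed
qed

end

lemma lan_of_wcolim:
  assumes alpha: "vfunctor V (vop V E) (vself V) \<alpha>"
    and c: "is_wcolim V D FC \<psi> (fcomp V YY T) \<alpha> \<theta>"
  shows "\<exists>\<eta>. lan E D T \<psi> \<alpha> \<eta>"
proof -
  note ga = vfunctor_vgraph[OF lE' alpha]
  have FC': "vcategory V (vop V FC)" using FC by simp
  obtain w where u: "limit_unit (vop V D) (vop V FC) \<psi> (fop (fcomp V YY T)) \<alpha> w"
    using limit_unit_of_wlim[OF sD FC' lpsi YT_op psi c[unfolded is_wcolim_def]] by blast
  have w: "w d \<in> ar (fob \<psi> d) (YG \<alpha> d)" if "d \<in> vob D" for d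
    using limit_unit_in[OF u, of d] that by simp
  have "\<exists>h. d \<in> vob D \<longrightarrow> h \<in> ar (fob \<psi> d) (fob \<alpha> (fob T d)) \<and> (\<forall>p\<in>El (fob \<psi> d).
     app h p = at_id \<alpha> d (app (w d) p))" for d
  proof (cases "d \<in> vob D")
    case d: True
    have i: "idn E (fob T d) \<in> El (fob (Yo (fob T d)) (fob T d))" using d lE by simp
    have "lin1 (fob \<psi> d) (fob \<alpha> (fob T d)) (\<lambda>p. at_id \<alpha> d (app (w d) p))"
      by (rule lin2_const[OF lin2_pre1[OF lin1_app[OF w[OF d]] lin2_nt[OF sE Yo_graph[OF T_ob[OF d]] ga]] i]) (use d in simp_all)
    then show ?thesis unfolding lin1_def by blast
  qed blast
  then obtain \<eta> where e: "\<And>d. d \<in> vob D \<Longrightarrow> \<eta> d \<in> ar (fob \<psi> d) (fob \<alpha> (fob T d))"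
    and e': "\<And>d p. d \<in> vob D \<Longrightarrow> p \<in> El (fob \<psi> d) \<Longrightarrow>
      at_id \<alpha> d (app (w d) p) = app (\<eta> d) p" by metis
  have "lan E D T \<psi> \<alpha> \<eta>" by (rule lan_of_limit_unit[OF alpha w e e' u])
  then show ?thesis by blast
qed

lemma wcolim_of_lan:
  assumes alpha: "vfunctor V (vop V E) (vself V) \<alpha>" and lan: "lan E D T \<psi> \<alpha> \<eta>"
  shows "\<exists>\<theta>. is_wcolim V D FC \<psi> (fcomp V YY T) \<alpha> \<theta>"
proof -
  have FC': "vcategory V (vop V FC)" using FC by simp
  have "\<exists>h. d \<in> vob D \<longrightarrow> h \<in> ar (fob \<psi> d) (YG \<alpha> d) \<and> (\<forall>p\<in>El (fob \<psi> d).
     at_id \<alpha> d (app h p) = app (\<eta> d) p)" for d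
  proof (cases "d \<in> vob D")
    case d: True
    show ?thesis by (rule yoneda_lift[OF alpha T_ob[OF d] lan_in[OF lan d]]) blast
  qed blast
  then obtain w where w: "\<And>d. d \<in> vob D \<Longrightarrow> w d \<in> ar (fob \<psi> d) (YG \<alpha> d)"
    and w': "\<And>d p. d \<in> vob D \<Longrightarrow> p \<in> El (fob \<psi> d) \<Longrightarrow>
      at_id \<alpha> d (app (w d) p) = app (\<eta> d) p" by metis
  have "limit_unit (vop V D) (vop V FC) \<psi> (fop (fcomp V YY T)) \<alpha> w"
    by (rule limit_unit_of_lan[OF alpha w lan_in[OF lan] w' lan])
  from wlim_of_limit_unit[OF sD FC' lpsi YT_op psi this] show ?thesis
    unfolding is_wcolim_def by blast
qed

section \<open>Existence of left Kan extensions\<close>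

text \<open>
  The pointwise formula: \<open>Lan\<close> has the value \<open>\<psi> \<star> E(e,T-)\<close> at \<open>e\<close>. Its elements are generated by
  \<open>sp e d p g\<close>, written \<open>p \<otimes> g\<close> below, with \<open>p\<close> in \<open>\<psi>d\<close> and \<open>g\<close> in \<open>E(e,Td)\<close>.
\<close>

abbreviation HT where "HT e \<equiv> fcomp V (homfun V E e) T"
abbreviation Lo where "Lo e \<equiv> star_ob V D \<psi> (HT e)"
abbreviation sp where "sp e \<equiv> su D \<psi> (HT e)"

lemmas [simp] = disj_su[OF D psi]

lemma HT: "e \<in> vob E \<Longrightarrow> vfunctor V D (vself V) (HT e)"
  by (rule vfunctor_fcomp[OF lD lE vcategory_vself T]) (simp add: lE)

lemma act_HT: "\<lbrakk>e \<in> vob E; d \<in> vob D; d' \<in> vob D; f \<in> El (vhom D d d'); g \<in> El (vhom E e (fob T d)); disj f g\<rbrakk> \<Longrightarrow>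
    act (HT e) d d' f g = cmp E e (fob T d) (fob T d') (app (far T d d') f) g"
  using act_fcomp[OF lD lE T, of "homfun V E e" d d' f g] lE by simp

lemma Lo_ob [simp]: "e \<in> vob E \<Longrightarrow> Lo e \<in> Ob V"
  by (rule star_ob_in[OF D psi HT])

lemma sp_in: "\<lbrakk>e \<in> vob E; d \<in> vob D; p \<in> El (fob \<psi> d); g \<in> El (vhom E e (fob T d)); disj p g\<rbrakk> \<Longrightarrow> sp e d p g \<in> El (Lo e)"
  using su_in[OF D psi HT, of e d p g] by simp

lemma sp_nat: "\<lbrakk>e \<in> vob E; d \<in> vob D; d' \<in> vob D; f \<in> El (vhom D d' d); p \<in> El (fob \<psi> d); g \<in> El (vhom E e (fob T d'));
    disj f p; disj f g; disj p g\<rbrakk> \<Longrightarrow>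
    sp e d' (act \<psi> d d' f p) g = sp e d p (cmp E e (fob T d') (fob T d) (app (far T d' d) f) g)"
  using su_nat[OF D psi HT, of e d d' f p g] act_HT[of e d' d f g] by simp

text \<open>
  \<open>E(e',e)\<close> acts by \<open>f(p \<otimes> g) = p \<otimes> gf\<close>.
\<close>

lemma Lo_arrow:
  assumes o: "e \<in> vob E" "e' \<in> vob E"
  shows "\<exists>h. h \<in> ar (vhom E e' e) (ihom (Lo e) (Lo e')) \<and> (\<forall>f d p g. f \<in> El (vhom E e' e) \<longrightarrow> d \<in> vob D \<longrightarrow> p \<in> El (fob \<psi> d) \<longrightarrow>
     g \<in> El (vhom E e (fob T d)) \<longrightarrow> disj f p \<longrightarrow> disj f g \<longrightarrow> disj p g \<longrightarrow>
     ap (Lo e) (Lo e') (app h f) (sp e d p g) = sp e' d p (cmp E e' e (fob T d) g f))"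
proof -
  have N: "vhom E e' e \<in> Ob V" using o lE by simp
  have "\<exists>h. d \<in> vob D \<longrightarrow> h \<in> ar (vhom E e' e) (ihom (fob \<psi> d) (ihom (vhom E e (fob T d)) (Lo e'))) \<and>
    (\<forall>f p g. f \<in> El (vhom E e' e) \<longrightarrow> p \<in> El (fob \<psi> d) \<longrightarrow> g \<in> El (vhom E e (fob T d)) \<longrightarrow> disj f p \<longrightarrow> disj f g \<longrightarrow> disj p g \<longrightarrow>
     ap (vhom E e (fob T d)) (Lo e') (ap (fob \<psi> d) (ihom (vhom E e (fob T d)) (Lo e')) (app h f) p) g = sp e' d p (cmp E e' e (fob T d) g f))" for d
  proof (cases "d \<in> vob D")
    case d: True
    have l2: "lin2 (vhom E e' e) (vhom E e (fob T d)) (vhom E e' (fob T d)) (\<lambda>f g. cmp E e' e (fob T d) g f)"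
      by (rule lin2_swap[OF lin2_cmp]) (use lE o d in simp_all)
    have su2: "lin2 (vhom E e' (fob T d)) (fob \<psi> d) (Lo e') (\<lambda>g p. sp e' d p g)"
      using lin2_swap[OF lin2_su[OF D psi HT[OF o(2)] d]] by simp
    have "lin3 (vhom E e' e) (fob \<psi> d) (vhom E e (fob T d)) (Lo e') (\<lambda>f p g. sp e' d p (cmp E e' e (fob T d) g f))"
      using lin3_swap23[OF lin3_l[OF l2 su2]] .
    then show ?thesis by (rule lin3_curry2) blast
  qed blast
  then obtain k where k: "\<And>d. d \<in> vob D \<Longrightarrow> k d \<in> ar (vhom E e' e) (ihom (fob \<psi> d) (ihom (vhom E e (fob T d)) (Lo e')))"
    and k': "\<And>d f p g. \<lbrakk>d \<in> vob D; f \<in> El (vhom E e' e); p \<in> El (fob \<psi> d); g \<in> El (vhom E e (fob T d));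
      disj f p; disj f g; disj p g\<rbrakk> \<Longrightarrow>
     ap (vhom E e (fob T d)) (Lo e') (ap (fob \<psi> d) (ihom (vhom E e (fob T d)) (Lo e')) (app (k d) f) p) g = sp e' d p (cmp E e' e (fob T d) g f)"
    by metis
  have W: "wedge V (vop V D) \<psi> (fcomp V (homfun V (vop V (vself V)) (Lo e')) (fop (HT e))) (vhom E e' e) k"
  proof (rule hom_into_wedgeI[OF D psi HT[OF o(1)] Lo_ob[OF o(2)] N])
    show "k d \<in> ar (vhom E e' e) (ihom (fob \<psi> d) (ihom (fob (HT e) d) (Lo e')))" if "d \<in> vob D" for d using k[OF that] by simp
    fix a b n f p x assume h: "a \<in> vob D" "b \<in> vob D" "n \<in> El (vhom E e' e)" "f \<in> El (vhom D b a)" "p \<in> El (fob \<psi> a)" "x \<in> El (fob (HT e) b)"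
      and d: "disj n f" "disj f n" "disj n p" "disj p n" "disj n x" "disj x n" "disj f p" "disj p f" "disj f x" "disj x f" "disj p x" "disj x p"
    have x: "x \<in> El (vhom E e (fob T b))" using h by simp
    have fx: "cmp E e (fob T b) (fob T a) (app (far T b a) f) x \<in> El (vhom E e (fob T a))" using o h x d lE by simp
    have xn: "cmp E e' e (fob T b) x n \<in> El (vhom E e' (fob T b))" using o h x d lE by simp
    show "ap (fob (HT e) b) (Lo e') (ap (fob \<psi> b) (ihom (fob (HT e) b) (Lo e')) (app (k b) n) (act \<psi> a b f p)) x =
      ap (fob (HT e) a) (Lo e') (ap (fob \<psi> a) (ihom (fob (HT e) a) (Lo e')) (app (k a) n) p) (act (HT e) b a f x)"
      using o h x d fx xn lE by (simp add: k' act_HT sp_nat cmp_assoc)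
  qed
  from su_desc[OF D psi HT[OF o(1)] Lo_ob[OF o(2)] W] obtain h where h: "h \<in> ar (vhom E e' e) (ihom (Lo e) (Lo e'))"
    and h': "\<And>n d p x. \<lbrakk>n \<in> El (vhom E e' e); d \<in> vob D; p \<in> El (fob \<psi> d); x \<in> El (fob (HT e) d); disj n p; disj n x; disj p x\<rbrakk> \<Longrightarrow>
      ap (Lo e) (Lo e') (app h n) (sp e d p x) =
      ap (fob (HT e) d) (Lo e') (ap (fob \<psi> d) (ihom (fob (HT e) d) (Lo e')) (app (k d) n) p) x" by blast
  show ?thesis by (rule exI[of _ h]) (use h h' k' in simp)
qed

text \<open>
  The unit is \<open>\<eta> p = p \<otimes> 1\<close>. Since \<open>p \<otimes> g = g(\<eta> p)\<close>, an extension \<open>\<pi>\<close> of \<open>\<sigma>\<close> must satisfy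
  \<open>\<pi>(p \<otimes> g) = g(\<sigma> p)\<close>, and this formula defines one.
\<close>

lemma lan_exists: "\<exists>\<alpha> \<eta>. vfunctor V (vop V E) (vself V) \<alpha> \<and> lan E D T \<psi> \<alpha> \<eta>"
proof -
  obtain A where A: "\<And>e e'. e \<in> vob E \<Longrightarrow> e' \<in> vob E \<Longrightarrow> A e e' \<in> ar (vhom E e' e) (ihom (Lo e) (Lo e'))"
    and A': "\<And>e e' f d p g. \<lbrakk>e \<in> vob E; e' \<in> vob E; f \<in> El (vhom E e' e); d \<in> vob D; p \<in> El (fob \<psi> d);
     g \<in> El (vhom E e (fob T d)); disj f p; disj f g; disj p g\<rbrakk> \<Longrightarrow>
     ap (Lo e) (Lo e') (app (A e e') f) (sp e d p g) = sp e' d p (cmp E e' e (fob T d) g f)"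
    using Lo_arrow by metis
  define \<alpha> where "\<alpha> = \<lparr>fob = Lo, far = A\<rparr>"
  have [simp]: "fob \<alpha> = Lo" "far \<alpha> = A" by (simp_all add: \<alpha>_def)
  have Ain: "app (A e e') f \<in> El (ihom (Lo e) (Lo e'))" if "e \<in> vob E" "e' \<in> vob E" "f \<in> El (vhom E e' e)" for e e' f
    using app_in[OF A] that by blast
  have alpha: "vfunctor V (vop V E) (vself V) \<alpha>"
  proof (rule vfunctorI[OF lE' vcategory_vself])
    show "far \<alpha> a b \<in> ar (vhom (vop V E) a b) (vhom (vself V) (fob \<alpha> a) (fob \<alpha> b))"
      if "a \<in> vob (vop V E)" "b \<in> vob (vop V E)" for a b using A that by simp
    show "fob \<alpha> a \<in> vob (vself V)" if "a \<in> vob (vop V E)" for a using that by simp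
  next
    fix a assume "a \<in> vob (vop V E)"
    then have a: "a \<in> vob E" by simp
    have i: "idn E a \<in> El (vhom E a a)" using a lE by simp
    have j: "idn (vself V) (Lo a) \<in> El (ihom (Lo a) (Lo a))" using idn_in[OF vcategory_vself, of "Lo a"] a by simp
    have "app (A a a) (idn E a) = idn (vself V) (Lo a)"
      by (rule su_ext[OF D psi HT[OF a] Lo_ob[OF a] Ain[OF a a i] j])
        (use a i lE A'[OF a a i] sp_in in simp_all)
    then show "app (far \<alpha> a a) (idn (vop V E) a) = idn (vself V) (fob \<alpha> a)" by simp
  next
    fix a b c g f assume "a \<in> vob (vop V E)" "b \<in> vob (vop V E)" "c \<in> vob (vop V E)"
      "g \<in> El (vhom (vop V E) b c)" "f \<in> El (vhom (vop V E) a b)" and d: "disj g f" "disj f g"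
    then have o: "a \<in> vob E" "b \<in> vob E" "c \<in> vob E" and g: "g \<in> El (vhom E c b)" and f: "f \<in> El (vhom E b a)" by simp_all
    have fg: "cmp E c b a f g \<in> El (vhom E c a)" using o g f d lE by simp
    note ii = Ain[OF o(1,3) fg] Ain[OF o(1,2) f] Ain[OF o(2,3) g]
    have "app (A a c) (cmp E c b a f g) = cmp (vself V) (Lo a) (Lo b) (Lo c) (app (A b c) g) (app (A a b) f)"
    proof (rule su_ext[OF D psi HT[OF o(1)] Lo_ob[OF o(3)] ii(1)])
      show "cmp (vself V) (Lo a) (Lo b) (Lo c) (app (A b c) g) (app (A a b) f) \<in> El (ihom (Lo a) (Lo c))"
        using ii o d by simp
      fix e p x assume h: "e \<in> vob D" "p \<in> El (fob \<psi> e)" "x \<in> El (fob (HT a) e)" "disj p x" "disj x p"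
        and "disj (app (A a c) (cmp E c b a f g)) p" "disj p (app (A a c) (cmp E c b a f g))"
        "disj (app (A a c) (cmp E c b a f g)) x" "disj x (app (A a c) (cmp E c b a f g))"
      then have dj: "disj f p" "disj g p" "disj p f" "disj p g" "disj f x" "disj g x" "disj x f" "disj x g" by simp_all
      have x: "x \<in> El (vhom E a (fob T e))" using h by simp
      have xf: "cmp E b a (fob T e) x f \<in> El (vhom E b (fob T e))" using o h x f dj lE by simp
      show "ap (Lo a) (Lo c) (app (A a c) (cmp E c b a f g)) (sp a e p x) =
        ap (Lo a) (Lo c) (cmp (vself V) (Lo a) (Lo b) (Lo c) (app (A b c) g) (app (A a b) f)) (sp a e p x)"
        using o h x f g d dj xf ii sp_in[OF o(1) h(1,2) x] lE A'[OF o(1,3) fg h(1,2) x] A'[OF o(2,3) g h(1,2) xf] A'[OF o(1,2) f h(1,2) x]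
        by (simp add: cmp_assoc)
    qed (simp add: join_ac)
    then show "app (far \<alpha> a c) (cmp (vop V E) a b c g f) =
       cmp (vself V) (fob \<alpha> a) (fob \<alpha> b) (fob \<alpha> c) (app (far \<alpha> b c) g) (app (far \<alpha> a b) f)"
      using o g f d lE by simp
  qed
  note ga = vfunctor_vgraph[OF lE' alpha]
  have act: "act \<alpha> e e' f (sp e d p g) = sp e' d p (cmp E e' e (fob T d) g f)"
    if "e \<in> vob E" "e' \<in> vob E" "f \<in> El (vhom E e' e)" "d \<in> vob D" "p \<in> El (fob \<psi> d)" "g \<in> El (vhom E e (fob T d))"
      "disj f p" "disj f g" "disj p g" for e e' f d p g
    using A'[OF that] by (simp add: act_def)
  have "\<exists>h. d \<in> vob D \<longrightarrow> h \<in> ar (fob \<psi> d) (Lo (fob T d)) \<and> (\<forall>p\<in>El (fob \<psi> d). app h p = sp (fob T d) d p (idn E (fob T d)))" for d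
  proof (cases "d \<in> vob D")
    case d: True
    have "lin1 (fob \<psi> d) (Lo (fob T d)) (\<lambda>p. sp (fob T d) d p (idn E (fob T d)))"
      by (rule lin2_const[OF lin2_su[OF D psi HT[OF T_ob[OF d]] d]]) (use d lE in simp_all)
    then show ?thesis unfolding lin1_def by blast
  qed blast
  then obtain \<eta> where e: "\<And>d. d \<in> vob D \<Longrightarrow> \<eta> d \<in> ar (fob \<psi> d) (Lo (fob T d))"
    and e': "\<And>d p. d \<in> vob D \<Longrightarrow> p \<in> El (fob \<psi> d) \<Longrightarrow> app (\<eta> d) p = sp (fob T d) d p (idn E (fob T d))" by metis
  have sp_eta: "act \<alpha> (fob T d) c g (app (\<eta> d) p) = sp c d p g"
    if "d \<in> vob D" "c \<in> vob E" "p \<in> El (fob \<psi> d)" "g \<in> El (vhom E c (fob T d))" "disj g p" for d c p g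
    using that act[of "fob T d" c g d p "idn E (fob T d)"] lE by (simp add: e')
  have sp_eta': "act \<alpha> (fob T d) c g (app (\<eta> d) p) = sp c d p g"
    if "d \<in> vob D" "c \<in> vob E" "p \<in> El (fob \<psi> d)" "g \<in> El (vhom E c (fob T d))" "disj p g" for d c p g
    using sp_eta[OF that(1-4)] that(5) by (simp add: disj_commute)
  have "lan E D T \<psi> \<alpha> \<eta>"
    unfolding lan_def
  proof (intro conjI)
    show "\<forall>d\<in>vob D. \<eta> d \<in> ar (fob \<psi> d) (fob \<alpha> (fob T d))" using e by simp
    show "\<forall>d\<in>vob D. \<forall>d'\<in>vob D. \<forall>f\<in>El (vhom D d' d). \<forall>p\<in>El (fob \<psi> d). disj f p \<longrightarrow>
        app (\<eta> d') (act \<psi> d d' f p) = act \<alpha> (fob T d) (fob T d') (app (far T d' d) f) (app (\<eta> d) p)"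
    proof (intro ballI impI)
      fix d d' f p assume h: "d \<in> vob D" "d' \<in> vob D" "f \<in> El (vhom D d' d)" "p \<in> El (fob \<psi> d)" "disj f p"
      show "app (\<eta> d') (act \<psi> d d' f p) = act \<alpha> (fob T d) (fob T d') (app (far T d' d) f) (app (\<eta> d) p)"
        using h sp_eta[OF h(1) T_ob[OF h(2)] h(4) T_far[OF h(2,1,3)]] lE sp_nat[OF T_ob[OF h(2)] h(1-4), of "idn E (fob T d')"]
        by (simp add: e')
    qed
    show "\<forall>G N \<sigma>. vfunctor V (vop V E) (vself V) G \<longrightarrow> wedge V (vop V D) \<psi> (fcomp V G (fop T)) N \<sigma> \<longrightarrow>
        (\<exists>\<pi>. wedge V (vop V E) \<alpha> G N \<pi> \<and> restricts D T \<psi> \<alpha> \<eta> G N \<pi> \<sigma>)"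
    proof (intro allI impI)
      fix G N \<sigma> assume G: "vfunctor V (vop V E) (vself V) G" and W: "wedge V (vop V D) \<psi> (fcomp V G (fop T)) N \<sigma>"
      note gG = vfunctor_vgraph[OF lE' G] and N = wedge_ob[OF W]
      note s = wedge_GT_in[OF gG W]
      have gob: "fob G a \<in> Ob V" if "a \<in> vob E" for a using gG that by simp
      have sap: "ap (fob \<psi> d) (fob G (fob T d)) (app (\<sigma> d) n) p \<in> El (fob G (fob T d))"
        if "d \<in> vob D" "n \<in> El N" "p \<in> El (fob \<psi> d)" "disj n p" for d n p
        using app_in[OF s that(2)] that gob by simp
      have gin: "act G a b f x \<in> El (fob G b)" if "a \<in> vob E" "b \<in> vob E" "f \<in> El (vhom E b a)" "x \<in> El (fob G a)" "disj f x" for a b f x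
        using act_in[OF gG, of a b f x] that by simp
      have gc: "act G a c (cmp E c b a f g) x = act G b c g (act G a b f x)"
        if "a \<in> vob E" "b \<in> vob E" "c \<in> vob E" "g \<in> El (vhom E c b)" "f \<in> El (vhom E b a)" "x \<in> El (fob G a)"
          "disj g f" "disj g x" "disj f x" for a b c f g x
        using act_cmp[OF lE' G, of a b c g f x] that lE by simp
      have desc: "\<exists>h. e \<in> vob E \<longrightarrow> h \<in> ar N (ihom (Lo e) (fob G e)) \<and> (\<forall>n d p g. n \<in> El N \<longrightarrow> d \<in> vob D \<longrightarrow> p \<in> El (fob \<psi> d) \<longrightarrow>
         g \<in> El (vhom E e (fob T d)) \<longrightarrow> disj n p \<longrightarrow> disj n g \<longrightarrow> disj p g \<longrightarrow> disj g n \<longrightarrow> disj g p \<longrightarrow>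
         ap (Lo e) (fob G e) (app h n) (sp e d p g) = act G (fob T d) e g (ap (fob \<psi> d) (fob G (fob T d)) (app (\<sigma> d) n) p))" for e
      proof (cases "e \<in> vob E")
        case eE: True
        have "\<exists>h. d \<in> vob D \<longrightarrow> h \<in> ar N (ihom (fob \<psi> d) (ihom (vhom E e (fob T d)) (fob G e))) \<and>
          (\<forall>n p g. n \<in> El N \<longrightarrow> p \<in> El (fob \<psi> d) \<longrightarrow> g \<in> El (vhom E e (fob T d)) \<longrightarrow> disj n p \<longrightarrow> disj n g \<longrightarrow> disj p g \<longrightarrow>
           ap (vhom E e (fob T d)) (fob G e) (ap (fob \<psi> d) (ihom (vhom E e (fob T d)) (fob G e)) (app h n) p) g =
             act G (fob T d) e g (ap (fob \<psi> d) (fob G (fob T d)) (app (\<sigma> d) n) p))" for d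
        proof (cases "d \<in> vob D")
          case d: True
          have s2: "lin2 N (fob \<psi> d) (fob G (fob T d)) (\<lambda>n p. ap (fob \<psi> d) (fob G (fob T d)) (app (\<sigma> d) n) p)"
            by (rule lin2_pre1[OF lin1_app[OF s[OF d]] lin2_ap]) (use d gob in simp_all)
          have a2: "lin2 (fob G (fob T d)) (vhom E e (fob T d)) (fob G e) (\<lambda>x g. act G (fob T d) e g x)"
            using lin2_swap[OF lin2_act[OF gG, of "fob T d" e]] d eE by simp
          from lin3_l[OF s2 a2] show ?thesis by (rule lin3_curry2) blast
        qed blast
        then obtain k where k: "\<And>d. d \<in> vob D \<Longrightarrow> k d \<in> ar N (ihom (fob \<psi> d) (ihom (vhom E e (fob T d)) (fob G e)))"
          and k': "\<And>d n p g. \<lbrakk>d \<in> vob D; n \<in> El N; p \<in> El (fob \<psi> d); g \<in> El (vhom E e (fob T d));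
            disj n p; disj n g; disj p g\<rbrakk> \<Longrightarrow>
           ap (vhom E e (fob T d)) (fob G e) (ap (fob \<psi> d) (ihom (vhom E e (fob T d)) (fob G e)) (app (k d) n) p) g =
             act G (fob T d) e g (ap (fob \<psi> d) (fob G (fob T d)) (app (\<sigma> d) n) p)" by metis
        have Wk: "wedge V (vop V D) \<psi> (fcomp V (homfun V (vop V (vself V)) (fob G e)) (fop (HT e))) N k"
        proof (rule hom_into_wedgeI[OF D psi HT[OF eE] gob[OF eE] N])
          show "k d \<in> ar N (ihom (fob \<psi> d) (ihom (fob (HT e) d) (fob G e)))" if "d \<in> vob D" for d using k[OF that] by simp
          fix a b n f p x assume h: "a \<in> vob D" "b \<in> vob D" "n \<in> El N" "f \<in> El (vhom D b a)" "p \<in> El (fob \<psi> a)" "x \<in> El (fob (HT e) b)"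
            and d: "disj n f" "disj f n" "disj n p" "disj p n" "disj n x" "disj x n" "disj f p" "disj p f" "disj f x" "disj x f" "disj p x" "disj x p"
          have x: "x \<in> El (vhom E e (fob T b))" using h by simp
          have fx: "cmp E e (fob T b) (fob T a) (app (far T b a) f) x \<in> El (vhom E e (fob T a))" using eE h x d lE by simp
          show "ap (fob (HT e) b) (fob G e) (ap (fob \<psi> b) (ihom (fob (HT e) b) (fob G e)) (app (k b) n) (act \<psi> a b f p)) x =
            ap (fob (HT e) a) (fob G e) (ap (fob \<psi> a) (ihom (fob (HT e) a) (fob G e)) (app (k a) n) p) (act (HT e) b a f x)"
            using eE h x d fx lE sap[OF h(1,3,5)]
            by (simp add: k' act_HT wedge_GT_nat[OF gG W] gc)
        qed
        from su_desc[OF D psi HT[OF eE] gob[OF eE] Wk] obtain h where h: "h \<in> ar N (ihom (Lo e) (fob G e))"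
          and h': "\<And>n d p x. \<lbrakk>n \<in> El N; d \<in> vob D; p \<in> El (fob \<psi> d); x \<in> El (fob (HT e) d); disj n p; disj n x; disj p x\<rbrakk> \<Longrightarrow>
            ap (Lo e) (fob G e) (app h n) (sp e d p x) =
            ap (fob (HT e) d) (fob G e) (ap (fob \<psi> d) (ihom (fob (HT e) d) (fob G e)) (app (k d) n) p) x" by blast
        show ?thesis by (rule exI[of _ h]) (use h h' k' in simp)
      qed blast
      then obtain \<pi> where p: "\<And>e. e \<in> vob E \<Longrightarrow> \<pi> e \<in> ar N (ihom (Lo e) (fob G e))"
        and p': "\<And>e n d p g. \<lbrakk>e \<in> vob E; n \<in> El N; d \<in> vob D; p \<in> El (fob \<psi> d);
         g \<in> El (vhom E e (fob T d)); disj n p; disj n g; disj p g; disj g n; disj g p\<rbrakk> \<Longrightarrow>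
         ap (Lo e) (fob G e) (app (\<pi> e) n) (sp e d p g) = act G (fob T d) e g (ap (fob \<psi> d) (fob G (fob T d)) (app (\<sigma> d) n) p)"
        by metis
      have "wedge V (vop V E) \<alpha> G N \<pi>"
      proof (rule wedgeI[OF ga gG N])
        show "\<pi> a \<in> ar N (ihom (fob \<alpha> a) (fob G a))" if "a \<in> vob (vop V E)" for a using p that by simp
        fix a b n f x assume "a \<in> vob (vop V E)" "b \<in> vob (vop V E)" and n: "n \<in> El N" and "f \<in> El (vhom (vop V E) a b)" "x \<in> El (fob \<alpha> a)"
          and d: "disj n f" "disj f n" "disj n x" "disj x n" "disj f x" "disj x f"
        then have o: "a \<in> vob E" "b \<in> vob E" and f: "f \<in> El (vhom E b a)" and x: "x \<in> El (Lo a)" by simp_all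
        note ii = app_in[OF p[OF o(1)] n] app_in[OF p[OF o(2)] n] Ain[OF o f]
        have gf: "app (far G a b) f \<in> El (ihom (fob G a) (fob G b))" using vgraph_far_app[OF gG, of a b f] o f by simp
        have "cmp (vself V) (Lo a) (Lo b) (fob G b) (app (\<pi> b) n) (app (A a b) f) =
          cmp (vself V) (Lo a) (fob G a) (fob G b) (app (far G a b) f) (app (\<pi> a) n)" (is "?l = ?r")
        proof (rule su_ext[OF D psi HT[OF o(1)] gob[OF o(2)]])
          show "?l \<in> El (ihom (Lo a) (fob G b))" "?r \<in> El (ihom (Lo a) (fob G b))" using ii gf o gob d by simp_all
          show "fst ?l = fst ?r" by (simp add: join_ac)
          fix z q y assume h: "z \<in> vob D" "q \<in> El (fob \<psi> z)" "y \<in> El (fob (HT a) z)" "disj q y" "disj y q" and "disj ?l q" "disj q ?l" "disj ?l y" "disj y ?l"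
          then have dj: "disj n q" "disj f q" "disj q n" "disj q f" "disj n y" "disj f y" "disj y n" "disj y f" by simp_all
          have y: "y \<in> El (vhom E a (fob T z))" using h by simp
          have yf: "cmp E b a (fob T z) y f \<in> El (vhom E b (fob T z))" using o h y f dj lE by simp
          show "ap (Lo a) (fob G b) ?l (sp a z q y) = ap (Lo a) (fob G b) ?r (sp a z q y)"
            using o h y yf f d dj ii gf gob n sp_in[OF o(1) h(1,2) y h(4)] A'[OF o f h(1,2) y] sap[OF h(1) n h(2)]
              p'[OF o(1) n h(1,2) y] p'[OF o(2) n h(1,2) yf] by (simp add: gc act_def[of G a b, symmetric])
        qed
        then have "ap (Lo a) (fob G b) ?l x = ap (Lo a) (fob G b) ?r x" by simp
        then show "ap (fob \<alpha> b) (fob G b) (app (\<pi> b) n) (act \<alpha> a b f x) = act G a b f (ap (fob \<alpha> a) (fob G a) (app (\<pi> a) n) x)"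
          using o n f x d ii gf gob by (simp add: act_def)
      qed
      moreover have "restricts D T \<psi> \<alpha> \<eta> G N \<pi> \<sigma>"
        unfolding restricts_def
      proof (intro ballI impI)
        fix d n q assume h: "d \<in> vob D" "n \<in> El N" "q \<in> El (fob \<psi> d)" "disj n q"
        show "ap (fob \<alpha> (fob T d)) (fob G (fob T d)) (app (\<pi> (fob T d)) n) (app (\<eta> d) q) = ap (fob \<psi> d) (fob G (fob T d)) (app (\<sigma> d) n) q"
          using h p'[OF T_ob[OF h(1)] h(2,1,3), of "idn E (fob T d)"] lE act_idn[OF lE' G, of "fob T d", OF _ sap[OF h]] by (simp add: e')
      qed
      ultimately show "\<exists>\<pi>. wedge V (vop V E) \<alpha> G N \<pi> \<and> restricts D T \<psi> \<alpha> \<eta> G N \<pi> \<sigma>" by blast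
    qed
    show "\<forall>G N \<sigma> \<pi> \<pi>'. vfunctor V (vop V E) (vself V) G \<longrightarrow> wedge V (vop V D) \<psi> (fcomp V G (fop T)) N \<sigma> \<longrightarrow>
        wedge V (vop V E) \<alpha> G N \<pi> \<longrightarrow> wedge V (vop V E) \<alpha> G N \<pi>' \<longrightarrow>
        restricts D T \<psi> \<alpha> \<eta> G N \<pi> \<sigma> \<longrightarrow> restricts D T \<psi> \<alpha> \<eta> G N \<pi>' \<sigma> \<longrightarrow> (\<forall>e\<in>vob E. \<pi> e = \<pi>' e)"
    proof (intro allI impI ballI)
      fix G N \<sigma> \<pi> \<pi>' c assume G: "vfunctor V (vop V E) (vself V) G" and "wedge V (vop V D) \<psi> (fcomp V G (fop T)) N \<sigma>"
        and W: "wedge V (vop V E) \<alpha> G N \<pi>" "wedge V (vop V E) \<alpha> G N \<pi>'"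
        and r: "restricts D T \<psi> \<alpha> \<eta> G N \<pi> \<sigma>" "restricts D T \<psi> \<alpha> \<eta> G N \<pi>' \<sigma>" and c: "c \<in> vob E"
      note gG = vfunctor_vgraph[OF lE' G]
      have gob: "fob G c \<in> Ob V" using gG c by simp
      have in': "\<pi> c \<in> ar N (ihom (Lo c) (fob G c))" "\<pi>' c \<in> ar N (ihom (Lo c) (fob G c))"
        using wedge_in[OF ga gG W(1), of c] wedge_in[OF ga gG W(2), of c] c by simp_all
      show "\<pi> c = \<pi>' c"
      proof (rule su_ext_ar[OF D psi HT[OF c] gob in'])
        fix n d p x assume h: "n \<in> El N" "d \<in> vob D" "p \<in> El (fob \<psi> d)" "x \<in> El (fob (HT c) d)"
          and dj: "disj p x" "disj x p" "disj n p" "disj p n" "disj n x" "disj x n"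
        have x: "x \<in> El (vhom E c (fob T d))" using h by simp
        have ed: "app (\<eta> d) p \<in> El (fob \<alpha> (fob T d))" using app_in[OF e[OF h(2)] h(3)] by simp
        note n1 = wedge_nat[OF ga gG W(1), of "fob T d" c n x "app (\<eta> d) p"]
          and n2 = wedge_nat[OF ga gG W(2), of "fob T d" c n x "app (\<eta> d) p"]
        show "ap (Lo c) (fob G c) (app (\<pi> c) n) (sp c d p x) = ap (Lo c) (fob G c) (app (\<pi>' c) n) (sp c d p x)"
          using n1 n2 h c x ed dj r sp_eta'[OF h(2) c h(3) x dj(1)] by (simp add: restricts_def)
      qed
    qed
  qed
  then show ?thesis using alpha by blast
qed

end
end

section \<open>Canonical morphisms\<close>

context bicomplete_smc begin

context
  fixes E D :: "('u, 'o, 'm) vcat" and T :: "('u, 'u, 'm) vfun" and \<phi> \<psi> \<alpha> :: "('u, 'o, 'm) vfun" and \<eta> :: "'u \<Rightarrow> 'm"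
  assumes E: "small_vcategory V E" and D: "small_vcategory V D" and T: "vfunctor V D E T"
    and psi: "vfunctor V (vop V D) (vself V) \<psi>"
    and alpha: "vfunctor V (vop V E) (vself V) \<alpha>" and lan: "lan E D T \<psi> \<alpha> \<eta>"
    and phi: "vfunctor V (vop V E) (vself V) \<phi>"
begin

lemma cE': "vcategory V (vop V E)" and ssE: "small_vcategory V (vop V E)" and ssD: "small_vcategory V (vop V D)"
  and cFC: "vcategory V (funcat V E)" and cY: "vfunctor V (vop V E) (funcat V E) (yoneda V E)"
  using E D vcategory_funcat[OF E] vfunctor_yoneda[OF E] by simp_all

lemma galpha': "vgraph (vop V E) \<alpha>" and gpsi': "vgraph (vop V D) \<psi>" and gphi': "vgraph (vop V E) \<phi>"
  using vfunctor_vgraph[OF cE' alpha] vfunctor_vgraph[OF small_vcategory_D[OF ssD] psi] vfunctor_vgraph[OF cE' phi] .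

lemmas ST_Y = ST[OF E D T psi alpha lan cFC cY]
lemmas ST_phi = ST[OF E D T psi alpha lan vcategory_vself phi]

text \<open>
  The canonical morphism is the \<open>k : \<phi> \<star> L \<rightarrow> P\<close> for which the cylinder of \<open>k\<close> is the image under
  \<open>\<phi> \<star> -\<close> of the unit of \<open>L\<close>. For the limits weighted by \<open>\<psi>\<close> both cylinders are the restrictions
  along \<open>\<eta>\<close> of those for \<open>\<alpha>\<close>. The latter are natural transformations \<open>\<alpha> \<rightarrow> [\<phi> \<star> L, \<phi>-]\<close>, hence equal as
  soon as their restrictions are equal. So both equations have the same solutions \<open>k\<close>.
\<close>

lemma can_restrict:
  assumes \<theta>: "is_wlim V (vop V E) (funcat V E) \<alpha> (yoneda V E) L \<theta>"
    and \<rho>: "is_wlim V (vop V E) (vself V) \<alpha> \<phi> P \<rho>"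
    and \<theta>': "is_wlim V (vop V D) (funcat V E) \<psi> (fcomp V (yoneda V E) (fop T)) L \<theta>'"
    and \<rho>': "is_wlim V (vop V D) (vself V) \<psi> (fcomp V \<phi> (fop T)) P \<rho>'"
    and ut: "\<And>d. d \<in> vob D \<Longrightarrow> lim_unit V (vop V D) (funcat V E) \<psi> (fcomp V (yoneda V E) (fop T)) L \<theta>' d =
      lim_unit V (vop V E) (funcat V E) \<alpha> (yoneda V E) L \<theta> (fob T d) \<cdot> \<eta> d"
    and ur: "\<And>d. d \<in> vob D \<Longrightarrow> lim_unit V (vop V D) (vself V) \<psi> (fcomp V \<phi> (fop T)) P \<rho>' d =
      lim_unit V (vop V E) (vself V) \<alpha> \<phi> P \<rho> (fob T d) \<cdot> \<eta> d"
  shows "can V E \<phi> (vop V D) \<psi> (fob T) (fcomp V (yoneda V E) (fop T)) L \<theta>' (fcomp V \<phi> (fop T)) P \<rho>' =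
    can V E \<phi> (vop V E) \<alpha> (\<lambda>e. e) (yoneda V E) L \<theta> \<phi> P \<rho>"
proof -
  let ?C = "star_ob V E \<phi> L"
  let ?v = "lim_unit V (vop V E) (funcat V E) \<alpha> (yoneda V E) L \<theta>" and ?p = "lim_unit V (vop V E) (vself V) \<alpha> \<phi> P \<rho>"
  note lv = limit_unit_of_wlim[OF ssE cFC galpha' cY alpha \<theta>] and lp = limit_unit_of_wlim[OF ssE vcategory_vself galpha' phi alpha \<rho>]
  have L: "vfunctor V E (vself V) L" using limit_unit_ob[OF lv] by simp
  have P: "P \<in> Ob V" using limit_unit_ob[OF lp] by simp
  have C: "?C \<in> Ob V" by (rule star_ob_in[OF E phi L])
  have To: "fob T d \<in> vob E" if "d \<in> vob D" for d using T that by simp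
  have pob: "fob \<phi> e \<in> Ob V" if "e \<in> vob E" for e using gphi' that by simp
  have eta: "\<eta> d \<in> ar (fob \<psi> d) (fob \<alpha> (fob T d))" if "d \<in> vob D" for d by (rule lan_in[OF lan that])
  have vin: "?v e \<in> ar (fob \<alpha> e) (natob V E L (homfun V E e))" if "e \<in> vob E" for e
    using limit_unit_in[OF lv, of e] that fob_yoneda[OF E] by simp
  have pin: "?p e \<in> ar (fob \<alpha> e) (ihom P (fob \<phi> e))" if "e \<in> vob E" for e
    using limit_unit_in[OF lp, of e] that by simp
  let ?cyl = "\<lambda>k e. cylinder V (vop V E) (vself V) \<alpha> \<phi> \<rho> ?C (nm V ?C P k) e"
  let ?cyl' = "\<lambda>k d. cylinder V (vop V D) (vself V) \<psi> (fcomp V \<phi> (fop T)) \<rho>' ?C (nm V ?C P k) d"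
  let ?r = "\<lambda>e. om E \<phi> L e \<cdot> ?v e"
  let ?r' = "\<lambda>d. om E \<phi> L (fob T d) \<cdot> lim_unit V (vop V D) (funcat V E) \<psi> (fcomp V (yoneda V E) (fop T)) L \<theta>' d"
  have iff: "(\<forall>d\<in>vob D. ?cyl' k d = ?r' d) \<longleftrightarrow> (\<forall>e\<in>vob E. ?cyl k e = ?r e)" if k0: "k \<in> Hom V ?C P" for k
  proof -
    have k: "k \<in> ar ?C P" using k0 C P by (simp add: ar_def)
    let ?k = "app (nm V ?C P k) one"
    have kin: "?k \<in> El (ihom ?C P)" by (rule app_in[OF nm_in[OF k] one_in])
    have kd: "disj ?k x" "disj x ?k" for x by simp_all
    have nk: "nm V ?C P k \<in> ar \<I> (vhom (vself V) ?C P)" using nm_in[OF k] by simp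
    have cin: "?cyl k e \<in> ar (fob \<alpha> e) (ihom ?C (fob \<phi> e))" if "e \<in> vob E" for e
      using cylinder_in[OF ssE vcategory_vself galpha' phi alpha \<rho> _ nk, of e] C that by simp
    have capp: "app (?cyl k e) q = cmp (vself V) ?C P (fob \<phi> e) (app (?p e) q) ?k" if "e \<in> vob E" "q \<in> El (fob \<alpha> e)" for e q
      using app_cylinder_unit[OF ssE vcategory_vself galpha' phi alpha \<rho> _ nk, of e q] C that by simp
    have rin: "?r e \<in> ar (fob \<alpha> e) (ihom ?C (fob \<phi> e))" if "e \<in> vob E" for e
      by (rule comp_in[OF vin[OF that] om_in[OF E phi L that]])
    have rapp: "app (?r e) q = app (om E \<phi> L e) (app (?v e) q)" if "e \<in> vob E" "q \<in> El (fob \<alpha> e)" for e q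
      using app_comp[OF that(2) vin[OF that(1)] om_in[OF E phi L that(1)]] .
    have cc: "?cyl' k d = ?cyl k (fob T d) \<cdot> \<eta> d" if d: "d \<in> vob D" for d
    proof (rule ext1)
      show "?cyl' k d \<in> ar (fob \<psi> d) (ihom ?C (fob \<phi> (fob T d)))"
        using cylinder_in[OF ssD vcategory_vself gpsi' ST_phi psi \<rho>' _ nk, of d] C d by simp
      show "?cyl k (fob T d) \<cdot> \<eta> d \<in> ar (fob \<psi> d) (ihom ?C (fob \<phi> (fob T d)))"
        by (rule comp_in[OF eta[OF d] cin[OF To[OF d]]])
      fix p assume p: "p \<in> El (fob \<psi> d)"
      have "app (?cyl' k d) p = cmp (vself V) ?C P (fob \<phi> (fob T d)) (app (?p (fob T d) \<cdot> \<eta> d) p) ?k"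
        using app_cylinder_unit[OF ssD vcategory_vself gpsi' ST_phi psi \<rho>' _ nk, of d p] C d p by (simp add: ur)
      then show "app (?cyl' k d) p = app (?cyl k (fob T d) \<cdot> \<eta> d) p"
        using app_comp[OF p eta[OF d] pin[OF To[OF d]]] app_comp[OF p eta[OF d] cin[OF To[OF d]]]
          capp[OF To[OF d] app_in[OF eta[OF d] p]] by simp
    qed
    have rr: "?r' d = ?r (fob T d) \<cdot> \<eta> d" if d: "d \<in> vob D" for d
      unfolding ut[OF d] by (rule cassoc[OF eta[OF d] vin[OF To[OF d]] om_in[OF E phi L To[OF d]], symmetric])
    have GC: "vfunctor V (vop V E) (vself V) (fcomp V (homfun V (vself V) ?C) \<phi>)"
      by (rule vfunctor_fcomp[OF cE' vcategory_vself vcategory_vself phi]) (simp add: C)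
    have actG: "act (fcomp V (homfun V (vself V) ?C) \<phi>) e e' f g = cmp (vself V) ?C (fob \<phi> e) (fob \<phi> e') (app (far \<phi> e e') f) g"
      if "e \<in> vob E" "e' \<in> vob E" "f \<in> El (vhom E e' e)" "g \<in> El (ihom ?C (fob \<phi> e))" "disj f g" for e e' f g
      using act_KD[OF ssE vcategory_vself galpha' phi, of ?C e e' f g] C that by simp
    show ?thesis
    proof
      assume "\<forall>e\<in>vob E. ?cyl k e = ?r e"
      then show "\<forall>d\<in>vob D. ?cyl' k d = ?r' d" using To by (simp add: cc rr)
    next
      assume h: "\<forall>d\<in>vob D. ?cyl' k d = ?r' d"
      show "\<forall>e\<in>vob E. ?cyl k e = ?r e"
      proof
        fix e assume e: "e \<in> vob E"
        \<comment> \<open>The values in \<open>[\<phi> \<star> L, \<phi>-]\<close> of the two natural transformations are compared on \<open>\<psi>\<close>.\<close>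
        show "?cyl k e = ?r e"
        proof (rule lan_nat_unique[OF E D T psi alpha lan GC _ _ _ _ _ e, of "?cyl k" ?r])
          show "?cyl k e \<in> ar (fob \<alpha> e) (fob (fcomp V (homfun V (vself V) ?C) \<phi>) e)" if "e \<in> vob E" for e
            using cin[OF that] by simp
          show "?r e \<in> ar (fob \<alpha> e) (fob (fcomp V (homfun V (vself V) ?C) \<phi>) e)" if "e \<in> vob E" for e
            using rin[OF that] by simp
          show "app (?cyl k (fob T d)) (app (\<eta> d) p) = app (?r (fob T d)) (app (\<eta> d) p)" if d: "d \<in> vob D" and p: "p \<in> El (fob \<psi> d)" for d p
            using h d cc[OF d] rr[OF d] app_comp[OF p eta[OF d] cin[OF To[OF d]]] app_comp[OF p eta[OF d] rin[OF To[OF d]]] by simp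
          fix e e' f q assume o: "e \<in> vob E" "e' \<in> vob E" and f: "f \<in> El (vhom E e' e)" and q: "q \<in> El (fob \<alpha> e)" and d: "disj f q" "disj q f"
          have aq: "act \<alpha> e e' f q \<in> El (fob \<alpha> e')" using act_in[OF galpha', of e e' f q] o f q d by simp
          have pq: "app (?p e) q \<in> El (ihom P (fob \<phi> e))" by (rule app_in[OF pin[OF o(1)] q])
          have vq: "app (?v e) q \<in> El (natob V E L (homfun V E e))" by (rule app_in[OF vin[OF o(1)] q])
          have ff: "app (far \<phi> e e') f \<in> El (ihom (fob \<phi> e) (fob \<phi> e'))" using vgraph_far_app[OF gphi', of e e' f] o f by simp
          have pn: "app (?p e') (act \<alpha> e e' f q) = cmp (vself V) P (fob \<phi> e) (fob \<phi> e') (app (far \<phi> e e') f) (app (?p e) q)"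
            using limit_unit_nat[OF lp, of e e' f q] o f q d by simp
          have vn: "app (?v e') (act \<alpha> e e' f q) = cmp (funcat V E) L (homfun V E e) (homfun V E e') (app (far (yoneda V E) e e') f) (app (?v e) q)"
            using limit_unit_nat[OF lv, of e e' f q] o f q d fob_yoneda[OF E] by simp
          have ci: "app (?cyl k e) q \<in> El (ihom ?C (fob \<phi> e))" by (rule app_in[OF cin[OF o(1)] q])
          show "app (?cyl k e') (act \<alpha> e e' f q) = act (fcomp V (homfun V (vself V) ?C) \<phi>) e e' f (app (?cyl k e) q)"
          proof -
            have "app (?cyl k e') (act \<alpha> e e' f q) = cmp (vself V) ?C P (fob \<phi> e') (cmp (vself V) P (fob \<phi> e) (fob \<phi> e') (app (far \<phi> e e') f) (app (?p e) q)) ?k"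
              using capp[OF o(2) aq] pn by simp
            also have "\<dots> = cmp (vself V) ?C (fob \<phi> e) (fob \<phi> e') (app (far \<phi> e e') f) (cmp (vself V) ?C P (fob \<phi> e) (app (?p e) q) ?k)"
              using cmp_assoc[OF vcategory_vself, of ?C P "fob \<phi> e" "fob \<phi> e'" "app (far \<phi> e e') f" "app (?p e) q" ?k] C P pob o ff pq kin d by simp
            also have "\<dots> = cmp (vself V) ?C (fob \<phi> e) (fob \<phi> e') (app (far \<phi> e e') f) (app (?cyl k e) q)"
              using capp[OF o(1) q] by simp
            finally show ?thesis using actG[OF o f ci] d by simp
          qed
          show "app (?r e') (act \<alpha> e e' f q) = act (fcomp V (homfun V (vself V) ?C) \<phi>) e e' f (app (?r e) q)"
          proof -
            have "app (?r e') (act \<alpha> e e' f q) = cmp (vself V) ?C (fob \<phi> e) (fob \<phi> e') (app (far \<phi> e e') f) (app (om E \<phi> L e) (app (?v e) q))"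
              using rapp[OF o(2) aq] vn om_nat[OF E phi L o vq f] d by simp
            then show ?thesis using actG[OF o f app_in[OF rin[OF o(1)] q]] rapp[OF o(1) q] d by simp
          qed
        qed
      qed
    qed
  qed
  have om_eq: "ihom_post V ?C (star_ob V E \<phi> (homfun V E e)) (fob \<phi> e) (star_yoneda V E \<phi> e) \<cdot> far (star V E \<phi>) L (homfun V E e) = om E \<phi> L e" for e
    by (simp add: om_def[OF E phi])
  show ?thesis
    unfolding can_def using iff by (simp add: om_eq fob_yoneda[OF E] cong: conj_cong)
qed

text \<open>
  Every limit for one weight is a limit for the other with the corresponding unit, so each instance
  of one condition has the same canonical morphism as an instance of the other.
\<close>

lemma can_is_iso_restrict:
  "can_is_iso V E \<phi> (vop V D) \<psi> (fob T) (fcomp V (yoneda V E) (fop T)) (fcomp V \<phi> (fop T)) \<longleftrightarrow>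
   can_is_iso V E \<phi> (vop V E) \<alpha> (\<lambda>e. e) (yoneda V E) \<phi>"
proof
  assume h: "can_is_iso V E \<phi> (vop V D) \<psi> (fob T) (fcomp V (yoneda V E) (fop T)) (fcomp V \<phi> (fop T))"
  show "can_is_iso V E \<phi> (vop V E) \<alpha> (\<lambda>e. e) (yoneda V E) \<phi>"
    unfolding can_is_iso_def
  proof (intro allI impI)
    fix L \<theta> P \<rho> assume t: "is_wlim V (vop V E) (funcat V E) \<alpha> (yoneda V E) L \<theta>" and r: "is_wlim V (vop V E) (vself V) \<alpha> \<phi> P \<rho>"
    note lt = limit_unit_restrict[OF E D T psi alpha lan cFC cY limit_unit_of_wlim[OF ssE cFC galpha' cY alpha t]]
    note lr = limit_unit_restrict[OF E D T psi alpha lan vcategory_vself phi limit_unit_of_wlim[OF ssE vcategory_vself galpha' phi alpha r]]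
    obtain \<theta>' where t': "is_wlim V (vop V D) (funcat V E) \<psi> (fcomp V (yoneda V E) (fop T)) L \<theta>'"
      and ut: "\<forall>d\<in>vob (vop V D). lim_unit V (vop V D) (funcat V E) \<psi> (fcomp V (yoneda V E) (fop T)) L \<theta>' d =
        lim_unit V (vop V E) (funcat V E) \<alpha> (yoneda V E) L \<theta> (fob T d) \<cdot> \<eta> d"
      using wlim_of_limit_unit[OF ssD cFC gpsi' ST_Y psi lt] by blast
    obtain \<rho>' where r': "is_wlim V (vop V D) (vself V) \<psi> (fcomp V \<phi> (fop T)) P \<rho>'"
      and ur: "\<forall>d\<in>vob (vop V D). lim_unit V (vop V D) (vself V) \<psi> (fcomp V \<phi> (fop T)) P \<rho>' d =
        lim_unit V (vop V E) (vself V) \<alpha> \<phi> P \<rho> (fob T d) \<cdot> \<eta> d"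
      using wlim_of_limit_unit[OF ssD vcategory_vself gpsi' ST_phi psi lr] by blast
    have "can V E \<phi> (vop V D) \<psi> (fob T) (fcomp V (yoneda V E) (fop T)) L \<theta>' (fcomp V \<phi> (fop T)) P \<rho>' =
      can V E \<phi> (vop V E) \<alpha> (\<lambda>e. e) (yoneda V E) L \<theta> \<phi> P \<rho>"
      by (rule can_restrict[OF t r t' r']) (use ut ur in simp_all)
    then show "iso V (star_ob V E \<phi> L) P (can V E \<phi> (vop V E) \<alpha> (\<lambda>e. e) (yoneda V E) L \<theta> \<phi> P \<rho>)"
      using h t' r' unfolding can_is_iso_def by metis
  qed
next
  assume h: "can_is_iso V E \<phi> (vop V E) \<alpha> (\<lambda>e. e) (yoneda V E) \<phi>"
  show "can_is_iso V E \<phi> (vop V D) \<psi> (fob T) (fcomp V (yoneda V E) (fop T)) (fcomp V \<phi> (fop T))"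
    unfolding can_is_iso_def
  proof (intro allI impI)
    fix L \<theta>' P \<rho>' assume t': "is_wlim V (vop V D) (funcat V E) \<psi> (fcomp V (yoneda V E) (fop T)) L \<theta>'"
      and r': "is_wlim V (vop V D) (vself V) \<psi> (fcomp V \<phi> (fop T)) P \<rho>'"
    obtain v where v: "limit_unit (vop V E) (funcat V E) \<alpha> (yoneda V E) L v"
      and vu: "\<forall>d\<in>vob D. v (fob T d) \<cdot> \<eta> d = lim_unit V (vop V D) (funcat V E) \<psi> (fcomp V (yoneda V E) (fop T)) L \<theta>' d"
      using limit_unit_extend[OF E D T psi alpha lan cFC cY limit_unit_of_wlim[OF ssD cFC gpsi' ST_Y psi t']] by blast
    obtain p where p: "limit_unit (vop V E) (vself V) \<alpha> \<phi> P p"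
      and pu: "\<forall>d\<in>vob D. p (fob T d) \<cdot> \<eta> d = lim_unit V (vop V D) (vself V) \<psi> (fcomp V \<phi> (fop T)) P \<rho>' d"
      using limit_unit_extend[OF E D T psi alpha lan vcategory_vself phi limit_unit_of_wlim[OF ssD vcategory_vself gpsi' ST_phi psi r']] by blast
    obtain \<theta> where t: "is_wlim V (vop V E) (funcat V E) \<alpha> (yoneda V E) L \<theta>"
      and tv: "\<forall>e\<in>vob (vop V E). lim_unit V (vop V E) (funcat V E) \<alpha> (yoneda V E) L \<theta> e = v e"
      using wlim_of_limit_unit[OF ssE cFC galpha' cY alpha v] by blast
    obtain \<rho> where r: "is_wlim V (vop V E) (vself V) \<alpha> \<phi> P \<rho>"
      and rp: "\<forall>e\<in>vob (vop V E). lim_unit V (vop V E) (vself V) \<alpha> \<phi> P \<rho> e = p e"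
      using wlim_of_limit_unit[OF ssE vcategory_vself galpha' phi alpha p] by blast
    have To: "fob T d \<in> vob E" if "d \<in> vob D" for d using T that by simp
    have "can V E \<phi> (vop V D) \<psi> (fob T) (fcomp V (yoneda V E) (fop T)) L \<theta>' (fcomp V \<phi> (fop T)) P \<rho>' =
      can V E \<phi> (vop V E) \<alpha> (\<lambda>e. e) (yoneda V E) L \<theta> \<phi> P \<rho>"
      by (rule can_restrict[OF t r t' r']) (use vu tv pu rp To in simp_all)
    then show "iso V (star_ob V E \<phi> L) P (can V E \<phi> (vop V D) \<psi> (fob T) (fcomp V (yoneda V E) (fop T)) L \<theta>' (fcomp V \<phi> (fop T)) P \<rho>')"
      using h t r unfolding can_is_iso_def by metis
  qed
qed

end

lemma preserves_limits_of_representables_iff: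
  fixes E :: "('u, 'o, 'm) vcat"
  assumes Psi: "weight_class V \<Psi>" and phi: "is_weight V E \<phi>"
  shows "preserves_limits_of_representables V \<Psi> E \<phi> \<longleftrightarrow>
    (\<forall>\<alpha>\<in>Psi1 V \<Psi> E. can_is_iso V E \<phi> (vop V E) \<alpha> (\<lambda>e. e) (yoneda V E) \<phi>)"
proof
  have E: "small_vcategory V E" and phi': "vfunctor V (vop V E) (vself V) \<phi>" using phi by (simp_all add: is_weight_def)
  have W: "small_vcategory V D" "vfunctor V (vop V D) (vself V) \<psi>" if "(D, \<psi>) \<in> \<Psi>" for D \<psi>
    using Psi that by (auto simp: weight_class_def is_weight_def)
  show "\<forall>\<alpha>\<in>Psi1 V \<Psi> E. can_is_iso V E \<phi> (vop V E) \<alpha> (\<lambda>e. e) (yoneda V E) \<phi>"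
    if h: "preserves_limits_of_representables V \<Psi> E \<phi>"
  proof
    fix \<alpha> assume "\<alpha> \<in> Psi1 V \<Psi> E"
    then obtain D \<psi> T \<theta> where a: "vfunctor V (vop V E) (vself V) \<alpha>" and m: "(D, \<psi>) \<in> \<Psi>" and T: "vfunctor V D E T"
      and c: "is_wcolim V D (funcat V (vop V E)) \<psi> (fcomp V (yoneda V (vop V E)) T) \<alpha> \<theta>"
      by (auto simp: Psi1_def)
    obtain \<eta> where lan: "lan E D T \<psi> \<alpha> \<eta>" using lan_of_wcolim[OF E W(1)[OF m] T W(2)[OF m] a c] by blast
    have "can_is_iso V E \<phi> (vop V D) \<psi> (fob T) (fcomp V (yoneda V E) (fop T)) (fcomp V \<phi> (fop T))"
      using h m T unfolding preserves_limits_of_representables_def by blast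
    then show "can_is_iso V E \<phi> (vop V E) \<alpha> (\<lambda>e. e) (yoneda V E) \<phi>"
      using can_is_iso_restrict[OF E W(1)[OF m] T W(2)[OF m] a lan phi'] by simp
  qed
  show "preserves_limits_of_representables V \<Psi> E \<phi>"
    if h: "\<forall>\<alpha>\<in>Psi1 V \<Psi> E. can_is_iso V E \<phi> (vop V E) \<alpha> (\<lambda>e. e) (yoneda V E) \<phi>"
    unfolding preserves_limits_of_representables_def
  proof (intro ballI, clarify)
    fix D \<psi> T assume m: "(D, \<psi>) \<in> \<Psi>" and T: "vfunctor V D E T"
    obtain \<alpha> \<eta> where a: "vfunctor V (vop V E) (vself V) \<alpha>" and lan: "lan E D T \<psi> \<alpha> \<eta>"
      using lan_exists[OF E W(1)[OF m] T W(2)[OF m]] by blast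
    obtain \<theta> where "is_wcolim V D (funcat V (vop V E)) \<psi> (fcomp V (yoneda V (vop V E)) T) \<alpha> \<theta>"
      using wcolim_of_lan[OF E W(1)[OF m] T W(2)[OF m] a lan] by blast
    then have "\<alpha> \<in> Psi1 V \<Psi> E" using a m T by (auto simp: Psi1_def)
    then show "can_is_iso V E \<phi> (vop V D) \<psi> (fob T) (fcomp V (yoneda V E) (fop T)) (fcomp V \<phi> (fop T))"
      using h can_is_iso_restrict[OF E W(1)[OF m] T W(2)[OF m] a lan phi'] by simp
  qed
qed

end

theorem proposition3p3:
  fixes V :: "('o, 'm) smc"
    and \<Psi> :: "(('u, 'o, 'm) vcat \<times> ('u, 'o, 'm) weight) set"
  assumes "infinite (UNIV :: 'u set)"
    and "sym_monoidal_closed V"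
    and "complete TYPE('u) V"
    and "cocomplete TYPE('u) V"
    and "weight_class V \<Psi>"
  shows "sound V \<Psi> \<longleftrightarrow>
    (\<forall>(E :: ('u, 'o, 'm) vcat) \<phi>. is_weight V E \<phi> \<longrightarrow>
       (\<forall>\<psi>\<in>Psi1 V \<Psi> E. can_is_iso V E \<phi> (vop V E) \<psi> (\<lambda>e. e) (yoneda V E) \<phi>) \<longrightarrow>
       flat V \<Psi> E \<phi>)"
proof -
  interpret bicomplete_smc V "TYPE('u)"
    using assms by unfold_locales
  show ?thesis
    unfolding sound_def using preserves_limits_of_representables_iff[OF assms(5)] by blast
qed

end
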